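(* Let $\Gamma$ be a non-elementary Kleinian group acting on $\mathbf{B}^n$, let $\alpha>0$ be such that the Poincaré series of $\Gamma$ converges at the exponent $\alpha$, and let $\{E_1,\dots,E_q\}$ be a complete collection of ends for $\Gamma$, where each $E_i\subset\mathbf{B}^n$ is an end of $\Gamma$. Put $\Gamma_i=\Gamma_{E_i}$ and suppose the numbering is such that $E_1,\dots,E_p$ ($p\le q$) are exactly the ends among $E_1,\dots,E_q$ with $\Lambda_e(E_i)\neq\emptyset$. Let $\mathcal{M}$ be the family of $\alpha$-conformal measures for $\Gamma$ on $\Lambda(\Gamma)$ and, for $i\le p$, let $\mathcal{M}_i$ be the family of $\alpha$-conformal measures for $\Gamma_i$ on $\Lambda_e(E_i)$. For $\mu_i\in\mathcal{M}_i$ let $\mu_i^*$ be the unique extension of $\mu_i$ to an $\alpha$-conformal measure for $\Gamma$ on $\bigcup_{\gamma\in\Gamma}\gamma\Lambda_e(E_i)$. (1) Let $\mu\in\mathcal{M}$ and let $\mu_i\in\mathcal{M}_i$ be the restriction of $\mu$ to $\Lambda_e(E_i)$, $i\le p$. Then $$\mu=\mu_1^*+\dots+\mu_p^*,$$ and for $i\ne j$ the measures $\mu_i^*$ and $\mu_j^*$ are mutually singular if non-trivial. (2) Conversely, if $\mu_i\in\mathcal{M}_i$ for $i=1,\dots,p$, then $\mu=\mu_1^*+\dots+\mu_p^*$ is an $\alpha$-conformal measure for $\Gamma$ on $\Lambda(\Gamma)$. (3) For each $i\le p$ there is a non-trivial measure $\mu_i\in\mathcal{M}_i$. Thus, if there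 are $p$ ends in the collection with $\Lambda_e(E_i)\neq\emptyset$, there are at least $p$ mutually singular non-trivial $\alpha$-conformal measures for $\Gamma$ on $\Lambda(\Gamma)$.
   Context: $\mathbf{B}^n$ ($n\ge2$) is the open unit ball in $\mathbf{R}^n$ with the hyperbolic (Poincaré) metric $2|dx|/(1-|x|^2)$ and distance $\mathrm{d}$; $\mathbf{S}^{n-1}$ is its sphere at infinity, $\overline{\mathbf{B}^n}=\mathbf{B}^n\cup\mathbf{S}^{n-1}$. A Kleinian group is a discrete group of (possibly orientation-reversing) isometries of $\mathbf{B}^n$; it is elementary if it has an abelian subgroup of finite index. $\Lambda(\Gamma)\subset\mathbf{S}^{n-1}$ is the limit set and $\Omega(\Gamma)=\mathbf{S}^{n-1}\setminus\Lambda(\Gamma)$. For $X\subset\overline{\mathbf{B}^n}$, $\Gamma_X=\{\gamma\in\Gamma:\gamma(X)=X\}$. The Poincaré series converges at $\alpha$ if $\sum_{\gamma\in\Gamma}\exp(-\alpha\,\mathrm{d}(x,\gamma(y)))<\infty$ for some (equivalently all) $x,y\in\mathbf{B}^n$. Ends. $M_\Gamma=\mathbf{B}^n/\Gamma$, $\overline{M_\Gamma}=(\mathbf{B}^n\cup\Omega(\Gamma))/\Gamma$, $\partial_\infty M_\Gamma=\Omega(\Gamma)/\Gamma$. An end of $M_\Gamma$ is a connected open set $E\subset M_\Gamma$ whose boundary $\partial E$ in $M_\Gamma$ is compact and non-empty and whose closure in $M_\Gamma$ is non-compact; $\partial_\infty E$ is the intersection of the closure of $E$ in $\overline{M_\Gamma}$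 with $\partial_\infty M_\Gamma$. An end of $\Gamma$ is a connected component of the preimage in $\mathbf{B}^n$ of an end of $M_\Gamma$. A complete collection of ends of $M_\Gamma$ is a finite collection $\mathcal{E}$ of pairwise disjoint ends of $M_\Gamma$ such that $\overline{M_\Gamma}\setminus\bigcup_{E\in\mathcal{E}}(E\cup\partial_\infty E)$ is compact. A complete collection of ends $\{E_1,\dots,E_q\}$ for $\Gamma$ is obtained by choosing, for each member of a complete collection of ends of $M_\Gamma$, one component of its preimage in $\mathbf{B}^n$. A point $z\in\mathbf{S}^{n-1}$ is an endpoint of an end $E\subset\mathbf{B}^n$ of $\Gamma$ if every hyperbolic ray $R$ with endpoint at infinity $z$ has a subray $R'\subset E$ such that $\mathrm{d}(x,\partial E)\to\infty$ as $x\to z$ on $R'$ ($\partial E$ is the boundary in $\mathbf{B}^n$). It is an end limit point of $E$ if moreover $z\in\Lambda(\Gamma_E)$. $\Lambda_e(E)$ is the set of end limit points of $E$. Measures are non-negative and finite. A measure $m$ on a $G$-invariant set $A\subset\overline{\mathbf{B}^n}$ is $\alpha$-conformal for a Kleinian group $G$ if Borel subsets of $A$ are measurable and $m(\gamma(B))=\int_B|\gamma'|^\alpha\,dm$ for all measurable $B\subset A$ and $\gamma\in G$, where $|\gamma'|$ is the operator norm of the derivative. A measure is supported by a measurable set if the complement of that set has measure zero. The extension $\mu_i^*$ is the $\alpha$-conformal measure for $\Gamma$ supported by $\bigcup_{\gamma\in\Gamma}\gamma\Lambda_e(E_i)$ whose restriction to $\Lambda_e(E_i)$ is $\mu_i$;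 under the present hypotheses it exists and is unique. "Non-trivial" means not identically zero. *)

theory Defs
  imports "HOL-Analysis.Analysis" "HOL-Algebra.Bij" "HOL-Algebra.Coset"
begin

definition hyp_length :: "(real \<Rightarrow> 'a::euclidean_space) \<Rightarrow> real" where
  "hyp_length g = integral {0..1} (\<lambda>t. 2 * norm (vector_derivative g (at t)) / (1 - (norm (g t))\<^sup>2))"

text \<open>Only \<open>C\<^sup>1\<close> curves are admitted: for the library's piecewise \<open>C\<^sup>1\<close> curves the derivative may blow up
  at the break points, and \<^const>\<open>integral\<close> would assign the length 0 to non-rectifiable curves.\<close>

definition hyp_dist :: "'a::euclidean_space \<Rightarrow> 'a \<Rightarrow> real" where
  "hyp_dist x y = Inf {hyp_length g | g.
     g C1_differentiable_on {0..1} \<and> path_image g \<subseteq> ball 0 1 \<and> pathstart g = x \<and> pathfinish g = y}"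

definition hyp_ray :: "(real \<Rightarrow> 'a::euclidean_space) \<Rightarrow> 'a \<Rightarrow> bool" where
  "hyp_ray r z \<longleftrightarrow>
     r ` {0..} \<subseteq> ball 0 1 \<and>
     (\<forall>s\<ge>0. \<forall>t\<ge>0. hyp_dist (r s) (r t) = \<bar>s - t\<bar>) \<and>
     (r \<longlongrightarrow> z) at_top"

text \<open>Every isometry of the ball, orientation preserving or not, extends uniquely to a
  homeomorphism of the closed ball. An isometry is represented by this extension, as an element of
  the library's group \<^term>\<open>BijGroup (cball 0 1)\<close>, whose elements are undefined
  outside the closed ball. So equality of functions is equality of isometries.\<close>

definition hyp_isometries :: "('a::euclidean_space \<Rightarrow> 'a) set" where
  "hyp_isometries = {\<gamma> \<in> Bij (cball 0 1).
     continuous_on (cball 0 1) \<gamma> \<and> \<gamma> ` ball 0 1 = ball 0 1 \<and>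
     (\<forall>x\<in>ball 0 1. \<forall>y\<in>ball 0 1. hyp_dist (\<gamma> x) (\<gamma> y) = hyp_dist x y)}"

text \<open>Discreteness refers to uniform convergence on the closed ball. On the isometry group this is the
  usual Lie group (compact-open) topology.\<close>

definition kleinian :: "('a::euclidean_space \<Rightarrow> 'a) set \<Rightarrow> bool" where
  "kleinian \<Gamma> \<longleftrightarrow>
     subgroup \<Gamma> (BijGroup (cball 0 1)) \<and> \<Gamma> \<subseteq> hyp_isometries \<and>
     (\<forall>\<gamma>\<in>\<Gamma>. \<exists>e>0. \<forall>\<gamma>'\<in>\<Gamma>. (\<forall>x\<in>cball 0 1. dist (\<gamma> x) (\<gamma>' x) < e) \<longrightarrow> \<gamma>' = \<gamma>)"

definition elementary :: "('a::euclidean_space \<Rightarrow> 'a) set \<Rightarrow> bool" where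
  "elementary \<Gamma> \<longleftrightarrow>
     (let G = BijGroup (cball 0 1)\<lparr>carrier := \<Gamma>\<rparr>
      in \<exists>H. subgroup H G \<and> comm_group (G\<lparr>carrier := H\<rparr>) \<and> finite (rcosets\<^bsub>G\<^esub> H))"

definition set_stab :: "('a \<Rightarrow> 'a) set \<Rightarrow> 'a set \<Rightarrow> ('a \<Rightarrow> 'a) set" where
  "set_stab \<Gamma> X = {\<gamma> \<in> \<Gamma>. \<gamma> ` X = X}"

definition group_orbit :: "('a \<Rightarrow> 'a) set \<Rightarrow> 'a \<Rightarrow> 'a set" where
  "group_orbit \<Gamma> x = (\<lambda>\<gamma>. \<gamma> x) ` \<Gamma>"

definition limit_set :: "('a::euclidean_space \<Rightarrow> 'a) set \<Rightarrow> 'a set" where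
  "limit_set \<Gamma> = {z \<in> sphere 0 1. \<exists>x\<in>ball 0 1. z islimpt group_orbit \<Gamma> x}"

definition ordinary_set :: "('a::euclidean_space \<Rightarrow> 'a) set \<Rightarrow> 'a set" where
  "ordinary_set \<Gamma> = sphere 0 1 - limit_set \<Gamma>"

definition poincare_converges :: "('a::euclidean_space \<Rightarrow> 'a) set \<Rightarrow> real \<Rightarrow> bool" where
  "poincare_converges \<Gamma> \<alpha> \<longleftrightarrow>
     (\<exists>x\<in>ball 0 1. \<exists>y\<in>ball 0 1. (\<lambda>\<gamma>. exp (- \<alpha> * hyp_dist x (\<gamma> y))) summable_on \<Gamma>)"

definition quotient_topology :: "'a topology \<Rightarrow> ('a \<Rightarrow> 'b) \<Rightarrow> 'b topology" where
  "quotient_topology X f =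
     topology (\<lambda>U. U \<subseteq> f ` topspace X \<and> openin X {x \<in> topspace X. f x \<in> U})"

lemma openin_quotient_topology:
  "openin (quotient_topology X f) U \<longleftrightarrow>
     U \<subseteq> f ` topspace X \<and> openin X {x \<in> topspace X. f x \<in> U}"
proof -
  have "istopology (\<lambda>U. U \<subseteq> f ` topspace X \<and> openin X {x \<in> topspace X. f x \<in> U})"
    unfolding istopology_def
  proof (intro conjI allI impI)
    fix S T assume *: "S \<subseteq> f ` topspace X \<and> openin X {x \<in> topspace X. f x \<in> S}"
      "T \<subseteq> f ` topspace X \<and> openin X {x \<in> topspace X. f x \<in> T}"
    have "{x \<in> topspace X. f x \<in> S \<inter> T} = {x \<in> topspace X. f x \<in> S} \<inter> {x \<in> topspace X. f x \<in> T}"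
      by auto
    with * show "openin X {x \<in> topspace X. f x \<in> S \<inter> T}" by (simp add: openin_Int del: Int_iff)
    from * show "S \<inter> T \<subseteq> f ` topspace X" by auto
  next
    fix K assume *: "\<forall>S\<in>K. S \<subseteq> f ` topspace X \<and> openin X {x \<in> topspace X. f x \<in> S}"
    have "{x \<in> topspace X. f x \<in> \<Union>K} = (\<Union>S\<in>K. {x \<in> topspace X. f x \<in> S})" by auto
    moreover have "openin X (\<Union>S\<in>K. {x \<in> topspace X. f x \<in> S})"
      by (rule openin_Union) (use * in blast)
    ultimately show "openin X {x \<in> topspace X. f x \<in> \<Union>K}" by (rule ssubst)
    from * show "\<Union>K \<subseteq> f ` topspace X" by auto
  qed
  then show ?thesis by (simp add: quotient_topology_def)
qed

lemma topspace_quotient_topology [simp]: "topspace (quotient_topology X f) = f ` topspace X"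
proof
  have "openin (quotient_topology X f) (f ` topspace X)"
  proof -
    have "{x \<in> topspace X. f x \<in> f ` topspace X} = topspace X" by auto
    then show ?thesis by (simp add: openin_quotient_topology)
  qed
  then show "f ` topspace X \<subseteq> topspace (quotient_topology X f)" by (rule openin_subset)
  show "topspace (quotient_topology X f) \<subseteq> f ` topspace X"
    using openin_quotient_topology[THEN iffD1, OF openin_topspace] by (rule conjunct1)
qed

lemma quotient_map_quotient_topology: "quotient_map X (quotient_topology X f) f"
  by (simp add: quotient_map_def openin_quotient_topology)

text \<open>Points of the quotients are orbits, so \<open>quot_M \<Gamma>\<close> is literally contained in \<open>quot_Mbar \<Gamma>\<close>.\<close>

definition quot_M :: "('a::euclidean_space \<Rightarrow> 'a) set \<Rightarrow> 'a set topology" where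
  "quot_M \<Gamma> = quotient_topology (top_of_set (ball 0 1)) (group_orbit \<Gamma>)"

definition quot_Mbar :: "('a::euclidean_space \<Rightarrow> 'a) set \<Rightarrow> 'a set topology" where
  "quot_Mbar \<Gamma> = quotient_topology (top_of_set (ball 0 1 \<union> ordinary_set \<Gamma>)) (group_orbit \<Gamma>)"

definition boundary_M :: "('a::euclidean_space \<Rightarrow> 'a) set \<Rightarrow> 'a set set" where
  "boundary_M \<Gamma> = group_orbit \<Gamma> ` ordinary_set \<Gamma>"

definition end_of_M :: "('a::euclidean_space \<Rightarrow> 'a) set \<Rightarrow> 'a set set \<Rightarrow> bool" where
  "end_of_M \<Gamma> E \<longleftrightarrow>
     connectedin (quot_M \<Gamma>) E \<and> openin (quot_M \<Gamma>) E \<and>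
     compactin (quot_M \<Gamma>) (quot_M \<Gamma> frontier_of E) \<and> quot_M \<Gamma> frontier_of E \<noteq> {} \<and>
     \<not> compactin (quot_M \<Gamma>) (quot_M \<Gamma> closure_of E)"

definition end_boundary :: "('a::euclidean_space \<Rightarrow> 'a) set \<Rightarrow> 'a set set \<Rightarrow> 'a set set" where
  "end_boundary \<Gamma> E = (quot_Mbar \<Gamma> closure_of E) \<inter> boundary_M \<Gamma>"

definition complete_ends_of_M :: "('a::euclidean_space \<Rightarrow> 'a) set \<Rightarrow> 'a set set set \<Rightarrow> bool" where
  "complete_ends_of_M \<Gamma> \<E> \<longleftrightarrow>
     finite \<E> \<and> (\<forall>E\<in>\<E>. end_of_M \<Gamma> E) \<and> pairwise disjnt \<E> \<and>
     compactin (quot_Mbar \<Gamma>) (topspace (quot_Mbar \<Gamma>) - (\<Union>E\<in>\<E>. E \<union> end_boundary \<Gamma> E))"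

text \<open>The family \<open>E 1, \<dots>, E q\<close> selects one component of the preimage of each member of a complete
  collection \<open>F 1, \<dots>, F q\<close> of ends of the quotient.\<close>

definition complete_ends :: "('a::euclidean_space \<Rightarrow> 'a) set \<Rightarrow> nat \<Rightarrow> (nat \<Rightarrow> 'a set) \<Rightarrow> bool" where
  "complete_ends \<Gamma> q E \<longleftrightarrow>
     (\<exists>F. inj_on F {1..q} \<and> complete_ends_of_M \<Gamma> (F ` {1..q}) \<and>
          (\<forall>i\<in>{1..q}. E i \<in> components {x \<in> ball 0 1. group_orbit \<Gamma> x \<in> F i}))"

text \<open>The infimum is taken in the extended reals only to make the distance to a set total.
  The boundary of an end is never empty.\<close>

definition is_endpoint :: "'a::euclidean_space set \<Rightarrow> 'a \<Rightarrow> bool" where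
  "is_endpoint E z \<longleftrightarrow> z \<in> sphere 0 1 \<and>
     (\<forall>r. hyp_ray r z \<longrightarrow>
        (\<exists>T\<ge>0. r ` {T..} \<subseteq> E) \<and>
        ((\<lambda>t. INF y \<in> top_of_set (ball 0 1) frontier_of E. ereal (hyp_dist (r t) y)) \<longlongrightarrow> \<infinity>) at_top)"

definition end_limit_points :: "('a::euclidean_space \<Rightarrow> 'a) set \<Rightarrow> 'a set \<Rightarrow> 'a set" where
  "end_limit_points \<Gamma> E = {z \<in> limit_set (set_stab \<Gamma> E). is_endpoint E z}"

text \<open>The derivative is taken within the closed ball, which determines it uniquely also at the
  points of the sphere.\<close>

definition deriv_norm :: "('a::euclidean_space \<Rightarrow> 'a) \<Rightarrow> 'a \<Rightarrow> real" where
  "deriv_norm \<gamma> x = onorm (frechet_derivative \<gamma> (at x within cball 0 1))"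

text \<open>The \<open>\<sigma>\<close>-algebra may be larger than that of the Borel sets. That it is preserved by the group
  is implicit in the transformation rule, and has to be said because \<^const>\<open>emeasure\<close> is 0 on
  non-measurable sets. It entails that \<open>A\<close> is invariant.\<close>

definition conformal_measures ::
    "real \<Rightarrow> ('a::euclidean_space \<Rightarrow> 'a) set \<Rightarrow> 'a set \<Rightarrow> 'a measure set" where
  "conformal_measures \<alpha> G A = {m.
     finite_measure m \<and> space m = A \<and> A \<subseteq> cball 0 1 \<and>
     sets (restrict_space borel A) \<subseteq> sets m \<and>
     (\<forall>\<gamma>\<in>G. \<forall>B\<in>sets m. \<gamma> ` B \<in> sets m \<and>
        emeasure m (\<gamma> ` B) = (\<integral>\<^sup>+x\<in>B. ennreal (deriv_norm \<gamma> x powr \<alpha>) \<partial>m))}"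

definition end_limit_orbit :: "('a::euclidean_space \<Rightarrow> 'a) set \<Rightarrow> 'a set \<Rightarrow> 'a set" where
  "end_limit_orbit \<Gamma> E = (\<Union>\<gamma>\<in>\<Gamma>. \<gamma> ` end_limit_points \<Gamma> E)"

text \<open>Equality with the restriction includes equality of \<open>\<sigma>\<close>-algebras. Together with invariance
  this determines the \<open>\<sigma>\<close>-algebra of the extension, so that uniqueness is equality of measures.\<close>

definition conformal_extension ::
    "real \<Rightarrow> ('a::euclidean_space \<Rightarrow> 'a) set \<Rightarrow> 'a set \<Rightarrow> 'a measure \<Rightarrow> 'a measure" where
  "conformal_extension \<alpha> \<Gamma> E m =
     (THE \<nu>. \<nu> \<in> conformal_measures \<alpha> \<Gamma> (end_limit_orbit \<Gamma> E) \<and>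
             restrict_space \<nu> (end_limit_points \<Gamma> E) = m)"

text \<open>The sum on \<open>A\<close> of measures living on subsets \<open>space (\<nu> i)\<close> of \<open>A\<close>, each extended by zero.\<close>

definition sum_measure :: "'a set \<Rightarrow> 'i set \<Rightarrow> ('i \<Rightarrow> 'a measure) \<Rightarrow> 'a measure" where
  "sum_measure A I \<nu> =
     measure_of A {B. B \<subseteq> A \<and> (\<forall>i\<in>I. B \<inter> space (\<nu> i) \<in> sets (\<nu> i))}
       (\<lambda>B. \<Sum>i\<in>I. emeasure (\<nu> i) (B \<inter> space (\<nu> i)))"

lemma sigma_algebra_sum_measure:
  fixes A :: "'a set"
  assumes "\<And>i. i \<in> I \<Longrightarrow> space (\<nu> i) \<subseteq> A"
  shows "sigma_algebra A {B. B \<subseteq> A \<and> (\<forall>i\<in>I. B \<inter> space (\<nu> i) \<in> sets (\<nu> i))}"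
proof (rule sigma_algebra_iff2[THEN iffD2], intro conjI ballI allI impI)
  fix B assume B: "B \<in> {B. B \<subseteq> A \<and> (\<forall>i\<in>I. B \<inter> space (\<nu> i) \<in> sets (\<nu> i))}"
  have "(A - B) \<inter> space (\<nu> i) = space (\<nu> i) - B \<inter> space (\<nu> i)" if "i \<in> I" for i
    using assms[OF that] by auto
  with B show "A - B \<in> {B. B \<subseteq> A \<and> (\<forall>i\<in>I. B \<inter> space (\<nu> i) \<in> sets (\<nu> i))}"
    by auto
next
  fix X :: "nat \<Rightarrow> 'a set"
  assume X: "range X \<subseteq> {B. B \<subseteq> A \<and> (\<forall>i\<in>I. B \<inter> space (\<nu> i) \<in> sets (\<nu> i))}"
  have "(\<Union>n. X n) \<inter> space (\<nu> i) \<in> sets (\<nu> i)" if "i \<in> I" for i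
  proof -
    have "(\<Union>n. X n \<inter> space (\<nu> i)) \<in> sets (\<nu> i)"
      using X that by (intro sets.countable_UN) auto
    then show ?thesis by (simp only: UN_simps)
  qed
  with X show "(\<Union>n. X n) \<in> {B. B \<subseteq> A \<and> (\<forall>i\<in>I. B \<inter> space (\<nu> i) \<in> sets (\<nu> i))}"
    by blast
qed auto

lemma space_sum_measure [simp]: "space (sum_measure A I \<nu>) = A"
  unfolding sum_measure_def by (rule space_measure_of) auto

lemma sets_sum_measure:
  assumes "\<And>i. i \<in> I \<Longrightarrow> space (\<nu> i) \<subseteq> A"
  shows "sets (sum_measure A I \<nu>) = {B. B \<subseteq> A \<and> (\<forall>i\<in>I. B \<inter> space (\<nu> i) \<in> sets (\<nu> i))}"
  unfolding sum_measure_def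
  by (rule sigma_algebra.sets_measure_of_eq[OF sigma_algebra_sum_measure[OF assms]])

lemma emeasure_sum_measure:
  fixes A :: "'a set"
  assumes "\<And>i. i \<in> I \<Longrightarrow> space (\<nu> i) \<subseteq> A" and "B \<in> sets (sum_measure A I \<nu>)"
  shows "emeasure (sum_measure A I \<nu>) B = (\<Sum>i\<in>I. emeasure (\<nu> i) (B \<inter> space (\<nu> i)))"
proof (rule emeasure_measure_of[OF sum_measure_def])
  show "countably_additive (sets (sum_measure A I \<nu>)) (\<lambda>B. \<Sum>i\<in>I. emeasure (\<nu> i) (B \<inter> space (\<nu> i)))"
    unfolding countably_additive_def
  proof (intro allI impI)
    fix X :: "nat \<Rightarrow> 'a set"
    assume X: "range X \<subseteq> sets (sum_measure A I \<nu>)" "disjoint_family X"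
    have "(\<Sum>n. emeasure (\<nu> i) (X n \<inter> space (\<nu> i))) = emeasure (\<nu> i) (\<Union>(range X) \<inter> space (\<nu> i))"
      if "i \<in> I" for i
    proof -
      have "range (\<lambda>n. X n \<inter> space (\<nu> i)) \<subseteq> sets (\<nu> i)"
        using X(1) that by (auto simp: sets_sum_measure[OF assms(1)])
      moreover have "disjoint_family (\<lambda>n. X n \<inter> space (\<nu> i))"
        using X(2) by (auto simp: disjoint_family_on_def)
      moreover have "\<Union>(range X) \<inter> space (\<nu> i) = (\<Union>n. X n \<inter> space (\<nu> i))" by auto
      ultimately show ?thesis by (simp add: suminf_emeasure)
    qed
    then show "(\<Sum>n. \<Sum>i\<in>I. emeasure (\<nu> i) (X n \<inter> space (\<nu> i))) =
        (\<Sum>i\<in>I. emeasure (\<nu> i) (\<Union>(range X) \<inter> space (\<nu> i)))"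
      by (subst suminf_sum) auto
  qed
qed (use assms(2) in \<open>auto simp: positive_def\<close>)

definition nontrivial_measure :: "'a measure \<Rightarrow> bool" where
  "nontrivial_measure m \<longleftrightarrow> emeasure m (space m) \<noteq> 0"

text \<open>The two measures may live on different sets; each is regarded as zero off its space.\<close>

definition mutually_singular :: "'a measure \<Rightarrow> 'a measure \<Rightarrow> bool" where
  "mutually_singular m m' \<longleftrightarrow>
     (\<exists>S. S \<inter> space m \<in> sets m \<and> S \<inter> space m' \<in> sets m' \<and>
          emeasure m (S \<inter> space m) = 0 \<and> emeasure m' (space m' - S) = 0)"

end

theory Submission
  imports Defs "HOL-Probability.Probability"
begin

text \<open>
  Since the Poincare series converges, a Borel--Cantelli argument shows that conformal measures on the limit set
  give no mass to conical limit points. The geodesic ray to a non-conical limit point leaves every compact subset of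
  the quotient, so it finally stays in one end, and by completeness of the collection the limit point is a translate
  of an end limit point of some \<open>E i\<close>. Translates of different \<open>E i\<close> never share
  an endpoint. This gives the decomposition.

  A conformal measure on the end limit points of \<open>E\<close> is extended by transporting it to each translate
  with the weight that conformality forces. The total mass is finite because end limit points
  can be moved by the stabilizer away from any given orbit point: the shell of \<open>E\<close>, through which every geodesic
  enters \<open>E\<close>, is compact modulo the stabilizer. The mass on a translate of \<open>E\<close>
  is then at most a constant times the sum of \<open>exp (- \<alpha> d(0, \<gamma> 0))\<close> over the elements \<open>\<gamma>\<close>
  realising that translate.

  Non-trivial measures arise as Patterson limits: let \<open>x\<close> tend radially to an end limit point and put masses
  proportional to \<open>exp (- \<alpha> d(0, \<gamma> x))\<close> at the points \<open>\<gamma> x\<close> of the orbit under the stabilizer.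
  Convergence of the series makes the masses that are not visible through a deep part of the end uniformly small,
  so the weak limit lives on end limit points.
\<close>

section \<open>Moebius transformations of the ball\<close>

definition mob_den :: "'a::real_inner \<Rightarrow> 'a \<Rightarrow> real" where
  "mob_den b x = 1 - 2 * (b \<bullet> x) + (norm b)\<^sup>2 * (norm x)\<^sup>2"

definition mob_factor :: "'a::real_inner \<Rightarrow> 'a \<Rightarrow> real" where
  "mob_factor b x = (1 - (norm b)\<^sup>2) / mob_den b x"

definition mob :: "'a::real_inner \<Rightarrow> 'a \<Rightarrow> 'a" where
  "mob b x = (1 / mob_den b x) *\<^sub>R ((1 - (norm b)\<^sup>2) *\<^sub>R (x - b) - (norm (x - b))\<^sup>2 *\<^sub>R b)"

lemma mob_den_commute: "mob_den b x = mob_den x b"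
  by (simp add: mob_den_def inner_commute)

lemma mob_den_eq: "mob_den b x = (norm (x - b))\<^sup>2 + (1 - (norm b)\<^sup>2) * (1 - (norm x)\<^sup>2)"
  by (simp add: mob_den_def power2_norm_eq_inner algebra_simps inner_commute)

lemma mob_den_ge: "(1 - norm b * norm x)\<^sup>2 \<le> mob_den b x"
  using norm_cauchy_schwarz[of b x] by (simp add: mob_den_def power2_diff power_mult_distrib)

lemma mob_den_pos:
  assumes "b \<in> ball 0 1" "x \<in> cball 0 1"
  shows "mob_den b x > 0"
proof -
  have "norm b * norm x < 1"
    using assms mult_left_le[of "norm x" "norm b"] by auto
  then have "0 < (1 - norm b * norm x)\<^sup>2" by simp
  then show ?thesis using mob_den_ge[of b x] by linarith
qed

lemma mob_factor_pos:
  assumes "b \<in> ball 0 1" "x \<in> cball 0 1"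
  shows "mob_factor b x > 0"
  using mob_den_pos[OF assms] assms by (simp add: mob_factor_def power_less_one_iff)

lemma norm_square_less_one: "x \<in> ball 0 1 \<Longrightarrow> (norm x)\<^sup>2 < 1"
  by (simp add: power_less_one_iff)

lemma norm_square_le_one: "x \<in> cball 0 1 \<Longrightarrow> (norm x)\<^sup>2 \<le> 1"
  by (simp add: power_le_one)

lemma mob_dist:
  assumes "b \<in> ball 0 1" "x \<in> cball 0 1" "y \<in> cball 0 1"
  shows "(norm (mob b x - mob b y))\<^sup>2 = mob_factor b x * mob_factor b y * (norm (x - y))\<^sup>2"
proof -
  define u v s where "u = x - b" and "v = y - b" and "s = 1 - (norm b)\<^sup>2"
  define N where "N w = s *\<^sub>R w - (norm w)\<^sup>2 *\<^sub>R b" for w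
  have bb: "b \<bullet> b = 1 - s" by (simp add: s_def power2_norm_eq_inner)
  have N: "N w \<bullet> N w' = s\<^sup>2 * (w \<bullet> w') - s * (w' \<bullet> w') * (b \<bullet> w) - s * (w \<bullet> w) * (b \<bullet> w')
      + (w \<bullet> w) * (w' \<bullet> w') * (1 - s)" for w w'
    unfolding N_def power2_norm_eq_inner
    by (simp add: inner_diff_left inner_diff_right bb inner_commute algebra_simps power2_eq_square)
  have dx: "mob_den b x = s\<^sup>2 - 2 * s * (b \<bullet> u) + (1 - s) * (u \<bullet> u)"
    and dy: "mob_den b y = s\<^sup>2 - 2 * s * (b \<bullet> v) + (1 - s) * (v \<bullet> v)"
    unfolding mob_den_def u_def v_def s_def power2_norm_eq_inner
    by (simp_all add: algebra_simps inner_commute power2_eq_square)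
  have pos: "mob_den b x > 0" "mob_den b y > 0" using mob_den_pos assms by auto
  define X Y where "X = mob_den b x" and "Y = mob_den b y"
  have "(norm (mob b x - mob b y))\<^sup>2 = (norm ((1/X) *\<^sub>R N u - (1/Y) *\<^sub>R N v))\<^sup>2"
    by (simp add: mob_def N_def u_def v_def s_def X_def Y_def)
  also have "\<dots> = (N u \<bullet> N u) / X\<^sup>2 + (N v \<bullet> N v) / Y\<^sup>2 - 2 * (N u \<bullet> N v) / (X * Y)"
    unfolding power2_norm_eq_inner
    by (simp add: inner_diff_left inner_diff_right inner_commute power2_eq_square field_simps)
  also have "N u \<bullet> N u = (u \<bullet> u) * X"
    unfolding X_def dx N by (simp add: algebra_simps power2_eq_square)
  also have "N v \<bullet> N v = (v \<bullet> v) * Y"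
    unfolding Y_def dy N by (simp add: algebra_simps power2_eq_square)
  also have "(u \<bullet> u) * X / X\<^sup>2 + (v \<bullet> v) * Y / Y\<^sup>2 - 2 * (N u \<bullet> N v) / (X * Y) =
      ((u \<bullet> u) * Y + (v \<bullet> v) * X - 2 * (N u \<bullet> N v)) / (X * Y)"
    using pos by (simp add: X_def[symmetric] Y_def[symmetric] field_simps power2_eq_square)
  also have "(u \<bullet> u) * Y + (v \<bullet> v) * X - 2 * (N u \<bullet> N v) = s\<^sup>2 * ((u - v) \<bullet> (u - v))"
    unfolding X_def Y_def dx dy N
    by (simp add: inner_diff_left inner_diff_right inner_commute algebra_simps power2_eq_square)
  finally show ?thesis
    by (simp add: mob_factor_def X_def Y_def u_def v_def s_def power2_norm_eq_inner flip: power2_eq_square)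
qed

lemma mob_self [simp]: "mob b b = 0"
  by (simp add: mob_def)

lemma mob_norm:
  assumes "b \<in> ball 0 1" "x \<in> cball 0 1"
  shows "(norm (mob b x))\<^sup>2 = (norm (x - b))\<^sup>2 / mob_den b x"
proof -
  have "mob_den b b = (1 - (norm b)\<^sup>2)\<^sup>2"
    by (simp add: mob_den_eq power2_eq_square)
  then have one: "mob_factor b b * (1 - (norm b)\<^sup>2) = 1"
    using norm_square_less_one[OF assms(1)] by (simp add: mob_factor_def power2_eq_square)
  have "(norm (mob b x))\<^sup>2 = mob_factor b x * mob_factor b b * (norm (x - b))\<^sup>2"
    using mob_dist[OF assms, of b] assms by simp
  also have "\<dots> = (mob_factor b b * (1 - (norm b)\<^sup>2)) * (norm (x - b))\<^sup>2 / mob_den b x"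
    unfolding mob_factor_def[of b x] by simp
  finally show ?thesis unfolding one by simp
qed

lemma mob_one_minus:
  assumes "b \<in> ball 0 1" "x \<in> cball 0 1"
  shows "1 - (norm (mob b x))\<^sup>2 = mob_factor b x * (1 - (norm x)\<^sup>2)"
  using mob_den_pos[OF assms] unfolding mob_norm[OF assms]
  by (simp add: mob_factor_def field_simps mob_den_eq)

lemma mob_in_ball:
  assumes "b \<in> ball 0 1" "x \<in> ball 0 1"
  shows "mob b x \<in> ball 0 1"
proof -
  have "0 < mob_factor b x * (1 - (norm x)\<^sup>2)"
    using assms mob_factor_pos[of b x] by (simp add: power_less_one_iff)
  then have "(norm (mob b x))\<^sup>2 < 1"
    using mob_one_minus[of b x] assms by simp
  then show ?thesis by (simp add: power_less_one_iff)
qed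

lemma mob_in_cball:
  assumes "b \<in> ball 0 1" "x \<in> cball 0 1"
  shows "mob b x \<in> cball 0 1"
proof -
  have "0 \<le> mob_factor b x * (1 - (norm x)\<^sup>2)"
    using mob_factor_pos[OF assms] norm_square_le_one[OF assms(2)] by simp
  then have "(norm (mob b x))\<^sup>2 \<le> 1"
    using mob_one_minus[OF assms] by linarith
  then show ?thesis by (simp add: power_le_one_iff)
qed

lemma mob_inverse:
  assumes "b \<in> ball 0 1" "x \<in> cball 0 1"
  shows "mob (- b) (mob b x) = x"
proof -
  define s d where "s = 1 - (norm b)\<^sup>2" and "d = mob_den b x"
  define y where "y = mob b x"
  have d: "d > 0" using mob_den_pos[OF assms] by (simp add: d_def)
  have s: "s > 0" using norm_square_less_one[OF assms(1)] by (simp add: s_def)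
  have "(1 / d) *\<^sub>R (s *\<^sub>R (x - b) - (norm (x - b))\<^sup>2 *\<^sub>R b) + b
      = (1 / d) *\<^sub>R (s *\<^sub>R (x - b) - (norm (x - b))\<^sup>2 *\<^sub>R b + d *\<^sub>R b)"
    using d by (simp add: scaleR_right_distrib)
  also have "s *\<^sub>R (x - b) - (norm (x - b))\<^sup>2 *\<^sub>R b + d *\<^sub>R b
      = s *\<^sub>R x + (d - s - (norm (x - b))\<^sup>2) *\<^sub>R b"
    by (simp add: algebra_simps)
  also have "d - s - (norm (x - b))\<^sup>2 = - s * (norm x)\<^sup>2"
    by (simp add: d_def mob_den_eq s_def algebra_simps)
  finally have yb: "y + b = (s / d) *\<^sub>R (x - (norm x)\<^sup>2 *\<^sub>R b)"
    by (simp add: y_def mob_def d_def[symmetric] s_def[symmetric] scaleR_diff_right)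
  have "(norm (x - (norm x)\<^sup>2 *\<^sub>R b))\<^sup>2 = (norm x)\<^sup>2 * d"
    unfolding d_def mob_den_def power2_norm_eq_inner
    by (simp add: inner_diff_left inner_diff_right inner_commute algebra_simps power2_eq_square)
  then have nyb: "(norm (y + b))\<^sup>2 = s\<^sup>2 * (norm x)\<^sup>2 / d"
    using d unfolding yb norm_scaleR power_mult_distrib power2_abs power_divide
    by (simp add: power2_eq_square[of d])
  have "1 - (norm y)\<^sup>2 = s / d * (1 - (norm x)\<^sup>2)"
    using mob_one_minus[OF assms] by (simp add: y_def mob_factor_def s_def d_def)
  moreover have "mob_den (- b) y = (norm (y + b))\<^sup>2 + s * (1 - (norm y)\<^sup>2)"
    by (simp add: mob_den_eq s_def)
  ultimately have "mob_den (- b) y = s\<^sup>2 * (norm x)\<^sup>2 / d + s * (s / d * (1 - (norm x)\<^sup>2))"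
    using nyb by simp
  then have "mob_den (- b) y = s\<^sup>2 / d"
    using d by (simp add: field_simps power2_eq_square)
  then have "mob (- b) y = (d / s\<^sup>2) *\<^sub>R (s *\<^sub>R (y + b) + (s\<^sup>2 * (norm x)\<^sup>2 / d) *\<^sub>R b)"
    using nyb by (simp add: mob_def s_def)
  also have "\<dots> = (d / s\<^sup>2 * s * (s / d)) *\<^sub>R (x - (norm x)\<^sup>2 *\<^sub>R b)
      + (d / s\<^sup>2 * (s\<^sup>2 * (norm x)\<^sup>2 / d)) *\<^sub>R b"
    unfolding yb by (simp add: scaleR_right_distrib)
  also have "\<dots> = x"
    using s d by (simp add: power2_eq_square)
  finally show ?thesis by (simp add: y_def)
qed

lemma mob_differentiable:
  fixes b x :: "'a::euclidean_space"
  assumes "mob_den b x \<noteq> 0"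
  shows "mob b differentiable (at x within S)"
  using assms unfolding mob_def[abs_def] mob_den_def power2_norm_eq_inner
  by (intro derivative_intros differentiable_inner differentiable_scaleR differentiable_divide
      differentiable_diff differentiable_add differentiable_mult) auto

lemma continuous_on_mob:
  fixes b :: "'a::euclidean_space"
  assumes "b \<in> ball 0 1"
  shows "continuous_on (cball 0 1) (mob b)"
  unfolding continuous_on_eq_continuous_within
  using mob_differentiable mob_den_pos[OF assms]
  by (metis differentiable_imp_continuous_within less_irrefl)

lemma continuous_on_mob_den [continuous_intros]:
  "continuous_on S f \<Longrightarrow> continuous_on S g \<Longrightarrow> continuous_on S (\<lambda>x. mob_den (f x) (g x))"
  unfolding mob_den_def by (intro continuous_intros)

lemma continuous_on_mob_factor:
  assumes "b \<in> ball 0 1"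
  shows "continuous_on (cball 0 1) (mob_factor b)"
  unfolding mob_factor_def[abs_def]
  using mob_den_pos[OF assms] by (intro continuous_intros) fastforce+

text \<open>On the sphere only the directions pointing into the ball can be tested directly; the others
  follow by linearity and continuity.\<close>

lemma norm_derivative_conformal:
  fixes f :: "'a::euclidean_space \<Rightarrow> 'a" and l :: "'a \<Rightarrow> real"
  assumes L: "(f has_derivative L) (at u within cball 0 1)" and u: "u \<in> cball 0 1"
    and l: "continuous_on (cball 0 1) l" "l u \<ge> 0"
    and conf: "\<And>v. v \<in> cball 0 1 \<Longrightarrow> (norm (f v - f u))\<^sup>2 = l u * l v * (norm (v - u))\<^sup>2"
  shows "norm (L h) = l u * norm h"
proof -
  have lin: "linear L" using L has_derivative_linear by blast
  have inner_dir: "norm (L k) = l u * norm k" if k: "u = 0 \<or> u \<bullet> k < 0" for k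
  proof (cases "k = 0")
    case True
    then show ?thesis using lin linear_0 by fastforce
  next
    case False
    obtain t where t: "t > 0" "norm (u + t *\<^sub>R k) \<le> 1"
    proof (cases "u = 0")
      case True
      have "norm (u + (1 / norm k) *\<^sub>R k) \<le> 1" using True False by simp
      then show ?thesis using that[of "1 / norm k"] False by simp
    next
      case nz: False
      define t where "t = - 2 * (u \<bullet> k) / (norm k)\<^sup>2"
      have "(norm (u + t *\<^sub>R k))\<^sup>2 = (norm u)\<^sup>2 + t * (2 * (u \<bullet> k) + t * (norm k)\<^sup>2)"
        unfolding power2_norm_eq_inner
        by (simp add: inner_add_left inner_add_right inner_commute algebra_simps)
      also have "2 * (u \<bullet> k) + t * (norm k)\<^sup>2 = 0" using False by (simp add: t_def)
      finally have "norm (u + t *\<^sub>R k) = norm u" by simp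
      moreover have "t > 0" using k nz False by (simp add: t_def divide_neg_pos)
      ultimately show ?thesis using that u by auto
    qed
    have in_cball: "u + r *\<^sub>R k \<in> cball 0 1" if r: "r \<in> {0..t}" for r
    proof -
      have "u + r *\<^sub>R k = (1 - r / t) *\<^sub>R u + (r / t) *\<^sub>R (u + t *\<^sub>R k)"
        using t by (simp add: algebra_simps)
      moreover have "u + t *\<^sub>R k \<in> cball 0 1" using t by simp
      ultimately show ?thesis
        using convexD[OF convex_cball[of 0 1] u \<open>u + t *\<^sub>R k \<in> cball 0 1\<close>, of "1 - r / t" "r / t"] r t
        by (simp add: algebra_simps)
    qed
    have c0: "((\<lambda>r. u + r *\<^sub>R k) has_derivative (\<lambda>r. r *\<^sub>R k)) (at 0 within {0..t})"
      by (auto intro!: derivative_eq_intros)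
    have "(f has_derivative L) (at (u + 0 *\<^sub>R k) within (\<lambda>r. u + r *\<^sub>R k) ` {0..t})"
      using L in_cball by (auto intro: has_derivative_subset)
    from diff_chain_within[OF c0 this]
    have "((\<lambda>r. f (u + r *\<^sub>R k)) has_derivative (\<lambda>r. r *\<^sub>R L k)) (at 0 within {0..t})"
      by (simp add: o_def linear_cmul[OF lin])
    then have "((\<lambda>r. (1 / norm r) *\<^sub>R (f (u + r *\<^sub>R k) - (f u + r *\<^sub>R L k))) \<longlongrightarrow> 0) (at 0 within {0..t})"
      by (simp add: has_derivative_within)
    moreover have "\<forall>\<^sub>F r in at 0 within {0..t}. (1 / norm r) *\<^sub>R (f (u + r *\<^sub>R k) - (f u + r *\<^sub>R L k))
        = (f (u + r *\<^sub>R k) - f u) /\<^sub>R r - L k"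
      unfolding eventually_at_filter
      by (intro always_eventually) (auto simp: algebra_simps divide_inverse)
    ultimately have "((\<lambda>r. (f (u + r *\<^sub>R k) - f u) /\<^sub>R r - L k) \<longlongrightarrow> 0) (at 0 within {0..t})"
      by (simp add: tendsto_cong)
    then have "((\<lambda>r. (f (u + r *\<^sub>R k) - f u) /\<^sub>R r) \<longlongrightarrow> L k) (at 0 within {0..t})"
      by (rule LIM_zero_cancel)
    then have "((\<lambda>r. norm ((f (u + r *\<^sub>R k) - f u) /\<^sub>R r)) \<longlongrightarrow> norm (L k)) (at 0 within {0..t})"
      by (rule tendsto_norm)
    moreover have "((\<lambda>r. norm ((f (u + r *\<^sub>R k) - f u) /\<^sub>R r)) \<longlongrightarrow> l u * norm k) (at 0 within {0..t})"
    proof -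
      have "continuous_on {0..t} (\<lambda>r. l (u + r *\<^sub>R k))"
        by (rule continuous_on_compose2[OF l(1)]) (auto intro!: continuous_intros in_cball simp del: mem_cball)
      then have "((\<lambda>r. l (u + r *\<^sub>R k)) \<longlongrightarrow> l u) (at 0 within {0..t})"
        using t by (force simp: continuous_on)
      then have "((\<lambda>r. sqrt (l u * l (u + r *\<^sub>R k)) * norm k) \<longlongrightarrow> sqrt (l u * l u) * norm k) (at 0 within {0..t})"
        by (intro tendsto_intros)
      moreover have "sqrt (l u * l u) = l u" using l by simp
      moreover have "\<forall>\<^sub>F r in at 0 within {0..t}. sqrt (l u * l (u + r *\<^sub>R k)) * norm k = norm ((f (u + r *\<^sub>R k) - f u) /\<^sub>R r)"
        unfolding eventually_at_filter
      proof (intro always_eventually allI impI)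
        fix r assume r: "r \<noteq> 0" "r \<in> {0..t}"
        have "norm (f (u + r *\<^sub>R k) - f u) = sqrt (l u * l (u + r *\<^sub>R k) * (norm (r *\<^sub>R k))\<^sup>2)"
          using conf[OF in_cball[OF r(2)]] by (metis add_diff_cancel_left' norm_ge_zero real_sqrt_unique)
        also have "\<dots> = sqrt (l u * l (u + r *\<^sub>R k)) * (r * norm k)"
          using r by (simp add: real_sqrt_mult)
        finally show "sqrt (l u * l (u + r *\<^sub>R k)) * norm k = norm ((f (u + r *\<^sub>R k) - f u) /\<^sub>R r)"
          using r by simp
      qed
      ultimately show ?thesis by (simp add: tendsto_cong)
    qed
    moreover have "at 0 within {0..t} \<noteq> bot"
      using t by (simp add: trivial_limit_within islimpt_Icc)
    ultimately show ?thesis by (rule tendsto_unique[rotated])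
  qed
  have half: "norm (L k) = l u * norm k" if k: "u \<bullet> k \<le> 0" for k
  proof -
    have ev: "\<forall>\<^sub>F e in at_right 0. norm (L (k - e *\<^sub>R u)) = l u * norm (k - e *\<^sub>R u)"
      unfolding eventually_at_filter
    proof (intro always_eventually allI impI)
      fix e :: real assume "e \<in> {0<..}"
      then have "u \<noteq> 0 \<Longrightarrow> 0 < e * (u \<bullet> u)" by simp
      then have "u \<noteq> 0 \<Longrightarrow> u \<bullet> (k - e *\<^sub>R u) < 0"
        using k by (simp add: inner_diff_right)
      then show "norm (L (k - e *\<^sub>R u)) = l u * norm (k - e *\<^sub>R u)"
        by (intro inner_dir) auto
    qed
    have "continuous_on UNIV L" using lin by (simp add: linear_continuous_on linear_conv_bounded_linear)
    then have "isCont L k" by (simp add: continuous_on_eq_continuous_at)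
    moreover have "((\<lambda>e. k - e *\<^sub>R u) \<longlongrightarrow> k - 0 *\<^sub>R u) (at_right 0)"
      by (intro tendsto_intros)
    ultimately have "((\<lambda>e. norm (L (k - e *\<^sub>R u))) \<longlongrightarrow> norm (L k)) (at_right 0)"
      by (intro tendsto_norm isCont_tendsto_compose[of k L]) auto
    moreover have "((\<lambda>e. l u * norm (k - e *\<^sub>R u)) \<longlongrightarrow> l u * norm (k - 0 *\<^sub>R u)) (at_right 0)"
      by (intro tendsto_intros)
    ultimately show ?thesis
      using tendsto_unique[of "at_right (0::real)"] tendsto_cong[OF ev] by fastforce
  qed
  show ?thesis
  proof (cases "u \<bullet> h \<le> 0")
    case False
    then have "norm (L (- h)) = l u * norm (- h)" by (intro half) simp
    then show ?thesis using linear_neg[OF lin] by simp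
  qed (rule half)
qed


lemma deriv_norm_conformal:
  fixes f :: "'a::euclidean_space \<Rightarrow> 'a" and l :: "'a \<Rightarrow> real"
  assumes "f differentiable (at u within cball 0 1)" "u \<in> cball 0 1"
    and "continuous_on (cball 0 1) l" "l u \<ge> 0"
    and "\<And>v. v \<in> cball 0 1 \<Longrightarrow> (norm (f v - f u))\<^sup>2 = l u * l v * (norm (v - u))\<^sup>2"
  shows "deriv_norm f u = l u"
proof -
  let ?L = "frechet_derivative f (at u within cball 0 1)"
  have D: "(f has_derivative ?L) (at u within cball 0 1)"
    using assms(1) by (simp add: frechet_derivative_works)
  have L: "norm (?L h) = l u * norm h" for h
    by (rule norm_derivative_conformal[OF D assms(2-5)])
  obtain i :: 'a where i: "i \<in> Basis" using nonempty_Basis by blast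
  have "onorm ?L \<le> l u"
    using L assms(4) by (intro onorm_bound) simp_all
  moreover have "l u \<le> onorm ?L"
    using onorm[OF has_derivative_bounded_linear[OF D], of i] i unfolding L by simp
  ultimately show ?thesis unfolding deriv_norm_def by (rule antisym)
qed

lemma norm_mob_derivative:
  fixes b u :: "'a::euclidean_space"
  assumes "b \<in> ball 0 1" "u \<in> cball 0 1" "(mob b has_derivative L) (at u)"
  shows "norm (L h) = mob_factor b u * norm h"
proof (rule norm_derivative_conformal[OF has_derivative_at_withinI[OF assms(3)] assms(2)])
  show "continuous_on (cball 0 1) (mob_factor b)"
    by (rule continuous_on_mob_factor[OF assms(1)])
  show "0 \<le> mob_factor b u"
    using mob_factor_pos[OF assms(1,2)] by simp
  show "(norm (mob b v - mob b u))\<^sup>2 = mob_factor b u * mob_factor b v * (norm (v - u))\<^sup>2"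
    if "v \<in> cball 0 1" for v
    using mob_dist[OF assms(1) that assms(2)] by (simp only: mult.commute[of "mob_factor b u"])
qed

lemma has_vector_derivative_two_artanh:
  fixes f :: "real \<Rightarrow> real"
  assumes f: "(f has_real_derivative d) (at t)" and "\<bar>f t\<bar> < 1"
  shows "((\<lambda>t. 2 * artanh (f t)) has_vector_derivative 2 * (d / (1 - (f t)\<^sup>2))) (at t within S)"
proof -
  have "(artanh has_real_derivative 1 / (1 - (f t)\<^sup>2)) (at (f t))"
    using assms(2) by (rule artanh_real_has_field_derivative)
  then have "((\<lambda>t. artanh (f t)) has_real_derivative 1 / (1 - (f t)\<^sup>2) * d) (at t)"
    using f by (rule DERIV_chain2)
  then have 1: "((\<lambda>t. 2 * artanh (f t)) has_real_derivative 2 * (1 / (1 - (f t)\<^sup>2) * d)) (at t)"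
    by (rule DERIV_cmult)
  have 2: "2 * (1 / (1 - (f t)\<^sup>2) * d) = 2 * (d / (1 - (f t)\<^sup>2))" by simp
  have 3: "((\<lambda>t. 2 * artanh (f t)) has_vector_derivative 2 * (d / (1 - (f t)\<^sup>2))) (at t)"
    using 1 unfolding 2 by (rule has_real_derivative_iff_has_vector_derivative[THEN iffD1])
  show ?thesis by (rule has_vector_derivative_at_within[OF 3])
qed

lemma hyp_length_ge:
  fixes g :: "real \<Rightarrow> 'a::euclidean_space"
  assumes g: "g C1_differentiable_on {0..1}" and img: "path_image g \<subseteq> ball 0 1"
  shows "2 * artanh (norm (mob (pathstart g) (pathfinish g))) \<le> hyp_length g"
proof -
  define x where "x = g 0"
  define n where "n = sgn (mob x (g 1))"
  define u where "u t = mob x (g t) \<bullet> n" for t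
  define g' where "g' t = vector_derivative g (at t)" for t
  define L where "L t = frechet_derivative (mob x) (at (g t))" for t
  define F where "F t = 2 * norm (g' t) / (1 - (norm (g t))\<^sup>2)" for t
  have gb: "g t \<in> ball 0 1" if "t \<in> {0..1}" for t
    using img that by (metis path_image_def image_subset_iff)
  have x: "x \<in> ball 0 1" using gb[of 0] by (simp add: x_def)
  have n1: "norm n \<le> 1" by (simp add: n_def norm_sgn)
  have g'd: "(g has_vector_derivative g' t) (at t)" if "t \<in> {0..1}" for t
    using g that by (simp add: C1_differentiable_on_eq vector_derivative_works g'_def)
  have Ld: "(mob x has_derivative L t) (at (g t))" if "t \<in> {0..1}" for t
    using mob_den_pos[OF x, of "g t"] gb[OF that] mob_differentiable[of x "g t" UNIV]
    unfolding L_def frechet_derivative_works[symmetric] by auto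
  have u1: "\<bar>u t\<bar> \<le> norm (mob x (g t))" "norm (mob x (g t)) < 1" if "t \<in> {0..1}" for t
  proof -
    have "\<bar>u t\<bar> \<le> norm (mob x (g t)) * norm n"
      unfolding u_def by (rule Cauchy_Schwarz_ineq2)
    then show "\<bar>u t\<bar> \<le> norm (mob x (g t))"
      using mult_left_le[OF n1, of "norm (mob x (g t))"] by simp
    show "norm (mob x (g t)) < 1" using mob_in_ball[OF x gb[OF that]] by simp
  qed
  have der: "((\<lambda>t. 2 * artanh (u t)) has_vector_derivative 2 * ((L t (g' t) \<bullet> n) / (1 - (u t)\<^sup>2)))
      (at t within {0..1})" if t: "t \<in> {0..1}" for t
  proof -
    have "(mob x \<circ> g has_vector_derivative L t (g' t)) (at t)"
      using vector_derivative_diff_chain_within[of g "g' t" t UNIV "mob x" "L t"] g'd[OF t] Ld[OF t]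
      by (auto intro: has_derivative_at_withinI)
    then have "((\<lambda>t. (mob x \<circ> g) t \<bullet> n) has_derivative (\<lambda>h. (h *\<^sub>R L t (g' t)) \<bullet> n)) (at t)"
      unfolding has_vector_derivative_def by (rule has_derivative_inner_left)
    then have "(u has_real_derivative (L t (g' t) \<bullet> n)) (at t)"
      unfolding has_field_derivative_def u_def[abs_def] o_def
      by (rule has_derivative_eq_rhs) (auto simp: fun_eq_iff)
    moreover have "\<bar>u t\<bar> < 1" using u1[OF t] by linarith
    ultimately show ?thesis by (rule has_vector_derivative_two_artanh)
  qed
  have "((\<lambda>t. 2 * ((L t (g' t) \<bullet> n) / (1 - (u t)\<^sup>2))) has_integral
      2 * artanh (u 1) - 2 * artanh (u 0)) {0..1}"
    using der by (intro fundamental_theorem_of_calculus) auto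
  moreover have "(F has_integral hyp_length g) {0..1}"
  proof -
    have "continuous_on {0..1} g'"
      using g by (simp add: C1_differentiable_on_eq g'_def[abs_def])
    moreover have "continuous_on {0..1} g"
      using g C1_diff_imp_diff differentiable_imp_continuous_on by blast
    moreover have "1 - (norm (g t))\<^sup>2 \<noteq> 0" if "t \<in> {0..1}" for t
      using norm_square_less_one[OF gb[OF that]] by simp
    ultimately have "continuous_on {0..1} F"
      unfolding F_def[abs_def] by (intro continuous_intros) auto
    then show ?thesis
      using integrable_continuous_real integrable_integral
      unfolding hyp_length_def F_def g'_def by blast
  qed
  moreover have "2 * ((L t (g' t) \<bullet> n) / (1 - (u t)\<^sup>2)) \<le> F t" if t: "t \<in> {0..1}" for t
  proof -
    let ?m = "mob_factor x (g t)"
    have gt: "g t \<in> cball 0 1" using gb[OF t] by simp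
    have m: "?m > 0" by (rule mob_factor_pos[OF x gt])
    have "L t (g' t) \<bullet> n \<le> norm (L t (g' t)) * norm n" by (rule norm_cauchy_schwarz)
    also have "\<dots> \<le> norm (L t (g' t))" using n1 by (simp add: mult_left_le)
    also have "\<dots> = ?m * norm (g' t)" by (rule norm_mob_derivative[OF x gt Ld[OF t]])
    finally have num: "L t (g' t) \<bullet> n \<le> ?m * norm (g' t)" .
    have "(u t)\<^sup>2 \<le> (norm (mob x (g t)))\<^sup>2"
      using u1[OF t] by (intro power2_le_iff_abs_le[THEN iffD2]) auto
    then have den: "?m * (1 - (norm (g t))\<^sup>2) \<le> 1 - (u t)\<^sup>2"
      using mob_one_minus[OF x gt] by linarith
    have pos: "0 < 1 - (norm (g t))\<^sup>2" using norm_square_less_one[OF gb[OF t]] by simp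
    have pos': "0 < ?m * (1 - (norm (g t))\<^sup>2)" using m pos by (rule mult_pos_pos)
    have "(L t (g' t) \<bullet> n) / (1 - (u t)\<^sup>2) \<le> (?m * norm (g' t)) / (1 - (u t)\<^sup>2)"
      by (rule divide_right_mono[OF num]) (use den pos' in linarith)
    also have "\<dots> \<le> (?m * norm (g' t)) / (?m * (1 - (norm (g t))\<^sup>2))"
    proof (rule divide_left_mono[OF den])
      show "0 \<le> ?m * norm (g' t)" using m by simp
      show "0 < (1 - (u t)\<^sup>2) * (?m * (1 - (norm (g t))\<^sup>2))"
        by (rule mult_pos_pos[OF less_le_trans[OF pos' den] pos'])
    qed
    also have "\<dots> = norm (g' t) / (1 - (norm (g t))\<^sup>2)" using m by simp
    finally show ?thesis by (simp add: F_def)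
  qed
  ultimately have "2 * artanh (u 1) - 2 * artanh (u 0) \<le> hyp_length g"
    by (rule has_integral_le)
  moreover have "u 0 = 0" by (simp add: u_def x_def)
  moreover have "u 1 = norm (mob x (g 1))"
    unfolding u_def n_def sgn_div_norm inner_scaleR_right power2_norm_eq_inner[symmetric]
    by (cases "mob x (g 1) = 0") (simp_all add: power2_eq_square)
  ultimately show ?thesis by (simp add: x_def pathstart_def pathfinish_def)
qed


lemma C1_differentiable_on_inverse_real:
  fixes f :: "real \<Rightarrow> real"
  assumes "f C1_differentiable_on S" "\<And>t. t \<in> S \<Longrightarrow> f t \<noteq> 0"
  shows "(\<lambda>t. 1 / f t) C1_differentiable_on S"
proof -
  obtain D where D: "\<forall>t\<in>S. (f has_vector_derivative D t) (at t)" "continuous_on S D"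
    using assms(1) by (auto simp: C1_differentiable_on_def)
  have "continuous_on S f"
    using assms(1) C1_diff_imp_diff differentiable_imp_continuous_on by blast
  then have "continuous_on S (\<lambda>t. - D t / (f t * f t))"
    using D(2) assms(2) by (intro continuous_intros) auto
  moreover have "((\<lambda>t. 1 / f t) has_vector_derivative - D t / (f t * f t)) (at t)" if "t \<in> S" for t
  proof -
    have "(f has_real_derivative D t) (at t)"
      by (rule has_real_derivative_iff_has_vector_derivative[THEN iffD2, OF D(1)[rule_format, OF that]])
    from DERIV_divide[OF DERIV_const this assms(2)[OF that]]
    have "((\<lambda>t. 1 / f t) has_real_derivative (0 * f t - 1 * D t) / (f t * f t)) (at t)" .
    then have "((\<lambda>t. 1 / f t) has_real_derivative - D t / (f t * f t)) (at t)"
      by (rule DERIV_cong) simp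
    then show ?thesis by (rule has_real_derivative_iff_has_vector_derivative[THEN iffD1])
  qed
  ultimately show ?thesis
    unfolding C1_differentiable_on_def by (intro exI[of _ "\<lambda>t. - D t / (f t * f t)"] conjI ballI)
qed

lemma hyp_length_mob_segment:
  fixes x w :: "'a::euclidean_space"
  assumes x: "x \<in> ball 0 1" and w: "w \<in> ball 0 1"
  defines "c \<equiv> \<lambda>t. mob x (t *\<^sub>R w)"
  shows "c C1_differentiable_on {0..1}" "path_image c \<subseteq> ball 0 1" "hyp_length c = 2 * artanh (norm w)"
proof -
  have tw: "t *\<^sub>R w \<in> ball 0 1" if "t \<in> {0..1}" for t
    using that w mult_left_le_one_le[of "norm w" t] by simp
  have den: "mob_den x (t *\<^sub>R w) = 1 - 2 * ((x \<bullet> w) * t) + (norm x)\<^sup>2 * ((norm w)\<^sup>2 * (t * t))" for t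
    by (simp add: mob_den_def power_mult_distrib power2_eq_square)
  have nrm: "(norm (t *\<^sub>R w - x))\<^sup>2 = (norm w)\<^sup>2 * (t * t) - 2 * ((x \<bullet> w) * t) + (norm x)\<^sup>2" for t
    unfolding power2_norm_eq_inner
    by (simp add: inner_diff_left inner_diff_right inner_commute algebra_simps)
  have "mob_den x (t *\<^sub>R w) \<noteq> 0" if "t \<in> {0..1}" for t
    using mob_den_pos[OF x, of "t *\<^sub>R w"] tw[OF that] by auto
  then show "c C1_differentiable_on {0..1}"
    unfolding c_def mob_def den nrm
    by (intro C1_differentiable_on_scaleR C1_differentiable_on_diff C1_differentiable_on_add
        C1_differentiable_on_mult C1_differentiable_on_const C1_differentiable_on_ident
        C1_differentiable_on_inverse_real) auto
  show "path_image c \<subseteq> ball 0 1"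
    unfolding path_image_def c_def using mob_in_ball[OF x tw] by blast
  have eq: "2 * (norm w / (1 - (t * norm w)\<^sup>2)) = 2 * norm (vector_derivative c (at t)) / (1 - (norm (c t))\<^sup>2)"
    if t: "t \<in> {0..1}" for t
  proof -
    have tw': "t *\<^sub>R w \<in> cball 0 1" using tw[OF t] by simp
    obtain L where L: "(mob x has_derivative L) (at (t *\<^sub>R w))"
      using mob_differentiable[of x "t *\<^sub>R w" UNIV] mob_den_pos[OF x tw'] by (auto simp: differentiable_def)
    have "((\<lambda>t. t *\<^sub>R w) has_vector_derivative w) (at t)"
      by (auto intro!: derivative_eq_intros)
    then have "(mob x \<circ> (\<lambda>t. t *\<^sub>R w) has_vector_derivative L w) (at t)"
      using vector_derivative_diff_chain_within[of "\<lambda>t. t *\<^sub>R w" w t UNIV "mob x" L] L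
      by (auto intro: has_derivative_at_withinI)
    then have "vector_derivative c (at t) = L w"
      by (simp add: c_def o_def vector_derivative_at)
    then have "norm (vector_derivative c (at t)) = mob_factor x (t *\<^sub>R w) * norm w"
      using norm_mob_derivative[OF x tw' L] by simp
    moreover have "1 - (norm (c t))\<^sup>2 = mob_factor x (t *\<^sub>R w) * (1 - (t * norm w)\<^sup>2)"
      using mob_one_minus[OF x tw'] by (simp add: c_def power_mult_distrib)
    ultimately show ?thesis using mob_factor_pos[OF x tw']
      by (simp only: mult.left_commute[of 2] mult_divide_mult_cancel_left_if) simp
  qed
  have int: "((\<lambda>t. 2 * (norm w / (1 - (t * norm w)\<^sup>2))) has_integral
      2 * artanh (1 * norm w) - 2 * artanh (0 * norm w)) {0..1}"
  proof (rule fundamental_theorem_of_calculus)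
    fix t :: real assume t: "t \<in> {0..1}"
    have "\<bar>t * norm w\<bar> < 1" using tw[OF t] by (simp add: abs_mult)
    have deriv: "((\<lambda>t. t * norm w) has_real_derivative norm w) (at t)"
      using DERIV_cmult_right[OF DERIV_ident] by fastforce
    show "((\<lambda>t. 2 * artanh (t * norm w)) has_vector_derivative 2 * (norm w / (1 - (t * norm w)\<^sup>2)))
        (at t within {0..1})"
      by (rule has_vector_derivative_two_artanh[OF deriv \<open>\<bar>t * norm w\<bar> < 1\<close>])
  qed simp
  from has_integral_eq[OF eq int] show "hyp_length c = 2 * artanh (norm w)"
    unfolding hyp_length_def by (simp add: integral_unique)
qed

lemma hyp_dist_eq:
  fixes x y :: "'a::euclidean_space"
  assumes x: "x \<in> ball 0 1" and y: "y \<in> ball 0 1"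
  shows "hyp_dist x y = 2 * artanh (norm (mob x y))"
proof -
  define w where "w = mob x y"
  have w: "w \<in> ball 0 1" using mob_in_ball[OF x y] by (simp add: w_def)
  have x': "- x \<in> ball 0 1" using x by simp
  have start: "mob (- x) (0 *\<^sub>R w) = x"
    using mob_inverse[OF x ball_subset_cball[THEN subsetD, OF x]] by (simp only: mob_self scaleR_zero_left)
  have fin: "mob (- x) (1 *\<^sub>R w) = y"
    using mob_inverse[OF x ball_subset_cball[THEN subsetD, OF y]] by (simp only: w_def scaleR_one)
  show ?thesis
    unfolding hyp_dist_def w_def[symmetric]
  proof (rule cInf_eq_minimum)
    show "2 * artanh (norm w) \<in> {hyp_length g |g. g C1_differentiable_on {0..1} \<and>
        path_image g \<subseteq> ball 0 1 \<and> pathstart g = x \<and> pathfinish g = y}"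
      unfolding mem_Collect_eq pathstart_def pathfinish_def
      by (rule exI[of _ "\<lambda>t. mob (- x) (t *\<^sub>R w)"])
        (intro conjI hyp_length_mob_segment[OF x' w] hyp_length_mob_segment(3)[OF x' w, symmetric] start fin)
  next
    fix l assume "l \<in> {hyp_length g |g. g C1_differentiable_on {0..1} \<and>
        path_image g \<subseteq> ball 0 1 \<and> pathstart g = x \<and> pathfinish g = y}"
    then obtain g where "l = hyp_length g" "g C1_differentiable_on {0..1}" "path_image g \<subseteq> ball 0 1"
      "pathstart g = x" "pathfinish g = y" by blast
    then show "2 * artanh (norm w) \<le> l" using hyp_length_ge[of g] unfolding w_def by blast
  qed
qed

section \<open>The hyperbolic distance and its isometries\<close>

lemma mob_0_right: "norm (mob x 0) = norm x"
  by (simp add: mob_def mob_den_def) (simp add: algebra_simps flip: scaleR_add_left)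

lemma mob_0_left: "norm (mob 0 x) = norm x"
  by (simp add: mob_def mob_den_def)

lemma exp_two_artanh: "\<bar>t\<bar> < 1 \<Longrightarrow> exp (2 * artanh t) = (1 + t) / (1 - t)" for t :: real
  by (simp add: artanh_def)

lemma exp_hyp_dist_mob:
  fixes x y :: "'a::euclidean_space"
  assumes "x \<in> ball 0 1" "y \<in> ball 0 1"
  shows "exp (hyp_dist x y) = (1 + norm (mob x y)) / (1 - norm (mob x y))"
  using mob_in_ball[OF assms] by (simp add: hyp_dist_eq[OF assms] exp_two_artanh)

lemma exp_hyp_dist:
  fixes x y :: "'a::euclidean_space"
  assumes "x \<in> ball 0 1" "y \<in> ball 0 1"
  shows "exp (hyp_dist x y)
    = (sqrt (mob_den x y) + norm (x - y))\<^sup>2 / ((1 - (norm x)\<^sup>2) * (1 - (norm y)\<^sup>2))"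
proof -
  define m a t where "m = sqrt (mob_den x y)" and "a = norm (x - y)" and "t = norm (mob x y)"
  have y: "y \<in> cball 0 1" using assms by simp
  have m: "m > 0" using mob_den_pos[OF assms(1) y] by (simp add: m_def)
  have m2: "m\<^sup>2 = mob_den x y" using mob_den_pos[OF assms(1) y] by (simp add: m_def)
  have "t\<^sup>2 = (a / m)\<^sup>2"
    unfolding t_def mob_norm[OF assms(1) y] power_divide m2 a_def by (simp only: norm_minus_commute)
  then have t: "t = a / m" using m by (simp add: t_def a_def)
  have t1: "t < 1" using mob_in_ball[OF assms] by (simp add: t_def)
  have a0: "a \<ge> 0" by (simp add: a_def)
  have am: "a < m" using t1 m unfolding t by simp
  have "(1 - (norm x)\<^sup>2) * (1 - (norm y)\<^sup>2) = m\<^sup>2 - a\<^sup>2"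
    unfolding m2 mob_den_eq a_def norm_minus_commute[of x y] by simp
  also have "\<dots> = (m + a) * (m - a)" by (simp add: power2_eq_square algebra_simps)
  finally have P: "(1 - (norm x)\<^sup>2) * (1 - (norm y)\<^sup>2) = (m + a) * (m - a)" .
  have "exp (hyp_dist x y) = (1 + t) / (1 - t)"
    unfolding exp_hyp_dist_mob[OF assms] t_def ..
  also have "\<dots> = (m + a) / (m - a)" using m am unfolding t by (simp add: field_simps)
  also have "\<dots> = (m + a)\<^sup>2 / ((m + a) * (m - a))"
    using m am a0 by (simp add: power2_eq_square)
  finally show ?thesis unfolding P m_def a_def .
qed

lemma hyp_dist_commute:
  fixes x y :: "'a::euclidean_space"
  assumes "x \<in> ball 0 1" "y \<in> ball 0 1"
  shows "hyp_dist x y = hyp_dist y x"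
proof -
  have "exp (hyp_dist x y) = exp (hyp_dist y x)"
    unfolding exp_hyp_dist[OF assms] exp_hyp_dist[OF assms(2,1)] mob_den_commute[of x y]
      norm_minus_commute[of x y] by (simp only: mult.commute)
  then show ?thesis by simp
qed

lemma hyp_dist_self [simp]: "x \<in> ball 0 1 \<Longrightarrow> hyp_dist x x = 0"
  for x :: "'a::euclidean_space"
  by (simp add: hyp_dist_eq)

lemma exp_hyp_dist_0:
  fixes x :: "'a::euclidean_space"
  assumes "x \<in> ball 0 1"
  shows "exp (hyp_dist 0 x) = (1 + norm x) / (1 - norm x)"
  using assms exp_hyp_dist_mob[of 0 x] by (simp add: mob_0_left)

lemma hyp_dist_nonneg:
  fixes x y :: "'a::euclidean_space"
  assumes "x \<in> ball 0 1" "y \<in> ball 0 1"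
  shows "0 \<le> hyp_dist x y"
proof -
  have "1 \<le> exp (hyp_dist x y)"
    using mob_in_ball[OF assms] unfolding exp_hyp_dist_mob[OF assms] by (simp add: field_simps)
  then show ?thesis by (simp only: one_le_exp_iff)
qed

lemma hyp_dist_mob:
  fixes b x y :: "'a::euclidean_space"
  assumes "b \<in> ball 0 1" "x \<in> ball 0 1" "y \<in> ball 0 1"
  shows "hyp_dist (mob b x) (mob b y) = hyp_dist x y"
proof -
  have c: "x \<in> cball 0 1" "y \<in> cball 0 1" using assms by auto
  define f g where "f = mob_factor b x" and "g = mob_factor b y"
  define P where "P = (1 - (norm x)\<^sup>2) * (1 - (norm y)\<^sup>2)"
  have pos: "f > 0" "g > 0" using mob_factor_pos assms(1) c by (auto simp: f_def g_def)
  have dst: "norm (mob b x - mob b y) = sqrt (f * g) * norm (x - y)"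
    using mob_dist[OF assms(1) c] unfolding f_def[symmetric] g_def[symmetric]
    by (metis norm_ge_zero real_sqrt_mult real_sqrt_unique real_sqrt_abs abs_norm_cancel)
  have PP: "(1 - (norm (mob b x))\<^sup>2) * (1 - (norm (mob b y))\<^sup>2) = f * g * P"
    using mob_one_minus[OF assms(1)] c by (simp add: f_def g_def P_def)
  have den: "mob_den u v = (norm (u - v))\<^sup>2 + (1 - (norm u)\<^sup>2) * (1 - (norm v)\<^sup>2)" for u v :: 'a
    using mob_den_eq[of u v] by (simp only: norm_minus_commute[of u v])
  have "mob_den (mob b x) (mob b y) = f * g * mob_den x y"
    unfolding den PP dst power_mult_distrib using pos by (simp add: P_def algebra_simps)
  then have "(sqrt (mob_den (mob b x) (mob b y)) + norm (mob b x - mob b y))\<^sup>2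
      = (sqrt (f * g) * (sqrt (mob_den x y) + norm (x - y)))\<^sup>2"
    unfolding dst by (simp only: real_sqrt_mult distrib_left)
  also have "\<dots> = f * g * (sqrt (mob_den x y) + norm (x - y))\<^sup>2"
    using pos by (simp add: power_mult_distrib)
  finally have "exp (hyp_dist (mob b x) (mob b y)) = exp (hyp_dist x y)"
    using pos unfolding exp_hyp_dist[OF mob_in_ball[OF assms(1,2)] mob_in_ball[OF assms(1,3)]] PP
      exp_hyp_dist[OF assms(2,3)] P_def[symmetric] by simp
  then show ?thesis by simp
qed

lemma hyp_dist_triangle:
  fixes x y z :: "'a::euclidean_space"
  assumes "x \<in> ball 0 1" "y \<in> ball 0 1" "z \<in> ball 0 1"
  shows "hyp_dist x z \<le> hyp_dist x y + hyp_dist y z"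
proof -
  have through_0: "hyp_dist u v \<le> hyp_dist u 0 + hyp_dist 0 v"
    if u: "u \<in> ball 0 1" and v: "v \<in> ball 0 1" for u v :: 'a
  proof -
    define s t where "s = norm u" and "t = norm v"
    have st: "0 \<le> s" "s < 1" "0 \<le> t" "t < 1" using u v by (auto simp: s_def t_def)
    have "- (u \<bullet> v) \<le> s * t"
      using Cauchy_Schwarz_ineq2[of u v] by (simp add: s_def t_def)
    then have "mob_den u v \<le> (1 + s * t)\<^sup>2"
      by (simp add: mob_den_def power2_sum power_mult_distrib s_def t_def)
    then have "sqrt (mob_den u v) \<le> 1 + s * t"
      using st by (intro real_le_lsqrt) auto
    moreover have "norm (u - v) \<le> s + t" unfolding s_def t_def by (rule norm_triangle_ineq4)
    ultimately have "sqrt (mob_den u v) + norm (u - v) \<le> (1 + s) * (1 + t)"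
      by (simp add: algebra_simps)
    moreover have "0 \<le> sqrt (mob_den u v) + norm (u - v)"
      using mob_den_pos[OF u, of v] v by auto
    ultimately have num: "(sqrt (mob_den u v) + norm (u - v))\<^sup>2 \<le> ((1 + s) * (1 + t))\<^sup>2"
      by (intro power_mono)
    have P: "(1 - s\<^sup>2) * (1 - t\<^sup>2) = ((1 + s) * (1 + t)) * ((1 - s) * (1 - t))"
      by (simp add: power2_eq_square algebra_simps)
    have "exp (hyp_dist u v) \<le> ((1 + s) * (1 + t))\<^sup>2 / (((1 + s) * (1 + t)) * ((1 - s) * (1 - t)))"
      unfolding exp_hyp_dist[OF u v] s_def[symmetric] t_def[symmetric] P
      using num st by (intro divide_right_mono) auto
    also have "\<dots> = (1 + s) / (1 - s) * ((1 + t) / (1 - t))"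
      using st by (simp add: power2_eq_square)
    also have "\<dots> = exp (hyp_dist 0 u) * exp (hyp_dist 0 v)"
      unfolding exp_hyp_dist_0[OF u] exp_hyp_dist_0[OF v] s_def t_def ..
    also have "\<dots> = exp (hyp_dist u 0 + hyp_dist 0 v)"
      using hyp_dist_commute[OF u, of 0] by (simp add: exp_add)
    finally show ?thesis by simp
  qed
  have "hyp_dist (mob y x) (mob y z) \<le> hyp_dist (mob y x) (mob y y) + hyp_dist (mob y y) (mob y z)"
    using through_0[OF mob_in_ball mob_in_ball] assms by simp
  then show ?thesis
    unfolding hyp_dist_mob[OF assms(2,1,3)] hyp_dist_mob[OF assms(2,1,2)] hyp_dist_mob[OF assms(2,2,3)] .
qed

lemma norm_diff_le_hyp_dist:
  fixes x y :: "'a::euclidean_space"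
  assumes "x \<in> ball 0 1" "y \<in> ball 0 1"
  shows "(norm (x - y))\<^sup>2 \<le> exp (hyp_dist x y) * ((1 - (norm x)\<^sup>2) * (1 - (norm y)\<^sup>2))"
proof -
  define P where "P = (1 - (norm x)\<^sup>2) * (1 - (norm y)\<^sup>2)"
  have P: "0 < P"
    using norm_square_less_one[OF assms(1)] norm_square_less_one[OF assms(2)] by (simp add: P_def)
  have "0 \<le> mob_den x y" using mob_den_pos[OF assms(1), of y] assms(2) by auto
  then have "(norm (x - y))\<^sup>2 \<le> (sqrt (mob_den x y) + norm (x - y))\<^sup>2"
    by (intro power_mono) auto
  then show ?thesis using P unfolding exp_hyp_dist[OF assms] P_def[symmetric] by simp
qed

lemma exp_hyp_dist_le:
  fixes x y :: "'a::euclidean_space"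
  assumes "x \<in> ball 0 1" "y \<in> ball 0 1"
    and le: "(norm (x - y))\<^sup>2 \<le> c * ((1 - (norm x)\<^sup>2) * (1 - (norm y)\<^sup>2))"
  shows "exp (hyp_dist x y) \<le> 4 * (c + 1)"
proof -
  define P where "P = (1 - (norm x)\<^sup>2) * (1 - (norm y)\<^sup>2)"
  have P: "0 < P"
    using norm_square_less_one[OF assms(1)] norm_square_less_one[OF assms(2)] by (simp add: P_def)
  have den: "mob_den x y = (norm (x - y))\<^sup>2 + P"
    unfolding mob_den_eq P_def norm_minus_commute[of y x] ..
  have "norm (x - y) \<le> sqrt (mob_den x y)"
    unfolding den using P by (intro real_le_rsqrt) simp
  then have "(sqrt (mob_den x y) + norm (x - y))\<^sup>2 \<le> (2 * sqrt (mob_den x y))\<^sup>2"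
    using P by (intro power_mono) (auto simp: den)
  also have "\<dots> = 4 * mob_den x y" using P by (simp add: den power_mult_distrib)
  also have "\<dots> \<le> 4 * (c + 1) * P" using le[folded P_def] by (simp add: den algebra_simps)
  finally show ?thesis
    using P unfolding exp_hyp_dist[OF assms(1,2)] P_def[symmetric] by (simp add: field_simps)
qed

lemma continuous_on_hyp_dist:
  fixes f g :: "'b::topological_space \<Rightarrow> 'a::euclidean_space"
  assumes f: "continuous_on S f" "\<And>s. s \<in> S \<Longrightarrow> f s \<in> ball 0 1"
    and g: "continuous_on S g" "\<And>s. s \<in> S \<Longrightarrow> g s \<in> ball 0 1"
  shows "continuous_on S (\<lambda>s. hyp_dist (f s) (g s))"
proof -
  have nz: "1 - (norm (f s))\<^sup>2 \<noteq> 0" "1 - (norm (g s))\<^sup>2 \<noteq> 0" if "s \<in> S" for s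
    using norm_square_less_one[OF f(2)[OF that]] norm_square_less_one[OF g(2)[OF that]] by auto
  have "continuous_on S (\<lambda>s. (sqrt (mob_den (f s) (g s)) + norm (f s - g s))\<^sup>2 /
      ((1 - (norm (f s))\<^sup>2) * (1 - (norm (g s))\<^sup>2)))"
    using nz by (intro continuous_intros f g) auto
  then have "continuous_on S (\<lambda>s. exp (hyp_dist (f s) (g s)))"
    by (rule continuous_on_eq) (simp only: exp_hyp_dist[OF f(2) g(2)])
  then have "continuous_on S (\<lambda>s. ln (exp (hyp_dist (f s) (g s))))"
    by (rule continuous_on_ln) simp
  then show ?thesis by simp
qed

lemma norm_mob_eqI:
  fixes x y x' y' :: "'a::euclidean_space"
  assumes "x \<in> ball 0 1" "y \<in> ball 0 1" "x' \<in> ball 0 1" "y' \<in> ball 0 1"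
    and "hyp_dist x y = hyp_dist x' y'"
  shows "norm (mob x y) = norm (mob x' y')"
proof -
  define s t where "s = norm (mob x y)" and "t = norm (mob x' y')"
  have st: "s < 1" "t < 1" using mob_in_ball assms by (auto simp: s_def t_def)
  have "(1 + s) / (1 - s) = (1 + t) / (1 - t)"
    using assms(5) exp_hyp_dist_mob[OF assms(1,2)] exp_hyp_dist_mob[OF assms(3,4)]
    by (simp add: s_def t_def)
  then show ?thesis using st unfolding s_def[symmetric] t_def[symmetric] by (simp add: field_simps)
qed

lemma norm_diff_eqI:
  fixes x y x' y' :: "'a::euclidean_space"
  assumes x: "x \<in> ball 0 1" and y: "y \<in> ball 0 1" and x': "x' \<in> ball 0 1" and y': "y' \<in> ball 0 1"
    and eq: "hyp_dist x y = hyp_dist x' y'" and nrm: "norm x = norm x'" "norm y = norm y'"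
  shows "norm (x - y) = norm (x' - y')"
proof -
  have eq': "norm (mob x y) = norm (mob x' y')" using assms by (intro norm_mob_eqI)
  define A B P where "A = (norm (x - y))\<^sup>2" and "B = (norm (x' - y'))\<^sup>2"
    and "P = (1 - (norm x)\<^sup>2) * (1 - (norm y)\<^sup>2)"
  have P: "P > 0"
    using norm_square_less_one[OF x] norm_square_less_one[OF y] by (simp add: P_def)
  have "P = (1 - (norm x')\<^sup>2) * (1 - (norm y')\<^sup>2)"
    using nrm by (simp add: P_def)
  then have "(norm (mob x' y'))\<^sup>2 = B / (B + P)"
    using mob_norm[OF x', of y'] y' unfolding mob_den_eq by (simp add: B_def norm_minus_commute[of y'])
  moreover have "(norm (mob x y))\<^sup>2 = A / (A + P)"
    using mob_norm[OF x, of y] y unfolding mob_den_eq by (simp add: A_def P_def norm_minus_commute[of y])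
  ultimately have AB: "A / (A + P) = B / (B + P)" using eq' by simp
  have "A \<ge> 0" "B \<ge> 0" by (auto simp: A_def B_def)
  then have "A + P > 0" "B + P > 0" using P by auto
  then have "A * P = B * P" using AB by (simp add: frac_eq_eq algebra_simps)
  then show ?thesis using P by (simp add: A_def B_def)
qed

lemma eq_on_cballI:
  fixes f g :: "'a::euclidean_space \<Rightarrow> real"
  assumes "continuous_on (cball 0 1) f" "continuous_on (cball 0 1) g"
    and "\<And>x. x \<in> ball 0 1 \<Longrightarrow> f x = g x" and x: "x \<in> cball 0 1"
  shows "f x = g x"
proof -
  have "f x - g x = 0"
    by (rule continuous_constant_on_closure[of "ball 0 1" "\<lambda>x. f x - g x" 0])
      (use assms in \<open>auto intro!: continuous_intros\<close>)
  then show ?thesis by simp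
qed

lemma hyp_isometry_eq:
  fixes \<gamma> :: "'a::euclidean_space \<Rightarrow> 'a"
  assumes \<gamma>: "\<gamma> \<in> hyp_isometries" and b: "b \<in> ball 0 1" "\<gamma> b = 0"
  obtains g where "orthogonal_transformation g" "\<And>x. x \<in> cball 0 1 \<Longrightarrow> \<gamma> x = g (mob b x)"
proof -
  have cont: "continuous_on (cball 0 1) \<gamma>" and img: "\<And>x. x \<in> ball 0 1 \<Longrightarrow> \<gamma> x \<in> ball 0 1"
    and iso: "\<And>x y. x \<in> ball 0 1 \<Longrightarrow> y \<in> ball 0 1 \<Longrightarrow> hyp_dist (\<gamma> x) (\<gamma> y) = hyp_dist x y"
    using \<gamma> unfolding hyp_isometries_def by blast+
  have contm: "continuous_on (cball 0 1) (mob b)" by (rule continuous_on_mob[OF b(1)])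
  have nrm: "norm (\<gamma> x) = norm (mob b x)" if x: "x \<in> cball 0 1" for x
  proof (rule eq_on_cballI[OF _ _ _ x])
    fix x :: 'a assume x: "x \<in> ball 0 1"
    show "norm (\<gamma> x) = norm (mob b x)"
      using norm_mob_eqI[OF img[OF b(1)] img[OF x] b(1) x iso[OF b(1) x]]
      by (simp add: b(2) mob_0_left)
  qed (intro continuous_intros cont contm)+
  have dist_ball: "norm (\<gamma> x - \<gamma> y) = norm (mob b x - mob b y)"
    if x: "x \<in> ball 0 1" and y: "y \<in> ball 0 1" for x y
  proof -
    have "hyp_dist (\<gamma> x) (\<gamma> y) = hyp_dist (mob b x) (mob b y)"
      using iso[OF x y] hyp_dist_mob[OF b(1) x y] by simp
    then show ?thesis
      using x y nrm by (intro norm_diff_eqI img mob_in_ball b(1)) auto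
  qed
  have dst: "norm (\<gamma> x - \<gamma> y) = norm (mob b x - mob b y)"
    if x: "x \<in> cball 0 1" and y: "y \<in> cball 0 1" for x y
  proof (rule eq_on_cballI[where f = "\<lambda>x. norm (\<gamma> x - \<gamma> y)", OF _ _ _ x])
    fix x :: 'a assume x: "x \<in> ball 0 1"
    show "norm (\<gamma> x - \<gamma> y) = norm (mob b x - mob b y)"
      by (rule eq_on_cballI[where f = "\<lambda>y. norm (\<gamma> x - \<gamma> y)", OF _ _ dist_ball[OF x] y])
        (intro continuous_intros cont contm)+
  qed (intro continuous_intros cont contm)+
  have b': "- b \<in> ball 0 1" using b by simp
  define A where "A x = \<gamma> (mob (- b) x)" for x
  have inv: "mob b (mob (- b) x) = x" if "x \<in> cball 0 1" for x
    using mob_inverse[OF b' that] by simp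
  have A_norm: "norm (A x) = norm x" if "x \<in> cball 0 1" for x
    unfolding A_def nrm[OF mob_in_cball[OF b' that]] inv[OF that] ..
  have A_dist: "norm (A x - A y) = norm (x - y)" if "x \<in> cball 0 1" "y \<in> cball 0 1" for x y
    unfolding A_def dst[OF mob_in_cball[OF b' that(1)] mob_in_cball[OF b' that(2)]] inv[OF that(1)] inv[OF that(2)] ..
  have A_inner: "A x \<bullet> A y = x \<bullet> y" if "x \<in> cball 0 1" "y \<in> cball 0 1" for x y
    using A_norm[OF that(1)] A_norm[OF that(2)] A_dist[OF that]
    by (simp add: dot_norm_neg)
  obtain g where g: "orthogonal_transformation g" "\<And>x. norm x = 1 \<Longrightarrow> g x = A x"
    using isometry_sphere_extend[of A] A_norm A_dist by (auto simp: dist_norm)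
  have gA: "g x = A x" if x: "x \<in> cball 0 1" for x
  proof -
    obtain w where w: "g w = A x - g x"
      using orthogonal_transformation_surj[OF g(1)] by (metis surjD)
    have "A x \<bullet> g w = g x \<bullet> g w"
    proof (cases "w = 0")
      case True
      then show ?thesis using g(1) by (simp add: orthogonal_transformation_def linear_0)
    next
      case False
      define u where "u = w /\<^sub>R norm w"
      have u: "norm u = 1" "w = norm w *\<^sub>R u" using False by (auto simp: u_def)
      have "g w = norm w *\<^sub>R g u"
        using u(2) g(1) by (metis linear_cmul orthogonal_transformation_def)
      moreover have "g x \<bullet> g u = x \<bullet> u" using g(1) by (simp add: orthogonal_transformation_def)
      moreover have "A x \<bullet> g u = x \<bullet> u"
        using A_inner[OF x, of u] u(1) g(2)[OF u(1)] by simp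
      ultimately show ?thesis by simp
    qed
    then have "(A x - g x) \<bullet> (A x - g x) = 0" by (simp add: w inner_diff_left)
    then show ?thesis by simp
  qed
  have "\<gamma> x = g (mob b x)" if x: "x \<in> cball 0 1" for x
  proof -
    have "g (mob b x) = A (mob b x)" by (rule gA[OF mob_in_cball[OF b(1) x]])
    then show ?thesis unfolding A_def mob_inverse[OF b(1) x] by simp
  qed
  with g(1) that show thesis by blast
qed

context
  fixes \<gamma> :: "'a::euclidean_space \<Rightarrow> 'a"
  assumes \<gamma>: "\<gamma> \<in> hyp_isometries"
begin

lemma hyp_isometry_zero: obtains b where "b \<in> ball 0 1" "\<gamma> b = 0"
proof -
  have "0 \<in> \<gamma> ` ball 0 1" using \<gamma> by (simp add: hyp_isometries_def)
  then show thesis using that by (metis imageE)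
qed

lemma hyp_isometry_continuous: "continuous_on (cball 0 1) \<gamma>"
  using \<gamma> by (simp add: hyp_isometries_def)

lemma hyp_isometry_ball: "x \<in> ball 0 1 \<Longrightarrow> \<gamma> x \<in> ball 0 1"
  using \<gamma> unfolding hyp_isometries_def by blast

lemma hyp_isometry_cball: "x \<in> cball 0 1 \<Longrightarrow> \<gamma> x \<in> cball 0 1"
  using \<gamma> unfolding hyp_isometries_def Bij_def bij_betw_def by blast

lemma hyp_isometry_hyp_dist:
  "x \<in> ball 0 1 \<Longrightarrow> y \<in> ball 0 1 \<Longrightarrow> hyp_dist (\<gamma> x) (\<gamma> y) = hyp_dist x y"
  using \<gamma> unfolding hyp_isometries_def by blast

lemma deriv_norm_eq_mob_factor:
  assumes b: "b \<in> ball 0 1" "\<gamma> b = 0" and x: "x \<in> cball 0 1"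
  shows "deriv_norm \<gamma> x = mob_factor b x"
proof -
  obtain g where g: "orthogonal_transformation g" "\<And>x. x \<in> cball 0 1 \<Longrightarrow> \<gamma> x = g (mob b x)"
    using hyp_isometry_eq[OF \<gamma> b] by blast
  have ling: "linear g" using g(1) by (simp add: orthogonal_transformation_def)
  show ?thesis
  proof (rule deriv_norm_conformal[OF _ x continuous_on_mob_factor[OF b(1)]])
    have "mob_den b x \<noteq> 0" using mob_den_pos[OF b(1) x] by simp
    then have "g \<circ> mob b differentiable (at x within cball 0 1)"
      by (intro differentiable_chain_within mob_differentiable linear_imp_differentiable ling)
    then show "\<gamma> differentiable (at x within cball 0 1)"
      by (rule differentiable_transform_within[OF _ zero_less_one x]) (simp only: o_apply g(2))
    show "0 \<le> mob_factor b x" using mob_factor_pos[OF b(1) x] by simp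
    fix v :: 'a assume v: "v \<in> cball 0 1"
    have "norm (\<gamma> v - \<gamma> x) = norm (mob b v - mob b x)"
      unfolding g(2)[OF v] g(2)[OF x] linear_diff[OF ling, symmetric]
      by (rule orthogonal_transformation_norm[OF g(1)])
    then show "(norm (\<gamma> v - \<gamma> x))\<^sup>2 = mob_factor b x * mob_factor b v * (norm (v - x))\<^sup>2"
      using mob_dist[OF b(1) v x] by (simp only: mult.commute[of "mob_factor b x"])
  qed
qed

lemma deriv_norm_pos: "x \<in> cball 0 1 \<Longrightarrow> 0 < deriv_norm \<gamma> x"
  by (metis hyp_isometry_zero deriv_norm_eq_mob_factor mob_factor_pos)

lemma continuous_on_deriv_norm: "continuous_on (cball 0 1) (deriv_norm \<gamma>)"
proof -
  obtain b where b: "b \<in> ball 0 1" "\<gamma> b = 0" by (rule hyp_isometry_zero)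
  show ?thesis
    by (rule continuous_on_eq[OF continuous_on_mob_factor[OF b(1)]])
      (simp only: deriv_norm_eq_mob_factor[OF b])
qed

lemma hyp_isometry_dist:
  assumes "x \<in> cball 0 1" "y \<in> cball 0 1"
  shows "(norm (\<gamma> x - \<gamma> y))\<^sup>2 = deriv_norm \<gamma> x * deriv_norm \<gamma> y * (norm (x - y))\<^sup>2"
proof -
  obtain b where b: "b \<in> ball 0 1" "\<gamma> b = 0" by (rule hyp_isometry_zero)
  obtain g where g: "orthogonal_transformation g" "\<And>x. x \<in> cball 0 1 \<Longrightarrow> \<gamma> x = g (mob b x)"
    using hyp_isometry_eq[OF \<gamma> b] by blast
  have ling: "linear g" using g(1) by (simp add: orthogonal_transformation_def)
  show ?thesis
    unfolding deriv_norm_eq_mob_factor[OF b assms(1)] deriv_norm_eq_mob_factor[OF b assms(2)]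
      g(2)[OF assms(1)] g(2)[OF assms(2)] linear_diff[OF ling, symmetric]
      orthogonal_transformation_norm[OF g(1)]
    by (rule mob_dist[OF b(1) assms])
qed

lemma hyp_isometry_one_minus:
  assumes "x \<in> cball 0 1"
  shows "1 - (norm (\<gamma> x))\<^sup>2 = deriv_norm \<gamma> x * (1 - (norm x)\<^sup>2)"
proof -
  obtain b where b: "b \<in> ball 0 1" "\<gamma> b = 0" by (rule hyp_isometry_zero)
  obtain g where g: "orthogonal_transformation g" "\<And>x. x \<in> cball 0 1 \<Longrightarrow> \<gamma> x = g (mob b x)"
    using hyp_isometry_eq[OF \<gamma> b] by blast
  show ?thesis
    unfolding deriv_norm_eq_mob_factor[OF b assms] g(2)[OF assms] orthogonal_transformation_norm[OF g(1)]
    by (rule mob_one_minus[OF b(1) assms])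
qed

lemma hyp_isometry_sphere:
  assumes "x \<in> sphere 0 1" shows "\<gamma> x \<in> sphere 0 1"
proof -
  have "1 - (norm (\<gamma> x))\<^sup>2 = 0" using hyp_isometry_one_minus[of x] assms by simp
  then have "(norm (\<gamma> x))\<^sup>2 = 1" by simp
  then show ?thesis by (metis mem_sphere_0 norm_ge_zero power2_eq_1_iff neg_0_le_iff_le not_one_le_zero)
qed

lemma norm_isometry_0:
  assumes "b \<in> ball 0 1" "\<gamma> b = 0"
  shows "norm (\<gamma> 0) = norm b"
proof -
  obtain g where g: "orthogonal_transformation g" "\<And>x. x \<in> cball 0 1 \<Longrightarrow> \<gamma> x = g (mob b x)"
    using hyp_isometry_eq[OF \<gamma> assms] by blast
  have "norm (\<gamma> 0) = norm (mob b 0)"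
    using g(2)[of 0] orthogonal_transformation_norm[OF g(1)] by simp
  then show ?thesis by (simp only: mob_0_right)
qed

end

section \<open>Groups of isometries of the ball\<close>

definition ball_inv :: "('a::euclidean_space \<Rightarrow> 'a) \<Rightarrow> 'a \<Rightarrow> 'a" where
  "ball_inv \<gamma> = (\<lambda>x\<in>cball 0 1. inv_into (cball 0 1) \<gamma> x)"

declare mem_cball [simp del] mem_cball_0 [simp del] mem_ball [simp del] mem_ball_0 [simp del]

locale hyp_group =
  fixes G :: "('a::euclidean_space \<Rightarrow> 'a) set"
  assumes sub: "subgroup G (BijGroup (cball 0 1))" and iso: "G \<subseteq> hyp_isometries"
begin

lemma isoD: "\<gamma> \<in> G \<Longrightarrow> \<gamma> \<in> hyp_isometries"
  using iso by blast

lemma Bij: "\<gamma> \<in> G \<Longrightarrow> \<gamma> \<in> Bij (cball 0 1)"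
  using subgroup.subset[OF sub] by (auto simp: BijGroup_def)

lemma id_in: "(\<lambda>x\<in>cball 0 1. x) \<in> G"
  using subgroup.one_closed[OF sub] by (simp add: BijGroup_def)

lemma comp_in: "\<gamma> \<in> G \<Longrightarrow> \<delta> \<in> G \<Longrightarrow> compose (cball 0 1) \<gamma> \<delta> \<in> G"
  using subgroup.m_closed[OF sub, of \<gamma> \<delta>] Bij by (simp add: BijGroup_def)

lemma inv_in: "\<gamma> \<in> G \<Longrightarrow> ball_inv \<gamma> \<in> G"
  using subgroup.m_inv_closed[OF sub, of \<gamma>] inv_BijGroup[OF Bij, of \<gamma>] by (simp add: ball_inv_def)

lemma ext: "\<gamma> \<in> G \<Longrightarrow> \<delta> \<in> G \<Longrightarrow> (\<And>x. x \<in> cball 0 1 \<Longrightarrow> \<gamma> x = \<delta> x) \<Longrightarrow> \<gamma> = \<delta>"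
  using Bij by (intro extensionalityI[of _ "cball 0 1"]) (auto simp: Bij_def)

lemma cball: "\<gamma> \<in> G \<Longrightarrow> x \<in> cball 0 1 \<Longrightarrow> \<gamma> x \<in> cball 0 1"
  using hyp_isometry_cball isoD by blast

lemma ball: "\<gamma> \<in> G \<Longrightarrow> x \<in> ball 0 1 \<Longrightarrow> \<gamma> x \<in> ball 0 1"
  using hyp_isometry_ball isoD by blast

lemma sphere: "\<gamma> \<in> G \<Longrightarrow> x \<in> sphere 0 1 \<Longrightarrow> \<gamma> x \<in> sphere 0 1"
  using hyp_isometry_sphere isoD by blast

lemma bij: "\<gamma> \<in> G \<Longrightarrow> bij_betw \<gamma> (cball 0 1) (cball 0 1)"
  using Bij by (simp add: Bij_def)

lemma inv_left [simp]: "\<gamma> \<in> G \<Longrightarrow> x \<in> cball 0 1 \<Longrightarrow> ball_inv \<gamma> (\<gamma> x) = x"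
  using cball[of \<gamma> x] bij[of \<gamma>] by (simp add: ball_inv_def bij_betw_def)

lemma inv_right [simp]: "\<gamma> \<in> G \<Longrightarrow> x \<in> cball 0 1 \<Longrightarrow> \<gamma> (ball_inv \<gamma> x) = x"
  using bij[of \<gamma>] by (simp add: ball_inv_def bij_betw_def f_inv_into_f)

lemma comp_apply [simp]: "x \<in> cball 0 1 \<Longrightarrow> compose (cball 0 1) \<gamma> \<delta> x = \<gamma> (\<delta> x)"
  for \<gamma> \<delta> :: "'a \<Rightarrow> 'a"
  by (simp add: compose_def)

lemma inv_inv: "\<gamma> \<in> G \<Longrightarrow> ball_inv (ball_inv \<gamma>) = \<gamma>"
  by (rule ext[OF inv_in[OF inv_in]]) (metis cball inv_in inv_left inv_right)+

lemma bij_comp_left: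
  assumes "\<gamma> \<in> G"
  shows "bij_betw (compose (cball 0 1) \<gamma>) G G"
proof (rule bij_betw_byWitness[where f' = "compose (cball 0 1) (ball_inv \<gamma>)"])
  show "\<forall>\<delta>\<in>G. compose (cball 0 1) (ball_inv \<gamma>) (compose (cball 0 1) \<gamma> \<delta>) = \<delta>"
    using assms by (intro ballI ext comp_in inv_in) (simp_all add: cball)
  show "\<forall>\<delta>\<in>G. compose (cball 0 1) \<gamma> (compose (cball 0 1) (ball_inv \<gamma>) \<delta>) = \<delta>"
    using assms by (intro ballI ext comp_in inv_in) (simp_all add: cball)
qed (use assms in \<open>auto intro: comp_in inv_in\<close>)

lemma inj_on: "\<gamma> \<in> G \<Longrightarrow> inj_on \<gamma> (cball 0 1)"
  using bij by (auto simp: bij_betw_def)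

lemma image_eq_vimage:
  assumes "\<gamma> \<in> G" "X \<subseteq> cball 0 1"
  shows "\<gamma> ` X = {x \<in> cball 0 1. ball_inv \<gamma> x \<in> X}"
proof (intro Set.set_eqI iffI)
  fix x assume "x \<in> \<gamma> ` X"
  then show "x \<in> {x \<in> cball 0 1. ball_inv \<gamma> x \<in> X}"
    using assms cball[of \<gamma>] by auto
next
  fix x assume "x \<in> {x \<in> cball 0 1. ball_inv \<gamma> x \<in> X}"
  then have "x = \<gamma> (ball_inv \<gamma> x)" "ball_inv \<gamma> x \<in> X" using assms by auto
  then show "x \<in> \<gamma> ` X" by blast
qed

lemma inv_image:
  assumes "\<gamma> \<in> G" "X \<subseteq> cball 0 1"
  shows "ball_inv \<gamma> ` \<gamma> ` X = X" "\<gamma> ` ball_inv \<gamma> ` X = X"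
  using assms by (force simp: image_iff subset_iff)+

lemma comp_image:
  fixes \<gamma> \<delta> :: "'a \<Rightarrow> 'a"
  assumes "X \<subseteq> cball 0 1"
  shows "compose (cball 0 1) \<gamma> \<delta> ` X = \<gamma> ` \<delta> ` X"
  using assms by (force simp: image_iff subset_iff)

lemma hyp_group_set_stab:
  assumes X: "X \<subseteq> cball 0 1"
  shows "hyp_group (set_stab G X)"
proof (rule hyp_group.intro)
  show "set_stab G X \<subseteq> hyp_isometries" using iso by (auto simp: set_stab_def)
  have grp: "group (BijGroup (cball (0::'a) 1))" by (rule group_BijGroup)
  show "subgroup (set_stab G X) (BijGroup (cball 0 1))"
  proof (rule group.subgroupI[OF grp])
    show "set_stab G X \<subseteq> carrier (BijGroup (cball 0 1))"
      using subgroup.subset[OF sub] by (auto simp: set_stab_def)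
    have "(\<lambda>x\<in>cball 0 1. x) ` X = X" using X by (force simp: subset_iff)
    then have "(\<lambda>x\<in>cball 0 1. x) \<in> set_stab G X" using id_in by (simp only: set_stab_def mem_Collect_eq)
    then show "set_stab G X \<noteq> {}" by blast
    fix \<gamma> assume \<gamma>: "\<gamma> \<in> set_stab G X"
    then have "\<gamma> \<in> G" "\<gamma> ` X = X" by (auto simp: set_stab_def)
    then have "ball_inv \<gamma> \<in> set_stab G X"
      using inv_image[OF _ X, of \<gamma>] inv_in by (auto simp: set_stab_def)
    then show "inv\<^bsub>BijGroup (cball 0 1)\<^esub> \<gamma> \<in> set_stab G X"
      using inv_BijGroup[OF Bij[OF \<open>\<gamma> \<in> G\<close>]] by (simp add: ball_inv_def)
    fix \<delta> assume "\<delta> \<in> set_stab G X"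
    then have "\<delta> \<in> G" "\<delta> ` X = X" by (auto simp: set_stab_def)
    then have "compose (cball 0 1) \<gamma> \<delta> \<in> set_stab G X"
      using comp_image[OF X] comp_in \<open>\<gamma> \<in> G\<close> \<open>\<gamma> ` X = X\<close> by (simp add: set_stab_def)
    then show "\<gamma> \<otimes>\<^bsub>BijGroup (cball 0 1)\<^esub> \<delta> \<in> set_stab G X"
      using Bij \<open>\<gamma> \<in> G\<close> \<open>\<delta> \<in> G\<close> by (simp add: BijGroup_def)
  qed
qed

lemma deriv_norm_comp:
  assumes \<gamma>: "\<gamma> \<in> G" and \<delta>: "\<delta> \<in> G" and x: "x \<in> cball 0 1"
  shows "deriv_norm (compose (cball 0 1) \<gamma> \<delta>) x = deriv_norm \<gamma> (\<delta> x) * deriv_norm \<delta> x"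
proof (rule eq_on_cballI[OF continuous_on_deriv_norm _ _ x])
  have I: "compose (cball 0 1) \<gamma> \<delta> \<in> hyp_isometries" using comp_in[OF \<gamma> \<delta>] isoD by blast
  show "compose (cball 0 1) \<gamma> \<delta> \<in> hyp_isometries" by (rule I)
  show "continuous_on (cball 0 1) (\<lambda>x. deriv_norm \<gamma> (\<delta> x) * deriv_norm \<delta> x)"
    by (intro continuous_on_mult continuous_on_deriv_norm[OF isoD[OF \<delta>]]
        continuous_on_compose2[OF continuous_on_deriv_norm[OF isoD[OF \<gamma>]] hyp_isometry_continuous[OF isoD[OF \<delta>]]])
      (use cball[OF \<delta>] in blast)
  fix x :: 'a assume "x \<in> ball 0 1"
  then have x: "x \<in> cball 0 1" and nz: "1 - (norm x)\<^sup>2 \<noteq> 0"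
    using norm_square_less_one[of x] ball_subset_cball[THEN subsetD, of x] by auto
  have "deriv_norm (compose (cball 0 1) \<gamma> \<delta>) x * (1 - (norm x)\<^sup>2)
      = deriv_norm \<gamma> (\<delta> x) * (deriv_norm \<delta> x * (1 - (norm x)\<^sup>2))"
    using hyp_isometry_one_minus[OF I x] hyp_isometry_one_minus[OF isoD[OF \<gamma>] cball[OF \<delta> x]]
      hyp_isometry_one_minus[OF isoD[OF \<delta>] x] unfolding comp_apply[OF x] by (simp only:)
  then show "deriv_norm (compose (cball 0 1) \<gamma> \<delta>) x = deriv_norm \<gamma> (\<delta> x) * deriv_norm \<delta> x"
    using nz by simp
qed

lemma deriv_norm_id:
  assumes "x \<in> cball (0::'a) 1"
  shows "deriv_norm (\<lambda>x\<in>cball 0 1. x) x = 1"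
  using deriv_norm_eq_mob_factor[OF isoD[OF id_in], of 0 x] assms
  by (simp add: mob_factor_def mob_den_def mem_ball mem_cball)

lemma deriv_norm_eq:
  assumes "\<gamma> \<in> G" "x \<in> cball 0 1"
  shows "deriv_norm \<gamma> x = mob_factor (ball_inv \<gamma> 0) x"
  using assms ball[OF inv_in[OF assms(1)], of 0]
  by (intro deriv_norm_eq_mob_factor isoD inv_right) (auto simp: mem_ball mem_cball)

lemma deriv_norm_sphere:
  assumes "\<gamma> \<in> G" "x \<in> sphere 0 1"
  shows "deriv_norm \<gamma> x = (1 - (norm (ball_inv \<gamma> 0))\<^sup>2) / (norm (x - ball_inv \<gamma> 0))\<^sup>2"
  using deriv_norm_eq[OF assms(1), of x] assms(2) by (simp add: mob_factor_def mob_den_eq mem_cball)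

lemma norm_inv_0:
  assumes "\<gamma> \<in> G" shows "norm (ball_inv \<gamma> 0) = norm (\<gamma> 0)"
  using norm_isometry_0[OF isoD[OF assms], of "ball_inv \<gamma> 0"] ball[OF inv_in[OF assms], of 0] assms
  by (simp add: mem_ball mem_cball)

lemma hyp_dist_inv:
  assumes "\<gamma> \<in> G" "x \<in> ball 0 1" "y \<in> ball 0 1"
  shows "hyp_dist (\<gamma> x) y = hyp_dist x (ball_inv \<gamma> y)"
  using hyp_isometry_hyp_dist[OF isoD[OF assms(1)], of x "ball_inv \<gamma> y"] assms ball[OF inv_in[OF assms(1)]]
  by (simp add: ball_subset_cball[THEN subsetD])

end

declare mem_cball [simp] mem_cball_0 [simp] mem_ball [simp] mem_ball_0 [simp]

text \<open>If a point of a geodesic ray from \<open>\<gamma> 0\<close> to \<open>\<gamma> z\<close> is close to the sphere, then it is close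
  to one of the two endpoints.\<close>

lemma geodesic_near_sphere:
  fixes \<gamma> :: "'a::euclidean_space \<Rightarrow> 'a"
  assumes \<gamma>: "\<gamma> \<in> hyp_isometries" and z: "z \<in> sphere 0 1" and s: "0 \<le> s" "s < 1"
  shows "norm (\<gamma> 0 - \<gamma> (s *\<^sub>R z)) * norm (\<gamma> (s *\<^sub>R z) - \<gamma> z) \<le> 1 - (norm (\<gamma> (s *\<^sub>R z)))\<^sup>2"
proof -
  have c: "0 \<in> cball 0 (1::real)" "s *\<^sub>R z \<in> cball 0 1" "z \<in> cball 0 1" "(0::'a) \<in> cball 0 1"
    using z s by auto
  define d0 d1 dz where "d0 = deriv_norm \<gamma> 0" and "d1 = deriv_norm \<gamma> (s *\<^sub>R z)" and "dz = deriv_norm \<gamma> z"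
  have pos: "d1 > 0" using deriv_norm_pos[OF \<gamma> c(2)] by (simp add: d1_def)
  have zz: "norm (s *\<^sub>R z - z) = 1 - s"
  proof -
    have "s *\<^sub>R z - z = (s - 1) *\<^sub>R z" by (simp add: algebra_simps)
    then show ?thesis using z s by simp
  qed
  have "norm (\<gamma> 0 - \<gamma> z) \<le> 2"
    using norm_triangle_ineq4[of "\<gamma> 0" "\<gamma> z"] hyp_isometry_cball[OF \<gamma> c(4)] hyp_isometry_cball[OF \<gamma> c(3)] by simp
  then have "(norm (\<gamma> 0 - \<gamma> z))\<^sup>2 \<le> 2\<^sup>2" by (intro power_mono) auto
  then have d4: "d0 * dz \<le> 4"
    using hyp_isometry_dist[OF \<gamma> c(4,3)] z by (simp add: d0_def dz_def)
  have "(norm (\<gamma> 0 - \<gamma> (s *\<^sub>R z)) * norm (\<gamma> (s *\<^sub>R z) - \<gamma> z))\<^sup>2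
      = (d0 * d1 * s\<^sup>2) * (d1 * dz * (1 - s)\<^sup>2)"
    unfolding power_mult_distrib hyp_isometry_dist[OF \<gamma> c(4,2)] hyp_isometry_dist[OF \<gamma> c(2,3)] zz
    using z s by (simp add: d0_def d1_def dz_def)
  also have "\<dots> = (d0 * dz) * (d1 * s * (1 - s))\<^sup>2" by (simp add: power2_eq_square)
  also have "\<dots> \<le> 4 * (d1 * s * (1 - s))\<^sup>2" using d4 by (intro mult_right_mono) auto
  also have "\<dots> = (d1 * (1 - s) * (2 * s))\<^sup>2" by (simp add: power2_eq_square)
  also have "\<dots> \<le> (d1 * (1 - s) * (1 + s))\<^sup>2"
    using pos s by (intro power_mono mult_left_mono) auto
  also have "d1 * (1 - s) * (1 + s) = 1 - (norm (\<gamma> (s *\<^sub>R z)))\<^sup>2"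
    using hyp_isometry_one_minus[OF \<gamma> c(2)] z s
    by (simp add: d1_def power_mult_distrib power2_eq_square algebra_simps)
  finally have "(norm (\<gamma> 0 - \<gamma> (s *\<^sub>R z)) * norm (\<gamma> (s *\<^sub>R z) - \<gamma> z))\<^sup>2 \<le> (1 - (norm (\<gamma> (s *\<^sub>R z)))\<^sup>2)\<^sup>2" .
  then show ?thesis
    by (rule power2_le_imp_le) (use norm_square_le_one[OF hyp_isometry_cball[OF \<gamma> c(2)]] in simp)
qed

lemma geodesic_through_compact:
  fixes \<gamma> :: "'a::euclidean_space \<Rightarrow> 'a"
  assumes \<gamma>: "\<gamma> \<in> hyp_isometries" and w: "w \<in> sphere 0 1" and s: "0 \<le> s" "s < 1"
    and c: "c \<le> 1 - (norm (\<gamma> (s *\<^sub>R w)))\<^sup>2"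
  shows "c / 4 \<le> norm (\<gamma> 0 - \<gamma> w)"
proof -
  obtain b where b: "b \<in> ball 0 1" "\<gamma> b = 0" using hyp_isometry_zero[OF \<gamma>] by blast
  have cb: "s *\<^sub>R w \<in> cball 0 1" "w \<in> cball 0 1" "(0::'a) \<in> cball 0 1" using w s by auto
  define D where "D = sqrt (mob_den b (s *\<^sub>R w))"
  have D: "D > 0" "D\<^sup>2 = mob_den b (s *\<^sub>R w)" using mob_den_pos[OF b(1) cb(1)] by (auto simp: D_def)
  have bn: "norm b < 1" and B: "0 < 1 - (norm b)\<^sup>2" using b(1) norm_square_less_one[OF b(1)] by auto
  have "norm b * s \<le> s" using bn s by (simp add: mult_left_le_one_le)
  then have "(1 - s)\<^sup>2 \<le> (1 - norm b * norm (s *\<^sub>R w))\<^sup>2"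
    using s w by (intro power_mono) auto
  then have "(1 - s)\<^sup>2 \<le> D\<^sup>2" using mob_den_ge[of b "s *\<^sub>R w"] D(2) by simp
  then have sD: "1 - s \<le> D" by (rule power2_le_imp_le) (use D(1) in simp)
  have "(norm (s *\<^sub>R w - b))\<^sup>2 \<le> D\<^sup>2"
    unfolding D(2) mob_den_eq using B norm_square_le_one[OF cb(1)] by simp
  then have sb: "norm (s *\<^sub>R w - b) \<le> D" by (rule power2_le_imp_le) (use D(1) in simp)
  have split: "(s *\<^sub>R w - b) + (1 - s) *\<^sub>R w = w - b" by (simp add: algebra_simps)
  have "norm ((1 - s) *\<^sub>R w) = 1 - s" using w s by simp
  then have "norm (w - b) \<le> norm (s *\<^sub>R w - b) + (1 - s)"
    using norm_triangle_ineq[of "s *\<^sub>R w - b" "(1 - s) *\<^sub>R w"] unfolding split by simp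
  then have wb: "norm (w - b) \<le> 2 * D" using sD sb by linarith
  have wb0: "norm (w - b) > 0" using w bn by auto
  have ww: "1 - (norm (s *\<^sub>R w))\<^sup>2 \<le> 2 * (1 - s)"
    using w s mult_left_le_one_le[of s s] zero_le_power2[of "1 - s"]
    by (simp add: power2_eq_square algebra_simps)
  have "c \<le> (1 - (norm b)\<^sup>2) / D\<^sup>2 * (1 - (norm (s *\<^sub>R w))\<^sup>2)"
    using c unfolding hyp_isometry_one_minus[OF \<gamma> cb(1)]
      deriv_norm_eq_mob_factor[OF \<gamma> b cb(1)] mob_factor_def D(2) .
  also have "\<dots> \<le> (1 - (norm b)\<^sup>2) / D\<^sup>2 * (2 * D)"
  proof (rule mult_left_mono)
    show "1 - (norm (s *\<^sub>R w))\<^sup>2 \<le> 2 * D"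
      by (rule order_trans[OF ww mult_left_mono[OF sD]]) simp
    show "0 \<le> (1 - (norm b)\<^sup>2) / D\<^sup>2"
      by (rule divide_nonneg_nonneg[OF less_imp_le[OF B] zero_le_power2])
  qed
  also have "\<dots> = 2 * (1 - (norm b)\<^sup>2) / D" using D(1) by (simp add: power2_eq_square)
  finally have cD: "c / 4 \<le> (1 - (norm b)\<^sup>2) / (2 * D)" using D(1) by (simp add: field_simps)
  also have "\<dots> \<le> (1 - (norm b)\<^sup>2) / norm (w - b)"
    using wb wb0 B D(1) by (intro divide_left_mono mult_pos_pos) auto
  also have "\<dots> = norm (\<gamma> 0 - \<gamma> w)"
  proof -
    have "(norm (\<gamma> 0 - \<gamma> w))\<^sup>2 = ((1 - (norm b)\<^sup>2) / norm (w - b))\<^sup>2"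
      unfolding hyp_isometry_dist[OF \<gamma> cb(3,2)] deriv_norm_eq_mob_factor[OF \<gamma> b cb(3)]
        deriv_norm_eq_mob_factor[OF \<gamma> b cb(2)] mob_factor_def mob_den_eq
      using w by (simp add: power_divide) (simp add: power2_eq_square)
    then show ?thesis using B wb0 by simp
  qed
  finally show ?thesis .
qed

lemma radial_image_bounded_dist:
  fixes \<gamma> :: "'a::euclidean_space \<Rightarrow> 'a"
  assumes \<gamma>: "\<gamma> \<in> hyp_isometries" and z: "z \<in> sphere 0 1"
  obtains C where "\<And>s. 0 \<le> s \<Longrightarrow> s < 1 \<Longrightarrow> hyp_dist (\<gamma> (s *\<^sub>R z)) (s *\<^sub>R \<gamma> z) \<le> C"
proof -
  have cont: "continuous_on (cball 0 1) (deriv_norm \<gamma>)" by (rule continuous_on_deriv_norm[OF \<gamma>])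
  have ne: "cball (0::'a) 1 \<noteq> {}" by simp
  obtain u where u: "u \<in> cball 0 1" "\<And>x. x \<in> cball 0 1 \<Longrightarrow> deriv_norm \<gamma> u \<le> deriv_norm \<gamma> x"
    using continuous_attains_inf[OF compact_cball ne cont] by blast
  obtain v where v: "v \<in> cball 0 1" "\<And>x. x \<in> cball 0 1 \<Longrightarrow> deriv_norm \<gamma> x \<le> deriv_norm \<gamma> v"
    using continuous_attains_sup[OF compact_cball ne cont] by blast
  define m M where "m = deriv_norm \<gamma> u" and "M = deriv_norm \<gamma> v"
  have m: "m > 0" using deriv_norm_pos[OF \<gamma> u(1)] by (simp add: m_def)
  have M: "M \<ge> m" using v(2)[OF u(1)] by (simp add: m_def M_def)
  have zc: "z \<in> cball 0 1" using z by simp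
  have gz: "norm (\<gamma> z) = 1" using hyp_isometry_sphere[OF \<gamma> z] by simp
  define c where "c = (M + 1)\<^sup>2 / m"
  have "hyp_dist (\<gamma> (s *\<^sub>R z)) (s *\<^sub>R \<gamma> z) \<le> ln (4 * (c + 1))" if s: "0 \<le> s" "s < 1" for s
  proof -
    have sz: "s *\<^sub>R z \<in> ball 0 1" "s *\<^sub>R z \<in> cball 0 1" using z s by auto
    have sgz: "s *\<^sub>R \<gamma> z \<in> ball 0 1" using gz s by simp
    have szz: "norm (s *\<^sub>R z - z) = 1 - s"
    proof -
      have "s *\<^sub>R z - z = (s - 1) *\<^sub>R z" by (simp add: algebra_simps)
      then show ?thesis using z s by simp
    qed
    have "(norm (\<gamma> (s *\<^sub>R z) - \<gamma> z))\<^sup>2 \<le> M * M * (1 - s)\<^sup>2"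
      unfolding hyp_isometry_dist[OF \<gamma> sz(2) zc] szz
      using v(2)[OF sz(2)] v(2)[OF zc] u(2)[OF sz(2)] u(2)[OF zc] m
      by (intro mult_right_mono mult_mono) (auto simp: M_def m_def)
    also have "\<dots> = (M * (1 - s))\<^sup>2" by (simp add: power2_eq_square)
    finally have a: "norm (\<gamma> (s *\<^sub>R z) - \<gamma> z) \<le> M * (1 - s)"
      by (rule power2_le_imp_le) (use m M s in simp)
    have split: "(\<gamma> (s *\<^sub>R z) - \<gamma> z) + (1 - s) *\<^sub>R \<gamma> z = \<gamma> (s *\<^sub>R z) - s *\<^sub>R \<gamma> z"
      by (simp add: algebra_simps)
    have "norm ((1 - s) *\<^sub>R \<gamma> z) = 1 - s" using gz s by simp
    then have "norm (\<gamma> (s *\<^sub>R z) - s *\<^sub>R \<gamma> z) \<le> norm (\<gamma> (s *\<^sub>R z) - \<gamma> z) + (1 - s)"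
      using norm_triangle_ineq[of "\<gamma> (s *\<^sub>R z) - \<gamma> z" "(1 - s) *\<^sub>R \<gamma> z"] unfolding split by simp
    then have "norm (\<gamma> (s *\<^sub>R z) - s *\<^sub>R \<gamma> z) \<le> (M + 1) * (1 - s)"
      using a by (simp add: algebra_simps)
    then have le1: "(norm (\<gamma> (s *\<^sub>R z) - s *\<^sub>R \<gamma> z))\<^sup>2 \<le> ((M + 1) * (1 - s))\<^sup>2"
      by (intro power_mono) auto
    have one: "1 - s \<le> 1 - (norm (s *\<^sub>R y))\<^sup>2" if "norm y = 1" for y :: 'a
      using s that mult_left_le_one_le[of s s] by (simp add: power2_eq_square)
    have "m * (1 - s) \<le> deriv_norm \<gamma> (s *\<^sub>R z) * (1 - (norm (s *\<^sub>R z))\<^sup>2)"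
      using u(2)[OF sz(2)] m s one[of z] z by (intro mult_mono) (auto simp: m_def)
    also have "\<dots> = 1 - (norm (\<gamma> (s *\<^sub>R z)))\<^sup>2"
      using hyp_isometry_one_minus[OF \<gamma> sz(2)] by simp
    finally have le2: "m * (1 - s) \<le> 1 - (norm (\<gamma> (s *\<^sub>R z)))\<^sup>2" .
    have "0 \<le> m * (1 - s)" using m s by simp
    then have "(m * (1 - s)) * (1 - s) \<le> (1 - (norm (\<gamma> (s *\<^sub>R z)))\<^sup>2) * (1 - (norm (s *\<^sub>R \<gamma> z))\<^sup>2)"
      using le2 s by (intro mult_mono one[OF gz]) linarith+
    then have "c * ((m * (1 - s)) * (1 - s)) \<le> c * ((1 - (norm (\<gamma> (s *\<^sub>R z)))\<^sup>2) * (1 - (norm (s *\<^sub>R \<gamma> z))\<^sup>2))"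
      using m by (intro mult_left_mono) (auto simp: c_def)
    moreover have "c * ((m * (1 - s)) * (1 - s)) = ((M + 1) * (1 - s))\<^sup>2"
      using m by (simp add: c_def power2_eq_square)
    ultimately have "exp (hyp_dist (\<gamma> (s *\<^sub>R z)) (s *\<^sub>R \<gamma> z)) \<le> 4 * (c + 1)"
      using le1 by (intro exp_hyp_dist_le hyp_isometry_ball[OF \<gamma> sz(1)] sgz) linarith
    moreover have "c \<ge> 0" using m by (simp add: c_def)
    ultimately show ?thesis by (simp add: ln_ge_iff)
  qed
  then show thesis by (rule that)
qed

section \<open>Geodesic rays and cores\<close>

lemma norm_eq_tanh_iff:
  fixes x :: "'a::euclidean_space"
  assumes "x \<in> ball 0 1"
  shows "hyp_dist 0 x = t \<longleftrightarrow> norm x = tanh (t / 2)"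
proof
  assume "norm x = tanh (t / 2)"
  then show "hyp_dist 0 x = t" using assms by (simp add: hyp_dist_eq mob_0_left artanh_tanh_real)
next
  assume h: "hyp_dist 0 x = t"
  define s where "s = norm x"
  have "exp t = (1 + s) / (1 - s)"
    using exp_hyp_dist_0[OF assms] h by (simp add: s_def)
  moreover have "\<bar>tanh (t / 2)\<bar> < 1"
    using tanh_real_lt_1[of "t / 2"] tanh_real_gt_neg1[of "t / 2"]
    unfolding abs_less_iff by (intro conjI) linarith+
  then have "exp t = (1 + tanh (t / 2)) / (1 - tanh (t / 2))"
    using exp_two_artanh[of "tanh (t / 2)"] by (simp add: artanh_tanh_real)
  ultimately have "(1 + s) / (1 - s) = (1 + tanh (t / 2)) / (1 - tanh (t / 2))" by simp
  then show "norm x = tanh (t / 2)"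
    using assms tanh_real_lt_1[of "t / 2"] by (simp add: s_def[symmetric] frac_eq_eq algebra_simps)
qed

lemma hyp_dist_0_mono:
  fixes x y :: "'a::euclidean_space"
  assumes "x \<in> ball 0 1" "y \<in> ball 0 1" "norm x \<le> norm y"
  shows "hyp_dist 0 x \<le> hyp_dist 0 y"
proof -
  have "exp (hyp_dist 0 x) \<le> exp (hyp_dist 0 y)"
    unfolding exp_hyp_dist_0[OF assms(1)] exp_hyp_dist_0[OF assms(2)]
    using assms by (intro frac_le) auto
  then show ?thesis by simp
qed

lemma hyp_dist_radial:
  fixes e :: "'a::euclidean_space"
  assumes e: "e \<in> sphere 0 1" and s: "0 \<le> s" "s \<le> t" "t < 1"
  shows "hyp_dist (s *\<^sub>R e) (t *\<^sub>R e) = hyp_dist 0 (t *\<^sub>R e) - hyp_dist 0 (s *\<^sub>R e)"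
proof -
  have b: "s *\<^sub>R e \<in> ball 0 1" "t *\<^sub>R e \<in> ball 0 1" using e s by auto
  have ee: "e \<bullet> e = 1" using e power2_norm_eq_inner[of e] by simp
  have "s * t < 1" using s mult_left_le_one_le[of t s] by simp
  moreover have "mob_den (s *\<^sub>R e) (t *\<^sub>R e) = (1 - s * t)\<^sup>2"
    using e s by (simp add: mob_den_def ee power2_eq_square algebra_simps)
  ultimately have sq: "sqrt (mob_den (s *\<^sub>R e) (t *\<^sub>R e)) = 1 - s * t" by simp
  have nd: "norm (s *\<^sub>R e - t *\<^sub>R e) = t - s"
    using e s by (simp flip: scaleR_diff_left)
  have "exp (hyp_dist (s *\<^sub>R e) (t *\<^sub>R e)) = (1 - s * t + (t - s))\<^sup>2 / ((1 - s\<^sup>2) * (1 - t\<^sup>2))"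
    unfolding exp_hyp_dist[OF b] sq nd using e s by (simp add: power_mult_distrib)
  also have "1 - s * t + (t - s) = (1 - s) * (1 + t)" by (simp add: algebra_simps)
  also have "(1 - s\<^sup>2) * (1 - t\<^sup>2) = ((1 - s) * (1 + t)) * ((1 + s) * (1 - t))"
    by (simp add: power2_eq_square algebra_simps)
  also have "((1 - s) * (1 + t))\<^sup>2 / (((1 - s) * (1 + t)) * ((1 + s) * (1 - t)))
      = ((1 + t) / (1 - t)) / ((1 + s) / (1 - s))"
    using s by (simp add: power2_eq_square) (simp only: mult.commute)
  also have "\<dots> = exp (hyp_dist 0 (t *\<^sub>R e) - hyp_dist 0 (s *\<^sub>R e))"
    unfolding exp_diff exp_hyp_dist_0[OF b(1)] exp_hyp_dist_0[OF b(2)] using e s by simp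
  finally show ?thesis by simp
qed

lemma mob_hyp_isometry:
  fixes b :: "'a::euclidean_space"
  assumes b: "b \<in> ball 0 1"
  shows "restrict (mob b) (cball 0 1) \<in> hyp_isometries"
proof -
  have b': "- b \<in> ball 0 1" using b by simp
  have inv1: "mob (- b) (mob b x) = x" if "x \<in> cball 0 1" for x using mob_inverse[OF b that] .
  have inv2: "mob b (mob (- b) x) = x" if "x \<in> cball 0 1" for x using mob_inverse[OF b' that] by simp
  have "bij_betw (mob b) (cball 0 1) (cball 0 1)"
    by (rule bij_betw_byWitness[where f' = "mob (- b)"])
      (use inv1 inv2 mob_in_cball[OF b] mob_in_cball[OF b'] in blast)+
  then have "bij_betw (restrict (mob b) (cball 0 1)) (cball 0 1) (cball 0 1)"
    by (subst bij_betw_cong[where g = "mob b"]) auto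
  moreover have "restrict (mob b) (cball 0 1) ` ball 0 1 = ball 0 1"
  proof (intro equalityI subsetI)
    fix x :: 'a assume x: "x \<in> ball 0 1"
    then have "x = restrict (mob b) (cball 0 1) (mob (- b) x)" and "mob (- b) x \<in> ball 0 1"
      using inv2[of x] mob_in_ball[OF b' x] by auto
    then show "x \<in> restrict (mob b) (cball 0 1) ` ball 0 1" by blast
  qed (use mob_in_ball[OF b] in auto)
  moreover have "continuous_on (cball 0 1) (restrict (mob b) (cball 0 1))"
    by (rule continuous_on_eq[OF continuous_on_mob[OF b]]) simp
  moreover have "\<forall>x\<in>ball 0 1. \<forall>y\<in>ball 0 1.
      hyp_dist (restrict (mob b) (cball 0 1) x) (restrict (mob b) (cball 0 1) y) = hyp_dist x y"
  proof (intro ballI)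
    fix x y :: 'a assume x: "x \<in> ball 0 1" and y: "y \<in> ball 0 1"
    then have "x \<in> cball 0 1" "y \<in> cball 0 1" by auto
    then show "hyp_dist (restrict (mob b) (cball 0 1) x) (restrict (mob b) (cball 0 1) y) = hyp_dist x y"
      using hyp_dist_mob[OF b x y] by (simp only: restrict_apply' )
  qed
  ultimately show ?thesis by (simp add: hyp_isometries_def Bij_def)
qed

lemma hyp_segment:
  fixes x y :: "'a::euclidean_space"
  assumes x: "x \<in> ball 0 1" and y: "y \<in> ball 0 1"
  obtains C where "connected C" "C \<subseteq> ball 0 1" "x \<in> C" "y \<in> C" "\<And>p. p \<in> C \<Longrightarrow> hyp_dist x p \<le> hyp_dist x y"
proof
  define w where "w = mob x y"
  define C where "C = mob (- x) ` closed_segment 0 w"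
  have x': "- x \<in> ball 0 1" using x by simp
  have w: "w \<in> ball 0 1" using mob_in_ball[OF x y] by (simp add: w_def)
  have seg: "closed_segment 0 w \<subseteq> ball 0 1"
    using w by (simp add: closed_segment_subset)
  then have segc: "closed_segment 0 w \<subseteq> cball 0 1" using ball_subset_cball by blast
  show "connected C"
    unfolding C_def
    by (intro connected_continuous_image continuous_on_subset[OF continuous_on_mob[OF x'] segc] connected_segment)
  show CB: "C \<subseteq> ball 0 1" unfolding C_def using mob_in_ball[OF x'] seg by blast
  have "mob (- x) 0 = x" "mob (- x) w = y"
    using mob_inverse[OF x ball_subset_cball[THEN subsetD, OF x]]
      mob_inverse[OF x ball_subset_cball[THEN subsetD, OF y]] unfolding w_def mob_self by blast+
  then show "x \<in> C" "y \<in> C" unfolding C_def by (metis ends_in_segment imageI)+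
  fix p assume "p \<in> C"
  then obtain q where q: "q \<in> closed_segment 0 w" "p = mob (- x) q" by (auto simp: C_def)
  have qb: "q \<in> ball 0 1" "q \<in> cball 0 1" using q seg segc by auto
  have "mob x p = q" unfolding q(2) using mob_inverse[OF x' qb(2)] by simp
  moreover have "p \<in> ball 0 1" unfolding q(2) by (rule mob_in_ball[OF x' qb(1)])
  ultimately have 1: "hyp_dist x p = hyp_dist 0 q"
    using hyp_dist_mob[OF x x, of p] by simp
  have 2: "hyp_dist x y = hyp_dist 0 w"
    using hyp_dist_mob[OF x x y] by (simp add: w_def)
  have "norm q \<le> norm w" using q(1) segment_bound1[of q 0 w] by simp
  then show "hyp_dist x p \<le> hyp_dist x y"
    unfolding 1 2 by (rule hyp_dist_0_mono[OF qb(1) w])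
qed

lemma hyp_dist_0_scaleR:
  fixes z :: "'a::euclidean_space"
  assumes "z \<in> sphere 0 1" "t \<ge> 0"
  shows "tanh (t / 2) *\<^sub>R z \<in> ball 0 1" "hyp_dist 0 (tanh (t / 2) *\<^sub>R z) = t"
proof -
  have "norm (tanh (t / 2) *\<^sub>R z) = tanh (t / 2)"
    using assms tanh_real_nonneg_iff[of "t / 2"] by simp
  then show "tanh (t / 2) *\<^sub>R z \<in> ball 0 1" "hyp_dist 0 (tanh (t / 2) *\<^sub>R z) = t"
    using tanh_real_lt_1[of "t / 2"] norm_eq_tanh_iff[of "tanh (t / 2) *\<^sub>R z" t] by auto
qed

lemma hyp_dist_radial_tanh:
  fixes z :: "'a::euclidean_space"
  assumes z: "z \<in> sphere 0 1" and t: "0 \<le> s" "s \<le> t"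
  shows "hyp_dist (tanh (s / 2) *\<^sub>R z) (tanh (t / 2) *\<^sub>R z) = t - s"
  using hyp_dist_radial[OF z, of "tanh (s / 2)" "tanh (t / 2)"] hyp_dist_0_scaleR[OF z] t
    tanh_real_lt_1[of "t / 2"] by simp

lemma tanh_half_tendsto: "((\<lambda>t::real. tanh (t / 2)) \<longlongrightarrow> 1) at_top"
proof (rule filterlim_compose[OF tanh_real_at_top])
  show "filterlim (\<lambda>t::real. t / 2) at_top at_top"
    using filterlim_tendsto_pos_mult_at_top[OF tendsto_const[of "1/2::real"] _ filterlim_ident] by simp
qed

lemma hyp_ray_radial:
  fixes z :: "'a::euclidean_space"
  assumes z: "z \<in> sphere 0 1"
  shows "hyp_ray (\<lambda>t. tanh (t / 2) *\<^sub>R z) z"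
  unfolding hyp_ray_def
proof (intro conjI allI impI)
  show "(\<lambda>t. tanh (t / 2) *\<^sub>R z) ` {0..} \<subseteq> ball 0 1" using hyp_dist_0_scaleR[OF z] by auto
  have "((\<lambda>t. tanh (t / 2) *\<^sub>R z) \<longlongrightarrow> 1 *\<^sub>R z) at_top"
    by (intro tendsto_intros tanh_half_tendsto)
  then show "((\<lambda>t. tanh (t / 2) *\<^sub>R z) \<longlongrightarrow> z) at_top" by simp
  fix s t :: real assume st: "s \<ge> 0" "t \<ge> 0"
  show "hyp_dist (tanh (s / 2) *\<^sub>R z) (tanh (t / 2) *\<^sub>R z) = \<bar>s - t\<bar>"
  proof (cases "s \<le> t")
    case False
    then show ?thesis
      using hyp_dist_radial_tanh[OF z, of t s] st hyp_dist_commute hyp_dist_0_scaleR(1)[OF z] by fastforce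
  qed (use hyp_dist_radial_tanh[OF z, of s t] st in simp)
qed

text \<open>A hyperbolic ray from the origin is radial, since equality holds in the triangle inequality.\<close>

lemma hyp_ray_bounded_dist:
  fixes z :: "'a::euclidean_space"
  assumes r: "hyp_ray r z" and z: "z \<in> sphere 0 1"
  obtains C where "\<And>t. t \<ge> 1 \<Longrightarrow> hyp_dist (r t) (tanh (t / 2) *\<^sub>R z) \<le> C"
proof -
  have rb: "r t \<in> ball 0 1" if "t \<ge> 0" for t using r that by (auto simp: hyp_ray_def)
  have rd: "hyp_dist (r s) (r t) = \<bar>s - t\<bar>" if "s \<ge> 0" "t \<ge> 0" for s t
    using r that by (auto simp: hyp_ray_def)
  have lim: "(r \<longlongrightarrow> z) at_top" using r by (simp add: hyp_ray_def)
  define x where "x = r 0"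
  have x: "x \<in> ball 0 1" using rb[of 0] by (simp add: x_def)
  have x': "- x \<in> ball 0 1" using x by simp
  define m where "m t = mob x (r t)" for t
  have mb: "m t \<in> ball 0 1" if "t \<ge> 0" for t unfolding m_def by (rule mob_in_ball[OF x rb[OF that]])
  have md: "hyp_dist (m s) (m t) = \<bar>s - t\<bar>" if "s \<ge> 0" "t \<ge> 0" for s t
    unfolding m_def hyp_dist_mob[OF x rb[OF that(1)] rb[OF that(2)]] by (rule rd[OF that])
  have m0: "m 0 = 0" by (simp add: m_def x_def)
  have mn: "norm (m t) = tanh (t / 2)" if "t \<ge> 0" for t
    using md[of 0 t] that norm_eq_tanh_iff[OF mb[OF that]] by (simp add: m0)
  define a where "a = tanh (1 / 2 :: real)"
  have a: "a > 0" by (simp add: a_def)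
  define e where "e = (1 / a) *\<^sub>R m 1"
  have e: "e \<in> sphere 0 1" using mn[of 1] a by (simp add: e_def a_def)
  have m1: "m 1 = a *\<^sub>R e" using a by (simp add: e_def)
  have mt: "m t = tanh (t / 2) *\<^sub>R e" if t: "t \<ge> 1" for t
  proof -
    define b where "b = tanh (t / 2)"
    have ab: "a \<le> b" using t by (simp add: a_def b_def)
    have nb: "norm (m t) = b" using mn[of t] t by (simp add: b_def)
    have "norm (m 1 - m t) = norm (tanh (1 / 2) *\<^sub>R e - tanh (t / 2) *\<^sub>R e)"
    proof (rule norm_diff_eqI)
      show "hyp_dist (m 1) (m t) = hyp_dist (tanh (1 / 2) *\<^sub>R e) (tanh (t / 2) *\<^sub>R e)"
        using md[of 1 t] hyp_dist_radial_tanh[OF e, of 1 t] t by simp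
    qed (use t mb hyp_dist_0_scaleR(1)[OF e, of 1] hyp_dist_0_scaleR(1)[OF e, of t] e nb ab a m1 in
        \<open>auto simp: a_def b_def\<close>)
    also have "\<dots> = b - a" using ab e by (simp add: a_def b_def flip: scaleR_diff_left)
    finally have "(norm (m 1 - m t))\<^sup>2 = (b - a)\<^sup>2" by simp
    moreover have "(norm (m 1 - m t))\<^sup>2 = (norm (m 1))\<^sup>2 + (norm (m t))\<^sup>2 - 2 * (m 1 \<bullet> m t)"
      unfolding power2_norm_eq_inner by (simp add: inner_diff_left inner_diff_right inner_commute)
    ultimately have "m 1 \<bullet> m t = a * b"
      using mn[of 1] nb by (simp add: a_def[symmetric] power2_eq_square algebra_simps)
    then have "(norm (b *\<^sub>R m 1 - a *\<^sub>R m t))\<^sup>2 = b\<^sup>2 * (norm (m 1))\<^sup>2 + a\<^sup>2 * (norm (m t))\<^sup>2 - 2 * (a * b) * (a * b)"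
      unfolding power2_norm_eq_inner
      by (simp add: inner_diff_left inner_diff_right inner_commute power2_eq_square algebra_simps)
    also have "\<dots> = 0" using mn[of 1] nb by (simp add: a_def[symmetric] power2_eq_square)
    finally have "a *\<^sub>R m t = b *\<^sub>R m 1" by simp
    then have "a *\<^sub>R m t = a *\<^sub>R (b *\<^sub>R e)" unfolding m1 by simp
    then have "m t = b *\<^sub>R e" by (rule scaleR_left_imp_eq[rotated]) (use a in simp)
    then show ?thesis by (simp only: b_def)
  qed
  define \<gamma> where "\<gamma> = restrict (mob (- x)) (cball 0 1)"
  have \<gamma>: "\<gamma> \<in> hyp_isometries" unfolding \<gamma>_def by (rule mob_hyp_isometry[OF x'])
  have r\<gamma>: "r t = \<gamma> (tanh (t / 2) *\<^sub>R e)" if t: "t \<ge> 1" for t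
  proof -
    have "tanh (t / 2) *\<^sub>R e \<in> cball 0 1" using hyp_dist_0_scaleR(1)[OF e, of t] t by auto
    then have "\<gamma> (tanh (t / 2) *\<^sub>R e) = mob (- x) (m t)" by (simp only: \<gamma>_def mt[OF t] restrict_apply')
    also have "\<dots> = r t"
      unfolding m_def using mob_inverse[OF x, of "r t"] rb[of t] t by auto
    finally show ?thesis by simp
  qed
  have "\<gamma> e = z"
  proof (rule tendsto_unique[OF _ _ lim])
    have "((\<lambda>t. tanh (t / 2) *\<^sub>R e) \<longlongrightarrow> 1 *\<^sub>R e) at_top"
      by (intro tendsto_intros tanh_half_tendsto)
    moreover have "\<forall>\<^sub>F t in at_top. tanh (t / 2) *\<^sub>R e \<in> cball 0 1"
      by (rule eventually_mono[OF eventually_ge_at_top[of 0]])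
        (use hyp_dist_0_scaleR(1)[OF e] ball_subset_cball in blast)
    ultimately have "((\<lambda>t. \<gamma> (tanh (t / 2) *\<^sub>R e)) \<longlongrightarrow> \<gamma> (1 *\<^sub>R e)) at_top"
      using continuous_on_tendsto_compose[OF hyp_isometry_continuous[OF \<gamma>], of "\<lambda>t. tanh (t / 2) *\<^sub>R e" "1 *\<^sub>R e"] e
      by simp
    moreover have "\<forall>\<^sub>F t in at_top. r t = \<gamma> (tanh (t / 2) *\<^sub>R e)"
      by (rule eventually_mono[OF eventually_ge_at_top[of 1]]) (rule r\<gamma>)
    ultimately show "(r \<longlongrightarrow> \<gamma> e) at_top" by (simp add: tendsto_cong)
  qed simp
  obtain C where C: "\<And>s. 0 \<le> s \<Longrightarrow> s < 1 \<Longrightarrow> hyp_dist (\<gamma> (s *\<^sub>R e)) (s *\<^sub>R \<gamma> e) \<le> C"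
    using radial_image_bounded_dist[OF \<gamma> e] by blast
  have "hyp_dist (r t) (tanh (t / 2) *\<^sub>R z) \<le> C" if "t \<ge> 1" for t
    using C[of "tanh (t / 2)"] that tanh_real_lt_1[of "t / 2"] unfolding r\<gamma>[OF that] \<open>\<gamma> e = z\<close> by simp
  then show thesis by (rule that)
qed

lemma hyp_dist_bounded_tendsto:
  fixes u v :: "'b \<Rightarrow> 'a::euclidean_space"
  assumes u: "(u \<longlongrightarrow> z) F" and z: "z \<in> sphere 0 1"
    and ub: "\<forall>\<^sub>F k in F. u k \<in> ball 0 1" and vb: "\<forall>\<^sub>F k in F. v k \<in> ball 0 1"
    and C: "\<forall>\<^sub>F k in F. hyp_dist (u k) (v k) \<le> C"
  shows "(v \<longlongrightarrow> z) F"
proof -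
  have "((\<lambda>k. exp C * (1 - (norm (u k))\<^sup>2)) \<longlongrightarrow> exp C * (1 - (norm z)\<^sup>2)) F"
    by (intro tendsto_intros u)
  moreover have "exp C * (1 - (norm z)\<^sup>2) = 0" using z by simp
  ultimately have "((\<lambda>k. exp C * (1 - (norm (u k))\<^sup>2)) \<longlongrightarrow> 0) F" by (simp only:)
  moreover have "\<forall>\<^sub>F k in F. norm ((norm (u k - v k))\<^sup>2) \<le> exp C * (1 - (norm (u k))\<^sup>2)"
    using ub vb C
  proof eventually_elim
    case (elim k)
    have p: "0 < 1 - (norm (u k))\<^sup>2" "0 < 1 - (norm (v k))\<^sup>2" "1 - (norm (v k))\<^sup>2 \<le> 1"
      using norm_square_less_one[OF elim(1)] norm_square_less_one[OF elim(2)] by auto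
    have "(norm (u k - v k))\<^sup>2 \<le> exp (hyp_dist (u k) (v k)) * ((1 - (norm (u k))\<^sup>2) * (1 - (norm (v k))\<^sup>2))"
      by (rule norm_diff_le_hyp_dist[OF elim(1,2)])
    also have "\<dots> \<le> exp C * ((1 - (norm (u k))\<^sup>2) * 1)"
      using elim(3) p by (intro mult_mono) auto
    finally show ?case by simp
  qed
  ultimately have "((\<lambda>k. (norm (u k - v k))\<^sup>2) \<longlongrightarrow> 0) F" by (rule Lim_null_comparison[rotated])
  then have "((\<lambda>k. sqrt ((norm (u k - v k))\<^sup>2)) \<longlongrightarrow> sqrt 0) F" by (rule tendsto_real_sqrt)
  then have "((\<lambda>k. norm (u k - v k)) \<longlongrightarrow> 0) F" by simp
  then have "((\<lambda>k. u k - v k) \<longlongrightarrow> 0) F" by (rule tendsto_norm_zero_cancel)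
  then have "((\<lambda>k. u k - (u k - v k)) \<longlongrightarrow> z - 0) F" by (intro tendsto_diff u)
  then show ?thesis by simp
qed

definition hyp_core :: "real \<Rightarrow> 'a::euclidean_space set \<Rightarrow> 'a set" where
  "hyp_core N E = {x \<in> ball 0 1. \<forall>y\<in>ball 0 1. hyp_dist x y < N \<longrightarrow> y \<in> E}"

lemma hyp_core_subset: "N > 0 \<Longrightarrow> hyp_core N E \<subseteq> E"
  unfolding hyp_core_def using hyp_dist_self by force

lemma hyp_core_subset_ball: "hyp_core N E \<subseteq> ball 0 1"
  by (auto simp: hyp_core_def)

lemma hyp_core_mono: "M \<le> N \<Longrightarrow> E \<subseteq> F \<Longrightarrow> hyp_core N E \<subseteq> hyp_core M F"
  by (fastforce simp: hyp_core_def simp del: mem_ball)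

lemma hyp_core_dist:
  assumes "x \<in> hyp_core N E" "y \<in> ball 0 1" "hyp_dist x y \<le> c"
  shows "y \<in> hyp_core (N - c) E"
proof -
  have x: "x \<in> ball 0 1" using assms(1) by (simp add: hyp_core_def)
  have "w \<in> E" if w: "w \<in> ball 0 1" "hyp_dist y w < N - c" for w
    using hyp_dist_triangle[OF x assms(2) w(1)] assms w by (simp add: hyp_core_def)
  then show ?thesis using assms(2) by (simp add: hyp_core_def)
qed

lemma closedin_hyp_core: "closedin (top_of_set (ball 0 1)) (hyp_core N E)"
proof -
  have *: "closedin (top_of_set (ball 0 1)) (ball 0 1 \<inter> (\<lambda>x. hyp_dist x y) -` {N..})" if "y \<in> ball 0 1" for y :: 'a
    by (rule continuous_closedin_preimage) (use that in \<open>auto intro!: continuous_on_hyp_dist continuous_intros\<close>)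
  show ?thesis
  proof (cases "ball 0 1 - E = {}")
    case True
    then have "hyp_core N E = ball 0 1" unfolding hyp_core_def by blast
    then show ?thesis by simp
  next
    case False
    have "hyp_core N E = (\<Inter>y\<in>ball 0 1 - E. ball 0 1 \<inter> (\<lambda>x. hyp_dist x y) -` {N..})"
    proof (intro Set.set_eqI iffI)
      fix x assume "x \<in> hyp_core N E"
      then show "x \<in> (\<Inter>y\<in>ball 0 1 - E. ball 0 1 \<inter> (\<lambda>x. hyp_dist x y) -` {N..})"
        unfolding hyp_core_def by (auto simp: not_less[symmetric] simp del: mem_ball)
    next
      fix x assume x: "x \<in> (\<Inter>y\<in>ball 0 1 - E. ball 0 1 \<inter> (\<lambda>x. hyp_dist x y) -` {N..})"
      then have "x \<in> ball 0 1" using False by blast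
      moreover have "y \<in> E" if "y \<in> ball 0 1" "hyp_dist x y < N" for y
      proof (rule ccontr)
        assume "y \<notin> E"
        then have "x \<in> (\<lambda>x. hyp_dist x y) -` {N..}" using x that(1) by blast
        then show False using that(2) by simp
      qed
      ultimately show "x \<in> hyp_core N E" unfolding hyp_core_def by blast
    qed
    then show ?thesis using False * by (simp only:) (intro closedin_INT, auto)
  qed
qed

lemma hyp_core_crossing:
  fixes C :: "'a::euclidean_space set"
  assumes C: "connected C" "C \<subseteq> ball 0 1" and a: "a \<in> C" "a \<in> hyp_core N E" and b: "b \<in> C" "b \<notin> hyp_core N E"
  obtains p where "p \<in> C" "p \<in> hyp_core N E" "p \<notin> hyp_core (N + 1) E"
proof -
  have "C \<inter> frontier (hyp_core N E) \<noteq> {}"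
    using a b by (intro connected_Int_frontier[OF C(1)]) auto
  then obtain p where p: "p \<in> C" "p \<in> closure (hyp_core N E)" "p \<notin> interior (hyp_core N E)"
    by (auto simp: frontier_def)
  have pb: "p \<in> ball 0 1" using p(1) C(2) by blast
  have 1: "p \<in> hyp_core N E"
  proof -
    obtain T where T: "closed T" "hyp_core N E = ball 0 1 \<inter> T"
      using closedin_hyp_core[of N E] unfolding closedin_closed by blast
    then have "closure (hyp_core N E) \<subseteq> T" by (simp add: closure_minimal)
    then show ?thesis using p(2) pb T(2) by blast
  qed
  have 2: "p \<notin> hyp_core (N + 1) E"
  proof
    assume pc: "p \<in> hyp_core (N + 1) E"
    define U where "U = ball 0 1 \<inter> (hyp_dist p -` {..<1})"
    have "continuous_on (ball 0 1) (\<lambda>y. hyp_dist p y)"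
      using pb by (intro continuous_on_hyp_dist continuous_intros) auto
    then have "open U" unfolding U_def by (intro continuous_open_preimage) auto
    moreover have "p \<in> U" using pb by (simp add: U_def)
    moreover have "U \<subseteq> hyp_core N E"
    proof
      fix y assume "y \<in> U"
      then have "y \<in> ball 0 1" "hyp_dist p y \<le> 1" by (auto simp: U_def)
      then show "y \<in> hyp_core N E" using hyp_core_dist[OF pc, of y 1] by simp
    qed
    ultimately show False using p(3) interiorI by blast
  qed
  show thesis by (rule that[OF p(1) 1 2])
qed

lemma frontier_of_ball:
  fixes E :: "'a::euclidean_space set"
  assumes "open E" "E \<subseteq> ball 0 1"
  shows "top_of_set (ball 0 1) frontier_of E = ball 0 1 \<inter> closure E - E"
proof -
  have "openin (top_of_set (ball 0 1)) E" using assms by (simp add: openin_open_eq)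
  then show ?thesis
    using assms by (simp add: frontier_of_def interior_of_openin closure_of_subtopology Int_absorb1)
qed

lemma hyp_dist_frontier:
  fixes E :: "'a::euclidean_space set"
  assumes E: "open E" and x: "x \<in> E" "x \<in> ball 0 1" and y: "y \<in> ball 0 1" "y \<notin> E"
  obtains f where "f \<in> ball 0 1" "f \<in> closure E" "f \<notin> E" "hyp_dist x f \<le> hyp_dist x y"
proof -
  obtain C where C: "connected C" "C \<subseteq> ball 0 1" "x \<in> C" "y \<in> C" "\<And>p. p \<in> C \<Longrightarrow> hyp_dist x p \<le> hyp_dist x y"
    using hyp_segment[OF x(2) y(1)] by blast
  have "C \<inter> frontier E \<noteq> {}" using C x y by (intro connected_Int_frontier) auto
  then obtain f where "f \<in> C" "f \<in> closure E" "f \<notin> E"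
    using E by (auto simp: frontier_def interior_open)
  then show thesis using C that by blast
qed

lemma is_endpoint_iff:
  fixes E :: "'a::euclidean_space set"
  assumes E: "open E" "E \<subseteq> ball 0 1"
  shows "is_endpoint E z \<longleftrightarrow> z \<in> sphere 0 1 \<and> (\<forall>N. \<forall>\<^sub>F s in at_left 1. s *\<^sub>R z \<in> hyp_core N E)"
proof (intro iffI conjI allI)
  assume ep: "is_endpoint E z"
  then show z: "z \<in> sphere 0 1" by (simp add: is_endpoint_def)
  fix N :: real
  let ?r = "\<lambda>t. tanh (t / 2) *\<^sub>R z"
  obtain T where T: "T \<ge> 0" "?r ` {T..} \<subseteq> E"
    and lim: "((\<lambda>t. INF y \<in> top_of_set (ball 0 1) frontier_of E. ereal (hyp_dist (?r t) y)) \<longlongrightarrow> \<infinity>) at_top"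
    using ep hyp_ray_radial[OF z] unfolding is_endpoint_def by blast
  have "\<forall>\<^sub>F t in at_top. ereal N < (INF y \<in> top_of_set (ball 0 1) frontier_of E. ereal (hyp_dist (?r t) y))"
    using lim by (simp add: tendsto_PInfty)
  then obtain T' where T': "\<And>t. t \<ge> T' \<Longrightarrow>
      ereal N < (INF y \<in> top_of_set (ball 0 1) frontier_of E. ereal (hyp_dist (?r t) y))"
    by (auto simp: eventually_at_top_linorder)
  have core: "?r t \<in> hyp_core N E" if t: "t \<ge> T" "t \<ge> T'" for t
  proof -
    have rb: "?r t \<in> ball 0 1" "?r t \<in> E" using hyp_dist_0_scaleR(1)[OF z, of t] T t by auto
    have "y \<in> E" if y: "y \<in> ball 0 1" "hyp_dist (?r t) y < N" for y
    proof (rule ccontr)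
      assume "y \<notin> E"
      then obtain f where f: "f \<in> ball 0 1" "f \<in> closure E" "f \<notin> E" "hyp_dist (?r t) f \<le> hyp_dist (?r t) y"
        using hyp_dist_frontier[OF E(1) rb(2,1) y(1)] by blast
      then have "f \<in> top_of_set (ball 0 1) frontier_of E" using frontier_of_ball[OF E] by simp
      then have "ereal N < ereal (hyp_dist (?r t) f)"
        using T'[OF t(2)] by (meson INF_lower less_le_trans)
      then show False using f(4) y(2) by simp
    qed
    then show ?thesis using rb(1) by (simp add: hyp_core_def)
  qed
  define M where "M = tanh (max T T' / 2)"
  have "\<forall>\<^sub>F s in at_left 1. max 0 M < s"
    using eventually_at_left_real[of "max 0 M" 1] tanh_real_lt_1 by (auto simp: M_def elim!: eventually_mono)
  moreover have "\<forall>\<^sub>F s in at_left 1. s < (1::real)" by (simp add: eventually_at_filter)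
  ultimately show "\<forall>\<^sub>F s in at_left 1. s *\<^sub>R z \<in> hyp_core N E"
  proof eventually_elim
    case (elim s)
    have b: "s *\<^sub>R z \<in> ball 0 1" using elim z by simp
    define t where "t = hyp_dist 0 (s *\<^sub>R z)"
    have s: "s = tanh (t / 2)" using norm_eq_tanh_iff[OF b, of t] z elim by (simp add: t_def)
    then have "max T T' \<le> t" using elim unfolding M_def s by simp
    then show ?case unfolding s by (intro core) auto
  qed
next
  assume "z \<in> sphere 0 1 \<and> (\<forall>N. \<forall>\<^sub>F s in at_left 1. s *\<^sub>R z \<in> hyp_core N E)"
  then have z: "z \<in> sphere 0 1" and deep: "\<And>N. \<forall>\<^sub>F s in at_left 1. s *\<^sub>R z \<in> hyp_core N E" by auto
  have flt: "filterlim (\<lambda>t::real. tanh (t / 2)) (at_left 1) at_top"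
    using tanh_half_tendsto tanh_real_lt_1 by (auto simp: filterlim_at intro!: always_eventually less_imp_neq)
  show "is_endpoint E z"
    unfolding is_endpoint_def
  proof (intro conjI allI impI z)
    fix r assume r: "hyp_ray r z"
    obtain C where C: "\<And>t. t \<ge> 1 \<Longrightarrow> hyp_dist (r t) (tanh (t / 2) *\<^sub>R z) \<le> C"
      using hyp_ray_bounded_dist[OF r z] by blast
    have rb: "r t \<in> ball 0 1" if "t \<ge> 0" for t using r that by (auto simp: hyp_ray_def)
    have rdeep: "\<forall>\<^sub>F t in at_top. r t \<in> hyp_core N E" for N
      using filterlim_iff[THEN iffD1, OF flt, rule_format, OF deep[of "N + C"]] eventually_ge_at_top[of 1]
    proof eventually_elim
      case (elim t)
      have "hyp_dist (tanh (t / 2) *\<^sub>R z) (r t) \<le> C"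
        using C[OF elim(2)] hyp_dist_commute[OF rb hyp_dist_0_scaleR(1)[OF z]] elim(2) by simp
      then show ?case using hyp_core_dist[OF elim(1) rb, of t C] elim(2) by simp
    qed
    obtain T where "\<And>t. t \<ge> T \<Longrightarrow> r t \<in> hyp_core 1 E"
      using rdeep[of 1] by (auto simp: eventually_at_top_linorder)
    then show "\<exists>T\<ge>0. r ` {T..} \<subseteq> E"
      using hyp_core_subset[of 1 E] by (intro exI[of _ "max T 0"]) auto
    show "((\<lambda>t. INF y \<in> top_of_set (ball 0 1) frontier_of E. ereal (hyp_dist (r t) y)) \<longlongrightarrow> \<infinity>) at_top"
      unfolding tendsto_PInfty
    proof
      fix M :: real
      show "\<forall>\<^sub>F t in at_top. ereal M < (INF y \<in> top_of_set (ball 0 1) frontier_of E. ereal (hyp_dist (r t) y))"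
        using rdeep[of "M + 1"]
      proof eventually_elim
        case (elim t)
        have "ereal (M + 1) \<le> (INF y \<in> top_of_set (ball 0 1) frontier_of E. ereal (hyp_dist (r t) y))"
        proof (rule INF_greatest)
          fix y assume "y \<in> top_of_set (ball 0 1) frontier_of E"
          then have "y \<in> ball 0 1" "y \<notin> E" using frontier_of_ball[OF E] by auto
          then show "ereal (M + 1) \<le> ereal (hyp_dist (r t) y)"
            using elim by (auto simp: hyp_core_def not_less[symmetric] simp del: mem_ball)
        qed
        then show ?case by (rule less_le_trans[rotated]) simp
      qed
    qed
  qed
qed

section \<open>Limit sets and components of the preimage of an end\<close>

lemma cball_eq_hyp_ball:
  fixes x :: "'a::euclidean_space"
  assumes "R \<ge> 0" "x \<in> ball 0 1" "hyp_dist 0 x \<le> R"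
  shows "x \<in> cball 0 (tanh (R / 2))"
proof -
  have "norm x = tanh (hyp_dist 0 x / 2)" using norm_eq_tanh_iff[OF assms(2)] by blast
  also have "\<dots> \<le> tanh (R / 2)" using assms(3) by simp
  finally show ?thesis by simp
qed

lemma cball_tanh_subset: "cball 0 (tanh R) \<subseteq> ball (0::'a::euclidean_space) 1"
  using tanh_real_lt_1[of R] by auto

lemma compact_hyp_dist_bounded:
  fixes K :: "'a::euclidean_space set"
  assumes "compact K" "K \<subseteq> ball 0 1" "x \<in> ball 0 1"
  obtains R where "R \<ge> 0" "\<And>k. k \<in> K \<Longrightarrow> hyp_dist x k \<le> R"
proof -
  have "continuous_on K (\<lambda>k. hyp_dist x k)"
    using assms by (intro continuous_on_hyp_dist continuous_intros) auto
  then have "bounded ((\<lambda>k. hyp_dist x k) ` K)"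
    using assms(1) compact_continuous_image compact_imp_bounded by blast
  then obtain R where "\<And>k. k \<in> K \<Longrightarrow> \<bar>hyp_dist x k\<bar> \<le> R"
    by (auto simp: bounded_iff)
  then show thesis using that[of "max R 0"] by fastforce
qed

context hyp_group
begin

lemma orbit_subset_ball: "x \<in> ball 0 1 \<Longrightarrow> group_orbit G x \<subseteq> ball 0 1"
  using ball by (auto simp: group_orbit_def simp del: mem_ball)

lemma orbit_image:
  assumes \<gamma>: "\<gamma> \<in> G" and x: "x \<in> cball 0 1"
  shows "group_orbit G (\<gamma> x) = group_orbit G x"
proof (intro Set.set_eqI iffI)
  fix y assume "y \<in> group_orbit G (\<gamma> x)"
  then obtain \<delta> where "\<delta> \<in> G" "y = \<delta> (\<gamma> x)" by (auto simp: group_orbit_def)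
  then show "y \<in> group_orbit G x"
    using comp_in[OF _ \<gamma>, of \<delta>] comp_apply[OF x, of \<delta> \<gamma>] unfolding group_orbit_def by (metis imageI)
next
  fix y assume "y \<in> group_orbit G x"
  then obtain \<delta> where \<delta>: "\<delta> \<in> G" "y = \<delta> x" by (auto simp: group_orbit_def)
  then have "y = compose (cball 0 1) \<delta> (ball_inv \<gamma>) (\<gamma> x)"
    using comp_apply[OF cball[OF \<gamma> x], of \<delta> "ball_inv \<gamma>"] inv_left[OF \<gamma> x] by simp
  then show "y \<in> group_orbit G (\<gamma> x)"
    using comp_in[OF \<delta>(1) inv_in[OF \<gamma>]] unfolding group_orbit_def by blast
qed

lemma orbit_self: "x \<in> cball 0 1 \<Longrightarrow> x \<in> group_orbit G x"
  using id_in unfolding group_orbit_def by (metis imageI restrict_apply')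

lemma orbit_eqD: "x \<in> cball 0 1 \<Longrightarrow> group_orbit G x = group_orbit G y \<Longrightarrow> \<exists>\<gamma>\<in>G. x = \<gamma> y"
  using orbit_self[of x] by (auto simp: group_orbit_def)

lemma orbit_tendsto:
  assumes z: "z \<in> sphere 0 1" and g: "\<And>k. g k \<in> G" and x: "\<And>k. x k \<in> ball 0 1" and y: "\<And>k. y k \<in> ball 0 1"
    and C: "\<And>k. hyp_dist (x k) (y k) \<le> C" and lim: "((\<lambda>k. g k (x k)) \<longlongrightarrow> z) F"
  shows "((\<lambda>k. g k (y k)) \<longlongrightarrow> z) F"
  by (rule hyp_dist_bounded_tendsto[OF lim z, where C = C])
    (use ball[OF g] x y C hyp_isometry_hyp_dist[OF isoD[OF g]] in simp_all)

lemma limit_set_eq: "limit_set G = sphere 0 1 \<inter> closure (group_orbit G 0)"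
proof (intro equalityI subsetI)
  fix z assume "z \<in> limit_set G"
  then obtain x where z: "z \<in> sphere 0 1" and x: "x \<in> ball 0 1" "z islimpt group_orbit G x"
    by (auto simp: limit_set_def)
  then have "z \<in> closure (group_orbit G x)" by (simp add: closure_def)
  then obtain f where f: "\<And>n. f n \<in> group_orbit G x" "f \<longlonglongrightarrow> z" by (auto simp: closure_sequential)
  have "\<forall>n. \<exists>\<gamma>. \<gamma> \<in> G \<and> f n = \<gamma> x" using f(1) unfolding group_orbit_def by blast
  from choice[OF this] obtain g where g: "\<And>n. g n \<in> G" "\<And>n. f n = g n x" by blast
  have "f = (\<lambda>n. g n x)" using g(2) by blast
  with f(2) have "(\<lambda>n. g n x) \<longlonglongrightarrow> z" by blast
  then have "(\<lambda>n. g n 0) \<longlonglongrightarrow> z"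
    by (rule orbit_tendsto[where g = g and x = "\<lambda>_. x" and y = "\<lambda>_. 0" and C = "hyp_dist x 0", rotated -1])
      (use z x g(1) in simp_all)
  then have "z \<in> closure (group_orbit G 0)"
    using g(1) unfolding closure_sequential group_orbit_def by (intro exI[of _ "\<lambda>n. g n 0"]) blast
  then show "z \<in> sphere 0 1 \<inter> closure (group_orbit G 0)" using z by simp
next
  fix z assume z: "z \<in> sphere 0 1 \<inter> closure (group_orbit G 0)"
  then have "z \<notin> group_orbit G 0" using orbit_subset_ball[of 0] by auto
  then show "z \<in> limit_set G"
    using z unfolding limit_set_def closure_def by (intro CollectI conjI bexI[of _ 0]) auto
qed

lemma limit_setI:
  assumes "z \<in> sphere 0 1" "\<And>k. g k \<in> G" "(\<lambda>k. g k 0) \<longlonglongrightarrow> z"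
  shows "z \<in> limit_set G"
proof -
  have "z \<in> closure (group_orbit G 0)"
    using assms(2,3) unfolding closure_sequential group_orbit_def by (intro exI[of _ "\<lambda>n. g n 0"]) blast
  then show ?thesis using assms(1) by (simp add: limit_set_eq)
qed

lemma limit_setE:
  assumes "z \<in> limit_set G"
  obtains g where "\<And>k. g k \<in> G" "(\<lambda>k. g k 0) \<longlonglongrightarrow> z"
proof -
  have "z \<in> closure (group_orbit G 0)" using assms by (simp add: limit_set_eq)
  then obtain f where f: "\<And>n::nat. f n \<in> group_orbit G 0" "f \<longlonglongrightarrow> z"
    unfolding closure_sequential by blast
  have "\<forall>n. \<exists>\<gamma>. \<gamma> \<in> G \<and> f n = \<gamma> 0" using f(1) unfolding group_orbit_def by blast
  from choice[OF this] obtain g where g: "\<And>n. g n \<in> G" "\<And>n. f n = g n 0" by blast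
  have "f = (\<lambda>n. g n 0)" using g(2) by blast
  then show thesis using that[of g] g(1) f(2) by blast
qed

lemma closed_limit_set: "closed (limit_set G)"
  unfolding limit_set_eq by auto

lemma limit_set_sphere: "limit_set G \<subseteq> sphere 0 1"
  by (auto simp: limit_set_def)

lemma limit_set_cball: "limit_set G \<subseteq> cball 0 1"
  using limit_set_sphere sphere_cball by blast

lemma limit_set_image:
  assumes \<gamma>: "\<gamma> \<in> G" and z: "z \<in> limit_set G"
  shows "\<gamma> z \<in> limit_set G"
proof -
  obtain g where g: "\<And>k. g k \<in> G" "(\<lambda>k. g k 0) \<longlonglongrightarrow> z" using limit_setE[OF z] by blast
  have zs: "z \<in> sphere 0 1" "z \<in> cball 0 1" using z limit_set_sphere limit_set_cball by blast+
  have gc: "g k 0 \<in> cball 0 1" for k using cball[OF g(1)] by simp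
  have "(\<lambda>k. \<gamma> (g k 0)) \<longlonglongrightarrow> \<gamma> z"
    by (rule continuous_on_tendsto_compose[OF hyp_isometry_continuous[OF isoD[OF \<gamma>]] g(2) zs(2)]) (intro always_eventually allI gc)
  then have "(\<lambda>k. compose (cball 0 1) \<gamma> (g k) 0) \<longlonglongrightarrow> \<gamma> z" by simp
  then show ?thesis
    by (intro limit_setI[where g = "\<lambda>k. compose (cball 0 1) \<gamma> (g k)"] sphere[OF \<gamma> zs(1)] comp_in \<gamma> g(1))
qed

lemma limit_set_image_iff:
  assumes \<gamma>: "\<gamma> \<in> G" and z: "z \<in> cball 0 1"
  shows "\<gamma> z \<in> limit_set G \<longleftrightarrow> z \<in> limit_set G"
  using limit_set_image[OF \<gamma>] limit_set_image[OF inv_in[OF \<gamma>], of "\<gamma> z"] inv_left[OF \<gamma> z] by metis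

lemma open_image:
  assumes \<gamma>: "\<gamma> \<in> G" and E: "open E" "E \<subseteq> ball 0 1"
  shows "open (\<gamma> ` E)" "\<gamma> ` E \<subseteq> ball 0 1"
proof -
  show sub: "\<gamma> ` E \<subseteq> ball 0 1" using E ball[OF \<gamma>] by blast
  have Ec: "E \<subseteq> cball 0 1" using E(2) ball_subset_cball by blast
  have "\<gamma> ` E = ball 0 1 \<inter> ball_inv \<gamma> -` E"
    using sub unfolding image_eq_vimage[OF \<gamma> Ec] by auto
  moreover have "continuous_on (ball 0 1) (ball_inv \<gamma>)"
    using hyp_isometry_continuous[OF isoD[OF inv_in[OF \<gamma>]]] ball_subset_cball continuous_on_subset by blast
  ultimately show "open (\<gamma> ` E)" using E(1) by (simp add: continuous_open_preimage)
qed

lemma hyp_core_image: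
  assumes \<gamma>: "\<gamma> \<in> G" and x: "x \<in> hyp_core N E"
  shows "\<gamma> x \<in> hyp_core N (\<gamma> ` E)"
proof -
  have xb: "x \<in> ball 0 1" using x by (simp add: hyp_core_def)
  have "y \<in> \<gamma> ` E" if y: "y \<in> ball 0 1" "hyp_dist (\<gamma> x) y < N" for y
  proof -
    have "ball_inv \<gamma> y \<in> E"
      using x y hyp_dist_inv[OF \<gamma> xb y(1)] ball[OF inv_in[OF \<gamma>] y(1)] by (simp add: hyp_core_def)
    moreover have "y \<in> cball 0 1" using y(1) by simp
    ultimately show ?thesis using inv_right[OF \<gamma>] by (metis imageI)
  qed
  then show ?thesis using ball[OF \<gamma> xb] by (simp add: hyp_core_def)
qed

lemma is_endpoint_image:
  assumes \<gamma>: "\<gamma> \<in> G" and E: "open E" "E \<subseteq> ball 0 1" and z: "is_endpoint E z"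
  shows "is_endpoint (\<gamma> ` E) (\<gamma> z)"
proof -
  have zs: "z \<in> sphere 0 1" and deep: "\<And>N. \<forall>\<^sub>F s in at_left 1. s *\<^sub>R z \<in> hyp_core N E"
    using z is_endpoint_iff[OF E] by auto
  obtain C where C: "\<And>s. 0 \<le> s \<Longrightarrow> s < 1 \<Longrightarrow> hyp_dist (\<gamma> (s *\<^sub>R z)) (s *\<^sub>R \<gamma> z) \<le> C"
    using radial_image_bounded_dist[OF isoD[OF \<gamma>] zs] by blast
  have "\<forall>\<^sub>F s in at_left 1. s *\<^sub>R \<gamma> z \<in> hyp_core N (\<gamma> ` E)" for N
  proof -
    have "\<forall>\<^sub>F s in at_left 1. (0::real) < s" using eventually_at_left_real[of 0 1] by (auto elim: eventually_mono)
    moreover have "\<forall>\<^sub>F s in at_left 1. s < (1::real)" by (simp add: eventually_at_filter)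
    ultimately show ?thesis using deep[of "N + C"]
    proof eventually_elim
      case (elim s)
      have "s *\<^sub>R \<gamma> z \<in> ball 0 1" using sphere[OF \<gamma> zs] elim by simp
      then show ?case
        using hyp_core_dist[OF hyp_core_image[OF \<gamma> elim(3)] _ C[of s]] elim by simp
    qed
  qed
  then show ?thesis unfolding is_endpoint_iff[OF open_image[OF \<gamma> E]] using sphere[OF \<gamma> zs] by blast
qed

text \<open>This works because the quotient map is open.\<close>

lemma lift_compact:
  assumes L: "closed L" and inv: "\<forall>\<gamma>\<in>G. \<forall>x\<in>cball 0 1 - L. \<gamma> x \<in> cball 0 1 - L"
    and C: "compactin (quotient_topology (top_of_set (cball 0 1 - L)) (group_orbit G)) C"
  obtains K where "compact K" "K \<subseteq> cball 0 1 - L" "C \<subseteq> group_orbit G ` K"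
proof -
  define X where "X = cball 0 1 - L"
  have "\<exists>r>0. cball x r \<inter> cball 0 1 \<subseteq> X" if "x \<in> X" for x
  proof -
    have "x \<in> - L" using that by (simp add: X_def)
    then obtain r where "r > 0" "cball x r \<subseteq> - L"
      using L open_contains_cball[of "- L"] by (auto simp: open_Compl)
    then show ?thesis by (intro exI[of _ r]) (auto simp: X_def)
  qed
  then obtain r where r: "\<And>x. x \<in> X \<Longrightarrow> r x > 0" "\<And>x. x \<in> X \<Longrightarrow> cball x (r x) \<inter> cball 0 1 \<subseteq> X" by metis
  define U where "U x = group_orbit G ` (X \<inter> ball x (r x))" for x
  let ?Q = "quotient_topology (top_of_set X) (group_orbit G)"
  have Xc: "X \<subseteq> cball 0 1" by (auto simp: X_def)
  have opU: "openin ?Q (U x)" for x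
  proof -
    have "{y \<in> X. group_orbit G y \<in> U x} = (\<Union>\<gamma>\<in>G. X \<inter> \<gamma> -` ball x (r x))"
    proof (intro Set.set_eqI iffI)
      fix y assume "y \<in> {y \<in> X. group_orbit G y \<in> U x}"
      then obtain w where w: "y \<in> X" "w \<in> X" "w \<in> ball x (r x)" "group_orbit G w = group_orbit G y"
        by (auto simp: U_def)
      then obtain \<gamma> where "\<gamma> \<in> G" "w = \<gamma> y" using orbit_eqD[of w y] Xc by blast
      then show "y \<in> (\<Union>\<gamma>\<in>G. X \<inter> \<gamma> -` ball x (r x))" using w by auto
    next
      fix y assume "y \<in> (\<Union>\<gamma>\<in>G. X \<inter> \<gamma> -` ball x (r x))"
      then obtain \<gamma> where g: "\<gamma> \<in> G" "y \<in> X" "\<gamma> y \<in> ball x (r x)" by blast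
      then have "\<gamma> y \<in> X" using inv unfolding X_def by blast
      moreover have "group_orbit G y = group_orbit G (\<gamma> y)" using orbit_image[OF g(1), of y] g(2) Xc by auto
      ultimately show "y \<in> {y \<in> X. group_orbit G y \<in> U x}" using g by (auto simp: U_def)
    qed
    moreover have "openin (top_of_set X) (X \<inter> \<gamma> -` ball x (r x))" if "\<gamma> \<in> G" for \<gamma>
      by (rule continuous_openin_preimage_gen[OF continuous_on_subset[OF hyp_isometry_continuous[OF isoD[OF that]] Xc]]) simp
    then have "openin (top_of_set X) (\<Union>\<gamma>\<in>G. X \<inter> \<gamma> -` ball x (r x))" by (intro openin_Union) blast
    ultimately have "openin (top_of_set X) {y \<in> X. group_orbit G y \<in> U x}" by (simp only:)
    then show ?thesis unfolding openin_quotient_topology by (auto simp: U_def)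
  qed
  have CX: "C \<subseteq> group_orbit G ` X"
    using compactin_subset_topspace[OF C] by (simp add: X_def)
  have CU: "C \<subseteq> \<Union> (U ` X)"
  proof
    fix c assume "c \<in> C"
    then obtain x where x: "x \<in> X" "c = group_orbit G x" using CX by blast
    then have "x \<in> ball x (r x)" using r(1) by simp
    then show "c \<in> \<Union> (U ` X)" using x unfolding U_def by blast
  qed
  have "\<forall>\<U>. (\<forall>V\<in>\<U>. openin ?Q V) \<and> C \<subseteq> \<Union>\<U> \<longrightarrow> (\<exists>\<F>. finite \<F> \<and> \<F> \<subseteq> \<U> \<and> C \<subseteq> \<Union>\<F>)"
    using C[folded X_def] unfolding compactin_def by blast
  from spec[OF this, of "U ` X"] obtain \<F> where F: "finite \<F>" "\<F> \<subseteq> U ` X" "C \<subseteq> \<Union>\<F>"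
    using opU CU by blast
  then obtain J where J: "finite J" "J \<subseteq> X" "\<F> = U ` J" by (metis finite_subset_image)
  define K where "K = (\<Union>x\<in>J. cball x (r x) \<inter> cball 0 1)"
  have "compact K" unfolding K_def using J(1) by (intro compact_UN compact_Int_closed) auto
  moreover have "K \<subseteq> cball 0 1 - L" using r(2) J(2) unfolding K_def X_def by blast
  moreover have "C \<subseteq> group_orbit G ` K"
  proof
    fix c assume "c \<in> C"
    then obtain x y where "x \<in> J" "y \<in> X" "y \<in> ball x (r x)" "c = group_orbit G y"
      using F(3) J(3) by (auto simp: U_def)
    moreover have "y \<in> cball 0 1" using \<open>y \<in> X\<close> Xc by blast
    ultimately show "c \<in> group_orbit G ` K"
      unfolding K_def using ball_subset_cball by blast
  qed
  ultimately show thesis by (rule that)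
qed

lemma lift_compact_M:
  assumes "compactin (quot_M G) C"
  obtains K where "compact K" "K \<subseteq> ball 0 1" "\<And>x. x \<in> ball 0 1 \<Longrightarrow> group_orbit G x \<in> C \<Longrightarrow> \<exists>\<gamma>\<in>G. \<exists>k\<in>K. x = \<gamma> k"
proof -
  have eq: "cball 0 1 - sphere 0 1 = ball (0::'a) 1" by auto
  obtain K where K: "compact K" "K \<subseteq> cball 0 1 - sphere 0 1" "C \<subseteq> group_orbit G ` K"
    using lift_compact[of "sphere 0 1" C] assms ball unfolding quot_M_def eq by auto
  have "\<exists>\<gamma>\<in>G. \<exists>k\<in>K. x = \<gamma> k" if x: "x \<in> ball 0 1" "group_orbit G x \<in> C" for x
  proof -
    obtain k where "k \<in> K" "group_orbit G x = group_orbit G k" using K(3) x(2) by blast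
    then show ?thesis using orbit_eqD[of x k] x(1) by fastforce
  qed
  then show thesis using that K unfolding eq by blast
qed

end

locale preimage_component = hyp_group \<Gamma> for \<Gamma> :: "('a::euclidean_space \<Rightarrow> 'a) set" +
  fixes F E
  assumes end_F: "end_of_M \<Gamma> F" and comp_E: "E \<in> components {x \<in> ball 0 1. group_orbit \<Gamma> x \<in> F}"
begin

definition P where "P = {x \<in> ball 0 1. group_orbit \<Gamma> x \<in> F}"

lemma E_comp: "E \<in> components P"
  using comp_E by (simp add: P_def)

lemma open_P: "open P"
proof -
  have "openin (top_of_set (ball 0 1)) P"
    using end_F unfolding end_of_M_def quot_M_def openin_quotient_topology P_def by simp
  then show ?thesis by (simp add: openin_open_eq)
qed

lemma P_ball: "P \<subseteq> ball 0 1"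
  by (auto simp: P_def)

lemma open_component: "C \<in> components P \<Longrightarrow> open C"
  using open_components open_P by blast

lemma E_open: "open E" and E_ball: "E \<subseteq> ball 0 1" and E_ne: "E \<noteq> {}" and E_connected: "connected E"
  using open_component[OF E_comp] in_components_subset[OF E_comp] P_ball in_components_nonempty[OF E_comp]
    in_components_connected[OF E_comp] by blast+

lemma E_cball: "E \<subseteq> cball 0 1"
  using E_ball ball_subset_cball by blast

lemma P_image: "\<gamma> \<in> \<Gamma> \<Longrightarrow> x \<in> P \<Longrightarrow> \<gamma> x \<in> P"
  using orbit_image[of \<gamma> x] ball[of \<gamma> x] by (simp add: P_def)

lemma P_image_eq: "\<gamma> \<in> \<Gamma> \<Longrightarrow> \<gamma> ` P = P"
proof (intro equalityI subsetI)
  fix x assume g: "\<gamma> \<in> \<Gamma>" and x: "x \<in> P"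
  then have "x = \<gamma> (ball_inv \<gamma> x)" "ball_inv \<gamma> x \<in> P"
    using inv_right[of \<gamma> x] P_ball P_image[OF inv_in[OF g] x] by auto
  then show "x \<in> \<gamma> ` P" by blast
qed (use P_image in blast)

lemma component_image:
  assumes \<gamma>: "\<gamma> \<in> \<Gamma>" and C: "C \<in> components P"
  shows "\<gamma> ` C \<in> components P"
proof -
  have Csub: "C \<subseteq> P" "C \<subseteq> cball 0 1"
    using in_components_subset[OF C] P_ball ball_subset_cball by blast+
  have conn: "connected (\<delta> ` B)" if "\<delta> \<in> \<Gamma>" "connected B" "B \<subseteq> cball 0 1" for \<delta> B
    using that hyp_isometry_continuous[OF isoD] continuous_on_subset connected_continuous_image by blast
  have img: "\<gamma> ` C \<subseteq> P" using P_image[OF \<gamma>] Csub by blast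
  have ne: "\<gamma> ` C \<noteq> {}" using in_components_nonempty[OF C] by blast
  obtain D where D: "D \<in> components P" "\<gamma> ` C \<subseteq> D"
    using exists_component_superset[OF img _ conn[OF \<gamma> in_components_connected[OF C] Csub(2)]] ne img by blast
  have Dsub: "D \<subseteq> P" "D \<subseteq> cball 0 1"
    using in_components_subset[OF D(1)] P_ball ball_subset_cball by blast+
  have inv: "ball_inv \<gamma> ` \<gamma> ` C = C" "\<gamma> ` ball_inv \<gamma> ` D = D"
    using inv_image[OF \<gamma>] Csub Dsub by auto
  have "ball_inv \<gamma> ` D \<subseteq> C"
  proof (rule components_maximal[OF C])
    show "connected (ball_inv \<gamma> ` D)" by (rule conn[OF inv_in[OF \<gamma>] in_components_connected[OF D(1)] Dsub(2)])
    show "ball_inv \<gamma> ` D \<subseteq> P" using P_image[OF inv_in[OF \<gamma>]] Dsub by blast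
    show "C \<inter> ball_inv \<gamma> ` D \<noteq> {}" using D(2) inv(1) in_components_nonempty[OF C] by blast
  qed
  then have "D \<subseteq> \<gamma> ` C" using inv(2) by blast
  then show ?thesis using D by (simp add: subset_antisym)
qed

lemma component_eqI: "C \<in> components P \<Longrightarrow> D \<in> components P \<Longrightarrow> x \<in> C \<Longrightarrow> x \<in> D \<Longrightarrow> C = D"
  using components_nonoverlap[of C P D] by blast

lemma stab_iff: "\<gamma> \<in> \<Gamma> \<Longrightarrow> x \<in> E \<Longrightarrow> \<gamma> x \<in> E \<Longrightarrow> \<gamma> \<in> set_stab \<Gamma> E"
  using component_eqI[OF component_image[OF _ E_comp] E_comp, of \<gamma> "\<gamma> x"] by (auto simp: set_stab_def)

lemma frontier_component:
  assumes C: "C \<in> components P" and f: "f \<in> ball 0 1" "f \<in> closure C" "f \<notin> C"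
  shows "group_orbit \<Gamma> f \<in> quot_M \<Gamma> frontier_of F"
proof -
  have opF: "openin (quot_M \<Gamma>) F" using end_F by (simp add: end_of_M_def)
  have "f \<notin> P"
  proof
    assume "f \<in> P"
    then obtain D where D: "D \<in> components P" "f \<in> D" using Union_components[of P] by blast
    then have "D \<inter> C \<noteq> {}" using f(2) open_component[OF D(1)] open_Int_closure_eq_empty by blast
    then have "D = C" using component_eqI[OF D(1) C] by blast
    then show False using D f by simp
  qed
  then have 1: "group_orbit \<Gamma> f \<notin> F" using f(1) by (simp add: P_def)
  have "group_orbit \<Gamma> f \<in> quot_M \<Gamma> closure_of F"
    unfolding in_closure_of
  proof (intro conjI allI impI)
    show "group_orbit \<Gamma> f \<in> topspace (quot_M \<Gamma>)" using f(1) by (simp add: quot_M_def)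
    fix T assume T: "group_orbit \<Gamma> f \<in> T \<and> openin (quot_M \<Gamma>) T"
    define V where "V = {x \<in> ball 0 1. group_orbit \<Gamma> x \<in> T}"
    have "openin (top_of_set (ball 0 1)) V"
      using T unfolding quot_M_def openin_quotient_topology V_def by simp
    then have "open V" by (simp add: openin_open_eq)
    moreover have "f \<in> V" using T f(1) by (simp add: V_def)
    ultimately obtain x where "x \<in> V" "x \<in> C" using f(2) open_Int_closure_eq_empty[of V C] by blast
    then show "\<exists>y. y \<in> F \<and> y \<in> T" using in_components_subset[OF C] by (auto simp: V_def P_def)
  qed
  then show ?thesis using 1 opF by (simp add: frontier_of_def interior_of_openin)
qed

text \<open>Only finitely many translates of \<open>E\<close> meet a compact part of the core of the preimage of the end.
  This replaces cocompactness of the action of the stabilizer on the boundary of \<open>E\<close>, which may fail.\<close>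

lemma shell_cocompact:
  assumes N: "N > 0"
  obtains L where "compact L" "L \<subseteq> ball 0 1"
    "\<And>y. y \<in> hyp_core N E \<Longrightarrow> y \<notin> hyp_core (N + 1) E \<Longrightarrow> \<exists>\<delta>\<in>set_stab \<Gamma> E. \<exists>l\<in>L. y = \<delta> l"
proof -
  obtain K0 where K0: "compact K0" "K0 \<subseteq> ball 0 1"
    "\<And>x. x \<in> ball 0 1 \<Longrightarrow> group_orbit \<Gamma> x \<in> quot_M \<Gamma> frontier_of F \<Longrightarrow> \<exists>\<gamma>\<in>\<Gamma>. \<exists>k\<in>K0. x = \<gamma> k"
    using lift_compact_M end_F unfolding end_of_M_def by blast
  obtain R where R: "R \<ge> 0" "\<And>k. k \<in> K0 \<Longrightarrow> hyp_dist 0 k \<le> R"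
    using compact_hyp_dist_bounded[OF K0(1,2), of 0] by auto
  define K where "K = cball 0 (tanh ((R + N + 1) / 2)) \<inter> hyp_core N P"
  obtain T where T: "closed T" "hyp_core N P = ball 0 1 \<inter> T"
    using closedin_hyp_core[of N P] unfolding closedin_closed by blast
  have "K = cball 0 (tanh ((R + N + 1) / 2)) \<inter> T"
    unfolding K_def T(2) using cball_tanh_subset by blast
  then have K: "compact K" using T(1) by (simp add: compact_Int_closed)
  have KP: "K \<subseteq> P" using hyp_core_subset[OF N] by (auto simp: K_def)
  have Kb: "K \<subseteq> ball 0 1" using KP P_ball by blast
  have "K \<subseteq> \<Union>(components P)" using KP Union_components by blast
  then obtain \<C> where C: "\<C> \<subseteq> components P" "finite \<C>" "K \<subseteq> \<Union>\<C>"
    using compactE[OF K, of "components P"] open_component by blast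
  define \<D> where "\<D> = {C \<in> \<C>. \<exists>\<epsilon>\<in>\<Gamma>. C = \<epsilon> ` E}"
  have "\<forall>C\<in>\<D>. \<exists>\<epsilon>. \<epsilon> \<in> \<Gamma> \<and> C = \<epsilon> ` E" by (auto simp: \<D>_def)
  from bchoice[OF this] obtain e where "\<forall>C\<in>\<D>. e C \<in> \<Gamma> \<and> C = e C ` E" ..
  note e = bspec[OF this, THEN conjunct1] bspec[OF this, THEN conjunct2]
  define L where "L = (\<Union>C\<in>\<D>. ball_inv (e C) ` K)"
  have cpt: "compact (ball_inv (e C) ` K)" if "C \<in> \<D>" for C
  proof -
    have "K \<subseteq> cball 0 1" using Kb ball_subset_cball by blast
    then have "continuous_on K (ball_inv (e C))"
      by (rule continuous_on_subset[OF hyp_isometry_continuous[OF isoD[OF inv_in[OF e(1)[OF that]]]]])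
    then show ?thesis by (rule compact_continuous_image[OF _ K])
  qed
  have "finite \<D>" using C(2) by (simp add: \<D>_def)
  then have "compact L"
    unfolding L_def using cpt by (rule compact_UN)
  moreover have "L \<subseteq> ball 0 1"
    unfolding L_def using ball[OF inv_in[OF e(1)]] Kb by blast
  moreover have "\<exists>\<delta>\<in>set_stab \<Gamma> E. \<exists>l\<in>L. y = \<delta> l" if y: "y \<in> hyp_core N E" "y \<notin> hyp_core (N + 1) E" for y
  proof -
    have yE: "y \<in> E" "y \<in> ball 0 1" "y \<in> cball 0 1" using y(1) hyp_core_subset[OF N] E_ball E_cball by blast+
    obtain w where w: "w \<in> ball 0 1" "hyp_dist y w < N + 1" "w \<notin> E"
      using y yE by (auto simp: hyp_core_def)
    obtain f where f: "f \<in> ball 0 1" "f \<in> closure E" "f \<notin> E" "hyp_dist y f \<le> hyp_dist y w"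
      using hyp_dist_frontier[OF E_open yE(1,2) w(1,3)] by blast
    obtain \<gamma> k where g: "\<gamma> \<in> \<Gamma>" "k \<in> K0" "f = \<gamma> k"
      using K0(3)[OF f(1) frontier_component[OF E_comp f(1-3)]] by blast
    have kb: "k \<in> ball 0 1" using g(2) K0(2) by blast
    define x where "x = ball_inv \<gamma> y"
    have xb: "x \<in> ball 0 1" unfolding x_def by (rule ball[OF inv_in[OF g(1)] yE(2)])
    have xc: "x \<in> cball 0 1" using xb by simp
    have gx: "\<gamma> x = y" unfolding x_def by (rule inv_right[OF g(1) yE(3)])
    have "hyp_dist k x = hyp_dist f y"
      using hyp_dist_inv[OF g(1) kb yE(2)] by (simp add: g(3) x_def)
    also have "\<dots> < N + 1" using f(4) w(2) hyp_dist_commute[OF f(1) yE(2)] by simp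
    finally have "hyp_dist 0 x \<le> R + N + 1"
      using hyp_dist_triangle[of 0 k x] kb xb R(2)[OF g(2)] by simp
    then have "x \<in> cball 0 (tanh ((R + N + 1) / 2))"
      using R(1) N by (intro cball_eq_hyp_ball xb) auto
    moreover have "x \<in> hyp_core N P"
    proof -
      have "y \<in> hyp_core N P" using y(1) hyp_core_mono[of N N E P] in_components_subset[OF E_comp] by blast
      then show ?thesis
        using hyp_core_image[OF inv_in[OF g(1)], of y N P] P_image_eq[OF inv_in[OF g(1)]] by (simp add: x_def)
    qed
    ultimately have xK: "x \<in> K" by (simp add: K_def)
    then obtain C where xC: "C \<in> \<C>" "x \<in> C" using C(3) by blast
    have "ball_inv \<gamma> ` E \<in> components P" by (rule component_image[OF inv_in[OF g(1)] E_comp])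
    moreover have "x \<in> ball_inv \<gamma> ` E" using yE(1) by (simp add: x_def)
    ultimately have CE: "C = ball_inv \<gamma> ` E" using component_eqI xC C(1) by blast
    then have CD: "C \<in> \<D>" using xC(1) inv_in[OF g(1)] by (auto simp: \<D>_def)
    define \<delta> where "\<delta> = compose (cball 0 1) \<gamma> (e C)"
    have d: "\<delta> \<in> \<Gamma>" unfolding \<delta>_def by (rule comp_in[OF g(1) e(1)[OF CD]])
    have "\<delta> ` E = \<gamma> ` e C ` E" unfolding \<delta>_def by (rule comp_image[OF E_cball])
    also have "\<dots> = \<gamma> ` ball_inv \<gamma> ` E" by (simp only: trans[OF e(2)[OF CD, symmetric] CE])
    also have "\<dots> = E" by (rule inv_image(2)[OF g(1) E_cball])
    finally have "\<delta> \<in> set_stab \<Gamma> E" using d by (simp add: set_stab_def)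
    moreover have "ball_inv (e C) x \<in> L" using CD xK by (auto simp: L_def)
    moreover have "y = \<delta> (ball_inv (e C) x)"
      using comp_apply[OF cball[OF inv_in[OF e(1)[OF CD]] xc], of \<gamma> "e C"] inv_right[OF e(1)[OF CD] xc] gx
      by (simp add: \<delta>_def)
    ultimately show ?thesis by blast
  qed
  ultimately show thesis by (rule that)
qed

end

section \<open>End limit points\<close>

lemma not_eventually_at_left_seq:
  assumes "\<not> (\<forall>\<^sub>F s in at_left (1::real). Q s)"
  obtains s where "\<And>k. \<not> Q (s k)" "\<And>k. 0 \<le> s k" "\<And>k. s k < 1" "s \<longlonglongrightarrow> 1"
proof -
  have "\<exists>s. \<not> Q s \<and> 1 - 1 / real (Suc k) < s \<and> s < 1" for k
  proof (rule ccontr)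
    assume *: "\<not> (\<exists>s. \<not> Q s \<and> 1 - 1 / real (Suc k) < s \<and> s < 1)"
    have "\<forall>\<^sub>F s in at_left 1. s \<in> {1 - 1 / real (Suc k)<..<1}"
      by (rule eventually_at_left_real) simp
    then have "\<forall>\<^sub>F s in at_left 1. Q s" by (rule eventually_mono) (use * in auto)
    then show False using assms by blast
  qed
  then obtain s where s: "\<And>k. \<not> Q (s k)" "\<And>k. 1 - 1 / real (Suc k) < s k" "\<And>k. s k < 1" by metis
  have "(\<lambda>k. 1 - 1 / real (Suc k)) \<longlonglongrightarrow> 1 - 0"
    by (intro tendsto_diff tendsto_const LIMSEQ_Suc lim_1_over_n)
  then have "s \<longlonglongrightarrow> 1"
    by (intro real_tendsto_sandwich[of "\<lambda>k. 1 - 1 / real (Suc k)" s sequentially "\<lambda>_. 1" 1])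
      (use s in \<open>auto intro!: always_eventually less_imp_le\<close>)
  moreover have "0 \<le> s k" for k
  proof -
    have "1 / real (Suc k) \<le> 1" by simp
    then show ?thesis using s(2)[of k] by linarith
  qed
  ultimately show thesis using that s by blast
qed

definition conical :: "('a::euclidean_space \<Rightarrow> 'a) set \<Rightarrow> 'a set" where
  "conical G = {z \<in> sphere 0 1. \<exists>m::nat. infinite {\<gamma> \<in> G. norm (z - \<gamma> 0) \<le> real m * (1 - norm (\<gamma> 0))}}"

definition deep_rays :: "real \<Rightarrow> real \<Rightarrow> 'a::euclidean_space set \<Rightarrow> 'a set" where
  "deep_rays N \<sigma> E = {x \<in> cball 0 1. \<forall>s\<in>{\<sigma>..<1}. s *\<^sub>R x \<in> hyp_core N E}"

lemma closed_deep_rays: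
  assumes "0 \<le> \<sigma>"
  shows "closed (deep_rays N \<sigma> E)"
proof -
  obtain T where T: "closed T" "hyp_core N E = ball 0 1 \<inter> T"
    using closedin_hyp_core[of N E] unfolding closedin_closed by blast
  have "s *\<^sub>R x \<in> ball 0 1" if "x \<in> cball 0 1" "s \<in> {\<sigma>..<1}" for x :: 'a and s
    using that assms mult_left_le[of "norm x" s] by (auto intro: le_less_trans)
  then have "deep_rays N \<sigma> E = cball 0 1 \<inter> (\<Inter>s\<in>{\<sigma>..<1}. (\<lambda>x. s *\<^sub>R x) -` T)"
    unfolding deep_rays_def T(2) by blast
  moreover have "closed ((\<lambda>x. s *\<^sub>R x) -` T)" for s
    using T(1) by (intro continuous_closed_vimage) (auto intro!: continuous_intros)
  ultimately show ?thesis by (simp only:) (intro closed_Int closed_cball closed_INT ballI)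
qed

lemma is_endpoint_iff_deep_rays:
  fixes E :: "'a::euclidean_space set"
  assumes E: "open E" "E \<subseteq> ball 0 1"
  shows "is_endpoint E z \<longleftrightarrow> z \<in> sphere 0 1 \<and> (\<forall>N::nat. \<exists>m::nat. z \<in> deep_rays N (1 - 1 / Suc m) E)"
  unfolding is_endpoint_iff[OF E]
proof (intro conj_cong refl iffI allI)
  fix N :: nat assume z: "z \<in> sphere 0 1" and "\<forall>N. \<forall>\<^sub>F s in at_left 1. s *\<^sub>R z \<in> hyp_core N E"
  then have "\<forall>\<^sub>F s in at_left 1. s *\<^sub>R z \<in> hyp_core (real N) E" by blast
  then obtain b where b: "b < 1" "\<And>s. b < s \<Longrightarrow> s < 1 \<Longrightarrow> s *\<^sub>R z \<in> hyp_core N E"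
    by (auto simp: eventually_at_left_field)
  obtain m where m: "1 / real (Suc m) < 1 - b" using reals_Archimedean[of "1 - b"] b(1) by (auto simp: inverse_eq_divide)
  have "z \<in> deep_rays N (1 - 1 / Suc m) E"
    unfolding deep_rays_def using z m by (auto intro!: b(2) simp del: of_nat_Suc)
  then show "\<exists>m::nat. z \<in> deep_rays N (1 - 1 / Suc m) E" ..
next
  fix N :: real assume z: "z \<in> sphere 0 1" and *: "\<forall>N::nat. \<exists>m::nat. z \<in> deep_rays N (1 - 1 / Suc m) E"
  obtain m where m: "z \<in> deep_rays (real (nat \<lceil>N\<rceil>)) (1 - 1 / Suc m) E" using * by blast
  have "\<forall>\<^sub>F s in at_left 1. s \<in> {1 - 1 / real (Suc m)<..<1}"
    by (rule eventually_at_left_real) simp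
  then show "\<forall>\<^sub>F s in at_left 1. s *\<^sub>R z \<in> hyp_core N E"
  proof (rule eventually_mono)
    fix s assume "s \<in> {1 - 1 / real (Suc m)<..<1}"
    then have "s *\<^sub>R z \<in> hyp_core (real (nat \<lceil>N\<rceil>)) E" using m by (auto simp: deep_rays_def)
    then show "s *\<^sub>R z \<in> hyp_core N E"
      using hyp_core_mono[of N "real (nat \<lceil>N\<rceil>)" E E] real_nat_ceiling_ge[of N] by blast
  qed
qed

lemma is_endpoint_Int:
  fixes E :: "'a::euclidean_space set"
  assumes "open E" "E \<subseteq> ball 0 1" "open E'" "E' \<subseteq> ball 0 1" "is_endpoint E z" "is_endpoint E' z"
  shows "E \<inter> E' \<noteq> {}"
proof -
  have "\<forall>\<^sub>F s in at_left 1. s *\<^sub>R z \<in> hyp_core 1 E" "\<forall>\<^sub>F s in at_left 1. s *\<^sub>R z \<in> hyp_core 1 E'"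
    using assms is_endpoint_iff by blast+
  then have "\<forall>\<^sub>F s in at_left (1::real). s *\<^sub>R z \<in> E \<inter> E'"
    by eventually_elim (use hyp_core_subset[of 1] in auto)
  then have "\<exists>s. s *\<^sub>R z \<in> E \<inter> E'" using eventually_happens'[OF trivial_limit_at_left_real] by blast
  then show ?thesis by blast
qed

lemma (in hyp_group) conicalI:
  assumes z: "z \<in> sphere 0 1" and g: "\<And>k. g k \<in> G" and s: "\<And>k. 0 \<le> s k" "\<And>k. s k < 1" "s \<longlonglongrightarrow> 1"
    and C: "\<And>k. hyp_dist (s k *\<^sub>R z) (g k 0) \<le> C"
  shows "z \<in> conical G"
proof -
  have sb: "s k *\<^sub>R z \<in> ball 0 1" for k using z s by simp
  have gb: "g k 0 \<in> ball 0 1" for k using ball[OF g] by simp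
  define m where "m = nat \<lceil>5 * exp C\<rceil>"
  have C0: "0 \<le> C" using hyp_dist_nonneg[OF sb gb] C order_trans by blast
  then have eC: "1 \<le> exp C" by simp
  have near: "norm (z - g k 0) \<le> real m * (1 - norm (g k 0))" for k
  proof -
    define r t where "r = norm (g k 0)" and "t = s k"
    have rt: "0 \<le> r" "r < 1" "0 \<le> t" "t < 1" using gb s by (auto simp: r_def t_def)
    have nt: "norm (t *\<^sub>R z) = t" using z rt by simp
    have "hyp_dist 0 (g k 0) \<le> hyp_dist 0 (t *\<^sub>R z) + C"
      using hyp_dist_triangle[of 0 "t *\<^sub>R z" "g k 0"] C[of k] sb[of k] gb[of k] by (simp add: t_def)
    then have "exp (hyp_dist 0 (g k 0)) \<le> exp (hyp_dist 0 (t *\<^sub>R z)) * exp C"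
      by (simp flip: exp_add)
    then have "(1 + r) / (1 - r) \<le> (1 + t) / (1 - t) * exp C"
      unfolding exp_hyp_dist_0[OF gb] using exp_hyp_dist_0[OF sb, of k] nt by (simp add: r_def t_def)
    then have "(1 + r) * (1 - t) \<le> (1 + t) * exp C * (1 - r)"
      using rt by (simp add: field_simps)
    moreover have "1 - t \<le> (1 + r) * (1 - t)"
      using mult_right_mono[of 1 "1 + r" "1 - t"] rt by simp
    moreover have "(1 + t) * exp C * (1 - r) \<le> 2 * exp C * (1 - r)"
      using rt by (intro mult_right_mono) auto
    ultimately have t: "1 - t \<le> 2 * exp C * (1 - r)" by linarith
    have "(norm (t *\<^sub>R z - g k 0))\<^sup>2 \<le> exp (hyp_dist (t *\<^sub>R z) (g k 0)) * ((1 - t\<^sup>2) * (1 - r\<^sup>2))"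
      using norm_diff_le_hyp_dist[OF sb[of k] gb[of k]] nt by (simp add: t_def[symmetric] r_def)
    also have "\<dots> \<le> exp C * ((2 * (1 - t)) * (2 * (1 - r)))"
    proof (intro mult_mono)
      show "exp (hyp_dist (t *\<^sub>R z) (g k 0)) \<le> exp C" using C[of k] by (simp add: t_def)
      show "1 - t\<^sup>2 \<le> 2 * (1 - t)" "1 - r\<^sup>2 \<le> 2 * (1 - r)"
        using zero_le_power2[of "1 - t"] zero_le_power2[of "1 - r"] by (simp_all add: power2_eq_square algebra_simps)
      show "0 \<le> 1 - r\<^sup>2" "0 \<le> (1 - t\<^sup>2) * (1 - r\<^sup>2)"
        using rt by (auto intro!: mult_nonneg_nonneg simp: power_le_one)
    qed (use rt in auto)
    also have "\<dots> \<le> exp C * ((2 * (2 * exp C * (1 - r))) * (2 * (1 - r)))"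
      using t rt by (intro mult_left_mono mult_right_mono) auto
    also have "\<dots> = 8 * (exp C * (1 - r))\<^sup>2" by (simp add: power2_eq_square)
    also have "\<dots> \<le> (3 * (exp C * (1 - r)))\<^sup>2" by (simp add: power_mult_distrib)
    finally have "norm (t *\<^sub>R z - g k 0) \<le> 3 * (exp C * (1 - r))"
      by (rule power2_le_imp_le) (use rt in simp)
    moreover have "norm (z - t *\<^sub>R z) = 1 - t"
    proof -
      have "z - t *\<^sub>R z = (1 - t) *\<^sub>R z" by (simp add: algebra_simps)
      then show ?thesis using z rt by simp
    qed
    moreover have "norm (z - g k 0) \<le> norm (z - t *\<^sub>R z) + norm (t *\<^sub>R z - g k 0)"
      using norm_triangle_ineq[of "z - t *\<^sub>R z" "t *\<^sub>R z - g k 0"] by simp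
    ultimately have "norm (z - g k 0) \<le> 5 * exp C * (1 - r)" using t by simp
    also have "\<dots> \<le> real m * (1 - r)"
      using rt real_nat_ceiling_ge[of "5 * exp C"] by (intro mult_right_mono) (auto simp: m_def)
    finally show ?thesis by (simp add: r_def)
  qed
  have lim: "(\<lambda>k. g k 0) \<longlonglongrightarrow> z"
  proof (rule hyp_dist_bounded_tendsto[where C = C])
    have "(\<lambda>k. s k *\<^sub>R z) \<longlonglongrightarrow> 1 *\<^sub>R z" by (intro tendsto_intros s(3))
    then show "(\<lambda>k. s k *\<^sub>R z) \<longlonglongrightarrow> z" by simp
  qed (use z sb gb C in simp_all)
  have "infinite {\<gamma> \<in> G. norm (z - \<gamma> 0) \<le> real m * (1 - norm (\<gamma> 0))}" (is "infinite ?A")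
  proof
    assume fin: "finite ?A"
    have gA: "g k \<in> ?A" for k using near g by simp
    define r where "r = Max ((\<lambda>\<gamma>. norm (\<gamma> 0)) ` ?A)"
    have r: "norm (g k 0) \<le> r" for k
      unfolding r_def using gA fin by (intro Max_ge) (auto intro: imageI)
    have "r \<in> (\<lambda>\<gamma>. norm (\<gamma> 0)) ` ?A"
      unfolding r_def using gA fin by (intro Max_in) auto
    then have "r < 1" using ball[of _ 0] by auto
    have "norm z \<le> r"
      by (rule Lim_bounded[OF tendsto_norm[OF lim], of 0]) (use r in auto)
    then show False using \<open>r < 1\<close> z by simp
  qed
  then show ?thesis using z unfolding conical_def by blast
qed

context preimage_component
begin

lemma stab_group: "hyp_group (set_stab \<Gamma> E)"
  by (rule hyp_group_set_stab[OF E_cball])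

lemma stab_subset: "set_stab \<Gamma> E \<subseteq> \<Gamma>"
  by (auto simp: set_stab_def)

lemma orbit_not_in_core:
  obtains N0 where "N0 > 0" "\<And>N \<gamma>. N \<ge> N0 \<Longrightarrow> \<gamma> \<in> \<Gamma> \<Longrightarrow> \<gamma> 0 \<notin> hyp_core N E"
proof -
  have opF: "openin (quot_M \<Gamma>) F" using end_F by (simp add: end_of_M_def)
  obtain p where p: "p \<in> ball 0 1" "p \<notin> P"
  proof -
    obtain y where y: "y \<in> quot_M \<Gamma> frontier_of F" using end_F by (auto simp: end_of_M_def)
    then have "y \<in> topspace (quot_M \<Gamma>)" using frontier_of_subset_topspace by fastforce
    moreover have "y \<notin> F" using y opF by (simp add: frontier_of_def interior_of_openin)
    ultimately
    show thesis using that by (auto simp: quot_M_def P_def)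
  qed
  define N0 where "N0 = hyp_dist 0 p + 1"
  have "\<gamma> 0 \<notin> hyp_core N E" if N: "N \<ge> N0" and \<gamma>: "\<gamma> \<in> \<Gamma>" for N \<gamma>
  proof
    assume "\<gamma> 0 \<in> hyp_core N E"
    moreover have "hyp_dist (\<gamma> 0) (\<gamma> p) < N"
      using hyp_isometry_hyp_dist[OF isoD[OF \<gamma>], of 0 p] p N by (simp add: N0_def)
    ultimately have "\<gamma> p \<in> E" using ball[OF \<gamma> p(1)] by (simp add: hyp_core_def)
    then have "\<gamma> p \<in> P" using in_components_subset[OF E_comp] by blast
    then have "ball_inv \<gamma> (\<gamma> p) \<in> P" by (rule P_image[OF inv_in[OF \<gamma>]])
    then show False using p inv_left[OF \<gamma>, of p] by simp
  qed
  moreover have "N0 > 0" using hyp_dist_nonneg[of 0 p] p by (simp add: N0_def)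
  ultimately show thesis using that by blast
qed

lemma endpoint_in_limit_set_stab:
  assumes z: "z \<in> limit_set \<Gamma>" and ep: "is_endpoint E z"
  shows "z \<in> limit_set (set_stab \<Gamma> E)"
proof -
  interpret S: hyp_group "set_stab \<Gamma> E" by (rule stab_group)
  obtain N where N: "N > 0" "\<And>M \<gamma>. M \<ge> N \<Longrightarrow> \<gamma> \<in> \<Gamma> \<Longrightarrow> \<gamma> 0 \<notin> hyp_core M E"
    using orbit_not_in_core by metis
  obtain L where L: "compact L" "L \<subseteq> ball 0 1"
    "\<And>y. y \<in> hyp_core N E \<Longrightarrow> y \<notin> hyp_core (N + 1) E \<Longrightarrow> \<exists>\<delta>\<in>set_stab \<Gamma> E. \<exists>l\<in>L. y = \<delta> l"
    using shell_cocompact[OF N(1)] by blast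
  obtain R where R: "\<And>l. l \<in> L \<Longrightarrow> hyp_dist 0 l \<le> R" using compact_hyp_dist_bounded[OF L(1,2), of 0] by auto
  obtain g where g: "\<And>k. g k \<in> \<Gamma>" "(\<lambda>k. g k 0) \<longlonglongrightarrow> z" using limit_setE[OF z] by blast
  have zs: "z \<in> sphere 0 1" using z limit_set_sphere by blast
  have deep: "\<forall>\<^sub>F s in at_left 1. s *\<^sub>R z \<in> hyp_core N E" using ep is_endpoint_iff[OF E_open E_ball] by blast
  define s where "s k = 1 - 1 / real (Suc k)" for k
  have s1: "s \<longlonglongrightarrow> 1"
  proof -
    have "(\<lambda>k. 1 - 1 / real (Suc k)) \<longlonglongrightarrow> 1 - 0"
      by (intro tendsto_diff tendsto_const LIMSEQ_Suc lim_1_over_n)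
    then show ?thesis by (simp add: s_def[abs_def])
  qed
  moreover have "s k < 1" for k by (simp add: s_def)
  ultimately have "filterlim s (at_left 1) sequentially"
    unfolding filterlim_at by (auto intro!: always_eventually less_imp_neq)
  then have "\<forall>\<^sub>F k in sequentially. s k *\<^sub>R z \<in> hyp_core N E"
    by (rule eventually_compose_filterlim[OF deep])
  then obtain k0 where k0: "\<And>k. k \<ge> k0 \<Longrightarrow> s k *\<^sub>R z \<in> hyp_core N E"
    by (auto simp: eventually_sequentially)
  have "\<exists>p \<delta> l. p \<in> closed_segment (s (k + k0) *\<^sub>R z) (g (k + k0) 0) \<and> \<delta> \<in> set_stab \<Gamma> E \<and> l \<in> L \<and> p = \<delta> l" for k
  proof -
    let ?C = "closed_segment (s (k + k0) *\<^sub>R z) (g (k + k0) 0)"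
    have a: "s (k + k0) *\<^sub>R z \<in> hyp_core N E" by (rule k0) simp
    have Cb: "?C \<subseteq> ball 0 1"
      using subsetD[OF hyp_core_subset_ball a] ball[OF g(1), of 0] by (intro closed_segment_subset) simp_all
    obtain p where p: "p \<in> ?C" "p \<in> hyp_core N E" "p \<notin> hyp_core (N + 1) E"
      using hyp_core_crossing[OF connected_segment Cb ends_in_segment(1) a ends_in_segment(2) N(2)[OF order_refl g(1)]]
      by blast
    then show ?thesis using L(3)[OF p(2,3)] by blast
  qed
  then obtain p \<delta> l where p: "\<And>k. p k \<in> closed_segment (s (k + k0) *\<^sub>R z) (g (k + k0) 0)"
    and d: "\<And>k. \<delta> k \<in> set_stab \<Gamma> E" and l: "\<And>k. l k \<in> L" and pd: "\<And>k. p k = \<delta> k (l k)" by metis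
  have "(\<lambda>k. norm (s (k + k0) *\<^sub>R z - z) + norm (g (k + k0) 0 - z)) \<longlonglongrightarrow> norm (1 *\<^sub>R z - z) + norm (z - z)"
    by (intro tendsto_intros LIMSEQ_ignore_initial_segment s1 g(2))
  then have lim0: "(\<lambda>k. norm (s (k + k0) *\<^sub>R z - z) + norm (g (k + k0) 0 - z)) \<longlonglongrightarrow> 0" by simp
  have "norm (p k - z) \<le> norm (s (k + k0) *\<^sub>R z - z) + norm (g (k + k0) 0 - z)" for k
  proof -
    define a b where "a = s (k + k0) *\<^sub>R z" and "b = g (k + k0) 0"
    obtain u where u: "0 \<le> u" "u \<le> 1" "p k = (1 - u) *\<^sub>R a + u *\<^sub>R b"
      using p[of k] by (auto simp: closed_segment_def a_def b_def)
    have eq: "(1 - u) *\<^sub>R (a - z) + u *\<^sub>R (b - z) = p k - z" unfolding u(3) by (simp add: algebra_simps)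
    have "norm (p k - z) \<le> norm ((1 - u) *\<^sub>R (a - z)) + norm (u *\<^sub>R (b - z))"
      unfolding eq[symmetric] by (rule norm_triangle_ineq)
    also have "\<dots> \<le> norm (a - z) + norm (b - z)"
      using u by (intro add_mono) (auto intro: mult_left_le_one_le)
    finally show ?thesis by (simp add: a_def b_def)
  qed
  then have "(\<lambda>k. p k - z) \<longlonglongrightarrow> 0"
    by (intro Lim_null_comparison[OF _ lim0]) simp
  then have "p \<longlonglongrightarrow> z" by (rule LIM_zero_cancel)
  then have "(\<lambda>k. \<delta> k (l k)) \<longlonglongrightarrow> z" unfolding pd[symmetric] .
  moreover have lb: "l k \<in> ball 0 1" for k using l L(2) by blast
  moreover have "hyp_dist (l k) 0 \<le> R" for k using R[OF l] hyp_dist_commute[OF lb, of 0] by simp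
  ultimately have "(\<lambda>k. \<delta> k 0) \<longlonglongrightarrow> z"
    by (intro S.orbit_tendsto[where g = \<delta> and x = l and y = "\<lambda>_. 0" and C = R, OF zs d]) auto
  then show ?thesis by (rule S.limit_setI[OF zs d])
qed

lemma components_transitive:
  assumes C: "C \<in> components P"
  obtains \<gamma> where "\<gamma> \<in> \<Gamma>" "C = \<gamma> ` E"
proof -
  define U where "U = (\<Union>\<gamma>\<in>\<Gamma>. \<gamma> ` E)"
  define V where "V = \<Union>{D \<in> components P. D \<inter> U = {}}"
  have cE: "\<gamma> ` E \<in> components P" if "\<gamma> \<in> \<Gamma>" for \<gamma> by (rule component_image[OF that E_comp])
  have UP: "U \<subseteq> P" unfolding U_def using cE in_components_subset by blast
  have VP: "V \<subseteq> P" unfolding V_def using in_components_subset by blast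
  have opU: "open U" unfolding U_def using cE open_component by blast
  have opV: "open V" unfolding V_def using open_component by blast
  have UV: "U \<inter> V = {}" unfolding V_def by blast
  have cover: "P \<subseteq> U \<union> V"
  proof
    fix x assume "x \<in> P"
    then obtain D where D: "D \<in> components P" "x \<in> D" using Union_components[of P] by blast
    show "x \<in> U \<union> V"
    proof (cases "D \<inter> U = {}")
      case False
      then obtain \<gamma> y where y: "\<gamma> \<in> \<Gamma>" "y \<in> D" "y \<in> \<gamma> ` E" by (auto simp: U_def)
      then have "D = \<gamma> ` E" using component_eqI[OF D(1) cE] by blast
      then show ?thesis using D(2) y(1) by (auto simp: U_def)
    qed (use D in \<open>auto simp: V_def\<close>)
  qed
  have Uinv: "\<gamma> x \<in> U" if g: "\<gamma> \<in> \<Gamma>" and x: "x \<in> U" for \<gamma> x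
  proof -
    obtain \<delta> e where d: "\<delta> \<in> \<Gamma>" "e \<in> E" "x = \<delta> e" using x by (auto simp: U_def)
    have "\<gamma> x = compose (cball 0 1) \<gamma> \<delta> e" using comp_apply[of e \<gamma> \<delta>] d E_cball by auto
    then show ?thesis using comp_in[OF g d(1)] d(2) unfolding U_def by blast
  qed
  have Vinv: "\<gamma> x \<in> V" if g: "\<gamma> \<in> \<Gamma>" and x: "x \<in> V" for \<gamma> x
  proof -
    have "\<gamma> x \<notin> U"
    proof
      assume "\<gamma> x \<in> U"
      then have "ball_inv \<gamma> (\<gamma> x) \<in> U" by (rule Uinv[OF inv_in[OF g]])
      moreover have "x \<in> cball 0 1" using x VP P_ball ball_subset_cball by blast
      ultimately show False using x UV inv_left[OF g] by auto
    qed
    then show ?thesis using P_image[OF g] x VP cover by blast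
  qed
  have op: "openin (quot_M \<Gamma>) (group_orbit \<Gamma> ` W)" and sat: "{x \<in> ball 0 1. group_orbit \<Gamma> x \<in> group_orbit \<Gamma> ` W} = W"
    if W: "open W" "W \<subseteq> ball 0 1" "\<forall>\<gamma>\<in>\<Gamma>. \<forall>x\<in>W. \<gamma> x \<in> W" for W
  proof -
    show sat: "{x \<in> ball 0 1. group_orbit \<Gamma> x \<in> group_orbit \<Gamma> ` W} = W"
    proof (intro equalityI subsetI)
      fix x assume x: "x \<in> {x \<in> ball 0 1. group_orbit \<Gamma> x \<in> group_orbit \<Gamma> ` W}"
      then obtain w where "w \<in> W" "group_orbit \<Gamma> x = group_orbit \<Gamma> w" by blast
      then show "x \<in> W" using orbit_eqD[of x w] x W(3) by auto
    qed (use W(2) in auto)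
    show "openin (quot_M \<Gamma>) (group_orbit \<Gamma> ` W)"
      unfolding quot_M_def openin_quotient_topology using W sat by (auto simp: openin_open_eq)
  qed
  have Ub: "U \<subseteq> ball 0 1" and Vb: "V \<subseteq> ball 0 1" using UP VP P_ball by blast+
  have disj: "group_orbit \<Gamma> ` U \<inter> group_orbit \<Gamma> ` V = {}"
    using sat[OF opU Ub] Uinv Vb UV by blast
  have FUV: "F \<subseteq> group_orbit \<Gamma> ` U \<union> group_orbit \<Gamma> ` V"
  proof
    fix y assume y: "y \<in> F"
    have "F \<subseteq> topspace (quot_M \<Gamma>)" using end_F openin_subset by (auto simp: end_of_M_def)
    then obtain x where "x \<in> ball 0 1" "y = group_orbit \<Gamma> x" using y by (auto simp: quot_M_def)
    then show "y \<in> group_orbit \<Gamma> ` U \<union> group_orbit \<Gamma> ` V" using y cover by (auto simp: P_def)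
  qed
  have FU: "group_orbit \<Gamma> ` U \<inter> F \<noteq> {}"
  proof -
    obtain e where "e \<in> E" using E_ne by blast
    then have "(\<lambda>x\<in>cball 0 1. x) e \<in> U" using id_in unfolding U_def by blast
    then show ?thesis using UP by (auto simp: P_def)
  qed
  have "group_orbit \<Gamma> ` V \<inter> F = {}"
  proof (rule ccontr)
    assume "group_orbit \<Gamma> ` V \<inter> F \<noteq> {}"
    moreover have "connectedin (quot_M \<Gamma>) F" using end_F by (simp add: end_of_M_def)
    moreover have "openin (quot_M \<Gamma>) (group_orbit \<Gamma> ` U)" "openin (quot_M \<Gamma>) (group_orbit \<Gamma> ` V)"
      using op[OF opU Ub] op[OF opV Vb] Uinv Vinv by blast+
    moreover have "group_orbit \<Gamma> ` U \<inter> group_orbit \<Gamma> ` V \<inter> F = {}" using disj by blast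
    ultimately show False
      using FUV FU unfolding connectedin by blast
  qed
  then have "V = {}" using VP by (force simp: P_def)
  obtain c where c: "c \<in> C" using in_components_nonempty[OF C] by blast
  then have "c \<in> U" using cover \<open>V = {}\<close> in_components_subset[OF C] by blast
  then obtain \<gamma> where g: "\<gamma> \<in> \<Gamma>" "c \<in> \<gamma> ` E" by (auto simp: U_def)
  then show thesis using that component_eqI[OF C cE[OF g(1)] c g(2)] by blast
qed

lemma end_limit_pointsD:
  assumes "z \<in> end_limit_points \<Gamma> E"
  shows "z \<in> limit_set \<Gamma>" "z \<in> limit_set (set_stab \<Gamma> E)" "is_endpoint E z" "z \<in> sphere 0 1" "z \<in> cball 0 1"
proof -
  show 1: "z \<in> limit_set (set_stab \<Gamma> E)" and "is_endpoint E z"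
    using assms by (auto simp: end_limit_points_def)
  have "group_orbit (set_stab \<Gamma> E) x \<subseteq> group_orbit \<Gamma> x" for x
    using stab_subset by (auto simp: group_orbit_def)
  moreover obtain x where "z \<in> sphere 0 1" "x \<in> ball 0 1" "z islimpt group_orbit (set_stab \<Gamma> E) x"
    using 1 unfolding limit_set_def by blast
  ultimately show "z \<in> limit_set \<Gamma>"
    unfolding limit_set_def using islimpt_subset[of z "group_orbit (set_stab \<Gamma> E) x" "group_orbit \<Gamma> x"] by blast
  then show "z \<in> sphere 0 1" "z \<in> cball 0 1" using limit_set_sphere limit_set_cball by blast+
qed

lemma end_limit_points_eq: "end_limit_points \<Gamma> E = {z \<in> limit_set \<Gamma>. is_endpoint E z}"
proof (intro equalityI subsetI)
  fix z assume "z \<in> {z \<in> limit_set \<Gamma>. is_endpoint E z}"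
  then show "z \<in> end_limit_points \<Gamma> E"
    using endpoint_in_limit_set_stab[of z] by (simp add: end_limit_points_def)
qed (use end_limit_pointsD in blast)

lemma end_limit_points_borel: "end_limit_points \<Gamma> E \<in> sets borel"
proof -
  have "end_limit_points \<Gamma> E = limit_set \<Gamma> \<inter> (\<Inter>N. \<Union>m. deep_rays (real N) (1 - 1 / Suc m) E)"
    unfolding end_limit_points_eq is_endpoint_iff_deep_rays[OF E_open E_ball] using limit_set_sphere by blast
  moreover have "deep_rays (real N) (1 - 1 / Suc m) E \<in> sets borel" for N m
    by (intro borel_closed closed_deep_rays) simp
  ultimately show ?thesis using borel_closed[OF closed_limit_set] by auto
qed

lemma end_limit_points_image:
  assumes \<gamma>: "\<gamma> \<in> \<Gamma>" and z: "z \<in> end_limit_points \<Gamma> E"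
  shows "\<gamma> z \<in> limit_set \<Gamma>" "is_endpoint (\<gamma> ` E) (\<gamma> z)"
  using limit_set_image[OF \<gamma>] is_endpoint_image[OF \<gamma> E_open E_ball] end_limit_pointsD[OF z] by blast+

lemma end_limit_points_stab:
  assumes \<gamma>: "\<gamma> \<in> set_stab \<Gamma> E" and z: "z \<in> end_limit_points \<Gamma> E"
  shows "\<gamma> z \<in> end_limit_points \<Gamma> E"
  using end_limit_points_image[of \<gamma> z] assms by (auto simp: end_limit_points_eq set_stab_def)

lemma end_limit_points_stab_iff:
  assumes \<gamma>: "\<gamma> \<in> \<Gamma>" and z: "z \<in> end_limit_points \<Gamma> E" and gz: "\<gamma> z \<in> end_limit_points \<Gamma> E"
  shows "\<gamma> \<in> set_stab \<Gamma> E"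
proof -
  have "\<gamma> ` E \<inter> E \<noteq> {}"
    using is_endpoint_Int[OF open_image[OF \<gamma> E_open E_ball] E_open E_ball end_limit_points_image(2)[OF \<gamma> z]
        end_limit_pointsD(3)[OF gz]] .
  then show ?thesis using stab_iff[OF \<gamma>] by blast
qed

end

section \<open>Conical limit points\<close>

locale poincare_group = hyp_group \<Gamma> for \<Gamma> :: "('a::euclidean_space \<Rightarrow> 'a) set" +
  fixes \<alpha> :: real
  assumes alpha: "\<alpha> > 0" and conv: "poincare_converges \<Gamma> \<alpha>"
begin

lemma hyp_dist_orbit_le:
  assumes "x \<in> ball 0 1" "y \<in> ball 0 1" "u \<in> ball 0 1" "v \<in> ball 0 1" "\<gamma> \<in> \<Gamma>"
  shows "hyp_dist x (\<gamma> y) \<le> hyp_dist x u + hyp_dist u (\<gamma> v) + hyp_dist v y"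
  using hyp_dist_triangle[of x u "\<gamma> y"] hyp_dist_triangle[of u "\<gamma> v" "\<gamma> y"]
    hyp_isometry_hyp_dist[OF isoD, of \<gamma> v y] assms ball[of \<gamma>] by fastforce

lemma summable_exp:
  assumes u: "u \<in> ball 0 1" and v: "v \<in> ball 0 1"
  shows "(\<lambda>\<gamma>. exp (- \<alpha> * hyp_dist u (\<gamma> v))) summable_on \<Gamma>"
proof -
  obtain x y where x: "x \<in> ball 0 1" and y: "y \<in> ball 0 1"
    and sum: "(\<lambda>\<gamma>. exp (- \<alpha> * hyp_dist x (\<gamma> y))) summable_on \<Gamma>"
    using conv unfolding poincare_converges_def by blast
  define C where "C = exp (\<alpha> * (hyp_dist x u + hyp_dist v y))"
  show ?thesis
  proof (rule summable_on_comparison_test[OF summable_on_cmult_right[OF sum, of C]])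
    fix \<gamma> assume "\<gamma> \<in> \<Gamma>"
    then have "\<alpha> * hyp_dist x (\<gamma> y) \<le> \<alpha> * (hyp_dist x u + hyp_dist u (\<gamma> v) + hyp_dist v y)"
      using hyp_dist_orbit_le[OF x y u v] alpha by (intro mult_left_mono) auto
    then show "exp (- \<alpha> * hyp_dist u (\<gamma> v)) \<le> C * exp (- \<alpha> * hyp_dist x (\<gamma> y))"
      unfolding C_def exp_add[symmetric] by (simp add: algebra_simps)
  qed simp
qed

lemma finite_norm_le:
  assumes "r < 1"
  shows "finite {\<gamma> \<in> \<Gamma>. norm (\<gamma> 0) \<le> r}" (is "finite ?A")
proof (rule ccontr)
  assume inf: "infinite ?A"
  let ?f = "\<lambda>\<gamma>. exp (- \<alpha> * hyp_dist 0 (\<gamma> 0))"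
  have sum: "?f summable_on \<Gamma>" by (rule summable_exp) auto
  obtain \<gamma>0 where "\<gamma>0 \<in> ?A" using infinite_imp_nonempty[OF inf] by blast
  then have r0: "0 \<le> r" using norm_ge_zero order_trans by blast
  define R where "R = ln ((1 + r) / (1 - r))"
  define c where "c = exp (- \<alpha> * R)"
  have c: "c > 0" by (simp add: c_def)
  have fc: "c \<le> ?f \<gamma>" if g: "\<gamma> \<in> ?A" for \<gamma>
  proof -
    have gb: "\<gamma> 0 \<in> ball 0 1" using g ball[of \<gamma> 0] by simp
    have "exp (hyp_dist 0 (\<gamma> 0)) \<le> (1 + r) / (1 - r)"
      unfolding exp_hyp_dist_0[OF gb] using g assms r0 by (intro frac_le) auto
    also have "\<dots> = exp R" using assms r0 by (simp add: R_def)
    finally show ?thesis using alpha by (simp add: c_def)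
  qed
  define S where "S = infsum ?f \<Gamma>"
  obtain B where B: "B \<subseteq> ?A" "finite B" "card B = nat \<lceil>S / c\<rceil> + 1"
    using infinite_arbitrarily_large[OF inf] by blast
  have "S < c * real (card B)"
  proof -
    have "S / c < real (card B)" unfolding B(3) by linarith
    then show ?thesis using c by (simp add: field_simps)
  qed
  also have "\<dots> = (\<Sum>\<gamma>\<in>B. c)" by simp
  also have "\<dots> \<le> (\<Sum>\<gamma>\<in>B. ?f \<gamma>)" using fc B(1) by (intro sum_mono) auto
  also have "\<dots> \<le> S" unfolding S_def using B by (intro finite_sum_le_infsum[OF sum]) auto
  finally show False by simp
qed

lemma countable_group: "countable \<Gamma>"
proof -
  have "\<Gamma> = (\<Union>n. {\<gamma> \<in> \<Gamma>. norm (\<gamma> 0) \<le> 1 - 1 / real (Suc n)})"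
  proof (intro equalityI subsetI)
    fix \<gamma> assume g: "\<gamma> \<in> \<Gamma>"
    then have "0 < 1 - norm (\<gamma> 0)" using ball[OF g, of 0] by simp
    then obtain n where "1 / real (Suc n) < 1 - norm (\<gamma> 0)"
      using reals_Archimedean[of "1 - norm (\<gamma> 0)"] by (auto simp: inverse_eq_divide)
    then show "\<gamma> \<in> (\<Union>n. {\<gamma> \<in> \<Gamma>. norm (\<gamma> 0) \<le> 1 - 1 / real (Suc n)})"
      using g by (auto intro!: exI[of _ n])
  qed auto
  moreover have "countable (\<Union>n. {\<gamma> \<in> \<Gamma>. norm (\<gamma> 0) \<le> 1 - 1 / real (Suc n)})"
    by (rule countable_UN[OF countableI_type countable_finite[OF finite_norm_le]]) simp
  ultimately show ?thesis by simp
qed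

text \<open>The shadow of \<open>\<gamma> 0\<close> has measure at most a constant times \<open>exp (- \<alpha> d(0, \<gamma> 0))\<close>, because \<open>\<gamma>\<inverse>\<close>
  expands it by a factor comparable to \<open>exp (d(0, \<gamma> 0))\<close>; so the Borel--Cantelli lemma applies.\<close>

lemma AE_not_conical:
  assumes mu: "\<mu> \<in> conformal_measures \<alpha> \<Gamma> A" and A: "A \<subseteq> sphere 0 1"
  shows "AE z in \<mu>. z \<notin> conical \<Gamma>"
proof -
  interpret finite_measure \<mu> using mu by (simp add: conformal_measures_def)
  have sp: "space \<mu> = A" and bor: "\<And>B. B \<in> sets borel \<Longrightarrow> A \<inter> B \<in> sets \<mu>"
    using mu by (auto simp: conformal_measures_def sets_restrict_space)
  have cf: "emeasure \<mu> (\<gamma> ` B) = (\<integral>\<^sup>+x\<in>B. ennreal (deriv_norm \<gamma> x powr \<alpha>) \<partial>\<mu>)"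
    if "\<gamma> \<in> \<Gamma>" "B \<in> sets \<mu>" for \<gamma> B
    using mu that by (auto simp: conformal_measures_def)
  show ?thesis
  proof (cases "finite \<Gamma>")
    case True
    then have "conical \<Gamma> = {}" by (auto simp: conical_def)
    then show ?thesis by simp
  next
    case False
    define e where "e = from_nat_into \<Gamma>"
    have e: "bij_betw e UNIV \<Gamma>" unfolding e_def by (rule bij_betw_from_nat_into[OF countable_group False])
    define S where "S m \<gamma> = {z \<in> A. norm (z - \<gamma> 0) \<le> real m * (1 - norm (\<gamma> 0))}" for m :: nat and \<gamma> :: "'a \<Rightarrow> 'a"
    have Sm: "S m \<gamma> \<in> sets \<mu>" for m \<gamma>
    proof -
      have "{z. norm (z - \<gamma> 0) \<le> real m * (1 - norm (\<gamma> 0))} \<in> sets borel"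
        by (intro borel_closed closed_Collect_le continuous_intros)
      from bor[OF this] show ?thesis by (simp add: S_def Int_def)
    qed
    have bound: "measure \<mu> (S m \<gamma>) \<le> real m powr (2 * \<alpha>) * measure \<mu> A * exp (- \<alpha> * hyp_dist 0 (\<gamma> 0))"
      if g: "\<gamma> \<in> \<Gamma>" for m \<gamma>
    proof -
      have gb: "\<gamma> 0 \<in> ball 0 1" using ball[OF g, of 0] by simp
      define b where "b = norm (\<gamma> 0)"
      have b: "0 \<le> b" "b < 1" using gb by (auto simp: b_def)
      define h where "h = ball_inv \<gamma>"
      have h: "h \<in> \<Gamma>" unfolding h_def by (rule inv_in[OF g])
      have hh: "ball_inv h 0 = \<gamma> 0" unfolding h_def inv_inv[OF g] ..
      define E where "E = exp (hyp_dist 0 (\<gamma> 0))"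
      have E: "E = (1 + b) / (1 - b)" "E > 0"
        using exp_hyp_dist_0[OF gb] exp_gt_zero unfolding E_def b_def by blast+
      show ?thesis
      proof (cases "m = 0")
        case True
        have "S m \<gamma> = {}" using gb A True by (fastforce simp: S_def)
        then show ?thesis by simp
      next
        case m: False
        have low: "(E / (real m)\<^sup>2) powr \<alpha> \<le> deriv_norm h z powr \<alpha>" if z: "z \<in> S m \<gamma>" for z
        proof -
          have zs: "z \<in> sphere 0 1" and zn: "norm (z - \<gamma> 0) \<le> real m * (1 - b)"
            using z A by (auto simp: S_def b_def)
          have pos: "norm (z - \<gamma> 0) > 0" using zs gb by auto
          have "E / (real m)\<^sup>2 = (1 - b\<^sup>2) / (real m * (1 - b))\<^sup>2"
          proof -
            have "1 - b\<^sup>2 = (1 + b) * (1 - b)" by (simp add: power2_eq_square algebra_simps)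
            then show ?thesis using b m by (simp add: E(1) power_mult_distrib) (simp add: power2_eq_square)
          qed
          also have "\<dots> \<le> (1 - b\<^sup>2) / (norm (z - \<gamma> 0))\<^sup>2"
            using pos zn b m by (intro divide_left_mono power_mono mult_pos_pos) (auto simp: power_le_one)
          also have "\<dots> = deriv_norm h z"
            using deriv_norm_sphere[OF h zs] by (simp add: hh b_def)
          finally show ?thesis using E(2) alpha by (intro powr_mono2) auto
        qed
        have "ennreal ((E / (real m)\<^sup>2) powr \<alpha>) * emeasure \<mu> (S m \<gamma>)
            = (\<integral>\<^sup>+x\<in>S m \<gamma>. ennreal ((E / (real m)\<^sup>2) powr \<alpha>) \<partial>\<mu>)"
          using Sm by (simp add: nn_integral_cmult_indicator)
        also have "\<dots> \<le> (\<integral>\<^sup>+x\<in>S m \<gamma>. ennreal (deriv_norm h x powr \<alpha>) \<partial>\<mu>)"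
          using low by (intro nn_integral_mono) (auto split: split_indicator intro!: ennreal_leI)
        also have "\<dots> = emeasure \<mu> (h ` S m \<gamma>)" by (rule cf[OF h Sm, symmetric])
        also have "\<dots> \<le> emeasure \<mu> A" using emeasure_space[of \<mu>] by (simp add: sp)
        finally have "(E / (real m)\<^sup>2) powr \<alpha> * measure \<mu> (S m \<gamma>) \<le> measure \<mu> A"
          by (simp add: emeasure_eq_measure flip: ennreal_mult)
        moreover have "(E / (real m)\<^sup>2) powr \<alpha> = exp (\<alpha> * hyp_dist 0 (\<gamma> 0)) / real m powr (2 * \<alpha>)"
        proof -
          have "(real m)\<^sup>2 powr \<alpha> = real m powr (2 * \<alpha>)"
            using m powr_powr[of "real m" 2 \<alpha>] by simp
          then show ?thesis
            using powr_divide[of E "(real m)\<^sup>2" \<alpha>] E(2) exp_powr_real[of "hyp_dist 0 (\<gamma> 0)" \<alpha>]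
            by (simp add: E_def mult.commute)
        qed
        ultimately show ?thesis using m by (simp add: field_simps exp_minus)
      qed
    qed
    have AE: "AE z in \<mu>. \<forall>\<^sub>F n in sequentially. z \<in> space \<mu> - S m (e n)" for m
    proof (rule borel_cantelli_AE1)
      show "S m (e n) \<in> sets \<mu>" for n by (rule Sm)
      show "emeasure \<mu> (S m (e n)) < \<infinity>" for n by (simp add: less_top[symmetric])
      have "(\<lambda>\<gamma>. real m powr (2 * \<alpha>) * measure \<mu> A * exp (- \<alpha> * hyp_dist 0 (\<gamma> 0))) summable_on \<Gamma>"
        by (intro summable_on_cmult_right summable_exp) auto
      then have "(\<lambda>\<gamma>. measure \<mu> (S m \<gamma>)) summable_on \<Gamma>"
        by (rule summable_on_comparison_test) (use bound in auto)
      then have "(\<lambda>n. measure \<mu> (S m (e n))) summable_on UNIV"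
        by (rule summable_on_reindex_bij_betw[OF e, THEN iffD2])
      then show "summable (\<lambda>n. measure \<mu> (S m (e n)))" by (rule summable_on_imp_summable)
    qed
    have "AE z in \<mu>. \<forall>m. \<forall>\<^sub>F n in sequentially. z \<in> space \<mu> - S m (e n)"
      using AE by (simp add: AE_all_countable)
    then show ?thesis
    proof eventually_elim
      case (elim z)
      have "finite {\<gamma> \<in> \<Gamma>. norm (z - \<gamma> 0) \<le> real m * (1 - norm (\<gamma> 0))}" for m
      proof -
        obtain n0 where n0: "\<And>n. n \<ge> n0 \<Longrightarrow> z \<in> A - S m (e n)"
          using elim[rule_format, of m] by (auto simp: eventually_sequentially sp)
        have "{\<gamma> \<in> \<Gamma>. norm (z - \<gamma> 0) \<le> real m * (1 - norm (\<gamma> 0))} \<subseteq> e ` {..<n0}"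
        proof
          fix \<gamma> assume g: "\<gamma> \<in> {\<gamma> \<in> \<Gamma>. norm (z - \<gamma> 0) \<le> real m * (1 - norm (\<gamma> 0))}"
          then obtain n where "\<gamma> = e n" using e by (auto simp: bij_betw_def)
          moreover have "\<not> n \<ge> n0" using n0[of n] g calculation by (auto simp: S_def)
          ultimately show "\<gamma> \<in> e ` {..<n0}" by auto
        qed
        then show ?thesis by (rule finite_subset) simp
      qed
      then show ?case by (simp add: conical_def)
    qed
  qed
qed

end

locale complete_end_collection = hyp_group \<Gamma> for \<Gamma> :: "('a::euclidean_space \<Rightarrow> 'a) set" +
  fixes q :: nat and E :: "nat \<Rightarrow> 'a set" and F :: "nat \<Rightarrow> 'a set set"
  assumes inj_F: "inj_on F {1..q}" and complete: "complete_ends_of_M \<Gamma> (F ` {1..q})"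
    and comp: "\<And>i. i \<in> {1..q} \<Longrightarrow> E i \<in> components {x \<in> ball 0 1. group_orbit \<Gamma> x \<in> F i}"
begin

lemma preimage_component: "i \<in> {1..q} \<Longrightarrow> preimage_component \<Gamma> (F i) (E i)"
  using complete comp hyp_group_axioms
  by (simp add: preimage_component_def preimage_component_axioms_def complete_ends_of_M_def)

lemma F_disjoint:
  assumes "i \<in> {1..q}" "j \<in> {1..q}" "i \<noteq> j"
  shows "F i \<inter> F j = {}"
proof -
  have "pairwise disjnt (F ` {1..q})" using complete by (simp only: complete_ends_of_M_def)
  then have "disjnt (F i) (F j)"
    by (rule pairwiseD) (use assms inj_onD[OF inj_F, of i j] in blast)+
  then show ?thesis by (simp add: disjnt_def)
qed

text \<open>A ray to a limit point that returns to the complement of the ends infinitely often accumulates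
  there at an interior point, so that its endpoint is conical, or at an ordinary point, which
  \<open>geodesic_near_sphere\<close> excludes.\<close>

lemma eventually_in_ends:
  assumes z: "z \<in> limit_set \<Gamma>" and nc: "z \<notin> conical \<Gamma>"
  shows "\<forall>\<^sub>F s in at_left 1. \<exists>i\<in>{1..q}. group_orbit \<Gamma> (s *\<^sub>R z) \<in> F i"
proof -
  have zs: "z \<in> sphere 0 1" using z limit_set_sphere by blast
  define Kc where "Kc = topspace (quot_Mbar \<Gamma>) - (\<Union>e\<in>F ` {1..q}. e \<union> end_boundary \<Gamma> e)"
  have cpt: "compactin (quot_Mbar \<Gamma>) Kc" using complete by (simp add: complete_ends_of_M_def Kc_def)
  have X: "ball 0 1 \<union> ordinary_set \<Gamma> = cball 0 1 - limit_set \<Gamma>"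
    using limit_set_sphere unfolding ordinary_set_def by auto
  have inv: "\<forall>\<gamma>\<in>\<Gamma>. \<forall>x\<in>cball 0 1 - limit_set \<Gamma>. \<gamma> x \<in> cball 0 1 - limit_set \<Gamma>"
    using cball limit_set_image_iff by blast
  obtain K where K: "compact K" "K \<subseteq> cball 0 1 - limit_set \<Gamma>" "Kc \<subseteq> group_orbit \<Gamma> ` K"
    using lift_compact[OF closed_limit_set inv, of Kc] cpt unfolding quot_Mbar_def X by blast
  have notK: "\<forall>\<^sub>F s in at_left 1. \<not> (\<exists>\<gamma>\<in>\<Gamma>. \<exists>k\<in>K. s *\<^sub>R z = \<gamma> k)"
  proof (rule ccontr)
    assume "\<not> ?thesis"
    then obtain s where s: "\<And>k. \<exists>\<gamma>\<in>\<Gamma>. \<exists>x\<in>K. s k *\<^sub>R z = \<gamma> x" "\<And>k. 0 \<le> s k" "\<And>k. s k < 1" "s \<longlonglongrightarrow> 1"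
      by (rule not_eventually_at_left_seq) blast
    then obtain g x where g: "\<And>k. g k \<in> \<Gamma>" "\<And>k. x k \<in> K" "\<And>k. s k *\<^sub>R z = g k (x k)" by metis
    obtain y r where y: "y \<in> K" "strict_mono r" "(x \<circ> r) \<longlonglongrightarrow> y"
      using compact_imp_seq_compact[OF K(1)] g(2) unfolding seq_compact_def by metis
    have sr: "(\<lambda>k. s (r k)) \<longlonglongrightarrow> 1" using LIMSEQ_subseq_LIMSEQ[OF s(4) y(2)] by (simp add: o_def)
    have xr: "(\<lambda>k. x (r k)) \<longlonglongrightarrow> y" using y(3) by (simp add: o_def)
    have sb: "s k *\<^sub>R z \<in> ball 0 1" for k using s zs by simp
    have xb: "x k \<in> ball 0 1" "x k = ball_inv (g k) (s k *\<^sub>R z)" for k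
    proof -
      have "x k \<in> cball 0 1" using g(2) K(2) by blast
      then show "x k = ball_inv (g k) (s k *\<^sub>R z)" using g inv_left by metis
      then show "x k \<in> ball 0 1" using ball[OF inv_in[OF g(1)] sb] by metis
    qed
    show False
    proof (cases "y \<in> ball 0 1")
      case True
      have "continuous_on (ball 0 1) (\<lambda>x. hyp_dist x 0)"
        by (intro continuous_on_hyp_dist continuous_intros) auto
      then have "(\<lambda>k. hyp_dist (x (r k)) 0) \<longlonglongrightarrow> hyp_dist y 0"
        using continuous_on_tendsto_compose[OF _ xr True] xb(1) by simp
      then have "Bseq (\<lambda>k. hyp_dist (x (r k)) 0)" by (rule convergent_imp_Bseq[OF convergentI])
      then obtain C where C: "\<And>k. \<bar>hyp_dist (x (r k)) 0\<bar> \<le> C" unfolding Bseq_def by auto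
      have "z \<in> conical \<Gamma>"
      proof (rule conicalI[OF zs])
        show "hyp_dist (s (r k) *\<^sub>R z) (g (r k) 0) \<le> C" for k
          using C[of k] hyp_isometry_hyp_dist[OF isoD[OF g(1)] xb(1), of 0 "r k"] unfolding g(3) by fastforce
      qed (use g s sr in auto)
      then show False using nc by blast
    next
      case False
      have yc: "y \<in> cball 0 1" "y \<notin> limit_set \<Gamma>" using y(1) K(2) by auto
      then have ys: "y \<in> sphere 0 1" using False by auto
      have "open (- limit_set \<Gamma>)" using closed_limit_set by (simp add: open_Compl)
      then obtain \<epsilon> where eps: "\<epsilon> > 0" "ball y \<epsilon> \<subseteq> - limit_set \<Gamma>" using yc(2) openE by blast
      have "\<forall>\<^sub>F k in sequentially. dist (x (r k)) y < \<epsilon> / 2" using xr eps(1) tendstoD half_gt_zero by blast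
      then have ev: "\<forall>\<^sub>F k in sequentially. norm (ball_inv (g (r k)) 0 - x (r k)) \<le> 2 / \<epsilon> * (1 - (norm (x (r k)))\<^sup>2)"
      proof eventually_elim
        case (elim k)
        define \<delta> where "\<delta> = ball_inv (g (r k))"
        have d: "\<delta> \<in> \<Gamma>" unfolding \<delta>_def by (rule inv_in[OF g(1)])
        have xk: "x (r k) = \<delta> (s (r k) *\<^sub>R z)" unfolding \<delta>_def by (rule xb(2))
        have "\<delta> z \<notin> ball y \<epsilon>" using limit_set_image[OF d z] eps(2) by blast
        then have "\<epsilon> \<le> dist y (\<delta> z)" by simp
        also have "\<dots> \<le> dist (x (r k)) y + norm (x (r k) - \<delta> z)"
          by (metis dist_commute dist_norm dist_triangle)
        finally have far: "\<epsilon> / 2 \<le> norm (x (r k) - \<delta> z)" using elim by simp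
        have "norm (\<delta> 0 - x (r k)) * (\<epsilon> / 2) \<le> norm (\<delta> 0 - x (r k)) * norm (x (r k) - \<delta> z)"
          using far by (intro mult_left_mono) auto
        also have "\<dots> \<le> 1 - (norm (x (r k)))\<^sup>2"
          unfolding xk using geodesic_near_sphere[OF isoD[OF d] zs] s by simp
        finally show ?case using eps(1) by (simp add: \<delta>_def field_simps)
      qed
      have "(\<lambda>k. 2 / \<epsilon> * (1 - (norm (x (r k)))\<^sup>2)) \<longlonglongrightarrow> 2 / \<epsilon> * (1 - (norm y)\<^sup>2)"
        by (intro tendsto_intros xr)
      moreover have "2 / \<epsilon> * (1 - (norm y)\<^sup>2) = 0" using ys by simp
      ultimately have "(\<lambda>k. 2 / \<epsilon> * (1 - (norm (x (r k)))\<^sup>2)) \<longlonglongrightarrow> 0" by (simp only:)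
      then have "(\<lambda>k. ball_inv (g (r k)) 0 - x (r k)) \<longlonglongrightarrow> 0" by (rule Lim_null_comparison[OF ev])
      from tendsto_add[OF this xr] have "(\<lambda>k. ball_inv (g (r k)) 0) \<longlonglongrightarrow> y" by simp
      then have "y \<in> limit_set \<Gamma>" by (intro limit_setI[OF ys, of "\<lambda>k. ball_inv (g (r k))"] inv_in g(1))
      then show False using yc by blast
    qed
  qed
  have "\<forall>\<^sub>F s in at_left 1. (0::real) < s" using eventually_at_left_real[of 0 1] by (auto elim: eventually_mono)
  moreover have "\<forall>\<^sub>F s in at_left 1. s < (1::real)" by (simp add: eventually_at_filter)
  ultimately show ?thesis using notK
  proof eventually_elim
    case (elim s)
    have sb: "s *\<^sub>R z \<in> ball 0 1" "s *\<^sub>R z \<in> cball 0 1" using elim zs by auto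
    have "group_orbit \<Gamma> (s *\<^sub>R z) \<notin> Kc"
    proof
      assume "group_orbit \<Gamma> (s *\<^sub>R z) \<in> Kc"
      then obtain k where "k \<in> K" "group_orbit \<Gamma> (s *\<^sub>R z) = group_orbit \<Gamma> k" using K(3) by blast
      then show False using orbit_eqD[OF sb(2)] elim(3) by blast
    qed
    moreover have "group_orbit \<Gamma> (s *\<^sub>R z) \<in> topspace (quot_Mbar \<Gamma>)"
      using sb(1) by (simp add: quot_Mbar_def del: mem_ball)
    ultimately obtain i where i: "i \<in> {1..q}" "group_orbit \<Gamma> (s *\<^sub>R z) \<in> F i \<union> end_boundary \<Gamma> (F i)"
      unfolding Kc_def by blast
    have "group_orbit \<Gamma> (s *\<^sub>R z) \<notin> boundary_M \<Gamma>"
    proof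
      assume "group_orbit \<Gamma> (s *\<^sub>R z) \<in> boundary_M \<Gamma>"
      then obtain w where w: "w \<in> sphere 0 1" "group_orbit \<Gamma> (s *\<^sub>R z) = group_orbit \<Gamma> w"
        by (auto simp: boundary_M_def ordinary_set_def)
      then obtain \<gamma> where "\<gamma> \<in> \<Gamma>" "s *\<^sub>R z = \<gamma> w" using orbit_eqD[OF sb(2)] by blast
      then show False using sphere[of \<gamma> w] w(1) sb(1) by auto
    qed
    then show ?case using i by (auto simp: end_boundary_def)
  qed
qed

lemma nonconical_limit_point:
  assumes z: "z \<in> limit_set \<Gamma>" and nc: "z \<notin> conical \<Gamma>"
  obtains i \<gamma> w where "i \<in> {1..q}" "\<gamma> \<in> \<Gamma>" "w \<in> end_limit_points \<Gamma> (E i)" "z = \<gamma> w"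
proof -
  have zs: "z \<in> sphere 0 1" using z limit_set_sphere by blast
  define P where "P i = {x \<in> ball 0 1. group_orbit \<Gamma> x \<in> F i}" for i
  have opP: "open (P i)" if "i \<in> {1..q}" for i
    using preimage_component.open_P[OF preimage_component[OF that]]
      preimage_component.P_def[OF preimage_component[OF that]] by (simp add: P_def)
  have "\<forall>\<^sub>F s in at_left 1. (0::real) < s" using eventually_at_left_real[of 0 1] by (auto elim: eventually_mono)
  moreover have "\<forall>\<^sub>F s in at_left 1. s < (1::real)" by (simp add: eventually_at_filter)
  ultimately have "\<forall>\<^sub>F s in at_left 1. s *\<^sub>R z \<in> (\<Union>i\<in>{1..q}. P i)"
    using eventually_in_ends[OF z nc] by eventually_elim (use zs in \<open>auto simp: P_def\<close>)
  then obtain b where b: "b < 1" "\<And>s. b < s \<Longrightarrow> s < 1 \<Longrightarrow> s *\<^sub>R z \<in> (\<Union>i\<in>{1..q}. P i)"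
    by (auto simp: eventually_at_left_field)
  define R where "R = (\<lambda>s. s *\<^sub>R z) ` {b<..<1}"
  have R: "connected R" "R \<subseteq> (\<Union>i\<in>{1..q}. P i)" "R \<noteq> {}"
    unfolding R_def using b by (auto intro!: connected_continuous_image continuous_intros)
  then obtain i where i: "i \<in> {1..q}" "P i \<inter> R \<noteq> {}" by blast
  interpret C: preimage_component \<Gamma> "F i" "E i" by (rule preimage_component[OF i(1)])
  have Pi: "C.P = P i" by (simp add: P_def C.P_def)
  have RP: "R \<subseteq> P i"
  proof -
    define V where "V = (\<Union>j\<in>{1..q} - {i}. P j)"
    have "open V" unfolding V_def using opP by blast
    moreover have "P i \<inter> V = {}" using F_disjoint[OF i(1)] unfolding V_def P_def by blast
    moreover have RV: "R \<subseteq> P i \<union> V" using R(2) by (auto simp: V_def)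
    ultimately have "V \<inter> R = {}" using connectedD[OF R(1) opP[OF i(1)], of V] i(2) by blast
    then show ?thesis using RV by blast
  qed
  obtain D where D: "D \<in> components (P i)" "R \<subseteq> D"
    using exists_component_superset[OF RP _ R(1)] R(3) RP by blast
  have Dop: "open D" "D \<subseteq> ball 0 1"
    using C.open_component[unfolded Pi, OF D(1)] in_components_subset[OF D(1)] by (auto simp: P_def)
  obtain K0 where K0: "compact K0" "K0 \<subseteq> ball 0 1"
    "\<And>x. x \<in> ball 0 1 \<Longrightarrow> group_orbit \<Gamma> x \<in> quot_M \<Gamma> frontier_of F i \<Longrightarrow> \<exists>\<gamma>\<in>\<Gamma>. \<exists>k\<in>K0. x = \<gamma> k"
    using lift_compact_M C.end_F unfolding end_of_M_def by blast
  obtain R0 where R0: "\<And>k. k \<in> K0 \<Longrightarrow> hyp_dist 0 k \<le> R0" using compact_hyp_dist_bounded[OF K0(1,2), of 0] by auto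
  have "\<forall>\<^sub>F s in at_left 1. s *\<^sub>R z \<in> hyp_core N D" for N
  proof (rule ccontr)
    assume *: "\<not> (\<forall>\<^sub>F s in at_left 1. s *\<^sub>R z \<in> hyp_core N D)"
    have inD: "\<forall>\<^sub>F s in at_left 1. s *\<^sub>R z \<in> D"
    proof -
      have "\<forall>\<^sub>F s in at_left 1. s \<in> {b<..<1}" by (rule eventually_at_left_real[OF b(1)])
      then show ?thesis by (rule eventually_mono) (use D(2) in \<open>auto simp: R_def image_subset_iff\<close>)
    qed
    have "\<not> (\<forall>\<^sub>F s in at_left 1. s *\<^sub>R z \<in> D \<longrightarrow> s *\<^sub>R z \<in> hyp_core N D)"
    proof
      assume "\<forall>\<^sub>F s in at_left 1. s *\<^sub>R z \<in> D \<longrightarrow> s *\<^sub>R z \<in> hyp_core N D"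
      then have "\<forall>\<^sub>F s in at_left 1. s *\<^sub>R z \<in> hyp_core N D" using inD by eventually_elim blast
      then show False using * by blast
    qed
    then obtain s where s: "\<And>k. \<not> (s k *\<^sub>R z \<in> D \<longrightarrow> s k *\<^sub>R z \<in> hyp_core N D)" "\<And>k. 0 \<le> s k" "\<And>k. s k < 1" "s \<longlonglongrightarrow> 1"
      by (rule not_eventually_at_left_seq) blast
    have sb: "s k *\<^sub>R z \<in> ball 0 1" for k using s(2,3) zs by simp
    have "\<exists>\<gamma>\<in>\<Gamma>. hyp_dist (s k *\<^sub>R z) (\<gamma> 0) \<le> N + R0" for k
    proof -
      have sD: "s k *\<^sub>R z \<in> D" using s(1)[of k] by blast
      obtain w where w: "w \<in> ball 0 1" "hyp_dist (s k *\<^sub>R z) w < N" "w \<notin> D"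
        using s(1)[of k] sb[of k] unfolding hyp_core_def by blast
      obtain f where f: "f \<in> ball 0 1" "f \<in> closure D" "f \<notin> D" "hyp_dist (s k *\<^sub>R z) f \<le> hyp_dist (s k *\<^sub>R z) w"
        using hyp_dist_frontier[OF Dop(1) sD sb w(1,3)] by blast
      obtain \<gamma> x where g: "\<gamma> \<in> \<Gamma>" "x \<in> K0" "f = \<gamma> x"
        using K0(3)[OF f(1) C.frontier_component[unfolded Pi, OF D(1) f(1-3)]] by blast
      have xb: "x \<in> ball 0 1" using g(2) K0(2) by blast
      have "hyp_dist f (\<gamma> 0) = hyp_dist x 0"
        unfolding g(3) using hyp_isometry_hyp_dist[OF isoD[OF g(1)] xb, of 0] by simp
      also have "\<dots> \<le> R0" using R0[OF g(2)] hyp_dist_commute[OF xb, of 0] by simp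
      finally have "hyp_dist (s k *\<^sub>R z) (\<gamma> 0) \<le> N + R0"
        using hyp_dist_triangle[OF sb f(1) ball[OF g(1), of 0], of k] f(4) w(2) by simp
      then show ?thesis using g(1) by blast
    qed
    then obtain g where "\<And>k. g k \<in> \<Gamma>" "\<And>k. hyp_dist (s k *\<^sub>R z) (g k 0) \<le> N + R0" by metis
    then have "z \<in> conical \<Gamma>" using conicalI[OF zs _ s(2-4)] by blast
    then show False using nc by blast
  qed
  then have epD: "is_endpoint D z" using is_endpoint_iff[OF Dop] zs by blast
  obtain \<gamma> where g: "\<gamma> \<in> \<Gamma>" "D = \<gamma> ` E i" using C.components_transitive[unfolded Pi, OF D(1)] by blast
  define w where "w = ball_inv \<gamma> z"
  have zc: "z \<in> cball 0 1" using zs by auto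
  have "is_endpoint (E i) w"
    using is_endpoint_image[OF inv_in[OF g(1)] Dop epD] inv_image(1)[OF g(1) C.E_cball] by (simp add: g(2) w_def)
  moreover have "w \<in> limit_set \<Gamma>" unfolding w_def by (rule limit_set_image[OF inv_in[OF g(1)] z])
  ultimately have "w \<in> end_limit_points \<Gamma> (E i)" by (simp add: C.end_limit_points_eq)
  moreover have "z = \<gamma> w" unfolding w_def using inv_right[OF g(1) zc] by simp
  ultimately show thesis using that i(1) g(1) by blast
qed

lemma end_limit_orbit_disjoint:
  assumes i: "i \<in> {1..q}" and j: "j \<in> {1..q}" and "i \<noteq> j"
  shows "end_limit_orbit \<Gamma> (E i) \<inter> end_limit_orbit \<Gamma> (E j) = {}"
proof (rule ccontr)
  interpret I: preimage_component \<Gamma> "F i" "E i" by (rule preimage_component[OF i])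
  interpret J: preimage_component \<Gamma> "F j" "E j" by (rule preimage_component[OF j])
  assume "end_limit_orbit \<Gamma> (E i) \<inter> end_limit_orbit \<Gamma> (E j) \<noteq> {}"
  then obtain \<gamma> \<delta> v w where g: "\<gamma> \<in> \<Gamma>" "\<delta> \<in> \<Gamma>" "v \<in> end_limit_points \<Gamma> (E i)" "w \<in> end_limit_points \<Gamma> (E j)" "\<gamma> v = \<delta> w"
    by (auto simp: end_limit_orbit_def)
  have "\<gamma> ` E i \<inter> \<delta> ` E j \<noteq> {}"
    using is_endpoint_Int[OF open_image[OF g(1) I.E_open I.E_ball] open_image[OF g(2) J.E_open J.E_ball]
        I.end_limit_points_image(2)[OF g(1,3)]] J.end_limit_points_image(2)[OF g(2,4)] g(5) by simp
  then obtain x where "x \<in> \<gamma> ` E i" "x \<in> \<delta> ` E j" by blast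
  moreover have "\<gamma> ` E i \<subseteq> I.P" "\<delta> ` E j \<subseteq> J.P"
    using in_components_subset I.component_image[OF g(1) I.E_comp] J.component_image[OF g(2) J.E_comp] by blast+
  ultimately have "group_orbit \<Gamma> x \<in> F i \<inter> F j" unfolding I.P_def J.P_def by blast
  then show False using F_disjoint[OF i j \<open>i \<noteq> j\<close>] by blast
qed

end

section \<open>Extension of conformal measures\<close>

lemma conformal_measuresD:
  assumes "m \<in> conformal_measures \<alpha> G A"
  shows "finite_measure m" "space m = A" "A \<subseteq> cball 0 1"
    "\<And>B. B \<in> sets borel \<Longrightarrow> A \<inter> B \<in> sets m"
    "\<And>\<gamma> B. \<gamma> \<in> G \<Longrightarrow> B \<in> sets m \<Longrightarrow> \<gamma> ` B \<in> sets m"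
    "\<And>\<gamma> B. \<gamma> \<in> G \<Longrightarrow> B \<in> sets m \<Longrightarrow>
      emeasure m (\<gamma> ` B) = (\<integral>\<^sup>+x\<in>B. ennreal (deriv_norm \<gamma> x powr \<alpha>) \<partial>m)"
  using assms by (auto simp: conformal_measures_def sets_restrict_space)

lemma borel_measurable_conformal:
  assumes m: "m \<in> conformal_measures \<alpha> G A" and f: "continuous_on (cball 0 1) f"
  shows "f \<in> borel_measurable m"
proof -
  have "f \<in> borel_measurable (restrict_space borel A)"
    using conformal_measuresD(3)[OF m] continuous_on_subset[OF f] by (intro borel_measurable_continuous_on_restrict) blast
  moreover have "sets (restrict_space borel A) \<subseteq> sets m" "space (restrict_space borel A) = space m"
    using m by (auto simp: conformal_measures_def space_restrict_space)
  ultimately show ?thesis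
    by (metis (no_types, lifting) measurable_mono order_refl subsetD)
qed

lemma (in hyp_group) nn_integral_conformal:
  assumes m: "m \<in> conformal_measures \<alpha> G A" and \<delta>: "\<delta> \<in> G" and f: "f \<in> borel_measurable m"
  shows "\<delta> \<in> measurable m m"
    and "(\<integral>\<^sup>+x. f (\<delta> x) * ennreal (deriv_norm \<delta> x powr \<alpha>) \<partial>m) = (\<integral>\<^sup>+x. f x \<partial>m)"
proof -
  note cm = conformal_measuresD[OF m]
  have inv: "ball_inv \<delta> \<in> G" by (rule inv_in[OF \<delta>])
  have pre: "\<delta> -` B \<inter> space m = ball_inv \<delta> ` B" if B: "B \<in> sets m" for B
  proof -
    have BA: "B \<subseteq> cball 0 1" using sets.sets_into_space[OF B] cm(2,3) by auto
    have "ball_inv \<delta> ` B \<subseteq> space m" using sets.sets_into_space[OF cm(5)[OF inv B]] .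
    moreover have "ball_inv \<delta> ` B \<subseteq> cball 0 1" using cball[OF inv] BA by blast
    ultimately show ?thesis
      using image_eq_vimage[OF inv BA] inv_inv[OF \<delta>] cm(2,3) by auto
  qed
  show meas: "\<delta> \<in> measurable m m"
  proof (rule measurableI)
    fix x assume x: "x \<in> space m"
    have "\<delta> ` space m \<subseteq> space m" using sets.sets_into_space[OF cm(5)[OF \<delta> sets.top]] .
    then show "\<delta> x \<in> space m" using x by blast
  next
    fix B assume "B \<in> sets m"
    then show "\<delta> -` B \<inter> space m \<in> sets m" using pre cm(5)[OF inv] by simp
  qed
  have w: "(\<lambda>x. ennreal (deriv_norm \<delta> x powr \<alpha>)) \<in> borel_measurable m"
    using borel_measurable_conformal[OF m continuous_on_deriv_norm[OF isoD[OF \<delta>]]] by measurable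
  have "distr (density m (\<lambda>x. ennreal (deriv_norm \<delta> x powr \<alpha>))) m \<delta> = m"
  proof (rule measure_eqI)
    fix B assume "B \<in> sets (distr (density m (\<lambda>x. ennreal (deriv_norm \<delta> x powr \<alpha>))) m \<delta>)"
    then have B: "B \<in> sets m" by simp
    have BA: "B \<subseteq> cball 0 1" using sets.sets_into_space[OF B] cm(2,3) by auto
    have "emeasure (distr (density m (\<lambda>x. ennreal (deriv_norm \<delta> x powr \<alpha>))) m \<delta>) B
        = (\<integral>\<^sup>+x\<in>ball_inv \<delta> ` B. ennreal (deriv_norm \<delta> x powr \<alpha>) \<partial>m)"
      using meas w B cm(5)[OF inv B] by (simp add: emeasure_distr pre emeasure_density)
    also have "\<dots> = emeasure m (\<delta> ` ball_inv \<delta> ` B)" by (rule cm(6)[OF \<delta> cm(5)[OF inv B], symmetric])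
    also have "\<delta> ` ball_inv \<delta> ` B = B" by (rule inv_image(2)[OF \<delta> BA])
    finally show "emeasure (distr (density m (\<lambda>x. ennreal (deriv_norm \<delta> x powr \<alpha>))) m \<delta>) B = emeasure m B" .
  qed simp
  then have "(\<integral>\<^sup>+x. f x \<partial>m) = (\<integral>\<^sup>+x. f x \<partial>distr (density m (\<lambda>x. ennreal (deriv_norm \<delta> x powr \<alpha>))) m \<delta>)" by simp
  also have "\<dots> = (\<integral>\<^sup>+x. ennreal (deriv_norm \<delta> x powr \<alpha>) * f (\<delta> x) \<partial>m)"
    using meas w f by (simp add: nn_integral_distr nn_integral_density)
  finally show "(\<integral>\<^sup>+x. f (\<delta> x) * ennreal (deriv_norm \<delta> x powr \<alpha>) \<partial>m) = (\<integral>\<^sup>+x. f x \<partial>m)"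
    by (simp add: mult.commute)
qed

lemma nn_integral_count_space_finite:
  assumes "f summable_on A" "\<And>x. x \<in> A \<Longrightarrow> 0 \<le> f x"
  shows "(\<integral>\<^sup>+x. ennreal (f x) \<partial>count_space A) < \<infinity>"
proof -
  have "(\<lambda>x. norm (f x)) summable_on A" using assms by (subst summable_on_cong[of A _ f]) auto
  then have "integrable (count_space A) f"
    using abs_summable_equivalent[of f A] unfolding Infinite_Set_Sum.abs_summable_on_def by blast
  then have "(\<integral>\<^sup>+x. ennreal (norm (f x)) \<partial>count_space A) < \<infinity>" by (simp add: integrable_iff_bounded)
  also have "(\<integral>\<^sup>+x. ennreal (norm (f x)) \<partial>count_space A) = (\<integral>\<^sup>+x. ennreal (f x) \<partial>count_space A)"
    using assms(2) by (intro nn_integral_cong) simp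
  finally show ?thesis .
qed

locale conformal_end = preimage_component \<Gamma> F E + poincare_group \<Gamma> \<alpha> for \<Gamma> F E \<alpha>
begin

abbreviation "\<Lambda> \<equiv> end_limit_points \<Gamma> E"
abbreviation "S \<equiv> set_stab \<Gamma> E"
abbreviation "Orb \<equiv> end_limit_orbit \<Gamma> E"

lemma Lam_cball: "\<Lambda> \<subseteq> cball 0 1" and Lam_sphere: "\<Lambda> \<subseteq> sphere 0 1"
  using end_limit_pointsD by blast+

lemma Orb_cball: "Orb \<subseteq> cball 0 1"
  unfolding end_limit_orbit_def using cball Lam_cball by blast

lemma Lam_Orb: "\<Lambda> \<subseteq> Orb"
proof
  fix x assume x: "x \<in> \<Lambda>"
  then have "x = (\<lambda>x\<in>cball 0 1. x) x" using Lam_cball by auto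
  then show "x \<in> Orb" using x id_in unfolding end_limit_orbit_def by blast
qed

lemma Orb_image: "\<gamma> \<in> \<Gamma> \<Longrightarrow> x \<in> Orb \<Longrightarrow> \<gamma> x \<in> Orb"
proof -
  assume g: "\<gamma> \<in> \<Gamma>" and "x \<in> Orb"
  then obtain \<delta> z where "\<delta> \<in> \<Gamma>" "z \<in> \<Lambda>" "x = \<delta> z" by (auto simp: end_limit_orbit_def)
  then have "\<gamma> x = compose (cball 0 1) \<gamma> \<delta> z" "compose (cball 0 1) \<gamma> \<delta> \<in> \<Gamma>"
    using comp_apply[of z \<gamma> \<delta>] Lam_cball comp_in[OF g] by auto
  then show ?thesis using \<open>z \<in> \<Lambda>\<close> unfolding end_limit_orbit_def by blast
qed

definition translates where "translates = (\<lambda>\<gamma>. \<gamma> ` E) ` \<Gamma>"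

definition rep where "rep C = (SOME \<gamma>. \<gamma> \<in> \<Gamma> \<and> \<gamma> ` E = C)"

lemma rep: assumes "C \<in> translates" shows "rep C \<in> \<Gamma>" "rep C ` E = C"
proof -
  have "\<exists>\<gamma>. \<gamma> \<in> \<Gamma> \<and> \<gamma> ` E = C" using assms by (auto simp: translates_def)
  from someI_ex[OF this] show "rep C \<in> \<Gamma>" "rep C ` E = C" unfolding rep_def by blast+
qed

lemma countable_translates: "countable translates"
  unfolding translates_def using countable_group by simp

lemma E_translates: "E \<in> translates"
proof -
  have "(\<lambda>x\<in>cball 0 1. x) ` E = E" using E_cball by (force simp: subset_iff)
  then show ?thesis using id_in unfolding translates_def by (metis imageI)
qed

lemma translates_image: "\<gamma> \<in> \<Gamma> \<Longrightarrow> C \<in> translates \<Longrightarrow> \<gamma> ` C \<in> translates"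
proof -
  assume g: "\<gamma> \<in> \<Gamma>" and "C \<in> translates"
  then obtain \<delta> where d: "\<delta> \<in> \<Gamma>" "C = \<delta> ` E" by (auto simp: translates_def)
  then have "\<gamma> ` C = compose (cball 0 1) \<gamma> \<delta> ` E" using comp_image[OF E_cball, of \<gamma> \<delta>] by simp
  then show ?thesis using comp_in[OF g d(1)] unfolding translates_def by blast
qed

lemma translates_cball: "C \<in> translates \<Longrightarrow> C \<subseteq> cball 0 1"
  unfolding translates_def using cball E_cball by blast

lemma translates_eqI:
  assumes "\<gamma> \<in> \<Gamma>" "\<delta> \<in> \<Gamma>" "x \<in> \<Lambda>" "y \<in> \<Lambda>" "\<gamma> x = \<delta> y"
  shows "\<gamma> ` E = \<delta> ` E"
proof -
  have "\<gamma> ` E \<inter> \<delta> ` E \<noteq> {}"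
    using is_endpoint_Int[OF open_image[OF assms(1) E_open E_ball] open_image[OF assms(2) E_open E_ball]
        end_limit_points_image(2)[OF assms(1,3)]] end_limit_points_image(2)[OF assms(2,4)] assms(5) by simp
  then show ?thesis
    using component_eqI[OF component_image[OF assms(1) E_comp] component_image[OF assms(2) E_comp]] by blast
qed

lemma same_translate:
  assumes "\<gamma> \<in> \<Gamma>" "\<delta> \<in> \<Gamma>" "\<gamma> ` E = \<delta> ` E"
  shows "compose (cball 0 1) (ball_inv \<delta>) \<gamma> \<in> S"
proof -
  have "compose (cball 0 1) (ball_inv \<delta>) \<gamma> ` E = ball_inv \<delta> ` \<delta> ` E"
    using comp_image[OF E_cball] assms(3) by metis
  then show ?thesis using inv_image(1)[OF assms(2) E_cball] comp_in[OF inv_in[OF assms(2)] assms(1)]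
    by (simp add: set_stab_def)
qed

text \<open>The geodesic from \<open>\<gamma>\<inverse> 0\<close> to an end limit point \<open>z\<close> enters the core of \<open>E\<close> through the shell, which is
  compact modulo the stabilizer.\<close>

lemma separated_from_orbit:
  obtains c where "c > 0" "\<And>z \<gamma>. z \<in> \<Lambda> \<Longrightarrow> \<gamma> \<in> \<Gamma> \<Longrightarrow>
    \<exists>\<delta>\<in>S. c \<le> norm (ball_inv \<delta> z - ball_inv \<delta> (ball_inv \<gamma> 0))"
proof -
  obtain N where N: "N > 0" "\<And>M \<gamma>. M \<ge> N \<Longrightarrow> \<gamma> \<in> \<Gamma> \<Longrightarrow> \<gamma> 0 \<notin> hyp_core M E"
    using orbit_not_in_core by metis
  obtain L where L: "compact L" "L \<subseteq> ball 0 1"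
    "\<And>y. y \<in> hyp_core N E \<Longrightarrow> y \<notin> hyp_core (N + 1) E \<Longrightarrow> \<exists>\<delta>\<in>S. \<exists>l\<in>L. y = \<delta> l"
    using shell_cocompact[OF N(1)] by blast
  obtain r where r: "r < 1" "\<And>l. l \<in> L \<Longrightarrow> norm l \<le> r" "0 \<le> r"
  proof (cases "L = {}")
    case False
    obtain l where "l \<in> L" "\<forall>y\<in>L. norm y \<le> norm l"
      using continuous_attains_sup[OF L(1) False continuous_on_norm_id] by blast
    then show thesis using L(2) that[of "norm l"] by auto
  qed (use that[of 0] in simp)
  define c0 where "c0 = 1 - r\<^sup>2"
  have c0: "c0 > 0" using r by (simp add: c0_def power_less_one_iff)
  have "\<exists>\<delta>\<in>S. c0 / 4 \<le> norm (ball_inv \<delta> z - ball_inv \<delta> (ball_inv \<gamma> 0))" if z: "z \<in> \<Lambda>" and g: "\<gamma> \<in> \<Gamma>" for z \<gamma>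
  proof -
    have zs: "z \<in> sphere 0 1" "z \<in> cball 0 1" using end_limit_pointsD[OF z] by blast+
    define h w where "h = ball_inv \<gamma>" and "w = \<gamma> z"
    have h: "h \<in> \<Gamma>" unfolding h_def by (rule inv_in[OF g])
    have ws: "w \<in> sphere 0 1" "w \<in> cball 0 1" unfolding w_def using sphere[OF g zs(1)] cball[OF g zs(2)] by auto
    have hw: "h w = z" unfolding h_def w_def by (rule inv_left[OF g zs(2)])
    obtain C where C: "\<And>s. 0 \<le> s \<Longrightarrow> s < 1 \<Longrightarrow> hyp_dist (h (s *\<^sub>R w)) (s *\<^sub>R h w) \<le> C"
      using radial_image_bounded_dist[OF isoD[OF h] ws(1)] by blast
    have "\<forall>\<^sub>F s in at_left 1. s *\<^sub>R z \<in> hyp_core (N + C) E"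
      using end_limit_pointsD(3)[OF z] is_endpoint_iff[OF E_open E_ball] by blast
    moreover have "\<forall>\<^sub>F s in at_left 1. s \<in> {0<..<(1::real)}" by (rule eventually_at_left_real) simp
    ultimately have "\<forall>\<^sub>F s in at_left 1. s \<in> {0<..<1} \<and> s *\<^sub>R z \<in> hyp_core (N + C) E"
      by eventually_elim blast
    from eventually_happens'[OF trivial_limit_at_left_real this]
    obtain s1 where "s1 \<in> {0<..<(1::real)}" and s1c: "s1 *\<^sub>R z \<in> hyp_core (N + C) E" by blast
    then have s1: "0 < s1" "s1 < 1" "s1 *\<^sub>R z \<in> hyp_core (N + C) E" by simp_all
    have sb: "s *\<^sub>R w \<in> ball 0 1" if "s \<in> {0..s1}" for s using that ws s1 by simp
    have "hyp_dist (s1 *\<^sub>R z) (h (s1 *\<^sub>R w)) \<le> C"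
      using C[of s1] s1 hyp_dist_commute[of "s1 *\<^sub>R z" "h (s1 *\<^sub>R w)"] ball[OF h sb[of s1]] zs hw by simp
    then have deep: "h (s1 *\<^sub>R w) \<in> hyp_core N E"
      using hyp_core_dist[OF s1(3) ball[OF h sb[of s1]], of C] s1 by simp
    let ?R = "(\<lambda>s. h (s *\<^sub>R w)) ` {0..s1}"
    have "continuous_on {0..s1} (\<lambda>s. h (s *\<^sub>R w))"
    proof (rule continuous_on_compose2[OF hyp_isometry_continuous[OF isoD[OF h]]])
      show "continuous_on {0..s1} (\<lambda>s. s *\<^sub>R w)" by (intro continuous_intros)
      show "(\<lambda>s. s *\<^sub>R w) ` {0..s1} \<subseteq> cball 0 1" using sb ball_subset_cball by blast
    qed
    then have R: "connected ?R" by (intro connected_continuous_image) auto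
    have Rb: "?R \<subseteq> ball 0 1" using ball[OF h sb] by blast
    have "h (0 *\<^sub>R w) \<in> ?R" by (rule imageI) (use s1 in simp)
    moreover have "h (s1 *\<^sub>R w) \<in> ?R" by (rule imageI) (use s1 in simp)
    moreover have "h (0 *\<^sub>R w) \<notin> hyp_core N E" using N(2)[OF order_refl h] by simp
    ultimately obtain p where p: "p \<in> ?R" "p \<in> hyp_core N E" "p \<notin> hyp_core (N + 1) E"
      using hyp_core_crossing[OF R Rb _ deep] by blast
    obtain s where s: "s \<in> {0..s1}" "p = h (s *\<^sub>R w)" using p(1) by blast
    obtain \<delta> l where d: "\<delta> \<in> S" "l \<in> L" "p = \<delta> l" using L(3)[OF p(2,3)] by blast
    have d\<Gamma>: "\<delta> \<in> \<Gamma>" using d(1) stab_subset by blast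
    have lc: "l \<in> cball 0 1" using d(2) L(2) ball_subset_cball by blast
    define k where "k = compose (cball 0 1) (ball_inv \<delta>) h"
    have k: "k \<in> \<Gamma>" unfolding k_def by (rule comp_in[OF inv_in[OF d\<Gamma>] h])
    have kx: "k x = ball_inv \<delta> (h x)" if "x \<in> cball 0 1" for x unfolding k_def by (rule comp_apply[OF that])
    have "k (s *\<^sub>R w) = l"
      using kx[of "s *\<^sub>R w"] sb[OF s(1)] s(2) d(3) inv_left[OF d\<Gamma> lc] by auto
    then have "c0 \<le> 1 - (norm (k (s *\<^sub>R w)))\<^sup>2"
      using r(2)[OF d(2)] power_mono[of "norm l" r 2] by (simp add: c0_def)
    then have "c0 / 4 \<le> norm (k 0 - k w)"
      by (rule geodesic_through_compact[OF isoD[OF k] ws(1), rotated -1]) (use s(1) s1 in auto)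
    also have "k 0 = ball_inv \<delta> (ball_inv \<gamma> 0)" using kx[of 0] by (simp add: h_def)
    also have "k w = ball_inv \<delta> z" using kx[OF ws(2)] hw by simp
    also have "norm (ball_inv \<delta> (ball_inv \<gamma> 0) - ball_inv \<delta> z) = norm (ball_inv \<delta> z - ball_inv \<delta> (ball_inv \<gamma> 0))"
      by (rule norm_minus_commute)
    finally show ?thesis using d(1) by blast
  qed
  then show thesis using that[of "c0 / 4"] c0 by simp
qed

context
  fixes m
  assumes m: "m \<in> conformal_measures \<alpha> S \<Lambda>"
begin

lemmas cm = conformal_measuresD[OF m]

lemma borel_measurable_weight: "\<gamma> \<in> \<Gamma> \<Longrightarrow> (\<lambda>x. ennreal (deriv_norm \<gamma> x powr \<alpha>)) \<in> borel_measurable m"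
  using borel_measurable_conformal[OF m continuous_on_deriv_norm[OF isoD]] by measurable

definition ext_sets where "ext_sets = {B. B \<subseteq> Orb \<and> (\<forall>\<gamma>\<in>\<Gamma>. {x \<in> \<Lambda>. \<gamma> x \<in> B} \<in> sets m)}"

lemma sigma_algebra_ext_sets: "sigma_algebra Orb ext_sets"
proof (rule sigma_algebra_iff2[THEN iffD2], intro conjI ballI allI impI)
  fix B assume B: "B \<in> ext_sets"
  have "{x \<in> \<Lambda>. \<gamma> x \<in> Orb - B} = space m - {x \<in> \<Lambda>. \<gamma> x \<in> B}" if "\<gamma> \<in> \<Gamma>" for \<gamma>
    using Orb_image[OF that] Lam_Orb cm(2) by blast
  then show "Orb - B \<in> ext_sets" using B by (auto simp: ext_sets_def)
next
  fix X :: "nat \<Rightarrow> _" assume X: "range X \<subseteq> ext_sets"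
  have "{x \<in> \<Lambda>. \<gamma> x \<in> (\<Union>n. X n)} = (\<Union>n. {x \<in> \<Lambda>. \<gamma> x \<in> X n})" for \<gamma> by blast
  moreover have "(\<Union>n. {x \<in> \<Lambda>. \<gamma> x \<in> X n}) \<in> sets m" if "\<gamma> \<in> \<Gamma>" for \<gamma>
    using X that by (intro sets.countable_UN) (auto simp: ext_sets_def)
  ultimately show "(\<Union>n. X n) \<in> ext_sets" using X by (fastforce simp: ext_sets_def)
qed (auto simp: ext_sets_def)

definition ext_space where "ext_space = sigma Orb ext_sets"

lemma space_ext_space: "space ext_space = Orb"
  unfolding ext_space_def by (rule space_measure_of) (auto simp: ext_sets_def)

lemma sets_ext_space: "sets ext_space = ext_sets"
  unfolding ext_space_def by (rule sigma_algebra.sets_measure_of_eq[OF sigma_algebra_ext_sets])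

lemma measurable_translate: "\<gamma> \<in> \<Gamma> \<Longrightarrow> \<gamma> \<in> measurable m ext_space"
proof (rule measurableI)
  assume g: "\<gamma> \<in> \<Gamma>"
  show "\<gamma> x \<in> space ext_space" if "x \<in> space m" for x
    using that Orb_image[OF g] Lam_Orb cm(2) space_ext_space by auto
  show "\<gamma> -` B \<inter> space m \<in> sets m" if "B \<in> sets ext_space" for B
  proof -
    have "\<gamma> -` B \<inter> space m = {x \<in> \<Lambda>. \<gamma> x \<in> B}" using cm(2) by blast
    then show ?thesis using that g by (simp add: sets_ext_space ext_sets_def)
  qed
qed

definition ext_measure where
  "ext_measure = distr (density (count_space translates \<Otimes>\<^sub>M m) (\<lambda>(C, x). ennreal (deriv_norm (rep C) x powr \<alpha>)))
     ext_space (\<lambda>(C, x). rep C x)"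

lemma space_ext_measure: "space ext_measure = Orb" and sets_ext_measure: "sets ext_measure = ext_sets"
  by (simp_all add: ext_measure_def space_ext_space sets_ext_space)

lemma nn_integral_ext_measure:
  assumes f: "f \<in> borel_measurable ext_space"
  shows "(\<integral>\<^sup>+x. f x \<partial>ext_measure) =
    (\<integral>\<^sup>+C. \<integral>\<^sup>+x. f (rep C x) * ennreal (deriv_norm (rep C) x powr \<alpha>) \<partial>m \<partial>count_space translates)"
proof -
  interpret finite_measure m by (rule cm(1))
  have 1: "(\<lambda>(C, x). rep C x) \<in> measurable (count_space translates \<Otimes>\<^sub>M m) ext_space"
    by (rule measurable_pair_measure_countable1[OF countable_translates]) (simp add: measurable_translate rep)
  have 2: "(\<lambda>(C, x). ennreal (deriv_norm (rep C) x powr \<alpha>)) \<in> borel_measurable (count_space translates \<Otimes>\<^sub>M m)"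
    by (rule measurable_pair_measure_countable1[OF countable_translates])
      (simp only: prod.case borel_measurable_weight rep)
  have 3: "(\<lambda>p. f (case p of (C, x) \<Rightarrow> rep C x)) \<in> borel_measurable (count_space translates \<Otimes>\<^sub>M m)"
    by (rule measurable_compose[OF 1 f])
  have "(\<integral>\<^sup>+x. f x \<partial>ext_measure) = (\<integral>\<^sup>+p. (case p of (C, x) \<Rightarrow> ennreal (deriv_norm (rep C) x powr \<alpha>)) *
      f (case p of (C, x) \<Rightarrow> rep C x) \<partial>(count_space translates \<Otimes>\<^sub>M m))"
    unfolding ext_measure_def using 1 2 3 f by (subst nn_integral_distr) (simp_all add: nn_integral_density)
  also have "\<dots> = (\<integral>\<^sup>+C. \<integral>\<^sup>+x. ennreal (deriv_norm (rep C) x powr \<alpha>) * f (rep C x) \<partial>m \<partial>count_space translates)"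
    using nn_integral_fst[OF borel_measurable_times_ennreal[OF 2 3]] by simp
  finally show ?thesis by (simp add: mult.commute)
qed

lemma weight_translate:
  assumes g: "\<gamma> \<in> \<Gamma>" and f: "f \<in> borel_measurable ext_space" and C: "C = \<gamma> ` E"
  shows "(\<integral>\<^sup>+x. f (rep C x) * ennreal (deriv_norm (rep C) x powr \<alpha>) \<partial>m)
    = (\<integral>\<^sup>+x. f (\<gamma> x) * ennreal (deriv_norm \<gamma> x powr \<alpha>) \<partial>m)"
proof -
  interpret S: hyp_group S by (rule stab_group)
  have CT: "C \<in> translates" using g C by (auto simp: translates_def)
  define \<delta> where "\<delta> = compose (cball 0 1) (ball_inv (rep C)) \<gamma>"
  have d: "\<delta> \<in> S" unfolding \<delta>_def using same_translate[OF g rep(1)[OF CT]] rep(2)[OF CT] C by simp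
  have d\<Gamma>: "\<delta> \<in> \<Gamma>" using d stab_subset by blast
  have eq: "\<gamma> = compose (cball 0 1) (rep C) \<delta>"
    using rep(1)[OF CT] g d\<Gamma> by (intro ext comp_in) (auto simp: \<delta>_def cball simp del: mem_cball mem_cball_0)
  have meas: "(\<lambda>x. f (rep C x) * ennreal (deriv_norm (rep C) x powr \<alpha>)) \<in> borel_measurable m"
    using measurable_compose[OF measurable_translate[OF rep(1)[OF CT]] f] borel_measurable_weight[OF rep(1)[OF CT]]
    by measurable
  have "(\<integral>\<^sup>+x. f (rep C x) * ennreal (deriv_norm (rep C) x powr \<alpha>) \<partial>m)
      = (\<integral>\<^sup>+x. (f (rep C (\<delta> x)) * ennreal (deriv_norm (rep C) (\<delta> x) powr \<alpha>)) * ennreal (deriv_norm \<delta> x powr \<alpha>) \<partial>m)"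
    by (rule S.nn_integral_conformal(2)[OF m d meas, symmetric])
  also have "\<dots> = (\<integral>\<^sup>+x. f (\<gamma> x) * ennreal (deriv_norm \<gamma> x powr \<alpha>) \<partial>m)"
  proof (rule nn_integral_cong)
    fix x assume "x \<in> space m"
    then have x: "x \<in> cball 0 1" using cm(2) Lam_cball by auto
    have "deriv_norm \<gamma> x = deriv_norm (rep C) (\<delta> x) * deriv_norm \<delta> x"
      using deriv_norm_comp[OF rep(1)[OF CT] d\<Gamma> x] eq by simp
    moreover have "\<gamma> x = rep C (\<delta> x)" using comp_apply[OF x] eq by metis
    moreover have "0 < deriv_norm (rep C) (\<delta> x)" "0 < deriv_norm \<delta> x"
      using deriv_norm_pos[OF isoD] rep(1)[OF CT] d\<Gamma> x cball by blast+
    ultimately show "f (rep C (\<delta> x)) * ennreal (deriv_norm (rep C) (\<delta> x) powr \<alpha>) * ennreal (deriv_norm \<delta> x powr \<alpha>)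
        = f (\<gamma> x) * ennreal (deriv_norm \<gamma> x powr \<alpha>)"
      by (simp add: powr_mult ennreal_mult mult.assoc)
  qed
  finally show ?thesis .
qed

end

end

context conformal_end
begin

context
  fixes m
  assumes m: "m \<in> conformal_measures \<alpha> S \<Lambda>"
begin

lemmas cm' = conformal_measuresD[OF m]

lemma ext_measure_finite: "finite_measure (ext_measure m)"
proof (rule finite_measureI)
  interpret finite_measure m by (rule cm'(1))
  interpret S: hyp_group S by (rule stab_group)
  obtain c where c: "c > 0" "\<And>z \<gamma>. z \<in> \<Lambda> \<Longrightarrow> \<gamma> \<in> \<Gamma> \<Longrightarrow>
    \<exists>\<delta>\<in>S. c \<le> norm (ball_inv \<delta> z - ball_inv \<delta> (ball_inv \<gamma> 0))" using separated_from_orbit by blast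
  define far where "far \<gamma> = {x. c \<le> norm (x - ball_inv \<gamma> 0)}" for \<gamma> :: "'a \<Rightarrow> 'a"
  define K where "K = ennreal ((4 / c\<^sup>2) powr \<alpha>) * emeasure m (space m)"
  define e where "e \<gamma> = ennreal (exp (- \<alpha> * hyp_dist 0 (\<gamma> 0)))" for \<gamma> :: "'a \<Rightarrow> 'a"
  have far_bound: "(\<integral>\<^sup>+x. indicator (far \<gamma>) x * ennreal (deriv_norm \<gamma> x powr \<alpha>) \<partial>m) \<le> K * e \<gamma>" if g: "\<gamma> \<in> \<Gamma>" for \<gamma>
  proof -
    define b where "b = norm (ball_inv \<gamma> 0)"
    have gb: "\<gamma> 0 \<in> ball 0 1" using ball[OF g, of 0] by simp
    have bg: "b = norm (\<gamma> 0)" unfolding b_def by (rule norm_inv_0[OF g])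
    have b: "0 \<le> b" "b < 1" using gb by (auto simp: bg)
    have b4: "1 - b\<^sup>2 \<le> 4 * exp (- hyp_dist 0 (\<gamma> 0))"
    proof -
      have "exp (- hyp_dist 0 (\<gamma> 0)) = (1 - b) / (1 + b)"
        using exp_hyp_dist_0[OF gb] by (simp add: exp_minus bg)
      moreover have "(1 - b\<^sup>2) * (1 + b) \<le> 4 * (1 - b)"
      proof -
        have "(1 + b)\<^sup>2 \<le> 2\<^sup>2" using b by (intro power_mono) auto
        then have "(1 - b) * (1 + b)\<^sup>2 \<le> (1 - b) * 4" using b by (intro mult_left_mono) auto
        then show ?thesis by (simp add: power2_eq_square algebra_simps)
      qed
      then have "1 - b\<^sup>2 \<le> 4 * (1 - b) / (1 + b)" using b by (simp add: pos_le_divide_eq)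
      ultimately show ?thesis by simp
    qed
    have "(\<integral>\<^sup>+x. indicator (far \<gamma>) x * ennreal (deriv_norm \<gamma> x powr \<alpha>) \<partial>m)
        \<le> (\<integral>\<^sup>+x. ennreal ((4 / c\<^sup>2) powr \<alpha>) * e \<gamma> \<partial>m)"
    proof (rule nn_integral_mono)
      fix x assume "x \<in> space m"
      then have x: "x \<in> sphere 0 1" using cm'(2) Lam_sphere by auto
      show "indicator (far \<gamma>) x * ennreal (deriv_norm \<gamma> x powr \<alpha>) \<le> ennreal ((4 / c\<^sup>2) powr \<alpha>) * e \<gamma>"
      proof (cases "x \<in> far \<gamma>")
        case True
        then have cx: "c \<le> norm (x - ball_inv \<gamma> 0)" by (simp add: far_def)
        have "deriv_norm \<gamma> x = (1 - b\<^sup>2) / (norm (x - ball_inv \<gamma> 0))\<^sup>2"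
          using deriv_norm_sphere[OF g x] by (simp add: b_def)
        also have "\<dots> \<le> (1 - b\<^sup>2) / c\<^sup>2"
          using cx c(1) b by (intro divide_left_mono power_mono mult_pos_pos) (auto simp: power_le_one)
        also have "\<dots> \<le> 4 * exp (- hyp_dist 0 (\<gamma> 0)) / c\<^sup>2"
          using b4 by (intro divide_right_mono) auto
        finally have "deriv_norm \<gamma> x \<le> 4 / c\<^sup>2 * exp (- hyp_dist 0 (\<gamma> 0))" by simp
        moreover have "0 \<le> deriv_norm \<gamma> x" using deriv_norm_pos[OF isoD[OF g], of x] x by auto
        ultimately have "deriv_norm \<gamma> x powr \<alpha> \<le> (4 / c\<^sup>2 * exp (- hyp_dist 0 (\<gamma> 0))) powr \<alpha>"
          using alpha by (intro powr_mono2) auto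
        also have "\<dots> = (4 / c\<^sup>2) powr \<alpha> * exp (- \<alpha> * hyp_dist 0 (\<gamma> 0))"
          using powr_mult[of "4 / c\<^sup>2" "exp (- hyp_dist 0 (\<gamma> 0))" \<alpha>] exp_powr_real[of "- hyp_dist 0 (\<gamma> 0)" \<alpha>]
          by (simp add: mult.commute)
        finally show ?thesis using True by (simp add: e_def ennreal_leI flip: ennreal_mult)
      qed simp
    qed
    also have "\<dots> = K * e \<gamma>" by (simp add: K_def mult_ac)
    finally show ?thesis .
  qed
  have coset_bound: "(\<integral>\<^sup>+x. ennreal (deriv_norm (rep C) x powr \<alpha>) \<partial>m) \<le> (\<integral>\<^sup>+\<gamma>. K * e \<gamma> * indicator {\<gamma>. \<gamma> ` E = C} \<gamma> \<partial>count_space \<Gamma>)"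
    if C: "C \<in> translates" for C
  proof -
    define \<tau> where "\<tau> = rep C"
    have t: "\<tau> \<in> \<Gamma>" "\<tau> ` E = C" unfolding \<tau>_def using rep[OF C] by auto
    define td where "td \<delta> = compose (cball 0 1) \<tau> \<delta>" for \<delta> :: "'a \<Rightarrow> 'a"
    have td: "td \<delta> \<in> \<Gamma>" "td \<delta> ` E = C" if "\<delta> \<in> S" for \<delta>
      using that comp_in[OF t(1)] stab_subset comp_image[OF E_cball] t(2) by (auto simp: td_def set_stab_def)
    define A where "A \<delta> = {x. c \<le> norm (ball_inv \<delta> x - ball_inv \<delta> (ball_inv \<tau> 0))}" for \<delta> :: "'a \<Rightarrow> 'a"
    have tdinv: "ball_inv (td \<delta>) 0 = ball_inv \<delta> (ball_inv \<tau> 0)" if d: "\<delta> \<in> S" for \<delta>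
    proof -
      have d\<Gamma>: "\<delta> \<in> \<Gamma>" using d stab_subset by blast
      define y where "y = ball_inv \<delta> (ball_inv \<tau> 0)"
      have i: "ball_inv \<tau> 0 \<in> cball 0 1" by (rule cball[OF inv_in[OF t(1)]]) simp
      have y: "y \<in> cball 0 1" unfolding y_def by (rule cball[OF inv_in[OF d\<Gamma>] i])
      have "td \<delta> y = 0"
        using comp_apply[OF y, of \<tau> \<delta>] inv_right[OF d\<Gamma> i] inv_right[OF t(1), of 0] by (simp add: td_def y_def)
      then show ?thesis using inv_left[OF td(1)[OF d] y] by (simp add: y_def)
    qed
    have Aborel: "(indicator (A \<delta>) :: 'a \<Rightarrow> ennreal) \<in> borel_measurable m" if d: "\<delta> \<in> S" for \<delta>
    proof -
      have d\<Gamma>: "\<delta> \<in> \<Gamma>" using d stab_subset by blast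
      have "continuous_on (cball 0 1) (\<lambda>x. norm (ball_inv \<delta> x - ball_inv \<delta> (ball_inv \<tau> 0)))"
        by (intro continuous_intros hyp_isometry_continuous[OF isoD[OF inv_in[OF d\<Gamma>]]])
      from borel_measurable_conformal[OF m this]
      have "{x \<in> space m. c \<le> norm (ball_inv \<delta> x - ball_inv \<delta> (ball_inv \<tau> 0))} \<in> sets m" by measurable
      then have "A \<delta> \<inter> space m \<in> sets m" by (simp add: A_def Int_def conj_commute)
      then show ?thesis by (simp only: borel_measurable_indicator_iff)
    qed
    have "(\<integral>\<^sup>+x. ennreal (deriv_norm \<tau> x powr \<alpha>) \<partial>m)
        \<le> (\<integral>\<^sup>+x. \<integral>\<^sup>+\<delta>. indicator (A \<delta>) x * ennreal (deriv_norm \<tau> x powr \<alpha>) \<partial>count_space S \<partial>m)"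
    proof (rule nn_integral_mono)
      fix x assume "x \<in> space m"
      then obtain \<delta> where d: "\<delta> \<in> S" "x \<in> A \<delta>" using c(2)[of x \<tau>] t(1) cm'(2) by (auto simp: A_def)
      have "ennreal (deriv_norm \<tau> x powr \<alpha>) = indicator (A \<delta>) x * ennreal (deriv_norm \<tau> x powr \<alpha>)" using d by simp
      also have "\<dots> \<le> (\<integral>\<^sup>+\<delta>. indicator (A \<delta>) x * ennreal (deriv_norm \<tau> x powr \<alpha>) \<partial>count_space S)"
        by (rule nn_integral_ge_point[OF d(1)])
      finally show "ennreal (deriv_norm \<tau> x powr \<alpha>) \<le> (\<integral>\<^sup>+\<delta>. indicator (A \<delta>) x * ennreal (deriv_norm \<tau> x powr \<alpha>) \<partial>count_space S)" .
    qed
    also have "\<dots> = (\<integral>\<^sup>+\<delta>. \<integral>\<^sup>+x. indicator (A \<delta>) x * ennreal (deriv_norm \<tau> x powr \<alpha>) \<partial>m \<partial>count_space S)"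
      using Aborel borel_measurable_weight[OF m t(1)] countable_subset[OF stab_subset countable_group]
      by (intro nn_integral_count_space_nn_integral borel_measurable_times_ennreal) auto
    also have "\<dots> \<le> (\<integral>\<^sup>+\<delta>. K * e (td \<delta>) \<partial>count_space S)"
    proof (rule nn_integral_mono)
      fix \<delta> assume "\<delta> \<in> space (count_space S)"
      then have d: "\<delta> \<in> S" "\<delta> \<in> \<Gamma>" using stab_subset by auto
      have "(\<integral>\<^sup>+x. indicator (A \<delta>) x * ennreal (deriv_norm \<tau> x powr \<alpha>) \<partial>m)
          = (\<integral>\<^sup>+x. (indicator (A \<delta>) (\<delta> x) * ennreal (deriv_norm \<tau> (\<delta> x) powr \<alpha>)) * ennreal (deriv_norm \<delta> x powr \<alpha>) \<partial>m)"
        using Aborel[OF d(1)] borel_measurable_weight[OF m t(1)]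
        by (intro S.nn_integral_conformal(2)[OF m d(1), symmetric] borel_measurable_times_ennreal)
      also have "\<dots> = (\<integral>\<^sup>+x. indicator (far (td \<delta>)) x * ennreal (deriv_norm (td \<delta>) x powr \<alpha>) \<partial>m)"
      proof (rule nn_integral_cong)
        fix x assume "x \<in> space m"
        then have x: "x \<in> cball 0 1" using cm'(2) Lam_cball by auto
        have "indicator (A \<delta>) (\<delta> x) = (indicator (far (td \<delta>)) x :: ennreal)"
          using inv_left[OF d(2) x] tdinv[OF d(1)] by (simp add: A_def far_def indicator_def)
        moreover have "deriv_norm (td \<delta>) x = deriv_norm \<tau> (\<delta> x) * deriv_norm \<delta> x"
          unfolding td_def by (rule deriv_norm_comp[OF t(1) d(2) x])
        moreover have "0 < deriv_norm \<tau> (\<delta> x)" "0 < deriv_norm \<delta> x"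
          using deriv_norm_pos[OF isoD] t(1) d(2) x cball by blast+
        ultimately show "indicator (A \<delta>) (\<delta> x) * ennreal (deriv_norm \<tau> (\<delta> x) powr \<alpha>) * ennreal (deriv_norm \<delta> x powr \<alpha>)
            = indicator (far (td \<delta>)) x * ennreal (deriv_norm (td \<delta>) x powr \<alpha>)"
          by (simp add: powr_mult ennreal_mult mult.assoc)
      qed
      also have "\<dots> \<le> K * e (td \<delta>)" by (rule far_bound[OF td(1)[OF d(1)]])
      finally show "(\<integral>\<^sup>+x. indicator (A \<delta>) x * ennreal (deriv_norm \<tau> x powr \<alpha>) \<partial>m) \<le> K * e (td \<delta>)" .
    qed
    also have "\<dots> = (\<integral>\<^sup>+\<gamma>. K * e \<gamma> \<partial>count_space {\<gamma> \<in> \<Gamma>. \<gamma> ` E = C})"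
    proof (rule nn_integral_bij_count_space)
      have "inj_on td S"
        using bij_comp_left[OF t(1)] stab_subset unfolding td_def[abs_def] bij_betw_def by (auto intro: inj_on_subset)
      moreover have "td ` S = {\<gamma> \<in> \<Gamma>. \<gamma> ` E = C}"
      proof (intro equalityI subsetI)
        fix \<gamma> assume g: "\<gamma> \<in> {\<gamma> \<in> \<Gamma>. \<gamma> ` E = C}"
        define \<delta> where "\<delta> = compose (cball 0 1) (ball_inv \<tau>) \<gamma>"
        have "\<delta> \<in> S" unfolding \<delta>_def using g t by (intro same_translate) auto
        moreover have "td \<delta> = \<gamma>"
          unfolding td_def \<delta>_def using g t(1) by (intro ext comp_in inv_in) (auto simp: cball simp del: mem_cball mem_cball_0)
        ultimately show "\<gamma> \<in> td ` S" by blast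
      next
        fix \<gamma> assume "\<gamma> \<in> td ` S"
        then show "\<gamma> \<in> {\<gamma> \<in> \<Gamma>. \<gamma> ` E = C}" using td by blast
      qed
      ultimately show "bij_betw td S {\<gamma> \<in> \<Gamma>. \<gamma> ` E = C}" by (simp add: bij_betw_def)
    qed
    also have "\<dots> = (\<integral>\<^sup>+\<gamma>. K * e \<gamma> * indicator {\<gamma>. \<gamma> ` E = C} \<gamma> \<partial>count_space \<Gamma>)"
    proof -
      have "(\<integral>\<^sup>+\<gamma>. K * e \<gamma> \<partial>count_space {\<gamma> \<in> \<Gamma>. \<gamma> ` E = C})
          = (\<integral>\<^sup>+\<gamma>. K * e \<gamma> * indicator {\<gamma> \<in> \<Gamma>. \<gamma> ` E = C} \<gamma> \<partial>count_space UNIV)"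
        by (rule nn_integral_count_space_indicator) simp
      also have "\<dots> = (\<integral>\<^sup>+\<gamma>. K * e \<gamma> * indicator {\<gamma>. \<gamma> ` E = C} \<gamma> * indicator \<Gamma> \<gamma> \<partial>count_space UNIV)"
        by (intro nn_integral_cong) (auto split: split_indicator)
      also have "\<dots> = (\<integral>\<^sup>+\<gamma>. K * e \<gamma> * indicator {\<gamma>. \<gamma> ` E = C} \<gamma> \<partial>count_space \<Gamma>)"
        by (rule nn_integral_count_space_indicator[symmetric]) simp
      finally show ?thesis .
    qed
    finally show ?thesis by (simp add: \<tau>_def)
  qed
  have "emeasure (ext_measure m) (space (ext_measure m)) = (\<integral>\<^sup>+x. 1 \<partial>ext_measure m)" by simp
  also have "\<dots> = (\<integral>\<^sup>+C. \<integral>\<^sup>+x. ennreal (deriv_norm (rep C) x powr \<alpha>) \<partial>m \<partial>count_space translates)"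
    by (subst nn_integral_ext_measure[OF m]) auto
  also have "\<dots> \<le> (\<integral>\<^sup>+C. \<integral>\<^sup>+\<gamma>. K * e \<gamma> * indicator {\<gamma>. \<gamma> ` E = C} \<gamma> \<partial>count_space \<Gamma> \<partial>count_space translates)"
    using coset_bound by (intro nn_integral_mono) auto
  also have "\<dots> = (\<integral>\<^sup>+\<gamma>. \<integral>\<^sup>+C. K * e \<gamma> * indicator {\<gamma>. \<gamma> ` E = C} \<gamma> \<partial>count_space translates \<partial>count_space \<Gamma>)"
    by (rule nn_integral_count_space_nn_integral[OF countable_group]) simp
  also have "\<dots> = (\<integral>\<^sup>+\<gamma>. K * e \<gamma> \<partial>count_space \<Gamma>)"
  proof (rule nn_integral_cong)
    fix \<gamma> assume "\<gamma> \<in> space (count_space \<Gamma>)"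
    then have "\<gamma> ` E \<in> translates" by (auto simp: translates_def)
    have "(\<integral>\<^sup>+C. K * e \<gamma> * indicator {\<gamma>. \<gamma> ` E = C} \<gamma> \<partial>count_space translates)
        = (\<integral>\<^sup>+C. K * e \<gamma> * indicator {\<gamma> ` E} C \<partial>count_space translates)"
      by (intro nn_integral_cong) (auto split: split_indicator)
    also have "\<dots> = K * e \<gamma>"
      using \<open>\<gamma> ` E \<in> translates\<close> by (simp add: nn_integral_cmult_indicator)
    finally show "(\<integral>\<^sup>+C. K * e \<gamma> * indicator {\<gamma>. \<gamma> ` E = C} \<gamma> \<partial>count_space translates) = K * e \<gamma>" .
  qed
  also have "\<dots> = K * (\<integral>\<^sup>+\<gamma>. e \<gamma> \<partial>count_space \<Gamma>)" by (rule nn_integral_cmult) simp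
  also have "\<dots> < \<infinity>"
  proof -
    have "(\<integral>\<^sup>+\<gamma>. e \<gamma> \<partial>count_space \<Gamma>) < \<infinity>"
      unfolding e_def by (intro nn_integral_count_space_finite summable_exp) auto
    moreover have "K < \<infinity>"
      unfolding K_def by (simp add: ennreal_mult_eq_top_iff less_top[symmetric])
    ultimately show ?thesis by (simp add: ennreal_mult_less_top)
  qed
  finally show "emeasure (ext_measure m) (space (ext_measure m)) \<noteq> \<infinity>" by simp
qed

lemma ext_measure_conformal: "ext_measure m \<in> conformal_measures \<alpha> \<Gamma> Orb"
proof -
  have sets_ext: "sets (ext_measure m) = ext_sets m" and space_ext: "space (ext_measure m) = Orb"
    and sets_sp: "sets (ext_space m) = ext_sets m"
    by (rule sets_ext_measure[OF m] space_ext_measure[OF m] sets_ext_space[OF m])+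
  have bor: "Orb \<inter> U \<in> ext_sets m" if U: "U \<in> sets borel" for U
  proof -
    have "{x \<in> \<Lambda>. \<gamma> x \<in> Orb \<inter> U} \<in> sets m" if g: "\<gamma> \<in> \<Gamma>" for \<gamma>
    proof -
      have "{x \<in> \<Lambda>. \<gamma> x \<in> Orb \<inter> U} = \<gamma> -` U \<inter> space m"
        using Orb_image[OF g] Lam_Orb cm'(2) by auto
      then show ?thesis
        using measurable_sets[OF borel_measurable_conformal[OF m hyp_isometry_continuous[OF isoD[OF g]]] U] by simp
    qed
    then show ?thesis by (auto simp: ext_sets_def[OF m])
  qed
  have img: "\<gamma> ` B \<in> ext_sets m" if g: "\<gamma> \<in> \<Gamma>" and B: "B \<in> ext_sets m" for \<gamma> B
  proof -
    have BO: "B \<subseteq> Orb" "B \<subseteq> cball 0 1" using B Orb_cball by (auto simp: ext_sets_def[OF m] simp del: mem_cball)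
    have "{x \<in> \<Lambda>. \<delta> x \<in> \<gamma> ` B} \<in> sets m" if d: "\<delta> \<in> \<Gamma>" for \<delta>
    proof -
      have "{x \<in> \<Lambda>. \<delta> x \<in> \<gamma> ` B} = {x \<in> \<Lambda>. compose (cball 0 1) (ball_inv \<gamma>) \<delta> x \<in> B}"
      proof (intro Collect_cong conj_cong refl)
        fix x assume "x \<in> \<Lambda>"
        then have x: "x \<in> cball 0 1" using Lam_cball by blast
        show "\<delta> x \<in> \<gamma> ` B \<longleftrightarrow> compose (cball 0 1) (ball_inv \<gamma>) \<delta> x \<in> B"
          unfolding image_eq_vimage[OF g BO(2)] comp_apply[OF x] using cball[OF d x] by blast
      qed
      then show ?thesis using B comp_in[OF inv_in[OF g] d] by (auto simp: ext_sets_def[OF m])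
    qed
    moreover have "\<gamma> ` B \<subseteq> Orb" using BO Orb_image[OF g] by blast
    ultimately show ?thesis by (simp add: ext_sets_def[OF m])
  qed
  have int: "emeasure (ext_measure m) (\<gamma> ` B) = (\<integral>\<^sup>+x\<in>B. ennreal (deriv_norm \<gamma> x powr \<alpha>) \<partial>ext_measure m)"
    if g: "\<gamma> \<in> \<Gamma>" and B: "B \<in> ext_sets m" for \<gamma> B
  proof -
    have BO: "B \<subseteq> Orb" "B \<subseteq> cball 0 1" using B Orb_cball by (auto simp: ext_sets_def[OF m] simp del: mem_cball)
    define f1 :: "'a \<Rightarrow> ennreal" where "f1 = indicator (\<gamma> ` B)"
    define f2 :: "'a \<Rightarrow> ennreal" where "f2 y = ennreal (deriv_norm \<gamma> y powr \<alpha>) * indicator B y" for y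
    have f1: "f1 \<in> borel_measurable (ext_space m)"
      unfolding f1_def using img[OF g B] by (intro borel_measurable_indicator) (simp only: sets_sp)
    have dn: "(\<lambda>y. deriv_norm \<gamma> y) \<in> borel_measurable (ext_space m)"
    proof (rule measurableI)
      fix U :: "real set" assume U: "U \<in> sets borel"
      have "deriv_norm \<gamma> \<in> borel_measurable (restrict_space borel (cball 0 1))"
        by (intro borel_measurable_continuous_on_restrict continuous_on_deriv_norm[OF isoD[OF g]])
      from measurable_sets[OF this U] have "deriv_norm \<gamma> -` U \<inter> cball 0 1 \<in> sets borel"
        by (simp add: sets_restrict_space_iff space_restrict_space)
      from bor[OF this] have "deriv_norm \<gamma> -` U \<inter> Orb \<in> ext_sets m"
        using Orb_cball by (metis (no_types, lifting) Int_absorb2 Int_assoc Int_commute)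
      then show "deriv_norm \<gamma> -` U \<inter> space (ext_space m) \<in> sets (ext_space m)"
        by (simp only: sets_sp space_ext_space[OF m])
    qed simp
    have Bs: "B \<in> sets (ext_space m)" using B by (simp only: sets_sp)
    have f2: "f2 \<in> borel_measurable (ext_space m)"
      unfolding f2_def[abs_def] using dn Bs by measurable
    have bij: "bij_betw (\<lambda>C. \<gamma> ` C) translates translates"
      by (rule bij_betw_byWitness[where f' = "\<lambda>C. ball_inv \<gamma> ` C"])
        (use translates_image[OF g] translates_image[OF inv_in[OF g]] inv_image[OF g translates_cball] in auto)
    have step: "(\<integral>\<^sup>+x. f2 (rep C x) * ennreal (deriv_norm (rep C) x powr \<alpha>) \<partial>m)
        = (\<integral>\<^sup>+x. f1 (rep (\<gamma> ` C) x) * ennreal (deriv_norm (rep (\<gamma> ` C)) x powr \<alpha>) \<partial>m)"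
      if C: "C \<in> translates" for C
    proof -
      define \<delta> where "\<delta> = compose (cball 0 1) \<gamma> (rep C)"
      have d: "\<delta> \<in> \<Gamma>" unfolding \<delta>_def by (rule comp_in[OF g rep(1)[OF C]])
      have dE: "\<gamma> ` C = \<delta> ` E" unfolding \<delta>_def using comp_image[OF E_cball] rep(2)[OF C] by metis
      have "(\<integral>\<^sup>+x. f1 (rep (\<gamma> ` C) x) * ennreal (deriv_norm (rep (\<gamma> ` C)) x powr \<alpha>) \<partial>m)
          = (\<integral>\<^sup>+x. f1 (\<delta> x) * ennreal (deriv_norm \<delta> x powr \<alpha>) \<partial>m)"
        by (rule weight_translate[OF m d f1 dE])
      also have "\<dots> = (\<integral>\<^sup>+x. f2 (rep C x) * ennreal (deriv_norm (rep C) x powr \<alpha>) \<partial>m)"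
      proof (rule nn_integral_cong)
        fix x assume "x \<in> space m"
        then have x: "x \<in> cball 0 1" using cm'(2) Lam_cball by auto
        have rx: "rep C x \<in> cball 0 1" by (rule cball[OF rep(1)[OF C] x])
        have dx: "\<delta> x = \<gamma> (rep C x)" unfolding \<delta>_def by (rule comp_apply[OF x])
        have "\<gamma> (rep C x) \<in> \<gamma> ` B \<longleftrightarrow> rep C x \<in> B"
          using inj_on_image_mem_iff[OF inj_on[OF g] rx BO(2)] .
        then have i: "f1 (\<delta> x) = indicator B (rep C x)" unfolding f1_def dx by (simp split: split_indicator)
        have dd: "deriv_norm \<delta> x = deriv_norm \<gamma> (rep C x) * deriv_norm (rep C) x"
          unfolding \<delta>_def by (rule deriv_norm_comp[OF g rep(1)[OF C] x])
        have pos: "0 < deriv_norm \<gamma> (rep C x)" "0 < deriv_norm (rep C) x"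
          using deriv_norm_pos[OF isoD] g rep(1)[OF C] x rx by blast+
        show "f1 (\<delta> x) * ennreal (deriv_norm \<delta> x powr \<alpha>) = f2 (rep C x) * ennreal (deriv_norm (rep C) x powr \<alpha>)"
          unfolding i dd f2_def using pos by (simp add: powr_mult ennreal_mult mult_ac)
      qed
      finally show ?thesis by simp
    qed
    have "(\<integral>\<^sup>+x\<in>B. ennreal (deriv_norm \<gamma> x powr \<alpha>) \<partial>ext_measure m) = (\<integral>\<^sup>+x. f2 x \<partial>ext_measure m)"
      by (simp add: f2_def)
    also have "\<dots> = (\<integral>\<^sup>+C. \<integral>\<^sup>+x. f2 (rep C x) * ennreal (deriv_norm (rep C) x powr \<alpha>) \<partial>m \<partial>count_space translates)"
      by (rule nn_integral_ext_measure[OF m f2])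
    also have "\<dots> = (\<integral>\<^sup>+C. \<integral>\<^sup>+x. f1 (rep (\<gamma> ` C) x) * ennreal (deriv_norm (rep (\<gamma> ` C)) x powr \<alpha>) \<partial>m \<partial>count_space translates)"
      by (rule nn_integral_cong, rule step) simp
    also have "\<dots> = (\<integral>\<^sup>+C. \<integral>\<^sup>+x. f1 (rep C x) * ennreal (deriv_norm (rep C) x powr \<alpha>) \<partial>m \<partial>count_space translates)"
      by (rule nn_integral_bij_count_space[OF bij])
    also have "\<dots> = (\<integral>\<^sup>+x. f1 x \<partial>ext_measure m)" by (rule nn_integral_ext_measure[OF m f1, symmetric])
    also have "\<dots> = emeasure (ext_measure m) (\<gamma> ` B)"
      unfolding f1_def using img[OF g B] by (intro nn_integral_indicator) (simp only: sets_ext)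
    finally show ?thesis by simp
  qed
  have "sets (restrict_space borel Orb) \<subseteq> sets (ext_measure m)"
    unfolding sets_restrict_space sets_ext using bor by blast
  then show ?thesis
    unfolding conformal_measures_def using ext_measure_finite space_ext Orb_cball img int
    by (simp only: mem_Collect_eq sets_ext) blast
qed

lemma restrict_ext_measure: "restrict_space (ext_measure m) \<Lambda> = m"
proof -
  interpret S: hyp_group S by (rule stab_group)
  have sets_ext: "sets (ext_measure m) = ext_sets m" and space_ext: "space (ext_measure m) = Orb"
    by (rule sets_ext_measure[OF m] space_ext_measure[OF m])+
  have LO: "\<Lambda> \<inter> space (ext_measure m) = \<Lambda>" using Lam_Orb space_ext by auto
  have ext: "A \<in> ext_sets m" if A: "A \<in> sets m" for A
  proof -
    have AL: "A \<subseteq> \<Lambda>" using sets.sets_into_space[OF A] cm'(2) by simp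
    have "{x \<in> \<Lambda>. \<gamma> x \<in> A} \<in> sets m" if g: "\<gamma> \<in> \<Gamma>" for \<gamma>
    proof (cases "\<gamma> \<in> S")
      case True
      have "{x \<in> \<Lambda>. \<gamma> x \<in> A} = \<gamma> -` A \<inter> space m" using cm'(2) by auto
      have "(\<lambda>x. 0::ennreal) \<in> borel_measurable m" by simp
      from measurable_sets[OF S.nn_integral_conformal(1)[OF m True this] A] \<open>{x \<in> \<Lambda>. \<gamma> x \<in> A} = \<gamma> -` A \<inter> space m\<close>
      show ?thesis by simp
    next
      case False
      then have "{x \<in> \<Lambda>. \<gamma> x \<in> A} = {}" using end_limit_points_stab_iff[OF g] AL by blast
      then show ?thesis by (simp only: sets.empty_sets)
    qed
    then show ?thesis using AL Lam_Orb by (auto simp: ext_sets_def[OF m])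
  qed
  have L: "\<Lambda> \<in> sets (ext_measure m)" using ext[OF sets.top] cm'(2) by (simp only: sets_ext)
  show ?thesis
  proof (rule measure_eqI)
    show eq: "sets (restrict_space (ext_measure m) \<Lambda>) = sets m"
    proof (intro equalityI subsetI)
      fix A assume "A \<in> sets (restrict_space (ext_measure m) \<Lambda>)"
      then obtain B where B: "B \<in> ext_sets m" "A = \<Lambda> \<inter> B" by (auto simp: sets_restrict_space sets_ext)
      have "\<forall>\<gamma>\<in>\<Gamma>. {x \<in> \<Lambda>. \<gamma> x \<in> B} \<in> sets m" using B(1) unfolding ext_sets_def[OF m] by blast
      then have "{x \<in> \<Lambda>. (\<lambda>x\<in>cball 0 1. x) x \<in> B} \<in> sets m" using id_in by (rule bspec)
      moreover have "{x \<in> \<Lambda>. (\<lambda>x\<in>cball 0 1. x) x \<in> B} = A" using B(2) Lam_cball by auto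
      ultimately show "A \<in> sets m" by simp
    next
      fix A assume A: "A \<in> sets m"
      then have "A = \<Lambda> \<inter> A" using sets.sets_into_space[OF A] cm'(2) by auto
      then show "A \<in> sets (restrict_space (ext_measure m) \<Lambda>)"
        using ext[OF A] unfolding sets_restrict_space sets_ext by blast
    qed
    fix A assume "A \<in> sets (restrict_space (ext_measure m) \<Lambda>)"
    then have A: "A \<in> sets m" using eq by simp
    have AL: "A \<subseteq> \<Lambda>" using sets.sets_into_space[OF A] cm'(2) by simp
    define f :: "'a \<Rightarrow> ennreal" where "f = indicator A"
    have f: "f \<in> borel_measurable (ext_space m)"
      unfolding f_def using ext[OF A] by (intro borel_measurable_indicator) (simp only: sets_ext_space[OF m])
    define h where "h C = (\<integral>\<^sup>+x. f (rep C x) * ennreal (deriv_norm (rep C) x powr \<alpha>) \<partial>m)" for C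
    have hE: "h E = emeasure m A"
    proof -
      have idE: "E = (\<lambda>x\<in>cball 0 1. x) ` E" using E_cball by (force simp: subset_iff)
      have "h E = (\<integral>\<^sup>+x. f ((\<lambda>x\<in>cball 0 1. x) x) * ennreal (deriv_norm (\<lambda>x\<in>cball 0 1. x) x powr \<alpha>) \<partial>m)"
        unfolding h_def by (rule weight_translate[OF m id_in f idE])
      also have "\<dots> = (\<integral>\<^sup>+x. f x \<partial>m)"
      proof (rule nn_integral_cong)
        fix x assume "x \<in> space m"
        then have x: "x \<in> cball 0 1" using cm'(2) Lam_cball by auto
        show "f ((\<lambda>x\<in>cball 0 1. x) x) * ennreal (deriv_norm (\<lambda>x\<in>cball 0 1. x) x powr \<alpha>) = f x"
          unfolding deriv_norm_id[OF x] using x by simp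
      qed
      also have "\<dots> = emeasure m A" unfolding f_def by (rule nn_integral_indicator[OF A])
      finally show ?thesis .
    qed
    have h0: "h C = h E * indicator {E} C" if C: "C \<in> translates" for C
    proof (cases "C = E")
      case False
      have "f (rep C x) * ennreal (deriv_norm (rep C) x powr \<alpha>) = 0" if "x \<in> space m" for x
      proof -
        have "rep C x \<notin> A"
        proof
          assume "rep C x \<in> A"
          then have "rep C \<in> S"
            using end_limit_points_stab_iff[OF rep(1)[OF C]] that AL cm'(2) by blast
          then show False using rep(2)[OF C] False by (simp add: set_stab_def)
        qed
        then show ?thesis by (simp add: f_def)
      qed
      then have "h C = (\<integral>\<^sup>+x. 0 \<partial>m)" unfolding h_def by (intro nn_integral_cong)
      then show ?thesis using False by simp
    qed simp
    have "emeasure (restrict_space (ext_measure m) \<Lambda>) A = emeasure (ext_measure m) A"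
      by (rule emeasure_restrict_space) (use LO L AL in auto)
    also have "\<dots> = (\<integral>\<^sup>+x. f x \<partial>ext_measure m)"
      unfolding f_def by (rule nn_integral_indicator[symmetric]) (simp only: sets_ext ext[OF A])
    also have "\<dots> = (\<integral>\<^sup>+C. h C \<partial>count_space translates)"
      unfolding h_def by (rule nn_integral_ext_measure[OF m f])
    also have "\<dots> = (\<integral>\<^sup>+C. h E * indicator {E} C \<partial>count_space translates)"
      using h0 by (intro nn_integral_cong) simp
    also have "\<dots> = emeasure m A" using E_translates hE by (simp add: nn_integral_cmult_indicator)
    finally show "emeasure (restrict_space (ext_measure m) \<Lambda>) A = emeasure m A" .
  qed
qed

lemma ext_measure_unique:
  assumes nu: "\<nu> \<in> conformal_measures \<alpha> \<Gamma> Orb" and res: "restrict_space \<nu> \<Lambda> = m"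
  shows "\<nu> = ext_measure m"
proof -
  note cn = conformal_measuresD[OF nu]
  have sets_ext: "sets (ext_measure m) = ext_sets m" by (rule sets_ext_measure[OF m])
  have L: "\<Lambda> \<in> sets \<nu>" using cn(4)[OF end_limit_points_borel] Lam_Orb by (simp add: Int_absorb1)
  have sm: "A \<in> sets m \<longleftrightarrow> A \<in> sets \<nu> \<and> A \<subseteq> \<Lambda>" for A
    using sets_restrict_space_iff[of \<Lambda> \<nu> A] L cn(2) Lam_Orb unfolding res by (auto simp: Int_absorb2)
  define X where "X B C = rep C ` {x \<in> \<Lambda>. rep C x \<in> B}" for B C
  have XU: "B = (\<Union>C\<in>translates. X B C)" if "B \<subseteq> Orb" for B
  proof (intro equalityI subsetI)
    fix y assume y: "y \<in> B"
    then obtain \<gamma> z where g: "\<gamma> \<in> \<Gamma>" "z \<in> \<Lambda>" "y = \<gamma> z" using \<open>B \<subseteq> Orb\<close> by (auto simp: end_limit_orbit_def)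
    define C where "C = \<gamma> ` E"
    have C: "C \<in> translates" using g(1) by (auto simp: C_def translates_def)
    define \<delta> where "\<delta> = compose (cball 0 1) (ball_inv (rep C)) \<gamma>"
    have d: "\<delta> \<in> S" unfolding \<delta>_def using rep[OF C] g(1) by (intro same_translate) (auto simp: C_def)
    have zc: "z \<in> cball 0 1" using g(2) Lam_cball by blast
    have dz: "\<delta> z \<in> \<Lambda>" by (rule end_limit_points_stab[OF d g(2)])
    have "rep C (\<delta> z) = y"
      unfolding \<delta>_def comp_apply[OF zc] g(3) by (rule inv_right[OF rep(1)[OF C] cball[OF g(1) zc]])
    then show "y \<in> (\<Union>C\<in>translates. X B C)" using C dz y unfolding X_def by blast
  qed (auto simp: X_def)
  have Xm: "{x \<in> \<Lambda>. rep C x \<in> B} \<in> sets m" if "B \<in> ext_sets m" "C \<in> translates" for B C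
    using that rep(1) by (auto simp: ext_sets_def[OF m])
  have XS: "X B C \<in> sets \<nu>" if "B \<in> ext_sets m" "C \<in> translates" for B C
    unfolding X_def using cn(5)[OF rep(1)[OF that(2)]] Xm[OF that] sm by blast
  show ?thesis
  proof (rule measure_eqI)
    show eq: "sets \<nu> = sets (ext_measure m)"
    proof (intro equalityI subsetI)
      fix B assume B: "B \<in> sets \<nu>"
      have BO: "B \<subseteq> Orb" using sets.sets_into_space[OF B] cn(2) by simp
      then have Bc: "B \<subseteq> cball 0 1" using Orb_cball by blast
      have "{x \<in> \<Lambda>. \<gamma> x \<in> B} \<in> sets m" if g: "\<gamma> \<in> \<Gamma>" for \<gamma>
      proof -
        have "{x \<in> \<Lambda>. \<gamma> x \<in> B} = \<Lambda> \<inter> ball_inv \<gamma> ` B"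
          unfolding image_eq_vimage[OF inv_in[OF g] Bc] inv_inv[OF g] using Lam_cball by blast
        then show ?thesis using sm L cn(5)[OF inv_in[OF g] B] by auto
      qed
      then show "B \<in> sets (ext_measure m)" using BO by (simp add: sets_ext ext_sets_def[OF m])
    next
      fix B assume "B \<in> sets (ext_measure m)"
      then have B: "B \<in> ext_sets m" by (simp only: sets_ext)
      then have "B \<subseteq> Orb" by (simp add: ext_sets_def[OF m])
      have "(\<Union>C\<in>translates. X B C) \<in> sets \<nu>"
        using XS[OF B] by (intro sets.countable_UN'' countable_translates)
      then show "B \<in> sets \<nu>" by (simp only: XU[OF \<open>B \<subseteq> Orb\<close>, symmetric])
    qed
    fix B assume "B \<in> sets \<nu>"
    then have B: "B \<in> ext_sets m" using eq by (simp only: sets_ext)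
    then have BO: "B \<subseteq> Orb" by (simp add: ext_sets_def[OF m])
    define f :: "'a \<Rightarrow> ennreal" where "f = indicator B"
    have f: "f \<in> borel_measurable (ext_space m)"
      unfolding f_def using B by (intro borel_measurable_indicator) (simp only: sets_ext_space[OF m])
    have disj: "disjoint_family_on (X B) translates"
      unfolding disjoint_family_on_def
    proof (intro ballI impI)
      fix C D assume CD: "C \<in> translates" "D \<in> translates" "C \<noteq> D"
      show "X B C \<inter> X B D = {}"
      proof (rule ccontr)
        assume "X B C \<inter> X B D \<noteq> {}"
        then obtain x y where "x \<in> \<Lambda>" "y \<in> \<Lambda>" "rep C x = rep D y" by (auto simp: X_def)
        then have "rep C ` E = rep D ` E" by (rule translates_eqI[OF rep(1)[OF CD(1)] rep(1)[OF CD(2)]])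
        then show False using rep(2) CD by simp
      qed
    qed
    have "emeasure \<nu> B = emeasure \<nu> (\<Union>C\<in>translates. X B C)" by (simp only: XU[OF BO, symmetric])
    also have "\<dots> = (\<integral>\<^sup>+C. emeasure \<nu> (X B C) \<partial>count_space translates)"
      by (rule emeasure_UN_countable[OF XS[OF B] countable_translates disj])
    also have "\<dots> = (\<integral>\<^sup>+C. \<integral>\<^sup>+x. f (rep C x) * ennreal (deriv_norm (rep C) x powr \<alpha>) \<partial>m \<partial>count_space translates)"
    proof (rule nn_integral_cong)
      fix C assume "C \<in> space (count_space translates)"
      then have C: "C \<in> translates" by simp
      define Y where "Y = {x \<in> \<Lambda>. rep C x \<in> B}"
      have Y: "Y \<in> sets \<nu>" using Xm[OF B C] sm by (simp add: Y_def)
      have "emeasure \<nu> (X B C) = (\<integral>\<^sup>+x\<in>Y. ennreal (deriv_norm (rep C) x powr \<alpha>) \<partial>\<nu>)"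
        unfolding X_def Y_def[symmetric] by (rule cn(6)[OF rep(1)[OF C] Y])
      also have "\<dots> = (\<integral>\<^sup>+x. f (rep C x) * ennreal (deriv_norm (rep C) x powr \<alpha>) * indicator \<Lambda> x \<partial>\<nu>)"
        by (intro nn_integral_cong) (auto simp: Y_def f_def split: split_indicator)
      also have "\<dots> = (\<integral>\<^sup>+x. f (rep C x) * ennreal (deriv_norm (rep C) x powr \<alpha>) \<partial>restrict_space \<nu> \<Lambda>)"
        by (rule nn_integral_restrict_space[symmetric]) (use L in auto)
      finally show "emeasure \<nu> (X B C) = (\<integral>\<^sup>+x. f (rep C x) * ennreal (deriv_norm (rep C) x powr \<alpha>) \<partial>m)"
        unfolding res .
    qed
    also have "\<dots> = (\<integral>\<^sup>+x. f x \<partial>ext_measure m)" by (rule nn_integral_ext_measure[OF m f, symmetric])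
    also have "\<dots> = emeasure (ext_measure m) B"
      unfolding f_def by (rule nn_integral_indicator) (simp only: sets_ext B)
    finally show "emeasure \<nu> B = emeasure (ext_measure m) B" .
  qed
qed

lemma conformal_extension_eq: "conformal_extension \<alpha> \<Gamma> E m = ext_measure m"
  unfolding conformal_extension_def
  by (rule the_equality, rule conjI[OF ext_measure_conformal restrict_ext_measure])
    (rule ext_measure_unique, erule conjunct1, erule conjunct2)

end

lemma conformal_extension:
  assumes "m \<in> conformal_measures \<alpha> S \<Lambda>"
  shows "conformal_extension \<alpha> \<Gamma> E m \<in> conformal_measures \<alpha> \<Gamma> Orb"
    and "restrict_space (conformal_extension \<alpha> \<Gamma> E m) \<Lambda> = m"
  unfolding conformal_extension_eq[OF assms]
  by (rule ext_measure_conformal[OF assms], rule restrict_ext_measure[OF assms])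

lemma conformal_extension_unique:
  assumes "\<nu> \<in> conformal_measures \<alpha> \<Gamma> Orb" "restrict_space \<nu> \<Lambda> \<in> conformal_measures \<alpha> S \<Lambda>"
  shows "conformal_extension \<alpha> \<Gamma> E (restrict_space \<nu> \<Lambda>) = \<nu>"
  unfolding conformal_extension_eq[OF assms(2)] by (rule ext_measure_unique[OF assms(2,1) refl, symmetric])

end

section \<open>Weak limits of discrete measures on the ball\<close>

lemma binary_expansion:
  fixes x :: real
  assumes "0 \<le> x" "x < 1"
  obtains b :: "nat \<Rightarrow> nat" where "\<And>k. b k = 0 \<or> b k = 1" "(\<lambda>k. real (b k) / 2 ^ Suc k) sums x"
proof -
  define b where "b k = nat (\<lfloor>2 ^ Suc k * x\<rfloor> - 2 * \<lfloor>2 ^ k * x\<rfloor>)" for k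
  have b: "0 \<le> \<lfloor>2 ^ Suc k * x\<rfloor> - 2 * \<lfloor>2 ^ k * x\<rfloor>" "\<lfloor>2 ^ Suc k * x\<rfloor> - 2 * \<lfloor>2 ^ k * x\<rfloor> \<le> 1" for k
  proof -
    have "2 ^ Suc k * x = 2 * (2 ^ k * x)" by simp
    then show "0 \<le> \<lfloor>2 ^ Suc k * x\<rfloor> - 2 * \<lfloor>2 ^ k * x\<rfloor>" "\<lfloor>2 ^ Suc k * x\<rfloor> - 2 * \<lfloor>2 ^ k * x\<rfloor> \<le> 1"
      by linarith+
  qed
  have "(\<Sum>k<K. real (b k) / 2 ^ Suc k) = of_int \<lfloor>2 ^ K * x\<rfloor> / 2 ^ K" for K
  proof (induction K)
    case 0
    have "\<lfloor>x\<rfloor> = 0" using assms by linarith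
    then show ?case by simp
  next
    case (Suc K)
    have "real (b K) = of_int \<lfloor>2 ^ Suc K * x\<rfloor> - 2 * of_int \<lfloor>2 ^ K * x\<rfloor>"
      using b(1)[of K] by (simp add: b_def)
    then show ?case unfolding sum.lessThan_Suc Suc.IH by (simp add: divide_simps)
  qed
  moreover have "(\<lambda>K. of_int \<lfloor>2 ^ K * x\<rfloor> / 2 ^ K) \<longlonglongrightarrow> x"
  proof (rule tendsto_sandwich[of "\<lambda>K. x - (1 / 2) ^ K" _ _ "\<lambda>K. x"])
    have "x - (1 / 2) ^ K \<le> of_int \<lfloor>2 ^ K * x\<rfloor> / 2 ^ K" for K
    proof -
      have "2 ^ K * x - 1 \<le> of_int \<lfloor>2 ^ K * x\<rfloor>" by linarith
      then have "(2 ^ K * x - 1) / 2 ^ K \<le> of_int \<lfloor>2 ^ K * x\<rfloor> / 2 ^ K" by (rule divide_right_mono) simp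
      then show ?thesis by (simp add: diff_divide_distrib power_divide)
    qed
    then show "\<forall>\<^sub>F K in sequentially. x - (1 / 2) ^ K \<le> of_int \<lfloor>2 ^ K * x\<rfloor> / 2 ^ K" by simp
    have "of_int \<lfloor>2 ^ K * x\<rfloor> / 2 ^ K \<le> x" for K
    proof -
      have "of_int \<lfloor>2 ^ K * x\<rfloor> \<le> 2 ^ K * x" by linarith
      then show ?thesis by (simp add: field_simps)
    qed
    then show "\<forall>\<^sub>F K in sequentially. of_int \<lfloor>2 ^ K * x\<rfloor> / 2 ^ K \<le> x" by simp
    have "(\<lambda>K. x - (1 / 2) ^ K) \<longlonglongrightarrow> x - 0" by (intro tendsto_intros) simp
    then show "(\<lambda>K. x - (1 / 2) ^ K) \<longlonglongrightarrow> x" by simp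
  qed simp
  ultimately have "(\<lambda>k. real (b k) / 2 ^ Suc k) sums x" by (simp add: sums_def)
  moreover have "b k = 0 \<or> b k = 1" for k using b[of k] unfolding b_def by linarith
  ultimately show thesis using that by blast
qed

definition schoenberg :: "real \<Rightarrow> real" where
  "schoenberg t = max 0 (min 1 (1 / 2 - cos (pi * t)))"

lemma schoenberg_bounds: "0 \<le> schoenberg t" "schoenberg t \<le> 1"
  by (auto simp: schoenberg_def)

lemma continuous_on_schoenberg: "continuous_on A schoenberg"
  unfolding schoenberg_def by (intro continuous_intros)

lemma ternary_sums: "(\<lambda>m. 2 / 3 ^ Suc m :: real) sums 1"
proof -
  have "(\<lambda>m. (2 / 3) * (1 / 3) ^ m :: real) sums ((2 / 3) * (1 / (1 - 1 / 3)))"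
    by (intro sums_mult geometric_sums) simp
  then show ?thesis by (simp add: power_divide)
qed

lemma schoenberg_digits:
  assumes c: "\<And>k::nat. c k = 0 \<or> c k = (1::nat)"
  shows "schoenberg (3 ^ M * (\<Sum>m. 2 * real (c m) / 3 ^ Suc m)) = real (c M)"
proof -
  note g = ternary_sums
  have bound: "2 * real (c (m + i)) / 3 ^ Suc m \<le> 2 / 3 ^ Suc m" "0 \<le> 2 * real (c (m + i)) / 3 ^ Suc m" for m i
    using c[of "m + i"] by (auto simp: divide_simps)
  have summ: "summable (\<lambda>m. 2 * real (c (m + i)) / 3 ^ Suc m)" for i
    by (rule summable_comparison_test'[OF sums_summable[OF g], of 0]) (use bound in auto)
  define \<tau> where "\<tau> = (\<Sum>m. 2 * real (c (m + M)) / 3 ^ Suc m)"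
  have "(\<Sum>m. 2 * real (c m) / 3 ^ Suc m)
      = (\<Sum>m. 2 * real (c (m + M)) / 3 ^ Suc (m + M)) + (\<Sum>m<M. 2 * real (c m) / 3 ^ Suc m)"
    using suminf_split_initial_segment[of "\<lambda>m. 2 * real (c m) / 3 ^ Suc m" M] summ[of 0] by simp
  moreover have "(\<Sum>m. 2 * real (c (m + M)) / 3 ^ Suc (m + M)) = \<tau> / 3 ^ M"
    unfolding \<tau>_def by (subst suminf_divide[OF summ, symmetric]) (simp add: power_add mult_ac)
  ultimately have t: "3 ^ M * (\<Sum>m. 2 * real (c m) / 3 ^ Suc m) = \<tau> + 3 ^ M * (\<Sum>m<M. 2 * real (c m) / 3 ^ Suc m)"
    by (simp add: algebra_simps)
  have "3 ^ M * (\<Sum>m<M. 2 * real (c m) / 3 ^ Suc m) = 2 * real (\<Sum>m<M. c m * 3 ^ (M - Suc m))"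
  proof -
    have "3 ^ M * (2 * real (c m) / 3 ^ Suc m) = 2 * real (c m * 3 ^ (M - Suc m))" if "m < M" for m
    proof -
      have "(3::real) ^ M = 3 ^ (M - Suc m) * 3 ^ Suc m" using that by (simp flip: power_add power_Suc)
      then show ?thesis by simp
    qed
    then show ?thesis unfolding sum_distrib_left of_nat_sum by (intro sum.cong) auto
  qed
  moreover have "cos (pi * (\<tau> + 2 * real n)) = cos (pi * \<tau>)" for n
  proof -
    have "pi * (\<tau> + 2 * real n) = pi * \<tau> + 2 * real n * pi" by (simp add: algebra_simps)
    then show ?thesis by (simp only: cos_add cos_2npi sin_2npi mult_1_right mult_zero_right diff_0_right)
  qed
  ultimately have s: "schoenberg (3 ^ M * (\<Sum>m. 2 * real (c m) / 3 ^ Suc m)) = schoenberg \<tau>"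
    unfolding t schoenberg_def by (simp only:)
  have \<tau>: "0 \<le> \<tau>" "\<tau> \<le> 1"
  proof -
    show "0 \<le> \<tau>" unfolding \<tau>_def using bound by (intro suminf_nonneg summ) auto
    have "\<tau> \<le> (\<Sum>m. 2 / 3 ^ Suc m)" unfolding \<tau>_def by (intro suminf_le summ sums_summable[OF g] bound)
    then show "\<tau> \<le> 1" using sums_unique[OF g] by simp
  qed
  have head: "\<tau> = 2 * real (c M) / 3 + (\<Sum>m. 2 * real (c (m + Suc M)) / 3 ^ Suc m) / 3"
  proof -
    have "\<tau> = (\<Sum>m. 2 * real (c (Suc m + M)) / 3 ^ Suc (Suc m)) + 2 * real (c M) / 3"
      unfolding \<tau>_def using suminf_split_head[OF summ[of M]] by simp
    moreover have "(\<Sum>m. 2 * real (c (Suc m + M)) / 3 ^ Suc (Suc m)) = (\<Sum>m. 2 * real (c (m + Suc M)) / 3 ^ Suc m) / 3"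
      by (subst suminf_divide[OF summ, symmetric]) (simp add: mult_ac)
    ultimately show ?thesis by simp
  qed
  have tail: "0 \<le> (\<Sum>m. 2 * real (c (m + Suc M)) / 3 ^ Suc m)" "(\<Sum>m. 2 * real (c (m + Suc M)) / 3 ^ Suc m) \<le> 1"
  proof -
    show "0 \<le> (\<Sum>m. 2 * real (c (m + Suc M)) / 3 ^ Suc m)" using bound by (intro suminf_nonneg summ) auto
    have "(\<Sum>m. 2 * real (c (m + Suc M)) / 3 ^ Suc m) \<le> (\<Sum>m. 2 / 3 ^ Suc m)"
      by (intro suminf_le summ sums_summable[OF g] bound)
    then show "(\<Sum>m. 2 * real (c (m + Suc M)) / 3 ^ Suc m) \<le> 1" using sums_unique[OF g] by simp
  qed
  show ?thesis
  proof (cases "c M = 0")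
    case True
    then have "\<tau> \<le> 1 / 3" using head tail by simp
    then have "cos (pi * (1 / 3)) \<le> cos (pi * \<tau>)"
      using \<tau> by (intro cos_monotone_0_pi_le) (auto simp: mult_le_cancel_left)
    then show ?thesis unfolding s using True cos_60 by (simp add: schoenberg_def)
  next
    case False
    then have cM: "c M = 1" using c[of M] by simp
    then have "2 / 3 \<le> \<tau>" using head tail by simp
    then have "cos (pi * \<tau>) \<le> cos (pi * (2 / 3))"
      using \<tau> by (intro cos_monotone_0_pi_le) auto
    moreover have "cos (pi * (2 / 3)) = - 1 / 2"
      using cos_pi_minus[of "pi / 3"] cos_60 by (simp add: field_simps)
    ultimately show ?thesis unfolding s using cM by (simp add: schoenberg_def)
  qed
qed

text \<open>Schoenberg's space-filling curve: the binary digits of the coordinates are interleaved into the ternary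
  digits of the parameter.\<close>

lemma continuous_surjection_cball:
  obtains g :: "real \<Rightarrow> 'a::euclidean_space"
  where "continuous_on UNIV g" "\<And>t. g t \<in> cball 0 1" "\<And>x. x \<in> cball 0 1 \<Longrightarrow> \<exists>t\<in>{0..1}. g t = x"
proof -
  define n where "n = DIM('a)"
  have n: "n > 0" by (simp add: n_def)
  obtain ix :: "'a \<Rightarrow> nat" where ix: "bij_betw ix Basis {..<n}"
    using ex_bij_betw_finite_nat[of "Basis :: 'a set"] finite_Basis unfolding n_def lessThan_atLeast0 by blast
  define h where "h j t = (\<Sum>k. schoenberg (3 ^ (n * k + j) * t) / 2 ^ Suc k)" for j t
  have hc: "continuous_on UNIV (h j)" for j
  proof -
    have "uniform_limit UNIV (\<lambda>K t. \<Sum>k<K. schoenberg (3 ^ (n * k + j) * t) / 2 ^ Suc k) (h j) sequentially"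
      unfolding h_def
    proof (rule Weierstrass_m_test)
      show "norm (schoenberg (3 ^ (n * k + j) * t) / 2 ^ Suc k) \<le> (1 / 2) ^ k / 2" for k t
      proof -
        have "schoenberg (3 ^ (n * k + j) * t) / 2 ^ Suc k \<le> 1 / 2 ^ Suc k"
          by (intro divide_right_mono schoenberg_bounds) simp
        moreover have "0 \<le> schoenberg (3 ^ (n * k + j) * t) / 2 ^ Suc k" using schoenberg_bounds by simp
        ultimately show ?thesis by (simp add: power_divide)
      qed
      show "summable (\<lambda>k. (1 / 2 :: real) ^ k / 2)" by (intro summable_divide summable_geometric) simp
    qed
    moreover have "continuous_on UNIV (\<lambda>t. \<Sum>k<K. schoenberg (3 ^ (n * k + j) * t) / 2 ^ Suc k)" for K
      by (intro continuous_intros continuous_on_compose2[OF continuous_on_schoenberg[of UNIV]]) auto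
    ultimately show ?thesis by (intro uniform_limit_theorem) auto
  qed
  define g0 :: "real \<Rightarrow> 'a" where "g0 t = (\<Sum>b\<in>Basis. (4 * h (ix b) t - 2) *\<^sub>R b)" for t
  have g0c: "continuous_on UNIV g0" unfolding g0_def by (intro continuous_intros hc)
  have surj: "\<exists>t\<in>{0..1}. g0 t = x" if x: "x \<in> cball 0 1" for x :: 'a
  proof -
    have co: "0 \<le> (x \<bullet> b + 2) / 4" "(x \<bullet> b + 2) / 4 < 1" if "b \<in> Basis" for b
      using Basis_le_norm[OF that, of x] x by auto
    have "\<forall>b\<in>Basis. \<exists>c::nat \<Rightarrow> nat. (\<forall>k. c k = 0 \<or> c k = 1) \<and> (\<lambda>k. real (c k) / 2 ^ Suc k) sums ((x \<bullet> b + 2) / 4)"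
    proof
      fix b :: 'a assume "b \<in> Basis"
      from binary_expansion[OF co[OF this]]
      show "\<exists>c::nat \<Rightarrow> nat. (\<forall>k. c k = 0 \<or> c k = 1) \<and> (\<lambda>k. real (c k) / 2 ^ Suc k) sums ((x \<bullet> b + 2) / 4)"
        by metis
    qed
    then obtain c where c: "\<And>b k. b \<in> Basis \<Longrightarrow> c b k = 0 \<or> c b k = (1::nat)"
      "\<And>b. b \<in> Basis \<Longrightarrow> (\<lambda>k. real (c b k) / 2 ^ Suc k) sums ((x \<bullet> b + 2) / 4)"
      by metis
    define e where "e = inv_into Basis ix"
    have e: "e (ix b) = b" if "b \<in> Basis" for b
      unfolding e_def using ix that by (simp add: bij_betw_def)
    have eB: "e j \<in> Basis" if "j < n" for j
      unfolding e_def using ix that by (intro inv_into_into) (auto simp: bij_betw_def)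
    have ixn: "ix b < n" if "b \<in> Basis" for b using ix that by (auto simp: bij_betw_def)
    define d where "d m = c (e (m mod n)) (m div n)" for m
    have d: "d m = 0 \<or> d m = 1" for m unfolding d_def using c(1) eB n by simp
    define t where "t = (\<Sum>m. 2 * real (d m) / 3 ^ Suc m)"
    have "h (ix b) t = (x \<bullet> b + 2) / 4" if b: "b \<in> Basis" for b
    proof -
      have "schoenberg (3 ^ (n * k + ix b) * t) = real (c b k)" for k
        unfolding t_def schoenberg_digits[of d, OF d] using ixn[OF b] e[OF b] by (simp add: d_def)
      then show ?thesis unfolding h_def using sums_unique[OF c(2)[OF b]] by simp
    qed
    then have "4 * h (ix b) t - 2 = x \<bullet> b" if "b \<in> Basis" for b using that by (simp add: field_simps)
    then have "g0 t = (\<Sum>b\<in>Basis. (x \<bullet> b) *\<^sub>R b)" unfolding g0_def by (intro sum.cong) simp_all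
    then have "g0 t = x" by (simp add: euclidean_representation)
    moreover have "t \<in> {0..1}"
    proof -
      note s = ternary_sums
      have b: "2 * real (d m) / 3 ^ Suc m \<le> 2 / 3 ^ Suc m" "0 \<le> 2 * real (d m) / 3 ^ Suc m" for m
        using d[of m] by (auto simp: divide_simps)
      have sd: "summable (\<lambda>m. 2 * real (d m) / 3 ^ Suc m)"
        by (rule summable_comparison_test'[OF sums_summable[OF s], of 0]) (use b in auto)
      have "t \<le> (\<Sum>m. 2 / 3 ^ Suc m)" unfolding t_def by (intro suminf_le sd sums_summable[OF s] b)
      moreover have "0 \<le> t" unfolding t_def by (intro suminf_nonneg sd b)
      ultimately show ?thesis using sums_unique[OF s] by simp
    qed
    ultimately show ?thesis by blast
  qed
  have ne: "cball (0::'a) 1 \<noteq> {}" by simp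
  show thesis
  proof (rule that[of "\<lambda>t. closest_point (cball 0 1) (g0 t)"])
    show "continuous_on UNIV (\<lambda>t. closest_point (cball 0 1) (g0 t))"
      by (rule continuous_on_compose2[OF continuous_on_closest_point[OF convex_cball closed_cball ne] g0c]) auto
    show "closest_point (cball 0 1) (g0 t) \<in> cball 0 1" for t by (rule closest_point_in_set[OF closed_cball ne])
    show "\<exists>t\<in>{0..1}. closest_point (cball 0 1) (g0 t) = x" if "x \<in> cball 0 1" for x
      using surj[OF that] closest_point_self[OF that] by metis
  qed
qed

text \<open>Probabilities on the closed ball are lifted to the line along a space-filling curve. For discrete
  probabilities no measurability of the lifting is needed.\<close>

lemma pmf_weak_limit:
  fixes p :: "nat \<Rightarrow> 'a::euclidean_space pmf"
  assumes p: "\<And>k. set_pmf (p k) \<subseteq> cball 0 1"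
  obtains r :: "nat \<Rightarrow> nat" and m where "strict_mono r" "prob_space m" "sets m = sets (restrict_space borel (cball 0 1))"
    "\<And>f. continuous_on (cball 0 1) f \<Longrightarrow>
      (\<lambda>k. measure_pmf.expectation (p (r k)) f) \<longlonglongrightarrow> (\<integral>x. (f x :: real) \<partial>m)"
proof -
  obtain g :: "real \<Rightarrow> 'a" where g: "continuous_on UNIV g" "\<And>t. g t \<in> cball 0 1"
    "\<And>x. x \<in> cball 0 1 \<Longrightarrow> \<exists>t\<in>{0..1}. g t = x"
    using continuous_surjection_cball by blast
  define s where "s x = (SOME t. t \<in> {0..1} \<and> g t = x)" for x
  have s: "s x \<in> {0..1}" "g (s x) = x" if "x \<in> cball 0 1" for x
  proof -
    have "\<exists>t. t \<in> {0..1} \<and> g t = x" using g(3)[OF that] by blast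
    from someI_ex[OF this] show "s x \<in> {0..1}" "g (s x) = x" unfolding s_def by blast+
  qed
  define \<mu> where "\<mu> k = distr (measure_pmf (p k)) borel s" for k
  have rd: "real_distribution (\<mu> k)" for k
    unfolding \<mu>_def real_distribution_def real_distribution_axioms_def
    by (auto intro!: measure_pmf.prob_space_distr)
  have "tight \<mu>"
    unfolding tight_def
  proof (intro conjI allI impI rd)
    fix \<epsilon> :: real assume e: "0 < \<epsilon>"
    have "measure (\<mu> k) {-1<..1} = 1" for k
    proof -
      have "measure (\<mu> k) {-1<..1} = measure (measure_pmf (p k)) (s -` {-1<..1})"
        unfolding \<mu>_def by (subst measure_distr) auto
      also have "\<dots> = 1"
      proof -
        have "set_pmf (p k) \<subseteq> s -` {-1<..1}" using s(1) p[of k] by fastforce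
        then show ?thesis by (intro measure_pmf.prob_eq_1[THEN iffD2]) (auto simp: AE_measure_pmf_iff)
      qed
      finally show ?thesis .
    qed
    then show "\<exists>a b. a < b \<and> (\<forall>n. 1 - \<epsilon> < measure (\<mu> n) {a<..b})"
      using e by (intro exI[of _ "-1"] exI[of _ 1]) auto
  qed
  from tight_imp_convergent_subsubsequence[OF this strict_mono_id]
  obtain r M where r: "strict_mono (r :: nat \<Rightarrow> nat)" and M: "real_distribution M" and conv: "weak_conv_m (\<mu> \<circ> id \<circ> r) M"
    by blast
  interpret M: real_distribution M by (rule M)
  have gm: "g \<in> measurable M (restrict_space borel (cball 0 1))"
    using borel_measurable_continuous_onI[OF g(1)] g(2) by (intro measurable_restrict_space2) (auto simp del: mem_cball)
  define m where "m = distr M (restrict_space borel (cball 0 1)) g"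
  show thesis
  proof (rule that[OF r, of m])
    show "prob_space m" unfolding m_def by (rule M.prob_space_distr[OF gm])
    show "sets m = sets (restrict_space borel (cball 0 1))" by (simp add: m_def)
    fix f :: "'a \<Rightarrow> real" assume f: "continuous_on (cball 0 1) f"
    have fg: "continuous_on UNIV (\<lambda>t. f (g t))"
      by (rule continuous_on_compose2[OF f g(1)]) (use g(2) in blast)
    have "bounded (f ` cball 0 1)" by (intro compact_imp_bounded compact_continuous_image f compact_cball)
    then obtain B where B: "\<And>x. x \<in> cball 0 1 \<Longrightarrow> norm (f x) \<le> B" unfolding bounded_iff by blast
    have "(\<lambda>k. \<integral>t. f (g t) \<partial>(\<mu> \<circ> id \<circ> r) k) \<longlonglongrightarrow> (\<integral>t. f (g t) \<partial>M)"
    proof (rule weak_conv_imp_integral_bdd_continuous_conv[OF _ M conv])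
      show "real_distribution ((\<mu> \<circ> id \<circ> r) k)" for k by (simp add: rd)
      show "isCont (\<lambda>t. f (g t)) t" for t using fg by (simp add: continuous_on_eq_continuous_at)
      show "norm (f (g t)) \<le> B" for t by (rule B[OF g(2)])
    qed
    moreover have "(\<integral>t. f (g t) \<partial>(\<mu> \<circ> id \<circ> r) k) = measure_pmf.expectation (p (r k)) f" for k
    proof -
      have "(\<integral>t. f (g t) \<partial>(\<mu> \<circ> id \<circ> r) k) = measure_pmf.expectation (p (r k)) (\<lambda>x. f (g (s x)))"
        unfolding \<mu>_def comp_def id_def using borel_measurable_continuous_onI[OF fg] by (subst integral_distr) auto
      also have "\<dots> = measure_pmf.expectation (p (r k)) f"
      proof (rule integral_cong_AE)
        show "AE x in measure_pmf (p (r k)). f (g (s x)) = f x"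
          using s(2) p[of "r k"] by (auto simp: AE_measure_pmf_iff simp del: mem_cball)
      qed auto
      finally show ?thesis .
    qed
    moreover have "(\<integral>t. f (g t) \<partial>M) = (\<integral>x. f x \<partial>m)"
      unfolding m_def using gm borel_measurable_continuous_on_restrict[OF f] by (subst integral_distr) auto
    ultimately show "(\<lambda>k. measure_pmf.expectation (p (r k)) f) \<longlonglongrightarrow> (\<integral>x. f x \<partial>m)" by simp
  qed
qed

definition near :: "'a::euclidean_space set \<Rightarrow> nat \<Rightarrow> 'a \<Rightarrow> real" where
  "near C j x = max 0 (1 - real j * infdist x C)"

lemma near_bounds: "0 \<le> near C j x" "near C j x \<le> 1"
  using infdist_nonneg[of x C] by (auto simp: near_def)

lemma continuous_on_near: "continuous_on A (near C j)"
  unfolding near_def by (intro continuous_intros)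

lemma near_in: "x \<in> C \<Longrightarrow> near C j x = 1"
  by (simp add: near_def)

lemma near_tendsto:
  assumes "closed C" "C \<noteq> {}"
  shows "(\<lambda>j. near C j x) \<longlonglongrightarrow> indicator C x"
proof (cases "x \<in> C")
  case False
  then have pos: "infdist x C > 0"
    using in_closed_iff_infdist_zero[OF assms] infdist_nonneg[of x C] by (metis order_less_le)
  obtain J where J: "1 / infdist x C < real J" using reals_Archimedean2 by blast
  have "near C j x = 0" if "j \<ge> J" for j
  proof -
    have "1 / infdist x C < real j" using J that by (meson of_nat_le_iff order_less_le_trans)
    then show ?thesis using pos by (simp add: near_def pos_divide_less_eq)
  qed
  then have "\<forall>\<^sub>F j in sequentially. near C j x = indicator C x"
    using False by (auto simp: eventually_sequentially)
  then show ?thesis by (rule tendsto_eventually)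
qed (simp add: near_in)

lemma integral_near_tendsto:
  assumes "finite_measure m" "sets m = sets (restrict_space borel (cball 0 1))" "closed C" "C \<noteq> {}"
  shows "(\<lambda>j. \<integral>x. near C j x \<partial>m) \<longlonglongrightarrow> measure m (C \<inter> cball 0 1)"
proof -
  interpret finite_measure m by (rule assms(1))
  have sp: "space m = cball 0 1" using sets_eq_imp_space_eq[OF assms(2)] by (simp add: space_restrict_space)
  have C: "C \<inter> cball 0 1 \<in> sets m" unfolding assms(2) sets_restrict_space using borel_closed[OF assms(3)] by blast
  have near: "near C j \<in> borel_measurable m" for j
    using borel_measurable_continuous_on_restrict[OF continuous_on_near] measurable_cong_sets[OF assms(2) refl] by blast
  have ind: "(indicator C :: 'a \<Rightarrow> real) \<in> borel_measurable m"
    using C by (simp only: borel_measurable_indicator_iff sp)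
  have "(\<lambda>j. \<integral>x. near C j x \<partial>m) \<longlonglongrightarrow> (\<integral>x. indicator C x \<partial>m)"
  proof (rule integral_dominated_convergence[where w = "\<lambda>_. 1"])
    show "AE x in m. (\<lambda>j. near C j x) \<longlonglongrightarrow> indicator C x" using near_tendsto[OF assms(3,4)] by simp
    show "AE x in m. norm (near C j x) \<le> 1" for j using near_bounds[of C j] by simp
  qed (use near ind in auto)
  also have "(\<integral>x. indicator C x \<partial>m) = measure m (C \<inter> cball 0 1)" using C by (simp add: sp)
  finally show ?thesis .
qed

lemma closed_measure_ge_limit:
  fixes p :: "nat \<Rightarrow> 'a::euclidean_space pmf"
  assumes m: "finite_measure m" "sets m = sets (restrict_space borel (cball 0 1))"
    and lim: "\<And>f. continuous_on (cball 0 1) f \<Longrightarrow> (\<lambda>k. measure_pmf.expectation (p k) f) \<longlonglongrightarrow> (\<integral>x. (f x :: real) \<partial>m)"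
    and C: "closed C" and ge: "\<forall>\<^sub>F k in sequentially. c \<le> measure_pmf.prob (p k) C"
  shows "c \<le> measure m (C \<inter> cball 0 1)"
proof (cases "C = {}")
  case True
  then show ?thesis using eventually_happens'[OF sequentially_bot ge] by simp
next
  case False
  have "c \<le> (\<integral>x. near C j x \<partial>m)" for j
  proof (rule tendsto_lowerbound[OF lim[OF continuous_on_near] _ sequentially_bot])
    show "\<forall>\<^sub>F k in sequentially. c \<le> measure_pmf.expectation (p k) (near C j)"
      using ge
    proof eventually_elim
      case (elim k)
      have "measure_pmf.prob (p k) C = measure_pmf.expectation (p k) (indicator C)" by simp
      also have "\<dots> \<le> measure_pmf.expectation (p k) (near C j)"
        using near_bounds[of C j] near_in[of _ C j]
        by (intro integral_mono measure_pmf.integrable_const_bound[where B = 1])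
          (auto split: split_indicator)
      finally show ?case using elim by simp
    qed
  qed
  then show ?thesis by (intro tendsto_lowerbound[OF integral_near_tendsto[OF m C False]]) auto
qed

lemma measure_eqI_continuous:
  fixes M N :: "'a::euclidean_space measure"
  assumes M: "finite_measure M" "sets M = sets (restrict_space borel (cball 0 1))"
    and N: "finite_measure N" "sets N = sets (restrict_space borel (cball 0 1))"
    and eq: "\<And>f. continuous_on (cball 0 1) f \<Longrightarrow> (\<integral>x. (f x :: real) \<partial>M) = (\<integral>x. f x \<partial>N)"
  shows "M = N"
proof -
  interpret M: finite_measure M by (rule M(1))
  interpret N: finite_measure N by (rule N(1))
  have cl: "measure M (C \<inter> cball 0 1) = measure N (C \<inter> cball 0 1)" if "closed C" for C
  proof (cases "C = {}")
    case False
    have "(\<integral>x. near C j x \<partial>M) = (\<integral>x. near C j x \<partial>N)" for j by (rule eq[OF continuous_on_near])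
    then show ?thesis
      using LIMSEQ_unique[OF integral_near_tendsto[OF M that False]] integral_near_tendsto[OF N that False] by simp
  qed simp
  let ?G = "{C \<inter> cball 0 1 |C. closed (C :: 'a set)}"
  have sig: "sets (restrict_space borel (cball (0::'a) 1)) = sigma_sets (cball 0 1) ?G"
  proof -
    have "sets (restrict_space borel (cball (0::'a) 1)) = (\<inter>) (cball 0 1) ` sigma_sets UNIV (Collect closed)"
      unfolding sets_restrict_space borel_eq_closed by simp
    also have "\<dots> = sigma_sets (cball 0 1) ((\<inter>) (cball 0 1) ` Collect closed)"
      by (intro sigma_sets_Int sigma_sets.Basic) auto
    also have "(\<inter>) (cball 0 1) ` Collect closed = ?G" by blast
    finally show ?thesis .
  qed
  show ?thesis
  proof (rule measure_eqI_generator_eq[where \<Omega> = "cball 0 1" and E = ?G and A = "\<lambda>_. cball 0 1"])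
    show "Int_stable ?G"
    proof (rule Int_stableI)
      fix a b assume "a \<in> ?G" "b \<in> ?G"
      then obtain C D where "closed C" "closed D" "a = C \<inter> cball 0 1" "b = D \<inter> cball 0 1" by blast
      then have "a \<inter> b = (C \<inter> D) \<inter> cball 0 1" "closed (C \<inter> D)" by auto
      then show "a \<inter> b \<in> ?G" by blast
    qed
    show "?G \<subseteq> Pow (cball 0 1)" by blast
    show "emeasure M X = emeasure N X" if "X \<in> ?G" for X
      using that cl by (auto simp: M.emeasure_eq_measure N.emeasure_eq_measure)
    show "range (\<lambda>_::nat. cball 0 1) \<subseteq> ?G" by (auto intro!: exI[of _ UNIV])
  qed (use sig M(2) N(2) in auto)
qed

section \<open>Patterson measures on end limit points\<close>

lemma sets_restrict_space_subset: "B \<in> sets m \<Longrightarrow> X \<in> sets (restrict_space m B) \<longleftrightarrow> X \<in> sets m \<and> X \<subseteq> B"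
  using sets.sets_into_space[of B m] by (subst sets_restrict_space_iff) (auto simp: Int_absorb2)

lemma emeasure_restrict_subset: "B \<in> sets m \<Longrightarrow> X \<subseteq> B \<Longrightarrow> emeasure (restrict_space m B) X = emeasure m X"
  using sets.sets_into_space[of B m] by (intro emeasure_restrict_space) (auto simp: Int_absorb2)

lemma conformal_restrict:
  assumes m: "m \<in> conformal_measures \<alpha> G A" and H: "H \<subseteq> G" and B: "B \<in> sets m"
    and inv: "\<And>\<gamma> x. \<gamma> \<in> H \<Longrightarrow> x \<in> B \<Longrightarrow> \<gamma> x \<in> B"
  shows "restrict_space m B \<in> conformal_measures \<alpha> H B"
proof -
  note cm = conformal_measuresD[OF m]
  have BA: "B \<subseteq> A" using sets.sets_into_space[OF B] cm(2) by simp
  have Bs: "B \<inter> space m \<in> sets m" using B by auto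
  show ?thesis
    unfolding conformal_measures_def mem_Collect_eq
  proof (intro conjI ballI)
    show "finite_measure (restrict_space m B)" by (rule finite_measure_restrict_space[OF cm(1) B])
    show "space (restrict_space m B) = B" by (rule space_restrict_space2[OF B])
    show "B \<subseteq> cball 0 1" using BA cm(3) by (rule order_trans)
    show "sets (restrict_space borel B) \<subseteq> sets (restrict_space m B)"
    proof
      fix X assume "X \<in> sets (restrict_space borel B)"
      then obtain U where U: "U \<in> sets borel" "X = B \<inter> U" by (auto simp: sets_restrict_space)
      then have "X = B \<inter> (A \<inter> U)" using BA by blast
      then show "X \<in> sets (restrict_space m B)"
        using sets.Int[OF B cm(4)[OF U(1)]] by (simp add: sets_restrict_space_subset[OF B])
    qed
    fix \<gamma> X assume g: "\<gamma> \<in> H" and "X \<in> sets (restrict_space m B)"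
    then have X: "X \<in> sets m" "X \<subseteq> B" and g': "\<gamma> \<in> G" using sets_restrict_space_subset[OF B] H by auto
    have gX: "\<gamma> ` X \<subseteq> B" using inv[OF g] X(2) by blast
    show "\<gamma> ` X \<in> sets (restrict_space m B)" using cm(5)[OF g' X(1)] gX sets_restrict_space_subset[OF B] by simp
    have "emeasure (restrict_space m B) (\<gamma> ` X) = (\<integral>\<^sup>+y\<in>X. ennreal (deriv_norm \<gamma> y powr \<alpha>) \<partial>m)"
      using cm(6)[OF g' X(1)] emeasure_restrict_subset[OF B gX] by simp
    also have "\<dots> = (\<integral>\<^sup>+y. ennreal (deriv_norm \<gamma> y powr \<alpha>) * indicator X y * indicator B y \<partial>m)"
      using X(2) by (intro nn_integral_cong) (auto split: split_indicator)
    also have "\<dots> = (\<integral>\<^sup>+y\<in>X. ennreal (deriv_norm \<gamma> y powr \<alpha>) \<partial>restrict_space m B)"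
      by (rule nn_integral_restrict_space[OF Bs, symmetric])
    finally show "emeasure (restrict_space m B) (\<gamma> ` X) = (\<integral>\<^sup>+y\<in>X. ennreal (deriv_norm \<gamma> y powr \<alpha>) \<partial>restrict_space m B)" .
  qed
qed

lemma hyp_dist_0_le_ln:
  fixes y :: "'a::euclidean_space"
  assumes "norm y \<le> \<rho>" "\<rho> < 1"
  shows "hyp_dist 0 y \<le> ln (2 / (1 - \<rho>))"
proof -
  have y: "y \<in> ball 0 1" using assms by simp
  have "exp (hyp_dist 0 y) \<le> 2 / (1 - \<rho>)" unfolding exp_hyp_dist_0[OF y] using assms by (intro frac_le) auto
  then show ?thesis by (metis exp_gt_zero ln_exp ln_le_cancel_iff order.strict_trans2)
qed

lemma hyp_dist_0_ge_ln:
  fixes y :: "'a::euclidean_space"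
  assumes "y \<in> ball 0 1" "1 - exp (- T) \<le> norm y"
  shows "T \<le> hyp_dist 0 y"
proof -
  have "norm y < 1" using assms(1) by simp
  then have "exp T \<le> 1 / (1 - norm y)"
    using assms(2) by (simp add: pos_le_divide_eq exp_minus field_simps)
  also have "\<dots> \<le> (1 + norm y) / (1 - norm y)" using \<open>norm y < 1\<close> by (intro divide_right_mono) auto
  also have "\<dots> = exp (hyp_dist 0 y)" by (rule exp_hyp_dist_0[OF assms(1), symmetric])
  finally show ?thesis by simp
qed

definition poisson :: "'a::euclidean_space \<Rightarrow> 'a \<Rightarrow> real" where
  "poisson b x = (1 + norm x)\<^sup>2 * (1 - (norm b)\<^sup>2) / (sqrt (mob_den b x) + norm (b - x))\<^sup>2"

lemma poisson_den_pos:
  assumes "b \<in> ball 0 1" "x \<in> cball 0 1"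
  shows "0 < sqrt (mob_den b x) + norm (b - x)"
  using mob_den_pos[OF assms] by (simp add: add_pos_nonneg)

lemma poisson_pos:
  assumes "b \<in> ball 0 1" "x \<in> cball 0 1"
  shows "0 < poisson b x"
proof -
  have "0 < 1 + norm x" using norm_ge_zero[of x] by linarith
  then have "0 < (1 + norm x)\<^sup>2" by simp
  then show ?thesis
    unfolding poisson_def using norm_square_less_one[OF assms(1)] poisson_den_pos[OF assms]
    by (intro divide_pos_pos mult_pos_pos) auto
qed

lemma continuous_on_poisson:
  assumes "b \<in> ball 0 1"
  shows "continuous_on (cball 0 1) (poisson b)"
proof -
  have "(sqrt (mob_den b x) + norm (b - x))\<^sup>2 \<noteq> 0" if "x \<in> cball 0 1" for x
    using poisson_den_pos[OF assms that] by simp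
  then show ?thesis unfolding poisson_def by (intro continuous_intros) auto
qed

lemma poisson_eq_exp:
  assumes b: "b \<in> ball 0 1" and x: "x \<in> ball 0 1"
  shows "poisson b x = exp (hyp_dist 0 x - hyp_dist b x)"
proof -
  define c where "c = (sqrt (mob_den b x) + norm (b - x))\<^sup>2"
  have c: "c \<noteq> 0" unfolding c_def using poisson_den_pos[OF b, of x] x by simp
  have "norm x < 1" using x by simp
  then have nx: "1 - norm x \<noteq> 0" "1 + norm x \<noteq> 0" using norm_ge_zero[of x] by linarith+
  have nb: "1 - (norm b)\<^sup>2 \<noteq> 0" using norm_square_less_one[OF b] by simp
  have "1 - (norm x)\<^sup>2 = (1 - norm x) * (1 + norm x)" by (simp add: power2_eq_square algebra_simps)
  then show ?thesis
    unfolding exp_diff exp_hyp_dist[OF b x] exp_hyp_dist_0[OF x] poisson_def c_def[symmetric]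
    using c nx nb by (simp add: power2_eq_square)
qed

lemma (in hyp_group) poisson_sphere:
  assumes g: "\<gamma> \<in> G" and x: "x \<in> sphere 0 1"
  shows "poisson (ball_inv \<gamma> 0) x = deriv_norm \<gamma> x"
proof -
  have "mob_den (ball_inv \<gamma> 0) x = (norm (x - ball_inv \<gamma> 0))\<^sup>2" using x by (simp add: mob_den_eq)
  then show ?thesis
    unfolding poisson_def deriv_norm_sphere[OF g x]
    using x mult_divide_mult_cancel_left[of 4 "1 - (norm (ball_inv \<gamma> 0))\<^sup>2" "(norm (x - ball_inv \<gamma> 0))\<^sup>2"]
    by (simp add: norm_minus_commute[of "ball_inv \<gamma> 0" x] power_mult_distrib right_diff_distrib)
qed

context poincare_group
begin

definition wt :: "'a \<Rightarrow> ('a \<Rightarrow> 'a) \<Rightarrow> real" where "wt x \<gamma> = exp (- \<alpha> * hyp_dist 0 (\<gamma> x))"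

definition total_wt :: "'a \<Rightarrow> real" where "total_wt x = enn2real (\<integral>\<^sup>+\<gamma>. ennreal (wt x \<gamma>) \<partial>count_space \<Gamma>)"

definition orbit_pmf :: "'a \<Rightarrow> ('a \<Rightarrow> 'a) pmf" where
  "orbit_pmf x = embed_pmf (\<lambda>\<gamma>. if \<gamma> \<in> \<Gamma> then wt x \<gamma> / total_wt x else 0)"

lemma nn_integral_wt_finite:
  assumes "x \<in> ball 0 1"
  shows "(\<integral>\<^sup>+\<gamma>. ennreal (wt x \<gamma>) \<partial>count_space \<Gamma>) < \<infinity>"
  unfolding wt_def using assms by (intro nn_integral_count_space_finite summable_exp) auto

lemma nn_integral_wt:
  assumes "x \<in> ball 0 1"
  shows "(\<integral>\<^sup>+\<gamma>. ennreal (wt x \<gamma>) \<partial>count_space \<Gamma>) = ennreal (total_wt x)"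
  unfolding total_wt_def using nn_integral_wt_finite[OF assms] by simp

lemma total_wt_pos:
  assumes "x \<in> ball 0 1"
  shows "0 < total_wt x"
proof -
  have "ennreal (wt x (\<lambda>x\<in>cball 0 1. x)) \<le> (\<integral>\<^sup>+\<gamma>. ennreal (wt x \<gamma>) \<partial>count_space \<Gamma>)"
    by (rule nn_integral_ge_point[OF id_in])
  also have "\<dots> = ennreal (total_wt x)" by (rule nn_integral_wt[OF assms])
  finally have "wt x (\<lambda>x\<in>cball 0 1. x) \<le> total_wt x"
    by (simp add: total_wt_def)
  then show ?thesis by (simp add: wt_def order.strict_trans2[OF exp_gt_zero])
qed

lemma pmf_orbit_pmf:
  assumes x: "x \<in> ball 0 1"
  shows "pmf (orbit_pmf x) \<gamma> = (if \<gamma> \<in> \<Gamma> then wt x \<gamma> / total_wt x else 0)"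
  unfolding orbit_pmf_def
proof (rule pmf_embed_pmf)
  show "0 \<le> (if \<gamma> \<in> \<Gamma> then wt x \<gamma> / total_wt x else 0)" for \<gamma>
    using total_wt_pos[OF x] by (simp add: wt_def)
  have "(\<integral>\<^sup>+\<gamma>. ennreal (if \<gamma> \<in> \<Gamma> then wt x \<gamma> / total_wt x else 0) \<partial>count_space UNIV)
      = (\<integral>\<^sup>+\<gamma>. ennreal (wt x \<gamma> / total_wt x) * indicator \<Gamma> \<gamma> \<partial>count_space UNIV)"
    by (intro nn_integral_cong) (auto split: split_indicator)
  also have "\<dots> = (\<integral>\<^sup>+\<gamma>. ennreal (wt x \<gamma> / total_wt x) \<partial>count_space \<Gamma>)"
    by (rule nn_integral_count_space_indicator[symmetric]) simp
  also have "\<dots> = (\<integral>\<^sup>+\<gamma>. ennreal (1 / total_wt x) * ennreal (wt x \<gamma>) \<partial>count_space \<Gamma>)"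
    using total_wt_pos[OF x] by (intro nn_integral_cong) (simp add: wt_def flip: ennreal_mult)
  also have "\<dots> = ennreal (1 / total_wt x) * ennreal (total_wt x)"
    by (simp add: nn_integral_cmult nn_integral_wt[OF x])
  also have "\<dots> = 1" using total_wt_pos[OF x] by (simp flip: ennreal_mult)
  finally show "(\<integral>\<^sup>+\<gamma>. ennreal (if \<gamma> \<in> \<Gamma> then wt x \<gamma> / total_wt x else 0) \<partial>count_space UNIV) = 1" .
qed

lemma set_orbit_pmf: "x \<in> ball 0 1 \<Longrightarrow> set_pmf (orbit_pmf x) \<subseteq> \<Gamma>"
  by (auto simp: set_pmf_eq pmf_orbit_pmf split: if_splits)

lemma expectation_orbit_pmf:
  fixes g :: "('a \<Rightarrow> 'a) \<Rightarrow> real"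
  assumes x: "x \<in> ball 0 1"
  shows "measure_pmf.expectation (orbit_pmf x) g = infsetsum (\<lambda>\<gamma>. wt x \<gamma> / total_wt x * g \<gamma>) \<Gamma>"
  unfolding pmf_expectation_eq_infsetsum
  by (rule infsetsum_cong_neutral) (auto simp: pmf_orbit_pmf[OF x])

lemma expectation_translate:
  fixes f :: "'a \<Rightarrow> real"
  assumes x: "x \<in> ball 0 1" and g: "\<gamma> \<in> \<Gamma>"
  shows "measure_pmf.expectation (orbit_pmf x) (\<lambda>\<delta>. f (ball_inv \<gamma> (\<delta> x)))
    = measure_pmf.expectation (orbit_pmf x) (\<lambda>\<delta>. f (\<delta> x) * poisson (ball_inv \<gamma> 0) (\<delta> x) powr \<alpha>)"
proof -
  have xc: "x \<in> cball 0 1" using x ball_subset_cball by blast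
  have "measure_pmf.expectation (orbit_pmf x) (\<lambda>\<delta>. f (ball_inv \<gamma> (\<delta> x)))
      = infsetsum (\<lambda>\<delta>. wt x \<delta> / total_wt x * f (ball_inv \<gamma> (\<delta> x))) \<Gamma>"
    by (rule expectation_orbit_pmf[OF x])
  also have "\<dots> = infsetsum (\<lambda>\<delta>. wt x (compose (cball 0 1) \<gamma> \<delta>) / total_wt x * f (ball_inv \<gamma> (compose (cball 0 1) \<gamma> \<delta> x))) \<Gamma>"
    by (rule infsetsum_reindex_bij_betw[OF bij_comp_left[OF g], symmetric])
  also have "\<dots> = infsetsum (\<lambda>\<delta>. wt x \<delta> / total_wt x * (f (\<delta> x) * poisson (ball_inv \<gamma> 0) (\<delta> x) powr \<alpha>)) \<Gamma>"
  proof (rule infsetsum_cong)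
    fix \<delta> assume d: "\<delta> \<in> \<Gamma>"
    have dx: "\<delta> x \<in> ball 0 1" "\<delta> x \<in> cball 0 1" by (rule ball[OF d x] cball[OF d xc])+
    have b: "ball_inv \<gamma> 0 \<in> ball 0 1" by (rule ball[OF inv_in[OF g]]) simp
    have z: "(0::'a) \<in> ball 0 1" by simp
    have cx: "compose (cball 0 1) \<gamma> \<delta> x = \<gamma> (\<delta> x)" by (rule comp_apply[OF xc])
    have "hyp_dist 0 (\<gamma> (\<delta> x)) = hyp_dist (\<gamma> (\<delta> x)) 0" by (rule hyp_dist_commute[OF z ball[OF g dx(1)]])
    also have "\<dots> = hyp_dist (\<delta> x) (ball_inv \<gamma> 0)" by (rule hyp_dist_inv[OF g dx(1) z])
    also have "\<dots> = hyp_dist (ball_inv \<gamma> 0) (\<delta> x)" by (rule hyp_dist_commute[OF dx(1) b])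
    finally have D: "hyp_dist 0 (\<gamma> (\<delta> x)) = hyp_dist (ball_inv \<gamma> 0) (\<delta> x)" .
    have "wt x (compose (cball 0 1) \<gamma> \<delta>) = wt x \<delta> * poisson (ball_inv \<gamma> 0) (\<delta> x) powr \<alpha>"
      unfolding poisson_eq_exp[OF b dx(1)] wt_def cx D exp_powr_real exp_add[symmetric] by (simp add: algebra_simps)
    then show "wt x (compose (cball 0 1) \<gamma> \<delta>) / total_wt x * f (ball_inv \<gamma> (compose (cball 0 1) \<gamma> \<delta> x))
        = wt x \<delta> / total_wt x * (f (\<delta> x) * poisson (ball_inv \<gamma> 0) (\<delta> x) powr \<alpha>)"
      unfolding cx inv_left[OF g dx(2)] by simp
  qed simp
  also have "\<dots> = measure_pmf.expectation (orbit_pmf x) (\<lambda>\<delta>. f (\<delta> x) * poisson (ball_inv \<gamma> 0) (\<delta> x) powr \<alpha>)"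
    by (rule expectation_orbit_pmf[OF x, symmetric])
  finally show ?thesis .
qed

lemma orbit_pmf_shadow:
  assumes x: "x \<in> ball 0 1" and D: "D \<subseteq> \<Gamma>"
    and B: "\<And>\<gamma>. \<gamma> \<in> \<Gamma> \<Longrightarrow> \<gamma> \<in> B \<Longrightarrow> \<exists>\<delta>\<in>D. hyp_dist 0 (\<delta> 0) + hyp_dist (\<delta> 0) (\<gamma> x) \<le> hyp_dist 0 (\<gamma> x) + c"
  shows "emeasure (orbit_pmf x) B \<le> ennreal (exp (\<alpha> * c)) * (\<integral>\<^sup>+\<delta>. ennreal (wt 0 \<delta>) \<partial>count_space D)"
proof -
  have xc: "x \<in> cball 0 1" using x ball_subset_cball by blast
  define K where "K = exp (\<alpha> * c) / total_wt x"
  have K: "0 \<le> K" using total_wt_pos[OF x] by (simp add: K_def)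
  define u where "u \<delta> \<gamma> = exp (- \<alpha> * hyp_dist (\<delta> 0) (\<gamma> x))" for \<delta> \<gamma> :: "'a \<Rightarrow> 'a"
  have u: "(\<integral>\<^sup>+\<gamma>. ennreal (u \<delta> \<gamma>) \<partial>count_space \<Gamma>) = ennreal (total_wt x)" if d: "\<delta> \<in> \<Gamma>" for \<delta>
  proof -
    have "(\<integral>\<^sup>+\<gamma>. ennreal (u \<delta> \<gamma>) \<partial>count_space \<Gamma>) = (\<integral>\<^sup>+\<gamma>. ennreal (u \<delta> (compose (cball 0 1) \<delta> \<gamma>)) \<partial>count_space \<Gamma>)"
      by (rule nn_integral_bij_count_space[OF bij_comp_left[OF d], symmetric])
    also have "\<dots> = (\<integral>\<^sup>+\<gamma>. ennreal (wt x \<gamma>) \<partial>count_space \<Gamma>)"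
    proof (rule nn_integral_cong)
      fix \<gamma> assume "\<gamma> \<in> space (count_space \<Gamma>)"
      then have g: "\<gamma> \<in> \<Gamma>" by simp
      have "hyp_dist (\<delta> 0) (\<delta> (\<gamma> x)) = hyp_dist 0 (\<gamma> x)"
        by (rule hyp_isometry_hyp_dist[OF isoD[OF d] _ ball[OF g x]]) simp
      then show "ennreal (u \<delta> (compose (cball 0 1) \<delta> \<gamma>)) = ennreal (wt x \<gamma>)"
        unfolding u_def wt_def comp_apply[OF xc] by simp
    qed
    finally show ?thesis using nn_integral_wt[OF x] by simp
  qed
  have "emeasure (orbit_pmf x) B = (\<integral>\<^sup>+\<gamma>. ennreal (pmf (orbit_pmf x) \<gamma>) * indicator B \<gamma> \<partial>count_space UNIV)"
    using nn_integral_measure_pmf[of "orbit_pmf x" "indicator B"] by simp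
  also have "\<dots> = (\<integral>\<^sup>+\<gamma>. ennreal (wt x \<gamma> / total_wt x) * indicator B \<gamma> * indicator \<Gamma> \<gamma> \<partial>count_space UNIV)"
    by (intro nn_integral_cong) (auto simp: pmf_orbit_pmf[OF x] split: split_indicator)
  also have "\<dots> = (\<integral>\<^sup>+\<gamma>. ennreal (wt x \<gamma> / total_wt x) * indicator B \<gamma> \<partial>count_space \<Gamma>)"
    by (rule nn_integral_count_space_indicator[symmetric]) simp
  also have "\<dots> \<le> (\<integral>\<^sup>+\<gamma>. \<integral>\<^sup>+\<delta>. ennreal (K * wt 0 \<delta>) * ennreal (u \<delta> \<gamma>) \<partial>count_space D \<partial>count_space \<Gamma>)"
  proof (rule nn_integral_mono)
    fix \<gamma> assume "\<gamma> \<in> space (count_space \<Gamma>)"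
    then have g: "\<gamma> \<in> \<Gamma>" by simp
    show "ennreal (wt x \<gamma> / total_wt x) * indicator B \<gamma> \<le> (\<integral>\<^sup>+\<delta>. ennreal (K * wt 0 \<delta>) * ennreal (u \<delta> \<gamma>) \<partial>count_space D)"
    proof (cases "\<gamma> \<in> B")
      case True
      obtain \<delta> where d: "\<delta> \<in> D" "hyp_dist 0 (\<delta> 0) + hyp_dist (\<delta> 0) (\<gamma> x) \<le> hyp_dist 0 (\<gamma> x) + c"
        using B[OF g True] by blast
      have "\<alpha> * (hyp_dist 0 (\<delta> 0) + hyp_dist (\<delta> 0) (\<gamma> x)) \<le> \<alpha> * (hyp_dist 0 (\<gamma> x) + c)"
        using d(2) alpha by (intro mult_left_mono) auto
      then have "wt x \<gamma> \<le> exp (\<alpha> * c) * wt 0 \<delta> * u \<delta> \<gamma>"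
        unfolding wt_def u_def exp_add[symmetric] by (simp add: algebra_simps)
      then have "wt x \<gamma> / total_wt x \<le> exp (\<alpha> * c) * wt 0 \<delta> * u \<delta> \<gamma> / total_wt x"
        using total_wt_pos[OF x] by (intro divide_right_mono) auto
      also have "\<dots> = K * wt 0 \<delta> * u \<delta> \<gamma>" by (simp add: K_def)
      finally have "ennreal (wt x \<gamma> / total_wt x) \<le> ennreal (K * wt 0 \<delta>) * ennreal (u \<delta> \<gamma>)"
        using K by (simp add: ennreal_leI wt_def u_def flip: ennreal_mult)
      also have "\<dots> \<le> (\<integral>\<^sup>+\<delta>. ennreal (K * wt 0 \<delta>) * ennreal (u \<delta> \<gamma>) \<partial>count_space D)"
        by (rule nn_integral_ge_point[OF d(1)])
      finally show ?thesis using True by simp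
    qed simp
  qed
  also have "\<dots> = (\<integral>\<^sup>+\<delta>. \<integral>\<^sup>+\<gamma>. ennreal (K * wt 0 \<delta>) * ennreal (u \<delta> \<gamma>) \<partial>count_space \<Gamma> \<partial>count_space D)"
    by (rule nn_integral_count_space_nn_integral[OF countable_subset[OF D countable_group]]) simp
  also have "\<dots> = (\<integral>\<^sup>+\<delta>. ennreal (exp (\<alpha> * c)) * ennreal (wt 0 \<delta>) \<partial>count_space D)"
  proof (rule nn_integral_cong)
    fix \<delta> assume "\<delta> \<in> space (count_space D)"
    then have d: "\<delta> \<in> \<Gamma>" using D by auto
    have "(\<integral>\<^sup>+\<gamma>. ennreal (K * wt 0 \<delta>) * ennreal (u \<delta> \<gamma>) \<partial>count_space \<Gamma>) = ennreal (K * wt 0 \<delta>) * ennreal (total_wt x)"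
      by (simp add: nn_integral_cmult u[OF d])
    also have "\<dots> = ennreal (exp (\<alpha> * c)) * ennreal (wt 0 \<delta>)"
      using total_wt_pos[OF x] K by (simp add: K_def wt_def flip: ennreal_mult)
    finally show "(\<integral>\<^sup>+\<gamma>. ennreal (K * wt 0 \<delta>) * ennreal (u \<delta> \<gamma>) \<partial>count_space \<Gamma>) = ennreal (exp (\<alpha> * c)) * ennreal (wt 0 \<delta>)" .
  qed
  also have "\<dots> = ennreal (exp (\<alpha> * c)) * (\<integral>\<^sup>+\<delta>. ennreal (wt 0 \<delta>) \<partial>count_space D)" by (rule nn_integral_cmult) simp
  finally show ?thesis .
qed

lemma orbit_tail:
  assumes e: "\<epsilon> > 0"
  obtains T :: nat where "(\<integral>\<^sup>+\<delta>. ennreal (wt 0 \<delta>) \<partial>count_space {\<delta> \<in> \<Gamma>. T \<le> hyp_dist 0 (\<delta> 0)}) < ennreal \<epsilon>"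
proof -
  define \<nu> where "\<nu> = density (count_space \<Gamma>) (\<lambda>\<delta>. ennreal (wt 0 \<delta>))"
  define A where "A T = {\<delta> \<in> \<Gamma>. real T \<le> hyp_dist 0 (\<delta> 0)}" for T :: nat
  have \<nu>: "emeasure \<nu> B = (\<integral>\<^sup>+\<delta>. ennreal (wt 0 \<delta>) \<partial>count_space B)" if "B \<subseteq> \<Gamma>" for B
  proof -
    have "emeasure \<nu> B = (\<integral>\<^sup>+\<delta>. ennreal (wt 0 \<delta>) * indicator B \<delta> \<partial>count_space \<Gamma>)"
      unfolding \<nu>_def using that by (subst emeasure_density) auto
    also have "\<dots> = (\<integral>\<^sup>+\<delta>. ennreal (wt 0 \<delta>) * indicator B \<delta> * indicator \<Gamma> \<delta> \<partial>count_space UNIV)"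
      by (rule nn_integral_count_space_indicator) simp
    also have "\<dots> = (\<integral>\<^sup>+\<delta>. ennreal (wt 0 \<delta>) * indicator B \<delta> \<partial>count_space UNIV)"
      using that by (intro nn_integral_cong) (auto split: split_indicator)
    also have "\<dots> = (\<integral>\<^sup>+\<delta>. ennreal (wt 0 \<delta>) \<partial>count_space B)"
      by (rule nn_integral_count_space_indicator[symmetric]) simp
    finally show ?thesis .
  qed
  have "(\<lambda>T. emeasure \<nu> (A T)) \<longlonglongrightarrow> emeasure \<nu> (\<Inter>T. A T)"
  proof (rule Lim_emeasure_decseq)
    show "range A \<subseteq> sets \<nu>" by (auto simp: \<nu>_def A_def)
    show "decseq A" unfolding decseq_def A_def by (auto intro: order_trans[of "real _" "real _"])
    show "emeasure \<nu> (A T) \<noteq> \<infinity>" for T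
    proof -
      have "emeasure \<nu> (A T) \<le> emeasure \<nu> \<Gamma>" by (rule emeasure_mono) (auto simp: A_def \<nu>_def)
      also have "\<dots> < \<infinity>" using \<nu>[of \<Gamma>] nn_integral_wt_finite[of 0] by simp
      finally show ?thesis by simp
    qed
  qed
  moreover have "(\<Inter>T. A T) = {}"
  proof -
    have False if "\<delta> \<in> (\<Inter>T. A T)" for \<delta>
    proof -
      obtain T :: nat where "hyp_dist 0 (\<delta> 0) < real T" using reals_Archimedean2 by blast
      then show False using that by (auto simp: A_def dest: spec[of _ T])
    qed
    then show ?thesis by blast
  qed
  ultimately have "(\<lambda>T. emeasure \<nu> (A T)) \<longlonglongrightarrow> 0" by simp
  then have "\<forall>\<^sub>F T in sequentially. emeasure \<nu> (A T) < ennreal \<epsilon>" using e by (intro order_tendstoD) auto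
  then obtain T where "emeasure \<nu> (A T) < ennreal \<epsilon>" using eventually_happens'[OF sequentially_bot] by blast
  moreover have "A T \<subseteq> \<Gamma>" by (auto simp: A_def)
  ultimately show thesis using that[of T] \<nu>[of "A T"] by (simp add: A_def)
qed

end


context conformal_end
begin

lemma hyp_core_far:
  obtains N0 where "\<And>N y. y \<in> hyp_core N E \<Longrightarrow> N - N0 \<le> hyp_dist 0 y"
proof -
  obtain N0 where N0: "\<And>N \<gamma>. N \<ge> N0 \<Longrightarrow> \<gamma> \<in> \<Gamma> \<Longrightarrow> \<gamma> 0 \<notin> hyp_core N E"
    using orbit_not_in_core by metis
  have "N - N0 \<le> hyp_dist 0 y" if y: "y \<in> hyp_core N E" for N y
  proof (rule ccontr)
    assume "\<not> N - N0 \<le> hyp_dist 0 y"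
    then have le: "N0 \<le> N - hyp_dist 0 y" by simp
    have yb: "y \<in> ball 0 1" using y hyp_core_subset_ball by blast
    have z: "(0::'a) \<in> ball 0 1" by simp
    have "0 \<in> hyp_core (N - hyp_dist 0 y) E"
      by (rule hyp_core_dist[OF y z]) (simp add: hyp_dist_commute[OF yb z])
    then show False using N0[OF le id_in] by simp
  qed
  then show thesis using that by blast
qed

lemma shadow_cover:
  assumes N: "N > 0"
  obtains R where "\<And>y \<sigma>. y \<in> hyp_core N E \<Longrightarrow> 0 \<le> \<sigma> \<Longrightarrow> y \<notin> deep_rays N \<sigma> E \<Longrightarrow>
    \<exists>\<delta>\<in>S. hyp_dist 0 (\<delta> 0) + hyp_dist (\<delta> 0) y \<le> hyp_dist 0 y + 2 * R \<and> hyp_dist 0 (\<sigma> *\<^sub>R y) \<le> hyp_dist 0 (\<delta> 0) + R"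
proof -
  have z: "(0::'a) \<in> ball 0 1" by simp
  obtain L where L: "compact L" "L \<subseteq> ball 0 1"
    "\<And>y. y \<in> hyp_core N E \<Longrightarrow> y \<notin> hyp_core (N + 1) E \<Longrightarrow> \<exists>\<delta>\<in>S. \<exists>l\<in>L. y = \<delta> l"
    using shell_cocompact[OF N] by blast
  obtain R where R: "\<And>l. l \<in> L \<Longrightarrow> hyp_dist 0 l \<le> R" using compact_hyp_dist_bounded[OF L(1,2) z] by blast
  have "\<exists>\<delta>\<in>S. hyp_dist 0 (\<delta> 0) + hyp_dist (\<delta> 0) y \<le> hyp_dist 0 y + 2 * R \<and> hyp_dist 0 (\<sigma> *\<^sub>R y) \<le> hyp_dist 0 (\<delta> 0) + R"
    if y: "y \<in> hyp_core N E" and \<sigma>: "0 \<le> \<sigma>" and nd: "y \<notin> deep_rays N \<sigma> E" for y \<sigma>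
  proof -
    have yb: "y \<in> ball 0 1" using y hyp_core_subset_ball by blast
    then have "y \<in> cball 0 1" by simp
    then obtain s where s: "\<sigma> \<le> s" "s < 1" "s *\<^sub>R y \<notin> hyp_core N E" using nd unfolding deep_rays_def by auto
    have s0: "0 \<le> s" using s \<sigma> by simp
    have "y \<noteq> 0" using s(3) y by auto
    let ?C = "(\<lambda>t. t *\<^sub>R y) ` {s..1}"
    have tb: "t *\<^sub>R y \<in> ball 0 1" if "t \<in> {s..1}" for t
    proof -
      have "norm (t *\<^sub>R y) \<le> 1 * norm y" using that s0 by (simp add: mult_left_le_one_le)
      then show ?thesis using yb by simp
    qed
    have C: "connected ?C" by (intro connected_continuous_image continuous_intros) auto
    have Cb: "?C \<subseteq> ball 0 1" using tb by blast
    have "1 *\<^sub>R y \<in> ?C" "s *\<^sub>R y \<in> ?C" using s by (intro imageI; simp)+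
    moreover have "1 *\<^sub>R y \<in> hyp_core N E" using y by simp
    ultimately obtain p where p: "p \<in> ?C" "p \<in> hyp_core N E" "p \<notin> hyp_core (N + 1) E"
      using hyp_core_crossing[OF C Cb _ _ _ s(3)] by blast
    obtain t where t: "t \<in> {s..1}" "p = t *\<^sub>R y" using p(1) by blast
    obtain \<delta> l where d: "\<delta> \<in> S" "l \<in> L" "p = \<delta> l" using L(3)[OF p(2,3)] by blast
    have d\<Gamma>: "\<delta> \<in> \<Gamma>" using d(1) stab_subset by blast
    have lb: "l \<in> ball 0 1" using d(2) L(2) by blast
    have pb: "p \<in> ball 0 1" using tb[OF t(1)] t(2) by simp
    have db: "\<delta> 0 \<in> ball 0 1" by (rule ball[OF d\<Gamma> z])
    have "hyp_dist p (\<delta> 0) = hyp_dist l 0" unfolding d(3) by (rule hyp_isometry_hyp_dist[OF isoD[OF d\<Gamma>] lb z])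
    also have "\<dots> \<le> R" using R[OF d(2)] hyp_dist_commute[OF lb z] by simp
    finally have pd: "hyp_dist p (\<delta> 0) \<le> R" .
    have ray: "hyp_dist p y = hyp_dist 0 y - hyp_dist 0 p"
    proof -
      define e where "e = (1 / norm y) *\<^sub>R y"
      have e: "e \<in> sphere 0 1" "y = norm y *\<^sub>R e" using \<open>y \<noteq> 0\<close> by (simp_all add: e_def)
      have pe: "p = (t * norm y) *\<^sub>R e" using \<open>y \<noteq> 0\<close> by (simp add: e_def t(2))
      have "hyp_dist ((t * norm y) *\<^sub>R e) (norm y *\<^sub>R e) = hyp_dist 0 (norm y *\<^sub>R e) - hyp_dist 0 ((t * norm y) *\<^sub>R e)"
        using t(1) s0 yb by (intro hyp_dist_radial[OF e(1)]) (auto simp: mult_left_le_one_le)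
      then show ?thesis by (simp only: pe[symmetric] e(2)[symmetric])
    qed
    have "hyp_dist 0 (\<delta> 0) \<le> hyp_dist 0 p + hyp_dist p (\<delta> 0)" by (rule hyp_dist_triangle[OF z pb db])
    moreover have "hyp_dist 0 p \<le> hyp_dist 0 (\<delta> 0) + hyp_dist (\<delta> 0) p" by (rule hyp_dist_triangle[OF z db pb])
    moreover have "hyp_dist (\<delta> 0) y \<le> hyp_dist (\<delta> 0) p + hyp_dist p y" by (rule hyp_dist_triangle[OF db pb yb])
    moreover have "hyp_dist (\<delta> 0) p = hyp_dist p (\<delta> 0)" by (rule hyp_dist_commute[OF db pb])
    moreover have "hyp_dist 0 (\<sigma> *\<^sub>R y) \<le> hyp_dist 0 p"
    proof (rule hyp_dist_0_mono[OF _ pb])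
      show le: "norm (\<sigma> *\<^sub>R y) \<le> norm p" using t s \<sigma> by (auto intro: mult_right_mono)
      then show "\<sigma> *\<^sub>R y \<in> ball 0 1" using pb by (simp only: mem_ball_0)
    qed
    ultimately show ?thesis using pd ray d(1) by (intro bexI[OF _ d(1)]) auto
  qed
  then show thesis using that by blast
qed

lemma poincare_group_stab: "poincare_group S \<alpha>"
proof -
  interpret S: hyp_group S by (rule stab_group)
  show ?thesis
  proof
    show "\<alpha> > 0" by (rule alpha)
    show "poincare_converges S \<alpha>"
      using conv stab_subset unfolding poincare_converges_def by (meson summable_on_subset_banach)
  qed
qed

lemma nontrivial_conformal_measure:
  assumes z: "z \<in> \<Lambda>"
  obtains m where "m \<in> conformal_measures \<alpha> S \<Lambda>" "nontrivial_measure m"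
proof -
  interpret S: poincare_group S \<alpha> by (rule poincare_group_stab)
  have zs: "z \<in> sphere 0 1" "z \<in> cball 0 1" and zl: "z \<in> limit_set S" and ze: "is_endpoint E z"
    using end_limit_pointsD[OF z] by blast+
  define s where "s k = 1 - 1 / Suc k" for k :: nat
  have s: "0 \<le> s k" "s k < 1" for k by (auto simp: s_def field_simps)
  have smono: "s j \<le> s k" if "j \<le> k" for j k using that by (simp add: s_def frac_le)
  have slim: "s \<longlonglongrightarrow> 1"
  proof -
    have "(\<lambda>k. 1 - 1 / real (Suc k)) \<longlonglongrightarrow> 1 - 0" by (intro tendsto_intros LIMSEQ_Suc lim_1_over_n)
    then show ?thesis by (simp add: s_def[abs_def])
  qed
  define x where "x k = s k *\<^sub>R z" for k
  have xb: "x k \<in> ball 0 1" for k using zs(1) s[of k] by (simp add: x_def)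
  define p where "p k = map_pmf (\<lambda>\<gamma>. \<gamma> (x k)) (S.orbit_pmf (x k))" for k
  have pset: "\<exists>\<gamma>\<in>S. y = \<gamma> (x k)" if "y \<in> set_pmf (p k)" for y k
    using that S.set_orbit_pmf[OF xb] unfolding p_def set_map_pmf by blast
  have pball: "y \<in> ball 0 1" if "y \<in> set_pmf (p k)" for y k
    using pset[OF that] S.ball[OF _ xb] by blast
  have "set_pmf (p k) \<subseteq> cball 0 1" for k using pball ball_subset_cball by blast
  then obtain r m where r: "strict_mono (r :: nat \<Rightarrow> nat)" and pm: "prob_space m"
    and sm: "sets m = sets (restrict_space borel (cball 0 1))"
    and lim: "\<And>f. continuous_on (cball 0 1) f \<Longrightarrow>
      (\<lambda>k. measure_pmf.expectation (p (r k)) f) \<longlonglongrightarrow> (\<integral>x. (f x :: real) \<partial>m)"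
    using pmf_weak_limit[of p] by blast
  interpret prob_space m by (rule pm)
  have sp: "space m = cball 0 1" using sets_eq_imp_space_eq[OF sm] by (simp add: space_restrict_space)
  have bm: "A \<inter> cball 0 1 \<in> sets m" if "A \<in> sets borel" for A
    using that unfolding sm sets_restrict_space by blast
  have ge: "c \<le> measure m (A \<inter> cball 0 1)" if "closed A" "\<forall>\<^sub>F k in sequentially. c \<le> measure_pmf.prob (p k) A" for A c
    by (rule closed_measure_ge_limit[OF finite_measure_axioms sm lim that(1) eventually_subseq[OF r that(2)]])
  have AE: "AE y in m. y \<in> A" if "closed A" "\<forall>\<^sub>F k in sequentially. set_pmf (p k) \<subseteq> A" for A
  proof -
    have "\<forall>\<^sub>F k in sequentially. 1 \<le> measure_pmf.prob (p k) A"
      using that(2)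
    proof eventually_elim
      case (elim k)
      then have "measure_pmf.prob (p k) A = 1"
        by (intro measure_pmf.prob_eq_1[THEN iffD2]) (auto simp: AE_measure_pmf_iff)
      then show ?case by simp
    qed
    from ge[OF that(1) this] have "measure m (A \<inter> cball 0 1) = 1" using prob_le_1 by (intro antisym) auto
    then have "AE y in m. y \<in> A \<inter> cball 0 1"
      using prob_eq_1[OF bm[OF borel_closed[OF that(1)]]] by simp
    then show ?thesis by eventually_elim blast
  qed
  have core: "\<forall>\<^sub>F k in sequentially. set_pmf (p k) \<subseteq> hyp_core (real N) E" for N :: nat
  proof -
    obtain j where j: "z \<in> deep_rays N (s j) E"
      using ze unfolding is_endpoint_iff_deep_rays[OF E_open E_ball] s_def by blast
    have "set_pmf (p k) \<subseteq> hyp_core N E" if "k \<ge> j" for k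
    proof
      fix y assume "y \<in> set_pmf (p k)"
      then obtain \<gamma> where g: "\<gamma> \<in> S" "y = \<gamma> (x k)" using pset by blast
      have "x k \<in> hyp_core N E" using j smono[OF that] s(2)[of k] unfolding deep_rays_def x_def by simp
      from S.hyp_core_image[OF g(1) this] show "y \<in> hyp_core N E" using g by (simp add: set_stab_def)
    qed
    then show ?thesis by (auto simp: eventually_sequentially)
  qed
  obtain N0 where N0: "\<And>N y. y \<in> hyp_core N E \<Longrightarrow> N - N0 \<le> hyp_dist 0 y" using hyp_core_far by blast
  have far: "\<forall>\<^sub>F k in sequentially. set_pmf (p k) \<subseteq> {y. \<rho> \<le> norm y}" if "\<rho> < 1" for \<rho>
  proof -
    obtain N :: nat where N: "ln (2 / (1 - \<rho>)) + N0 < real N" using reals_Archimedean2 by blast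
    show ?thesis using core[of N]
    proof eventually_elim
      case (elim k)
      show ?case
      proof
        fix y assume "y \<in> set_pmf (p k)"
        then have "real N - N0 \<le> hyp_dist 0 y" using elim N0 by blast
        then have "\<not> norm y \<le> \<rho>" using hyp_dist_0_le_ln[OF _ that, of y] N by linarith
        then show "y \<in> {y. \<rho> \<le> norm y}" by simp
      qed
    qed
  qed
  have AE_sphere: "AE y in m. y \<in> sphere 0 1"
  proof -
    have "AE y in m. \<forall>j. y \<in> {y. s j \<le> norm y}"
      unfolding AE_all_countable using s(2) by (intro allI AE far closed_Collect_le continuous_intros)
    then show ?thesis using AE_space
    proof eventually_elim
      case (elim y)
      then have "1 \<le> norm y" by (intro LIMSEQ_le_const2[OF slim]) auto
      then show ?case using elim(2) sp by auto
    qed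
  qed
  define Cl where "Cl = closure (group_orbit S 0)"
  have Cl: "closed Cl" "Cl \<noteq> {}" using S.orbit_self[of 0] closure_subset[of "group_orbit S 0"] by (auto simp: Cl_def)
  have AE_orbit: "AE y in m. y \<in> Cl"
  proof -
    have "AE y in m. y \<in> {y. infdist y Cl \<le> 1 / Suc j}" for j
    proof (rule AE)
      show "closed {y. infdist y Cl \<le> 1 / real (Suc j)}" by (intro closed_Collect_le continuous_intros)
      define e where "e = 1 / real (Suc j)"
      have e: "0 < e" "e \<le> 1" by (simp_all add: e_def)
      have "sqrt (1 - e\<^sup>2) < 1" using e by (simp add: real_sqrt_less_iff)
      from far[OF this] have "\<forall>\<^sub>F k in sequentially. set_pmf (p k) \<subseteq> {y. infdist y Cl \<le> e}"
      proof eventually_elim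
        case (elim k)
        show ?case
        proof
          fix y assume y: "y \<in> set_pmf (p k)"
          then obtain \<gamma> where g: "\<gamma> \<in> S" "y = \<gamma> (x k)" using pset by blast
          have "sqrt (1 - e\<^sup>2) \<le> norm y" using elim y by blast
          then have "(sqrt (1 - e\<^sup>2))\<^sup>2 \<le> (norm y)\<^sup>2" using e by (intro power_mono) (auto simp: power_le_one)
          then have ye: "1 - (norm y)\<^sup>2 \<le> e\<^sup>2" using e by (simp add: power_le_one)
          have "norm (\<gamma> 0 - y) * norm (y - \<gamma> z) \<le> e * e"
            using geodesic_near_sphere[OF S.isoD[OF g(1)] zs(1) s, of k] ye g(2) by (simp add: x_def power2_eq_square)
          then have "norm (\<gamma> 0 - y) \<le> e \<or> norm (y - \<gamma> z) \<le> e"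
            using mult_strict_mono[of e "norm (\<gamma> 0 - y)" e "norm (y - \<gamma> z)"] e by linarith
          moreover have "\<gamma> 0 \<in> Cl"
            using g(1) closure_subset[of "group_orbit S 0"] unfolding Cl_def group_orbit_def by blast
          moreover have "\<gamma> z \<in> Cl"
            using S.limit_set_image[OF g(1) zl] unfolding S.limit_set_eq Cl_def by blast
          ultimately have "infdist y Cl \<le> e"
            using infdist_le2[of "\<gamma> 0" Cl y e] infdist_le2[of "\<gamma> z" Cl y e] by (auto simp: dist_norm norm_minus_commute[of y "\<gamma> 0"])
          then show "y \<in> {y. infdist y Cl \<le> e}" by simp
        qed
      qed
      then show "\<forall>\<^sub>F k in sequentially. set_pmf (p k) \<subseteq> {y. infdist y Cl \<le> 1 / real (Suc j)}" by (simp add: e_def)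
    qed
    then have "AE y in m. \<forall>j. infdist y Cl \<le> 1 / Suc j" unfolding AE_all_countable by simp
    then show ?thesis
    proof eventually_elim
      case (elim y)
      have "infdist y Cl \<le> 0"
        by (rule LIMSEQ_le_const[OF LIMSEQ_Suc[OF lim_1_over_n]]) (use elim in auto)
      then have "infdist y Cl = 0" using infdist_nonneg[of y Cl] by simp
      then show ?case using in_closed_iff_infdist_zero[OF Cl] by blast
    qed
  qed
  have AE_deep: "AE y in m. \<exists>j. y \<in> deep_rays N (s j) E" if N: "N > 0" for N :: nat
  proof -
    have rN: "real N > 0" using N by simp
    obtain R where R: "\<And>y \<sigma>. y \<in> hyp_core N E \<Longrightarrow> 0 \<le> \<sigma> \<Longrightarrow> y \<notin> deep_rays N \<sigma> E \<Longrightarrow>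
      \<exists>\<delta>\<in>S. hyp_dist 0 (\<delta> 0) + hyp_dist (\<delta> 0) y \<le> hyp_dist 0 y + 2 * R \<and> hyp_dist 0 (\<sigma> *\<^sub>R y) \<le> hyp_dist 0 (\<delta> 0) + R"
      using shadow_cover[OF rN] by blast
    define D where "D j = deep_rays N (s j) E" for j
    have Dcl: "closed (D j)" for j unfolding D_def by (rule closed_deep_rays[OF s(1)])
    have Dc: "D j \<subseteq> cball 0 1" for j by (auto simp: D_def deep_rays_def)
    have Dm: "D j \<in> sets m" for j using bm[OF borel_closed[OF Dcl[of j]]] Dc[of j] by (simp add: Int_absorb2)
    have UD: "(\<Union>j. D j) \<in> sets m" using Dm by blast
    have le: "1 - \<epsilon> \<le> measure m (\<Union>j. D j)" if e: "\<epsilon> > 0" for \<epsilon>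
    proof -
      have "\<epsilon> / exp (\<alpha> * (2 * R)) > 0" using e by simp
      then obtain T :: nat where T: "(\<integral>\<^sup>+\<delta>. ennreal (S.wt 0 \<delta>) \<partial>count_space {\<delta> \<in> S. T \<le> hyp_dist 0 (\<delta> 0)})
          < ennreal (\<epsilon> / exp (\<alpha> * (2 * R)))"
        using S.orbit_tail by blast
      define A where "A = {\<delta> \<in> S. T \<le> hyp_dist 0 (\<delta> 0)}"
      have "(\<lambda>j. s j * s j) \<longlonglongrightarrow> 1 * 1" by (intro tendsto_mult slim)
      moreover have "1 - exp (- (T + R)) < 1 * 1" by simp
      ultimately have "\<forall>\<^sub>F j in sequentially. 1 - exp (- (T + R)) < s j * s j" by (rule order_tendstoD(1))
      then obtain j where j: "1 - exp (- (T + R)) < s j * s j" using eventually_happens'[OF sequentially_bot] by blast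
      have "\<forall>\<^sub>F k in sequentially. 1 - \<epsilon> \<le> measure_pmf.prob (p k) (D j)"
        using core[of N] far[OF s(2)[of j]]
      proof eventually_elim
        case (elim k)
        define B where "B = {\<gamma>. \<gamma> (x k) \<in> set_pmf (p k) \<and> \<gamma> (x k) \<notin> D j}"
        have "emeasure (S.orbit_pmf (x k)) B \<le> ennreal (exp (\<alpha> * (2 * R))) * (\<integral>\<^sup>+\<delta>. ennreal (S.wt 0 \<delta>) \<partial>count_space A)"
        proof (rule S.orbit_pmf_shadow[OF xb])
          show "A \<subseteq> S" by (auto simp: A_def)
          fix \<gamma> assume g: "\<gamma> \<in> S" "\<gamma> \<in> B"
          define y where "y = \<gamma> (x k)"
          have y: "y \<in> set_pmf (p k)" "y \<notin> deep_rays N (s j) E" using g(2) by (auto simp: B_def D_def y_def)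
          have yc: "y \<in> hyp_core N E" "s j \<le> norm y" using elim y(1) by blast+
          obtain \<delta> where d: "\<delta> \<in> S" "hyp_dist 0 (\<delta> 0) + hyp_dist (\<delta> 0) y \<le> hyp_dist 0 y + 2 * R"
            "hyp_dist 0 (s j *\<^sub>R y) \<le> hyp_dist 0 (\<delta> 0) + R"
            using R[OF yc(1) s(1) y(2)] by blast
          have "T + R \<le> hyp_dist 0 (s j *\<^sub>R y)"
          proof (rule hyp_dist_0_ge_ln)
            have "s j * norm y \<le> 1 * norm y" using s by (intro mult_right_mono) (auto intro: less_imp_le)
            then show "s j *\<^sub>R y \<in> ball 0 1" using pball[OF y(1)] s(1)[of j] by simp
            have "s j * s j \<le> s j * norm y" using yc(2) s by (intro mult_left_mono) auto
            then show "1 - exp (- (T + R)) \<le> norm (s j *\<^sub>R y)" using j s(1)[of j] by simp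
          qed
          then have "\<delta> \<in> A" using d by (simp add: A_def)
          then show "\<exists>\<delta>\<in>A. hyp_dist 0 (\<delta> 0) + hyp_dist (\<delta> 0) (\<gamma> (x k)) \<le> hyp_dist 0 (\<gamma> (x k)) + 2 * R"
            using d(2) unfolding y_def by blast
        qed
        also have "\<dots> \<le> ennreal (exp (\<alpha> * (2 * R))) * ennreal (\<epsilon> / exp (\<alpha> * (2 * R)))"
          using T unfolding A_def by (intro mult_left_mono) auto
        also have "\<dots> = ennreal \<epsilon>" using e by (simp flip: ennreal_mult)
        finally have Be: "measure_pmf.prob (S.orbit_pmf (x k)) B \<le> \<epsilon>"
          using e by (simp add: measure_pmf.emeasure_eq_measure)
        have "measure_pmf.prob (p k) (D j) = measure_pmf.prob (S.orbit_pmf (x k)) ((\<lambda>\<gamma>. \<gamma> (x k)) -` D j)"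
          unfolding p_def by simp
        also have "\<dots> \<ge> measure_pmf.prob (S.orbit_pmf (x k)) (- B)"
        proof (rule measure_pmf.finite_measure_mono_AE)
          show "AE \<gamma> in S.orbit_pmf (x k). \<gamma> \<in> - B \<longrightarrow> \<gamma> \<in> (\<lambda>\<gamma>. \<gamma> (x k)) -` D j"
            by (auto simp: AE_measure_pmf_iff B_def p_def)
        qed simp
        finally have "measure_pmf.prob (S.orbit_pmf (x k)) (- B) \<le> measure_pmf.prob (p k) (D j)" .
        moreover have "measure_pmf.prob (S.orbit_pmf (x k)) (- B) = 1 - measure_pmf.prob (S.orbit_pmf (x k)) B"
          using measure_pmf.prob_compl[of B "S.orbit_pmf (x k)"] by (simp add: Compl_eq_Diff_UNIV)
        ultimately show ?case using Be by simp
      qed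
      from ge[OF Dcl this] have "1 - \<epsilon> \<le> measure m (D j)" using Dc[of j] by (simp add: Int_absorb2)
      also have "\<dots> \<le> measure m (\<Union>j. D j)" by (rule finite_measure_mono) (use UD in auto)
      finally show ?thesis .
    qed
    have "1 \<le> measure m (\<Union>j. D j)"
    proof (rule field_le_epsilon)
      fix e :: real assume "0 < e"
      from le[OF this] show "1 \<le> measure m (\<Union>j. D j) + e" by linarith
    qed
    then have "measure m (\<Union>j. D j) = 1" using prob_le_1 by (intro antisym) auto
    then have "AE y in m. y \<in> (\<Union>j. D j)" using prob_eq_1[OF UD] by simp
    then show ?thesis unfolding D_def by eventually_elim blast
  qed
  have AE_Lam: "AE y in m. y \<in> \<Lambda>"
  proof -
    have "AE y in m. \<forall>N. \<exists>j. y \<in> deep_rays (real (Suc N)) (s j) E"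
      unfolding AE_all_countable by (intro allI AE_deep) simp
    then show ?thesis using AE_sphere AE_orbit
    proof eventually_elim
      case (elim y)
      have "\<exists>j. y \<in> deep_rays (real N) (1 - 1 / real (Suc j)) E" for N
      proof -
        obtain j where "y \<in> deep_rays (real (Suc N)) (s j) E" using elim(1) by blast
        then have "y \<in> deep_rays (real N) (s j) E"
          unfolding deep_rays_def using hyp_core_mono[of "real N" "real (Suc N)" E E] by auto
        then show ?thesis unfolding s_def by blast
      qed
      then have "is_endpoint E y" using is_endpoint_iff_deep_rays[OF E_open E_ball] elim(2) by blast
      moreover have "y \<in> limit_set S" using elim(2,3) unfolding S.limit_set_eq Cl_def by blast
      ultimately show ?case by (simp add: end_limit_points_def)
    qed
  qed
  have L: "\<Lambda> \<in> sets m" using bm[OF end_limit_points_borel] Lam_cball by (simp add: Int_absorb2)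
  have wm: "(\<lambda>y. ennreal (f y)) \<in> borel_measurable m" if "continuous_on (cball 0 1) f" for f :: "'a \<Rightarrow> real"
  proof -
    have "f \<in> borel_measurable m"
      using borel_measurable_continuous_on_restrict[OF that] measurable_cong_sets[OF sm refl] by blast
    then show ?thesis by measurable
  qed
  have conf: "\<gamma> ` B \<in> sets m \<and> emeasure m (\<gamma> ` B) = (\<integral>\<^sup>+y\<in>B. ennreal (deriv_norm \<gamma> y powr \<alpha>) \<partial>m)"
    if g: "\<gamma> \<in> S" and B: "B \<in> sets m" for \<gamma> B
  proof -
    define b where "b = ball_inv \<gamma> 0"
    have b: "b \<in> ball 0 1" unfolding b_def by (rule S.ball[OF S.inv_in[OF g]]) simp
    define J where "J y = poisson b y powr \<alpha>" for y
    have J: "continuous_on (cball 0 1) J"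
    proof -
      have "poisson b y \<noteq> 0" if "y \<in> cball 0 1" for y using poisson_pos[OF b that] by simp
      then show ?thesis unfolding J_def by (intro continuous_on_powr continuous_on_poisson[OF b] continuous_intros) auto
    qed
    have J0: "0 \<le> J y" for y by (simp add: J_def)
    have hc: "continuous_on (cball 0 1) (ball_inv \<gamma>)" by (rule hyp_isometry_continuous[OF S.isoD[OF S.inv_in[OF g]]])
    have h: "ball_inv \<gamma> \<in> measurable m m"
    proof -
      have "ball_inv \<gamma> \<in> measurable (restrict_space borel (cball 0 1)) (restrict_space borel (cball 0 1))"
        using S.cball[OF S.inv_in[OF g]]
        by (intro measurable_restrict_space2 borel_measurable_continuous_on_restrict[OF hc])
          (auto simp: space_restrict_space simp del: mem_cball mem_cball_0)
      then show ?thesis using measurable_cong_sets[OF sm sm] by blast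
    qed
    have "distr m m (ball_inv \<gamma>) = density m (\<lambda>y. ennreal (J y))"
    proof (rule measure_eqI_continuous)
      show "finite_measure (distr m m (ball_inv \<gamma>))" by (rule finite_measure_distr[OF h])
      have "bounded (J ` cball 0 1)" by (intro compact_imp_bounded compact_continuous_image J compact_cball)
      then obtain K where K: "\<And>y. y \<in> cball 0 1 \<Longrightarrow> norm (J y) \<le> K" unfolding bounded_iff by blast
      have "J y \<le> K" if "y \<in> space m" for y
        using that K[of y] unfolding sp real_norm_def by linarith
      then have "(\<integral>\<^sup>+y. ennreal (J y) \<partial>m) \<le> (\<integral>\<^sup>+y. ennreal K \<partial>m)"
        by (intro nn_integral_mono ennreal_leI)
      also have "\<dots> < \<infinity>" by (simp add: emeasure_space_1)
      finally show "finite_measure (density m (\<lambda>y. ennreal (J y)))"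
        using wm[OF J] by (intro finite_measureI) (simp add: emeasure_density cong: nn_integral_cong)
      show "sets (distr m m (ball_inv \<gamma>)) = sets (restrict_space borel (cball 0 1))"
        "sets (density m (\<lambda>y. ennreal (J y))) = sets (restrict_space borel (cball 0 1))" by (simp_all add: sm)
      fix f :: "'a \<Rightarrow> real" assume f: "continuous_on (cball 0 1) f"
      have fm: "f \<in> borel_measurable m" and Jm: "J \<in> borel_measurable m"
        using borel_measurable_continuous_on_restrict f J measurable_cong_sets[OF sm refl] by blast+
      have fh: "continuous_on (cball 0 1) (\<lambda>y. f (ball_inv \<gamma> y))"
        by (rule continuous_on_compose2[OF f hc]) (use S.cball[OF S.inv_in[OF g]] in blast)
      have "measure_pmf.expectation (p k) (\<lambda>y. f (ball_inv \<gamma> y)) = measure_pmf.expectation (p k) (\<lambda>y. f y * J y)" for k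
        unfolding p_def integral_map_pmf J_def b_def by (rule S.expectation_translate[OF xb g])
      then have "(\<lambda>k. measure_pmf.expectation (p (r k)) (\<lambda>y. f (ball_inv \<gamma> y))) \<longlonglongrightarrow> (\<integral>y. f y * J y \<partial>m)"
        using lim[OF continuous_on_mult[OF f J]] by simp
      then have "(\<integral>y. f (ball_inv \<gamma> y) \<partial>m) = (\<integral>y. f y * J y \<partial>m)"
        by (rule LIMSEQ_unique[OF lim[OF fh]])
      moreover have "(\<integral>y. f y \<partial>distr m m (ball_inv \<gamma>)) = (\<integral>y. f (ball_inv \<gamma> y) \<partial>m)"
        by (rule integral_distr[OF h fm])
      moreover have "(\<integral>y. f y \<partial>density m (\<lambda>y. ennreal (J y))) = (\<integral>y. f y * J y \<partial>m)"
        using integral_density[OF fm Jm] J0 by (simp add: mult.commute)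
      ultimately show "(\<integral>y. f y \<partial>distr m m (ball_inv \<gamma>)) = (\<integral>y. f y \<partial>density m (\<lambda>y. ennreal (J y)))" by simp
    qed
    then have "emeasure (distr m m (ball_inv \<gamma>)) B = emeasure (density m (\<lambda>y. ennreal (J y))) B" by simp
    then have "emeasure m (ball_inv \<gamma> -` B \<inter> space m) = (\<integral>\<^sup>+y\<in>B. ennreal (J y) \<partial>m)"
      using h B wm[OF J] by (simp add: emeasure_distr emeasure_density)
    moreover have "(\<integral>\<^sup>+y\<in>B. ennreal (J y) \<partial>m) = (\<integral>\<^sup>+y\<in>B. ennreal (deriv_norm \<gamma> y powr \<alpha>) \<partial>m)"
    proof (rule nn_integral_cong_AE)
      show "AE y in m. ennreal (J y) * indicator B y = ennreal (deriv_norm \<gamma> y powr \<alpha>) * indicator B y"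
        using AE_sphere by eventually_elim (simp only: J_def b_def S.poisson_sphere[OF g])
    qed
    moreover have "ball_inv \<gamma> -` B \<inter> space m = \<gamma> ` B"
    proof -
      have Bc: "B \<subseteq> cball 0 1" using sets.sets_into_space[OF B] sp by simp
      show ?thesis unfolding S.image_eq_vimage[OF g Bc] sp by blast
    qed
    ultimately show ?thesis using measurable_sets[OF h B] by simp
  qed
  have cm: "m \<in> conformal_measures \<alpha> S (cball 0 1)"
    unfolding conformal_measures_def using finite_measure_axioms sp sm conf by simp
  show thesis
  proof (rule that)
    show "restrict_space m \<Lambda> \<in> conformal_measures \<alpha> S \<Lambda>"
      by (rule conformal_restrict[OF cm order_refl L]) (rule end_limit_points_stab)
    show "nontrivial_measure (restrict_space m \<Lambda>)"
      using emeasure_eq_1_AE[OF L AE_Lam] emeasure_restrict_subset[OF L order_refl]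
      by (simp add: nontrivial_measure_def space_restrict_space2[OF L])
  qed
qed

end

section \<open>Decomposition of conformal measures\<close>

lemma measurable_sum_measure:
  fixes f :: "'a \<Rightarrow> ennreal"
  assumes "\<And>i. i \<in> I \<Longrightarrow> space (\<nu> i) \<subseteq> B" and f: "f \<in> borel_measurable (sum_measure B I \<nu>)" and i: "i \<in> I"
  shows "f \<in> borel_measurable (\<nu> i)"
proof (rule measurableI)
  fix U :: "ennreal set" assume "U \<in> sets borel"
  then have "f -` U \<inter> B \<in> sets (sum_measure B I \<nu>)" using measurable_sets[OF f] by simp
  then have "f -` U \<inter> B \<inter> space (\<nu> i) \<in> sets (\<nu> i)" using i by (simp add: sets_sum_measure[OF assms(1)])
  also have "f -` U \<inter> B \<inter> space (\<nu> i) = f -` U \<inter> space (\<nu> i)" using assms(1)[OF i] by blast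
  finally show "f -` U \<inter> space (\<nu> i) \<in> sets (\<nu> i)" .
qed simp

lemma nn_integral_sum_measure:
  fixes f :: "'a \<Rightarrow> ennreal"
  assumes I: "finite I" and sub: "\<And>i. i \<in> I \<Longrightarrow> space (\<nu> i) \<subseteq> B" and f: "f \<in> borel_measurable (sum_measure B I \<nu>)"
  shows "(\<integral>\<^sup>+x. f x \<partial>sum_measure B I \<nu>) = (\<Sum>i\<in>I. \<integral>\<^sup>+x. f x \<partial>\<nu> i)"
  using f
proof (induction rule: borel_measurable_induct)
  case (cong f g)
  have "(\<integral>\<^sup>+x. f x \<partial>sum_measure B I \<nu>) = (\<integral>\<^sup>+x. g x \<partial>sum_measure B I \<nu>)"
    by (intro nn_integral_cong cong) simp
  moreover have "(\<integral>\<^sup>+x. f x \<partial>\<nu> i) = (\<integral>\<^sup>+x. g x \<partial>\<nu> i)" if "i \<in> I" for i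
    using sub[OF that] by (intro nn_integral_cong cong) auto
  ultimately show ?case using cong by simp
next
  case (set A)
  have "(\<integral>\<^sup>+x. indicator A x \<partial>\<nu> i) = emeasure (\<nu> i) (A \<inter> space (\<nu> i))" if "i \<in> I" for i
  proof -
    have "A \<inter> space (\<nu> i) \<in> sets (\<nu> i)" using set that by (simp add: sets_sum_measure[OF sub])
    from nn_integral_indicator[OF this] show ?thesis
      by (metis (no_types, lifting) Int_commute indicator_inter_arith mult.right_neutral indicator_simps(1) nn_integral_cong)
  qed
  then show ?case using set by (simp add: emeasure_sum_measure[OF sub])
next
  case (mult u c)
  then show ?case
    using measurable_sum_measure[OF sub mult(2)] by (simp add: nn_integral_cmult sum_distrib_left)
next
  case (add u v)
  then show ?case
    using measurable_sum_measure[OF sub add(1)] measurable_sum_measure[OF sub add(3)]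
    by (simp add: nn_integral_add sum.distrib)
next
  case (seq U)
  have m: "U n \<in> borel_measurable (\<nu> i)" if "i \<in> I" for i n by (rule measurable_sum_measure[OF sub seq(1) that])
  have "(\<integral>\<^sup>+x. (SUP n. U n) x \<partial>sum_measure B I \<nu>) = (SUP n. \<integral>\<^sup>+x. U n x \<partial>sum_measure B I \<nu>)"
    unfolding SUP_apply by (rule nn_integral_monotone_convergence_SUP[OF seq(3) seq(1)])
  also have "\<dots> = (SUP n. \<Sum>i\<in>I. \<integral>\<^sup>+x. U n x \<partial>\<nu> i)" by (simp only: seq(5))
  also have "\<dots> = (\<Sum>i\<in>I. SUP n. \<integral>\<^sup>+x. U n x \<partial>\<nu> i)"
  proof (rule ennreal_SUP_sum)
    show "incseq (\<lambda>n. \<integral>\<^sup>+x. U n x \<partial>\<nu> i)" for i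
      using seq(3) by (auto simp: incseq_def le_fun_def intro!: nn_integral_mono)
  qed
  also have "\<dots> = (\<Sum>i\<in>I. \<integral>\<^sup>+x. (SUP n. U n) x \<partial>\<nu> i)"
    unfolding SUP_apply by (intro sum.cong refl nn_integral_monotone_convergence_SUP[OF seq(3) m, symmetric])
  finally show ?case .
qed

lemma (in hyp_group) conformal_sum_measure:
  assumes I: "finite I" and nu: "\<And>i. i \<in> I \<Longrightarrow> \<nu> i \<in> conformal_measures \<alpha> G (A i)" and sub: "\<And>i. i \<in> I \<Longrightarrow> A i \<subseteq> B"
    and B: "B \<subseteq> cball 0 1" and inv: "\<And>\<gamma> x. \<gamma> \<in> G \<Longrightarrow> x \<in> B \<Longrightarrow> \<gamma> x \<in> B"
  shows "sum_measure B I \<nu> \<in> conformal_measures \<alpha> G B"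
proof -
  note cn = conformal_measuresD[OF nu]
  have sp: "space (\<nu> i) \<subseteq> B" if "i \<in> I" for i using cn(2)[OF that] sub[OF that] by simp
  note sets = sets_sum_measure[OF sp]
  have bor: "sets (restrict_space borel B) \<subseteq> sets (sum_measure B I \<nu>)"
  proof
    fix X assume "X \<in> sets (restrict_space borel B)"
    then obtain U where U: "U \<in> sets borel" "X = B \<inter> U" by (auto simp: sets_restrict_space)
    have "X \<inter> space (\<nu> i) \<in> sets (\<nu> i)" if "i \<in> I" for i
    proof -
      have "X \<inter> space (\<nu> i) = A i \<inter> U" using U(2) cn(2)[OF that] sub[OF that] by auto
      then show ?thesis using cn(4)[OF that U(1)] by simp
    qed
    then show "X \<in> sets (sum_measure B I \<nu>)" using U(2) by (simp add: sets)
  qed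
  have cut: "\<gamma> ` X \<inter> space (\<nu> i) = \<gamma> ` (X \<inter> space (\<nu> i))" if g: "\<gamma> \<in> G" and i: "i \<in> I" and X: "X \<subseteq> B" for \<gamma> i X
  proof -
    have st: "\<delta> ` A i \<subseteq> A i" if "\<delta> \<in> G" for \<delta>
      using sets.sets_into_space[OF cn(5)[OF i that sets.top]] cn(2)[OF i] by simp
    have "x \<in> A i" if "x \<in> X" "\<gamma> x \<in> A i" for x
    proof -
      have "ball_inv \<gamma> (\<gamma> x) \<in> A i" using st[OF inv_in[OF g]] that(2) by blast
      moreover have "x \<in> cball 0 1" using that(1) X B by blast
      ultimately show ?thesis using inv_left[OF g] by simp
    qed
    then show ?thesis using st[OF g] cn(2)[OF i] by auto
  qed
  show ?thesis
    unfolding conformal_measures_def mem_Collect_eq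
  proof (intro conjI ballI)
    show "finite_measure (sum_measure B I \<nu>)"
    proof (rule finite_measureI)
      have "emeasure (sum_measure B I \<nu>) (space (sum_measure B I \<nu>)) = (\<Sum>i\<in>I. emeasure (\<nu> i) (B \<inter> space (\<nu> i)))"
        using emeasure_sum_measure[OF sp sets.top] by simp
      also have "\<dots> < \<infinity>"
        using I finite_measure.emeasure_finite[OF cn(1)] by (simp add: less_top[symmetric])
      finally show "emeasure (sum_measure B I \<nu>) (space (sum_measure B I \<nu>)) \<noteq> \<infinity>" by simp
    qed
    show "sets (restrict_space borel B) \<subseteq> sets (sum_measure B I \<nu>)" by (rule bor)
    fix \<gamma> X assume g: "\<gamma> \<in> G" and X: "X \<in> sets (sum_measure B I \<nu>)"
    have XB: "X \<subseteq> B" using X by (simp add: sets)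
    have Xi: "X \<inter> space (\<nu> i) \<in> sets (\<nu> i)" if "i \<in> I" for i using X that by (simp add: sets)
    have "\<gamma> ` X \<subseteq> B" using inv[OF g] XB by blast
    moreover have "\<gamma> ` X \<inter> space (\<nu> i) \<in> sets (\<nu> i)" if "i \<in> I" for i
      unfolding cut[OF g that XB] by (rule cn(5)[OF that g Xi[OF that]])
    ultimately show gX: "\<gamma> ` X \<in> sets (sum_measure B I \<nu>)" by (simp add: sets)
    have "deriv_norm \<gamma> \<in> borel_measurable (restrict_space borel B)"
      by (intro borel_measurable_continuous_on_restrict continuous_on_subset[OF continuous_on_deriv_norm[OF isoD[OF g]] B])
    then have "deriv_norm \<gamma> \<in> borel_measurable (sum_measure B I \<nu>)"
      using bor measurable_mono[OF order_refl refl bor] by (auto simp: space_restrict_space)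
    then have w: "(\<lambda>x. ennreal (deriv_norm \<gamma> x powr \<alpha>) * indicator X x) \<in> borel_measurable (sum_measure B I \<nu>)"
      using X by measurable
    have "emeasure (sum_measure B I \<nu>) (\<gamma> ` X) = (\<Sum>i\<in>I. emeasure (\<nu> i) (\<gamma> ` X \<inter> space (\<nu> i)))"
      by (rule emeasure_sum_measure[OF sp gX])
    also have "\<dots> = (\<Sum>i\<in>I. \<integral>\<^sup>+x\<in>X. ennreal (deriv_norm \<gamma> x powr \<alpha>) \<partial>\<nu> i)"
    proof (rule sum.cong[OF refl])
      fix i assume i: "i \<in> I"
      have "emeasure (\<nu> i) (\<gamma> ` X \<inter> space (\<nu> i)) = (\<integral>\<^sup>+x\<in>X \<inter> space (\<nu> i). ennreal (deriv_norm \<gamma> x powr \<alpha>) \<partial>\<nu> i)"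
        unfolding cut[OF g i XB] by (rule cn(6)[OF i g Xi[OF i]])
      also have "\<dots> = (\<integral>\<^sup>+x\<in>X. ennreal (deriv_norm \<gamma> x powr \<alpha>) \<partial>\<nu> i)"
        by (intro nn_integral_cong) (auto split: split_indicator)
      finally show "emeasure (\<nu> i) (\<gamma> ` X \<inter> space (\<nu> i)) = (\<integral>\<^sup>+x\<in>X. ennreal (deriv_norm \<gamma> x powr \<alpha>) \<partial>\<nu> i)" .
    qed
    also have "\<dots> = (\<integral>\<^sup>+x\<in>X. ennreal (deriv_norm \<gamma> x powr \<alpha>) \<partial>sum_measure B I \<nu>)"
      by (rule nn_integral_sum_measure[OF I sp w, symmetric])
    finally show "emeasure (sum_measure B I \<nu>) (\<gamma> ` X) = (\<integral>\<^sup>+x\<in>X. ennreal (deriv_norm \<gamma> x powr \<alpha>) \<partial>sum_measure B I \<nu>)" .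
  qed (use B in auto)
qed

lemma mutually_singular_disjoint:
  assumes "space m \<inter> space m' = {}"
  shows "mutually_singular m m'"
  unfolding mutually_singular_def using assms by (intro exI[of _ "space m'"]) (simp add: Int_commute)

locale end_collection = complete_end_collection \<Gamma> q E F + poincare_group \<Gamma> \<alpha> for \<Gamma> q E F \<alpha>
begin

abbreviation "\<Lambda>e i \<equiv> end_limit_points \<Gamma> (E i)"
abbreviation "Orbe i \<equiv> end_limit_orbit \<Gamma> (E i)"
abbreviation "Ext i \<equiv> conformal_extension \<alpha> \<Gamma> (E i)"

lemma conformal_end: "i \<in> {1..q} \<Longrightarrow> conformal_end \<Gamma> (F i) (E i) \<alpha>"
  by (intro conformal_end.intro preimage_component poincare_group_axioms)

lemma Orb_limit_set: "i \<in> {1..q} \<Longrightarrow> Orbe i \<subseteq> limit_set \<Gamma>"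
  using limit_set_image preimage_component.end_limit_pointsD(1)[OF preimage_component]
  unfolding end_limit_orbit_def by blast

context
  fixes \<mu>
  assumes mu: "\<mu> \<in> conformal_measures \<alpha> \<Gamma> (limit_set \<Gamma>)"
begin

lemmas cmu = conformal_measuresD[OF mu]

lemma Lam_sets: "i \<in> {1..q} \<Longrightarrow> \<Lambda>e i \<in> sets \<mu>"
proof -
  assume i: "i \<in> {1..q}"
  interpret conformal_end \<Gamma> "F i" "E i" \<alpha> by (rule conformal_end[OF i])
  have "limit_set \<Gamma> \<inter> \<Lambda>e i = \<Lambda>e i" using end_limit_pointsD(1) by blast
  then show ?thesis using cmu(4)[OF end_limit_points_borel] by simp
qed

lemma Orb_sets: "i \<in> {1..q} \<Longrightarrow> Orbe i \<in> sets \<mu>"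
  unfolding end_limit_orbit_def using cmu(5) Lam_sets countable_group by (intro sets.countable_UN'') auto

lemma restrict_Lam:
  assumes i: "i \<in> {1..q}"
  shows "restrict_space \<mu> (\<Lambda>e i) \<in> conformal_measures \<alpha> (set_stab \<Gamma> (E i)) (\<Lambda>e i)"
proof -
  interpret conformal_end \<Gamma> "F i" "E i" \<alpha> by (rule conformal_end[OF i])
  show ?thesis by (rule conformal_restrict[OF mu stab_subset Lam_sets[OF i]]) (rule end_limit_points_stab)
qed

lemma ext_restrict_Lam:
  assumes i: "i \<in> {1..q}"
  shows "Ext i (restrict_space \<mu> (\<Lambda>e i)) = restrict_space \<mu> (Orbe i)"
proof -
  interpret conformal_end \<Gamma> "F i" "E i" \<alpha> by (rule conformal_end[OF i])
  have "restrict_space (restrict_space \<mu> (Orbe i)) (\<Lambda>e i) = restrict_space \<mu> (Orbe i \<inter> \<Lambda>e i)"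
    using Orb_sets[OF i] Lam_sets[OF i] by (intro restrict_restrict_space) auto
  also have "Orbe i \<inter> \<Lambda>e i = \<Lambda>e i" using Lam_Orb by blast
  finally have eq: "restrict_space (restrict_space \<mu> (Orbe i)) (\<Lambda>e i) = restrict_space \<mu> (\<Lambda>e i)" .
  have "restrict_space \<mu> (Orbe i) \<in> conformal_measures \<alpha> \<Gamma> (Orbe i)"
    by (rule conformal_restrict[OF mu order_refl Orb_sets[OF i]]) (rule Orb_image)
  from conformal_extension_unique[OF this] show ?thesis using restrict_Lam[OF i] by (simp only: eq)
qed

lemma emeasure_decomposition:
  assumes p: "p \<le> q" and ne: "\<And>i. i \<in> {1..q} \<Longrightarrow> \<Lambda>e i \<noteq> {} \<Longrightarrow> i \<le> p" and B: "B \<in> sets \<mu>"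
  shows "emeasure \<mu> B = (\<Sum>i\<in>{1..p}. emeasure \<mu> (B \<inter> Orbe i))"
proof -
  have pq: "i \<in> {1..q}" if "i \<in> {1..p}" for i using that p by simp
  have "AE z in \<mu>. z \<in> (\<Union>i\<in>{1..p}. Orbe i)"
    using AE_not_conical[OF mu limit_set_sphere] AE_space
  proof eventually_elim
    case (elim z)
    then have "z \<in> limit_set \<Gamma>" using cmu(2) by simp
    from nonconical_limit_point[OF this elim(1)] obtain i \<gamma> w where
      w: "i \<in> {1..q}" "\<gamma> \<in> \<Gamma>" "w \<in> \<Lambda>e i" "z = \<gamma> w" by blast
    then have "i \<in> {1..p}" using ne by auto
    then show ?case using w unfolding end_limit_orbit_def by blast
  qed
  then have "AE z in \<mu>. z \<in> B \<longleftrightarrow> z \<in> (\<Union>i\<in>{1..p}. B \<inter> Orbe i)" by eventually_elim blast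
  then have "emeasure \<mu> B = emeasure \<mu> (\<Union>i\<in>{1..p}. B \<inter> Orbe i)"
    using B Orb_sets pq by (intro emeasure_eq_AE) auto
  also have "\<dots> = (\<Sum>i\<in>{1..p}. emeasure \<mu> (B \<inter> Orbe i))"
  proof (rule sum_emeasure[symmetric])
    show "(\<lambda>i. B \<inter> Orbe i) ` {1..p} \<subseteq> sets \<mu>" using B Orb_sets pq by blast
    show "disjoint_family_on (\<lambda>i. B \<inter> Orbe i) {1..p}"
      unfolding disjoint_family_on_def using end_limit_orbit_disjoint pq by blast
  qed simp
  finally show ?thesis .
qed

end

lemma ext_conformal:
  assumes i: "i \<in> {1..q}" and m: "m \<in> conformal_measures \<alpha> (set_stab \<Gamma> (E i)) (\<Lambda>e i)"
  shows "Ext i m \<in> conformal_measures \<alpha> \<Gamma> (Orbe i)" "space (Ext i m) = Orbe i" "restrict_space (Ext i m) (\<Lambda>e i) = m"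
proof -
  interpret conformal_end \<Gamma> "F i" "E i" \<alpha> by (rule conformal_end[OF i])
  show "Ext i m \<in> conformal_measures \<alpha> \<Gamma> (Orbe i)" "restrict_space (Ext i m) (\<Lambda>e i) = m"
    by (rule conformal_extension[OF m])+
  then show "space (Ext i m) = Orbe i" using conformal_measuresD(2) by blast
qed

lemma nontrivial_ext:
  assumes i: "i \<in> {1..q}" and m: "m \<in> conformal_measures \<alpha> (set_stab \<Gamma> (E i)) (\<Lambda>e i)" and nt: "nontrivial_measure m"
  shows "emeasure (Ext i m) (Orbe i) \<noteq> 0"
proof -
  interpret conformal_end \<Gamma> "F i" "E i" \<alpha> by (rule conformal_end[OF i])
  note e = ext_conformal[OF i m]
  have "Orbe i \<inter> \<Lambda>e i = \<Lambda>e i" using Lam_Orb by blast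
  then have L: "\<Lambda>e i \<in> sets (Ext i m)" using conformal_measuresD(4)[OF e(1) end_limit_points_borel] by simp
  have "emeasure m (\<Lambda>e i) = emeasure (Ext i m) (\<Lambda>e i)"
    using emeasure_restrict_subset[OF L order_refl] e(3) by simp
  also have "\<dots> \<le> emeasure (Ext i m) (Orbe i)"
    using Lam_Orb sets.top[of "Ext i m"] e(2) by (intro emeasure_mono) auto
  finally show ?thesis using nt conformal_measuresD(2)[OF m] by (auto simp: nontrivial_measure_def)
qed

lemma sum_ext_conformal:
  assumes "I \<subseteq> {1..q}" "\<And>i. i \<in> I \<Longrightarrow> m i \<in> conformal_measures \<alpha> (set_stab \<Gamma> (E i)) (\<Lambda>e i)"
  shows "sum_measure (limit_set \<Gamma>) I (\<lambda>i. Ext i (m i)) \<in> conformal_measures \<alpha> \<Gamma> (limit_set \<Gamma>)"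
proof (rule conformal_sum_measure)
  show "finite I" using assms(1) finite_subset by blast
  show "Ext i (m i) \<in> conformal_measures \<alpha> \<Gamma> (Orbe i)" if "i \<in> I" for i using ext_conformal(1) assms that by blast
  show "Orbe i \<subseteq> limit_set \<Gamma>" if "i \<in> I" for i using Orb_limit_set assms(1) that by blast
qed (rule limit_set_cball limit_set_image; assumption?)+

end

theorem theorem4p6:
  fixes \<Gamma> :: "(real ^ 'n \<Rightarrow> real ^ 'n) set" and \<alpha> :: real
    and E :: "nat \<Rightarrow> (real ^ 'n) set" and p q :: nat
  assumes "CARD('n) \<ge> 2"
    and "kleinian \<Gamma>" and "\<not> elementary \<Gamma>"
    and "\<alpha> > 0" and "poincare_converges \<Gamma> \<alpha>"
    and "complete_ends \<Gamma> q E"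
    and "p \<le> q" and "\<forall>i\<in>{1..q}. end_limit_points \<Gamma> (E i) \<noteq> {} \<longleftrightarrow> i \<le> p"
  defines "\<M> \<equiv> conformal_measures \<alpha> \<Gamma> (limit_set \<Gamma>)"
    and "\<M>i \<equiv> \<lambda>i. conformal_measures \<alpha> (set_stab \<Gamma> (E i)) (end_limit_points \<Gamma> (E i))"
    and "ext \<equiv> \<lambda>i. conformal_extension \<alpha> \<Gamma> (E i)"
  shows
    "(\<forall>\<mu>\<in>\<M>. \<forall>\<mu>i. (\<forall>i\<in>{1..p}. \<mu>i i = restrict_space \<mu> (end_limit_points \<Gamma> (E i))) \<longrightarrow>
        (\<forall>i\<in>{1..p}. \<mu>i i \<in> \<M>i i) \<and>
        sets \<mu> \<subseteq> sets (sum_measure (limit_set \<Gamma>) {1..p} (\<lambda>i. ext i (\<mu>i i))) \<and>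
        (\<forall>B\<in>sets \<mu>. emeasure \<mu> B =
            emeasure (sum_measure (limit_set \<Gamma>) {1..p} (\<lambda>i. ext i (\<mu>i i))) B) \<and>
        (\<forall>i\<in>{1..p}. \<forall>j\<in>{1..p}. i \<noteq> j \<longrightarrow>
            nontrivial_measure (ext i (\<mu>i i)) \<longrightarrow> nontrivial_measure (ext j (\<mu>i j)) \<longrightarrow>
            mutually_singular (ext i (\<mu>i i)) (ext j (\<mu>i j))))
     \<and> (\<forall>\<mu>i. (\<forall>i\<in>{1..p}. \<mu>i i \<in> \<M>i i) \<longrightarrow>
          sum_measure (limit_set \<Gamma>) {1..p} (\<lambda>i. ext i (\<mu>i i)) \<in> \<M>)
     \<and> (\<forall>i\<in>{1..p}. \<exists>m\<in>\<M>i i. nontrivial_measure m)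
     \<and> (\<exists>\<nu>. (\<forall>i\<in>{1..p}. \<nu> i \<in> \<M> \<and> nontrivial_measure (\<nu> i)) \<and>
          (\<forall>i\<in>{1..p}. \<forall>j\<in>{1..p}. i \<noteq> j \<longrightarrow> mutually_singular (\<nu> i) (\<nu> j)))"
proof -
  obtain F where F: "inj_on F {1..q}" "complete_ends_of_M \<Gamma> (F ` {1..q})"
    "\<And>i. i \<in> {1..q} \<Longrightarrow> E i \<in> components {x \<in> ball 0 1. group_orbit \<Gamma> x \<in> F i}"
    using assms(6) unfolding complete_ends_def by blast
  interpret hyp_group \<Gamma>
    by (rule hyp_group.intro) (use assms(2) in \<open>simp_all add: kleinian_def\<close>)
  interpret end_collection \<Gamma> q E F \<alpha>
    by unfold_locales (fact assms F)+
  have pq: "i \<in> {1..q}" if "i \<in> {1..p}" for i using that assms(7) by simp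
  have ne: "i \<le> p" if "i \<in> {1..q}" "\<Lambda>e i \<noteq> {}" for i using assms(8) that by blast
  have nt: "\<exists>m\<in>\<M>i i. nontrivial_measure m" if i: "i \<in> {1..p}" for i
  proof -
    interpret conformal_end \<Gamma> "F i" "E i" \<alpha> by (rule conformal_end[OF pq[OF i]])
    obtain z where "z \<in> \<Lambda>e i" using assms(8) pq[OF i] i by fastforce
    then show ?thesis unfolding \<M>i_def using nontrivial_conformal_measure by metis
  qed
  have disj: "Orbe i \<inter> Orbe j = {}" if "i \<in> {1..p}" "j \<in> {1..p}" "i \<noteq> j" for i j
    using end_limit_orbit_disjoint pq that by blast
  have one: "(\<forall>i\<in>{1..p}. \<mu>i i \<in> \<M>i i) \<and>
        sets \<mu> \<subseteq> sets (sum_measure (limit_set \<Gamma>) {1..p} (\<lambda>i. ext i (\<mu>i i))) \<and>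
        (\<forall>B\<in>sets \<mu>. emeasure \<mu> B =
            emeasure (sum_measure (limit_set \<Gamma>) {1..p} (\<lambda>i. ext i (\<mu>i i))) B) \<and>
        (\<forall>i\<in>{1..p}. \<forall>j\<in>{1..p}. i \<noteq> j \<longrightarrow>
            nontrivial_measure (ext i (\<mu>i i)) \<longrightarrow> nontrivial_measure (ext j (\<mu>i j)) \<longrightarrow>
            mutually_singular (ext i (\<mu>i i)) (ext j (\<mu>i j)))"
    if mu: "\<mu> \<in> \<M>" and mi: "\<forall>i\<in>{1..p}. \<mu>i i = restrict_space \<mu> (\<Lambda>e i)" for \<mu> \<mu>i
  proof -
    note mu = mu[unfolded \<M>_def]
    have e: "ext i (\<mu>i i) = restrict_space \<mu> (Orbe i)" if i: "i \<in> {1..p}" for i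
      unfolding ext_def mi[rule_format, OF i] by (rule ext_restrict_Lam[OF mu pq[OF i]])
    have O: "Orbe i \<in> sets \<mu>" if "i \<in> {1..p}" for i by (rule Orb_sets[OF mu pq[OF that]])
    have spe: "space (ext i (\<mu>i i)) = Orbe i" if i: "i \<in> {1..p}" for i
      unfolding e[OF i] by (rule space_restrict_space2[OF O[OF i]])
    have sub: "space (ext i (\<mu>i i)) \<subseteq> limit_set \<Gamma>" if "i \<in> {1..p}" for i
      using spe[OF that] Orb_limit_set[OF pq[OF that]] by simp
    have sets: "sets \<mu> \<subseteq> sets (sum_measure (limit_set \<Gamma>) {1..p} (\<lambda>i. ext i (\<mu>i i)))"
    proof
      fix B assume B: "B \<in> sets \<mu>"
      have "B \<inter> Orbe i \<in> sets (ext i (\<mu>i i))" if i: "i \<in> {1..p}" for i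
        unfolding e[OF i] sets_restrict_space_subset[OF O[OF i]] using B O[OF i] by blast
      then show "B \<in> sets (sum_measure (limit_set \<Gamma>) {1..p} (\<lambda>i. ext i (\<mu>i i)))"
        using sets.sets_into_space[OF B] conformal_measuresD(2)[OF mu] spe
        by (subst sets_sum_measure) (use sub in auto)
    qed
    moreover have "emeasure \<mu> B = emeasure (sum_measure (limit_set \<Gamma>) {1..p} (\<lambda>i. ext i (\<mu>i i))) B"
      if B: "B \<in> sets \<mu>" for B
    proof -
      have "emeasure \<mu> B = (\<Sum>i\<in>{1..p}. emeasure \<mu> (B \<inter> Orbe i))"
        by (rule emeasure_decomposition[OF mu assms(7) ne B])
      also have "\<dots> = (\<Sum>i\<in>{1..p}. emeasure (ext i (\<mu>i i)) (B \<inter> space (ext i (\<mu>i i))))"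
      proof (rule sum.cong[OF refl])
        fix i assume i: "i \<in> {1..p}"
        show "emeasure \<mu> (B \<inter> Orbe i) = emeasure (ext i (\<mu>i i)) (B \<inter> space (ext i (\<mu>i i)))"
          unfolding spe[OF i] unfolding e[OF i] by (rule emeasure_restrict_subset[OF O[OF i] Int_lower2, symmetric])
      qed
      also have "\<dots> = emeasure (sum_measure (limit_set \<Gamma>) {1..p} (\<lambda>i. ext i (\<mu>i i))) B"
        by (rule emeasure_sum_measure[OF sub, symmetric]) (use sets B in auto)
      finally show ?thesis .
    qed
    moreover have "\<mu>i i \<in> \<M>i i" if i: "i \<in> {1..p}" for i
      unfolding \<M>i_def mi[rule_format, OF i] by (rule restrict_Lam[OF mu pq[OF i]])
    moreover have "mutually_singular (ext i (\<mu>i i)) (ext j (\<mu>i j))" if "i \<in> {1..p}" "j \<in> {1..p}" "i \<noteq> j" for i j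
      using mutually_singular_disjoint[of "ext i (\<mu>i i)" "ext j (\<mu>i j)"] spe disj that by simp
    ultimately show ?thesis by blast
  qed
  have two: "sum_measure (limit_set \<Gamma>) {1..p} (\<lambda>i. ext i (\<mu>i i)) \<in> \<M>" if "\<forall>i\<in>{1..p}. \<mu>i i \<in> \<M>i i" for \<mu>i
    using that pq sum_ext_conformal[of "{1..p}" \<mu>i] unfolding \<M>_def \<M>i_def ext_def by blast
  obtain m where m: "\<And>i. i \<in> {1..p} \<Longrightarrow> m i \<in> \<M>i i" "\<And>i. i \<in> {1..p} \<Longrightarrow> nontrivial_measure (m i)"
    using nt by metis
  define \<nu> where "\<nu> i = sum_measure (limit_set \<Gamma>) {i} (\<lambda>i. ext i (m i))" for i
  have spe: "space (ext i (m i)) = Orbe i" if "i \<in> {1..p}" for i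
    using ext_conformal(2)[OF pq[OF that]] m(1)[OF that] unfolding \<M>i_def ext_def by blast
  have sub: "space (ext j (m j)) \<subseteq> limit_set \<Gamma>" if "i \<in> {1..p}" "j \<in> {i}" for i j
    using that spe Orb_limit_set[OF pq] by auto
  have nu: "\<nu> i \<in> \<M>" if "i \<in> {1..p}" for i
    using that pq m(1) sum_ext_conformal[of "{i}" m] unfolding \<nu>_def \<M>_def \<M>i_def ext_def by blast
  have nus: "B \<in> sets (\<nu> i) \<longleftrightarrow> B \<subseteq> limit_set \<Gamma> \<and> B \<inter> Orbe i \<in> sets (ext i (m i))" if i: "i \<in> {1..p}" for B i
    unfolding \<nu>_def using spe[OF i] by (subst sets_sum_measure) (use sub[OF i] in auto)
  have nue: "emeasure (\<nu> i) B = emeasure (ext i (m i)) (B \<inter> Orbe i)" if i: "i \<in> {1..p}" and B: "B \<in> sets (\<nu> i)" for B i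
    using emeasure_sum_measure[where I = "{i}" and \<nu> = "\<lambda>i. ext i (m i)" and A = "limit_set \<Gamma>", OF sub[OF i]] B spe[OF i]
    unfolding \<nu>_def by simp
  have spn: "space (\<nu> i) = limit_set \<Gamma>" for i by (simp add: \<nu>_def)
  have OL: "Orbe i \<subseteq> limit_set \<Gamma>" if "i \<in> {1..p}" for i by (rule Orb_limit_set[OF pq[OF that]])
  have "nontrivial_measure (\<nu> i)" if i: "i \<in> {1..p}" for i
  proof -
    have "emeasure (\<nu> i) (space (\<nu> i)) = emeasure (ext i (m i)) (Orbe i)"
      using nue[OF i sets.top] OL[OF i] by (simp add: spn Int_absorb1)
    then show ?thesis
      using nontrivial_ext[OF pq[OF i] _ m(2)[OF i]] m(1)[OF i] unfolding nontrivial_measure_def \<M>i_def ext_def by simp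
  qed
  moreover have "mutually_singular (\<nu> i) (\<nu> j)" if ij: "i \<in> {1..p}" "j \<in> {1..p}" "i \<noteq> j" for i j
    unfolding mutually_singular_def
  proof (intro exI conjI)
    have Oj: "Orbe j \<inter> limit_set \<Gamma> = Orbe j" using OL[OF ij(2)] by blast
    have "Orbe j \<inter> Orbe i = {}" using disj[OF ij] by blast
    then show 1: "Orbe j \<inter> space (\<nu> i) \<in> sets (\<nu> i)" unfolding spn nus[OF ij(1)] Oj using OL[OF ij(2)] by simp
    show 2: "Orbe j \<inter> space (\<nu> j) \<in> sets (\<nu> j)"
      unfolding spn nus[OF ij(2)] Oj using OL[OF ij(2)] sets.top[of "ext j (m j)"] spe[OF ij(2)] by simp
    show "emeasure (\<nu> i) (Orbe j \<inter> space (\<nu> i)) = 0"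
      unfolding nue[OF ij(1) 1] using \<open>Orbe j \<inter> Orbe i = {}\<close> by (simp add: spn Oj)
    have "space (\<nu> j) - Orbe j \<in> sets (\<nu> j)"
      using sets.compl_sets[OF 2] by (simp add: spn Oj)
    from nue[OF ij(2) this] show "emeasure (\<nu> j) (space (\<nu> j) - Orbe j) = 0"
      by (simp only: Diff_disjoint Int_commute[of _ "Orbe j"] emeasure_empty)
  qed
  ultimately have three: "\<exists>\<nu>. (\<forall>i\<in>{1..p}. \<nu> i \<in> \<M> \<and> nontrivial_measure (\<nu> i)) \<and>
      (\<forall>i\<in>{1..p}. \<forall>j\<in>{1..p}. i \<noteq> j \<longrightarrow> mutually_singular (\<nu> i) (\<nu> j))"
    using nu by (intro exI[of _ \<nu>]) simp
  show ?thesis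
    by (rule conjI[OF _ conjI[OF _ conjI[OF _ three]]])
      (intro ballI allI impI, rule one, assumption, assumption, intro allI impI, rule two, assumption,
        intro ballI, rule nt, assumption)
qed

end
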